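(* Let $T>0$, $\sigma>0$, $\varepsilon=1$, $x_0\in\mathbb T^2$, $w=e_1$, $x_c(t)=x_0+tw$. Let $u_n$ be the smooth divergence-free coefficients on $[0,T]\times\mathbb T^2$ defined in the context. Let $E_*\in\mathbb R^2\setminus\{0\}$ be constant and put $$\overline X(t)=(e^{-\sigma t}E_*,0).$$ Then there are exact (energy) solutions $\widehat X_n=(\widehat E_n,b_n)$ of the planar Maxwell--Ohm system with coefficients $u_n$ such that $$\widehat X_n(0)\longrightarrow(E_*,0)\ \text{in }\mathcal H_2,\qquad \liminf_{n\to\infty}\|\widehat X_n(T)-\overline X(T)\|_{\mathcal H_2}>0.$$ Their currents $\widehat j_n=\sigma(\widehat E_n+b_nRu_n)$ are bounded in $L^2((0,T)\times\mathbb T^2)$, and their Lorentz forces satisfy $$b_nR\widehat j_n\ \overset{*}{\rightharpoonup}\ -\frac{t}{2T^2}\,w\,dt\,\delta_{x=x_c(t)}$$ as vector-valued Radon measures on $[0,T]\times\mathbb T^2$.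
   Context: $\mathbb T^2=(\mathbb R/2\pi\mathbb Z)^2$; $R(z_1,z_2)=(z_2,-z_1)$. States are $X=(E,b)$, $E$ $\mathbb R^2$-valued and $b$ real-valued; with $\varepsilon=1$, $\|X\|_{\mathcal H_2}^2=\|E\|_{L^2}^2+\|b\|_{L^2}^2$. The planar Maxwell--Ohm system with coefficient $v$ is $$\partial_tE-R\nabla b=-j,\qquad \partial_tb+\operatorname{curl}E=0,\qquad j=\sigma(E+bRv),\qquad \operatorname{curl}E=\partial_1E_2-\partial_2E_1.$$ Energy solutions are mild solutions $X\in C([0,T];\mathcal H_2)$: $X(t)=S(t)X(0)+\int_0^tS(t-s)(-\sigma b(s)Rv(s),0)\,ds$, with $S$ the contraction semigroup on $\mathcal H_2$ generated by $(E,b)\mapsto(R\nabla b-\sigma E,-\operatorname{curl}E)$ on its maximal domain. Coefficients $u_n$: fix $r_0>0$ such that the closed disk of radius $r_0$ about the origin lies in one coordinate chart of $\mathbb T^2$. Fix $\Theta\in C^\infty(\mathbb R;[0,1])$ with $\Theta(z)=0$ for $z\le0$, $\Theta(z)=z$ for $\frac14\le z\le\frac34$, $\Theta(z)=1$ for $z\ge1$, with $|\Theta'|+|\Theta''|\le C$ and $\Theta(z)\le Cz$ on $[0,1]$. For $L\ge2$ let $\chi_L(r)=\Theta(L^{-1}\log(r_0/r))$ for $0<r<r_0$, $\chi_L(r)=0$ for $r\ge r_0$, $\chi_L(0)=1$. For $A\ge1$ set $\psi_{A,L}(x)=-A(Rw\cdot x)\chi_L(|x|)$ and $W_{A,L}=R\nabla\psi_{A,L}$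 (extended by zero to $\mathbb T^2$). With $\delta_n=e^{-n}$ ($n\ge1$), $A_n(t)=1+\frac{2}{\sigma(t+\delta_n)}$ and $L_n(t)=n+A_n(t)^2$, set $u_n(t,x)=W_{A_n(t),L_n(t)}(x-x_c(t))$. These are smooth, divergence-free, and tend to $0$ strongly in $L^2(0,T;H^1(\mathbb T^2))$. The measure $-\frac{t}{2T^2}w\,dt\,\delta_{x=x_c(t)}$ acts on $\Psi\in C([0,T]\times\mathbb T^2;\mathbb R^2)$ by $-\int_0^T\frac{t}{2T^2}\,w\cdot\Psi(t,x_c(t))\,dt$. *)

theory Defs
  imports "HOL-Analysis.Analysis"
begin

text \<open>
  Functions on the torus $(\mathbb{R}/2\pi\mathbb{Z})^2$ are represented by functions on the plane:
  test functions and coefficients as $2\pi$-periodic functions, elements of $L^2$ by their values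
  on the fundamental cell. Points of the torus are represented by arbitrary lifts.
\<close>

definition torus_measure :: "(real^2) measure" where
  "torus_measure = restrict_space lborel (cbox 0 (vec (2 * pi)))"

definition periodic :: "(real^2 \<Rightarrow> 'b) \<Rightarrow> bool" where
  "periodic f \<longleftrightarrow> (\<forall>x i. f (x + axis i (2 * pi)) = f x)"

text \<open>The representative in $[-\pi,\pi)^2$ of the class of a point modulo $2\pi\mathbb{Z}^2$.\<close>

definition torus_rep :: "real^2 \<Rightarrow> real^2" where
  "torus_rep x = (\<chi> i. x $ i - 2 * pi * of_int \<lfloor>(x $ i + pi) / (2 * pi)\<rfloor>)"

definition rot :: "real^2 \<Rightarrow> real^2" where
  "rot z = vector [z $ 2, - (z $ 1)]"

definition pd :: "2 \<Rightarrow> (real^2 \<Rightarrow> real) \<Rightarrow> real^2 \<Rightarrow> real" where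
  "pd i f x = frechet_derivative f (at x) (axis i 1)"

definition grad :: "(real^2 \<Rightarrow> real) \<Rightarrow> real^2 \<Rightarrow> real^2" where
  "grad f x = (\<chi> i. pd i f x)"

primrec C_k :: "nat \<Rightarrow> ('a::euclidean_space \<Rightarrow> real) \<Rightarrow> bool" where
  "C_k 0 f \<longleftrightarrow> continuous_on UNIV f"
| "C_k (Suc k) f \<longleftrightarrow> (\<forall>x. f differentiable (at x)) \<and>
     (\<forall>e\<in>Basis. C_k k (\<lambda>x. frechet_derivative f (at x) e))"

definition smooth :: "('a::euclidean_space \<Rightarrow> real) \<Rightarrow> bool" where
  "smooth f \<longleftrightarrow> (\<forall>k. C_k k f)"

definition test_function :: "(real^2 \<Rightarrow> real) \<Rightarrow> bool" where
  "test_function \<phi> \<longleftrightarrow> smooth \<phi> \<and> periodic \<phi>"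


subsection \<open>The energy space\<close>

definition square_integrable :: "(real^2 \<Rightarrow> 'b::euclidean_space) \<Rightarrow> bool" where
  "square_integrable f \<longleftrightarrow> f \<in> borel_measurable torus_measure \<and>
     integrable torus_measure (\<lambda>x. (norm (f x))\<^sup>2)"

definition l2_eq :: "(real^2 \<Rightarrow> (real^2) \<times> real) \<Rightarrow> (real^2 \<Rightarrow> (real^2) \<times> real) \<Rightarrow> bool" where
  "l2_eq f g \<longleftrightarrow> square_integrable f \<and> square_integrable g \<and> (AE x in torus_measure. f x = g x)"

lemma square_integrable_inner:
  assumes "square_integrable f" "square_integrable g"
  shows "integrable torus_measure (\<lambda>x. f x \<bullet> g x)"
proof (rule Bochner_Integration.integrable_bound)
  show "integrable torus_measure (\<lambda>x. (norm (f x))\<^sup>2 + (norm (g x))\<^sup>2)"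
    using assms by (simp add: square_integrable_def)
  show "(\<lambda>x. f x \<bullet> g x) \<in> borel_measurable torus_measure"
    using assms by (auto simp: square_integrable_def intro: borel_measurable_inner)
  have "\<bar>f x \<bullet> g x\<bar> \<le> (norm (f x))\<^sup>2 + (norm (g x))\<^sup>2" for x
  proof -
    have "\<bar>f x \<bullet> g x\<bar> \<le> norm (f x) * norm (g x)"
      by (rule Cauchy_Schwarz_ineq2)
    also have "\<dots> \<le> (norm (f x))\<^sup>2 + (norm (g x))\<^sup>2"
      using sum_squares_bound[of "norm (f x)" "norm (g x)"]
        mult_nonneg_nonneg[OF norm_ge_zero[of "f x"] norm_ge_zero[of "g x"]]
      by linarith
    finally show ?thesis .
  qed
  then show "AE x in torus_measure. norm (f x \<bullet> g x) \<le> norm ((norm (f x))\<^sup>2 + (norm (g x))\<^sup>2)"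
    by simp
qed

lemma square_integrable_add:
  assumes "square_integrable f" "square_integrable g"
  shows "square_integrable (\<lambda>x. f x + g x)"
proof -
  have "integrable torus_measure (\<lambda>x. f x \<bullet> f x + g x \<bullet> g x + 2 * (f x \<bullet> g x))"
    using assms square_integrable_inner by (intro Bochner_Integration.integrable_add) auto
  then have "integrable torus_measure (\<lambda>x. (norm (f x + g x))\<^sup>2)"
    by (simp add: power2_norm_eq_inner inner_add_left inner_add_right inner_commute algebra_simps)
  with assms show ?thesis
    by (auto simp: square_integrable_def intro: borel_measurable_add)
qed

lemma square_integrable_scaleR:
  "square_integrable f \<Longrightarrow> square_integrable (\<lambda>x. c *\<^sub>R f x)"
  by (auto simp: square_integrable_def power_mult_distrib intro: borel_measurable_scaleR)

lemma square_integrable_zero: "square_integrable (\<lambda>x. 0)"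
  by (simp add: square_integrable_def)

text \<open>
  The space $\mathcal H_2 = L^2(\mathbb{T}^2;\mathbb{R}^2)\times L^2(\mathbb{T}^2)$, as
  classes of square integrable functions $x \mapsto (E(x), b(x))$ up to equality almost everywhere.
\<close>

quotient_type h2 = "real^2 \<Rightarrow> (real^2) \<times> real" / partial: l2_eq
proof (rule part_equivpI)
  show "\<exists>f. l2_eq f f"
    using square_integrable_zero by (auto simp: l2_eq_def intro!: exI[of _ "\<lambda>x. 0"])
  show "symp l2_eq"
    by (auto simp: symp_def l2_eq_def)
  show "transp l2_eq"
    by (auto simp: transp_def l2_eq_def)
qed

instantiation h2 :: real_inner
begin

lift_definition zero_h2 :: h2 is "\<lambda>x. 0"
  by (simp add: l2_eq_def square_integrable_zero)

lift_definition plus_h2 :: "h2 \<Rightarrow> h2 \<Rightarrow> h2" is "\<lambda>f g x. f x + g x"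
  by (auto simp: l2_eq_def intro: square_integrable_add)

lift_definition scaleR_h2 :: "real \<Rightarrow> h2 \<Rightarrow> h2" is "\<lambda>c f x. c *\<^sub>R f x"
  by (auto simp: l2_eq_def intro: square_integrable_scaleR)

definition uminus_h2 :: "h2 \<Rightarrow> h2" where "- X = (-1) *\<^sub>R X" for X :: h2

definition minus_h2 :: "h2 \<Rightarrow> h2 \<Rightarrow> h2" where "X - Y = X + (- Y)" for X Y :: h2

lift_definition inner_h2 :: "h2 \<Rightarrow> h2 \<Rightarrow> real" is "\<lambda>f g. \<integral>x. f x \<bullet> g x \<partial>torus_measure"
  by (rule integral_cong_AE) (auto simp: l2_eq_def square_integrable_def)

definition norm_h2 :: "h2 \<Rightarrow> real" where "norm X = sqrt (X \<bullet> X)" for X :: h2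

definition sgn_h2 :: "h2 \<Rightarrow> h2" where "sgn X = inverse (norm X) *\<^sub>R X" for X :: h2

definition dist_h2 :: "h2 \<Rightarrow> h2 \<Rightarrow> real" where "dist X Y = norm (X - Y)" for X Y :: h2

definition uniformity_h2 :: "(h2 \<times> h2) filter" where
  "uniformity_h2 = (INF e\<in>{0<..}. principal {(X, Y). dist X Y < e})"

definition open_h2 :: "h2 set \<Rightarrow> bool" where
  "open_h2 U \<longleftrightarrow> (\<forall>X\<in>U. eventually (\<lambda>(X', Y). X' = X \<longrightarrow> Y \<in> U) uniformity)"

instance
proof
  fix X Y Z :: h2 and r s :: real
  show "X + Y + Z = X + (Y + Z)"
    by transfer (auto simp: l2_eq_def add.assoc intro!: square_integrable_add)
  show "X + Y = Y + X"
    by transfer (auto simp: l2_eq_def add.commute intro!: square_integrable_add)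
  show "0 + X = X"
    by transfer (auto simp: l2_eq_def)
  show "- X + X = 0"
    unfolding uminus_h2_def
    by transfer (auto simp: l2_eq_def square_integrable_zero)
  show "X - Y = X + - Y"
    by (rule minus_h2_def)
  show "r *\<^sub>R (X + Y) = r *\<^sub>R X + r *\<^sub>R Y"
    by transfer (auto simp: l2_eq_def scaleR_add_right
        intro!: square_integrable_add square_integrable_scaleR)
  show "(r + s) *\<^sub>R X = r *\<^sub>R X + s *\<^sub>R X"
    by transfer (auto simp: l2_eq_def scaleR_add_left
        intro!: square_integrable_add square_integrable_scaleR)
  show "r *\<^sub>R s *\<^sub>R X = (r * s) *\<^sub>R X"
    by transfer (auto simp: l2_eq_def intro!: square_integrable_scaleR)
  show "1 *\<^sub>R X = X"
    by transfer (auto simp: l2_eq_def)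
  show "sgn X = inverse (norm X) *\<^sub>R X"
    by (rule sgn_h2_def)
  show "dist X Y = norm (X - Y)"
    by (rule dist_h2_def)
  show "uniformity = (INF e\<in>{0<..}. principal {(X, Y :: h2). dist X Y < e})"
    by (rule uniformity_h2_def)
  show "open U \<longleftrightarrow> (\<forall>X\<in>U. \<forall>\<^sub>F (X', Y) in uniformity. X' = X \<longrightarrow> Y \<in> U)" for U :: "h2 set"
    by (rule open_h2_def)
  show "X \<bullet> Y = Y \<bullet> X"
    by transfer (simp add: inner_commute)
  show "(X + Y) \<bullet> Z = X \<bullet> Z + Y \<bullet> Z"
    by transfer (simp add: l2_eq_def inner_add_left square_integrable_inner)
  show "(r *\<^sub>R X) \<bullet> Y = r * (X \<bullet> Y)"
    by transfer simp
  show "0 \<le> X \<bullet> X"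
    by transfer simp
  show "X \<bullet> X = 0 \<longleftrightarrow> X = 0"
  proof transfer
    fix f :: "real^2 \<Rightarrow> (real^2) \<times> real"
    assume "l2_eq f f"
    then have f: "square_integrable f" by (simp add: l2_eq_def)
    have "(\<integral>x. f x \<bullet> f x \<partial>torus_measure) = 0 \<longleftrightarrow> (AE x in torus_measure. f x \<bullet> f x = 0)"
      using square_integrable_inner[OF f f] by (intro integral_nonneg_eq_0_iff_AE) auto
    then show "(\<integral>x. f x \<bullet> f x \<partial>torus_measure) = 0 \<longleftrightarrow> l2_eq f (\<lambda>x. 0)"
      using f by (simp add: l2_eq_def square_integrable_zero)
  qed
  show "norm X = sqrt (X \<bullet> X)"
    by (rule norm_h2_def)
qed

end

text \<open>The class of a function (a junk value unless the function is square integrable), and the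
  two components of a chosen representative.\<close>

definition state :: "(real^2 \<Rightarrow> real^2) \<Rightarrow> (real^2 \<Rightarrow> real) \<Rightarrow> h2" where
  "state E b = abs_h2 (\<lambda>x. (E x, b x))"

definition electric :: "h2 \<Rightarrow> real^2 \<Rightarrow> real^2" where
  "electric X x = fst (rep_h2 X x)"

definition magnetic :: "h2 \<Rightarrow> real^2 \<Rightarrow> real" where
  "magnetic X x = snd (rep_h2 X x)"


subsection \<open>The Maxwell--Ohm operator and its semigroup\<close>

definition has_weak_gradient :: "(real^2 \<Rightarrow> real) \<Rightarrow> (real^2 \<Rightarrow> real^2) \<Rightarrow> bool" where
  "has_weak_gradient b g \<longleftrightarrow> (\<forall>\<phi> i. test_function \<phi> \<longrightarrow>
     (\<integral>x. g x $ i * \<phi> x \<partial>torus_measure) = - (\<integral>x. b x * pd i \<phi> x \<partial>torus_measure))"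

text \<open>$\operatorname{curl} E = \partial_1E_2-\partial_2E_1$ as a distribution; the individual
  derivatives of \<open>E\<close> need not be functions.\<close>

definition has_weak_curl :: "(real^2 \<Rightarrow> real^2) \<Rightarrow> (real^2 \<Rightarrow> real) \<Rightarrow> bool" where
  "has_weak_curl E c \<longleftrightarrow> (\<forall>\<phi>. test_function \<phi> \<longrightarrow>
     (\<integral>x. c x * \<phi> x \<partial>torus_measure) =
     - (\<integral>x. E x $ 2 * pd 1 \<phi> x - E x $ 1 * pd 2 \<phi> x \<partial>torus_measure))"

text \<open>Graph of $(E,b)\mapsto(R\nabla b-\sigma E,-\operatorname{curl}E)$ on its maximal domain.\<close>

definition maxwell_ohm_op :: "real \<Rightarrow> h2 \<Rightarrow> h2 \<Rightarrow> bool" where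
  "maxwell_ohm_op \<sigma> X Y \<longleftrightarrow> (\<exists>g c. square_integrable g \<and> square_integrable c \<and>
     has_weak_gradient (magnetic X) g \<and> has_weak_curl (electric X) c \<and>
     Y = state (\<lambda>x. rot (g x) - \<sigma> *\<^sub>R electric X x) (\<lambda>x. - c x))"

definition contraction_semigroup :: "(real \<Rightarrow> 'a::real_normed_vector \<Rightarrow> 'a) \<Rightarrow> bool" where
  "contraction_semigroup S \<longleftrightarrow>
     (\<forall>t\<ge>0. bounded_linear (S t)) \<and>
     (\<forall>X. S 0 X = X) \<and>
     (\<forall>s\<ge>0. \<forall>t\<ge>0. \<forall>X. S (s + t) X = S s (S t X)) \<and>
     (\<forall>t\<ge>0. \<forall>X. norm (S t X) \<le> norm X) \<and>
     (\<forall>X. continuous_on {0..} (\<lambda>t. S t X))"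

definition generator :: "(real \<Rightarrow> 'a::real_normed_vector \<Rightarrow> 'a) \<Rightarrow> 'a \<Rightarrow> 'a \<Rightarrow> bool" where
  "generator S X Y \<longleftrightarrow> ((\<lambda>h. (S h X - X) /\<^sub>R h) \<longlongrightarrow> Y) (at_right 0)"

text \<open>
  Mild solutions. The semigroup is determined by its generator, so the existential quantifier only
  names it. The Duhamel integral is the gauge integral of the library; for the bounded smooth
  coefficients used below its integrand is continuous in time with values in $\mathcal H_2$.
\<close>

definition energy_solution ::
  "real \<Rightarrow> real \<Rightarrow> (real \<Rightarrow> real^2 \<Rightarrow> real^2) \<Rightarrow> (real \<Rightarrow> h2) \<Rightarrow> bool" where
  "energy_solution \<sigma> T v X \<longleftrightarrow> continuous_on {0..T} X \<and>
     (\<exists>S. contraction_semigroup S \<and> generator S = maxwell_ohm_op \<sigma> \<and>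
       (\<forall>t\<in>{0..T}.
         ((\<lambda>s. S (t - s) (state (\<lambda>x. - (\<sigma> * magnetic (X s) x) *\<^sub>R rot (v s x)) (\<lambda>x. 0)))
           has_integral (X t - S t (X 0))) {0..t}))"

definition current :: "real \<Rightarrow> (real^2 \<Rightarrow> real^2) \<Rightarrow> h2 \<Rightarrow> real^2 \<Rightarrow> real^2" where
  "current \<sigma> v X x = \<sigma> *\<^sub>R (electric X x + magnetic X x *\<^sub>R rot (v x))"

definition lorentz_force :: "real \<Rightarrow> (real^2 \<Rightarrow> real^2) \<Rightarrow> h2 \<Rightarrow> real^2 \<Rightarrow> real^2" where
  "lorentz_force \<sigma> v X x = magnetic X x *\<^sub>R rot (current \<sigma> v X x)"


subsection \<open>The coefficients\<close>

definition w :: "real^2" where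
  "w = axis 1 1"

definition x_c :: "real^2 \<Rightarrow> real \<Rightarrow> real^2" where
  "x_c x0 t = x0 + t *\<^sub>R w"

definition chi_cut :: "(real \<Rightarrow> real) \<Rightarrow> real \<Rightarrow> real \<Rightarrow> real \<Rightarrow> real" where
  "chi_cut \<Theta> r0 L r = (if r = 0 then 1 else if r < r0 then \<Theta> (ln (r0 / r) / L) else 0)"

definition psi :: "(real \<Rightarrow> real) \<Rightarrow> real \<Rightarrow> real \<Rightarrow> real \<Rightarrow> real^2 \<Rightarrow> real" where
  "psi \<Theta> r0 A L x = - A * (rot w \<bullet> x) * chi_cut \<Theta> r0 L (norm x)"

text \<open>The field is supported in the disk of radius \<open>r0\<close>, which for \<open>r0 < pi\<close> lies in
  $[-\pi,\pi)^2$; composing with the reduction to that cell is the extension by zero to the torus.\<close>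

definition W :: "(real \<Rightarrow> real) \<Rightarrow> real \<Rightarrow> real \<Rightarrow> real \<Rightarrow> real^2 \<Rightarrow> real^2" where
  "W \<Theta> r0 A L x = rot (grad (psi \<Theta> r0 A L) (torus_rep x))"

definition A_coef :: "real \<Rightarrow> nat \<Rightarrow> real \<Rightarrow> real" where
  "A_coef \<sigma> n t = 1 + 2 / (\<sigma> * (t + exp (- real n)))"

definition L_coef :: "real \<Rightarrow> nat \<Rightarrow> real \<Rightarrow> real" where
  "L_coef \<sigma> n t = real n + (A_coef \<sigma> n t)\<^sup>2"

definition u :: "(real \<Rightarrow> real) \<Rightarrow> real \<Rightarrow> real \<Rightarrow> real^2 \<Rightarrow> nat \<Rightarrow> real \<Rightarrow> real^2 \<Rightarrow> real^2" where
  "u \<Theta> r0 \<sigma> x0 n t x = W \<Theta> r0 (A_coef \<sigma> n t) (L_coef \<sigma> n t) (x - x_c x0 t)"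

end

theory Submission
  imports Defs
begin

text \<open>
  Around the moving point \<open>x_c\<close> the coefficient equals \<open>A(t) w\<close>, constant in space, on a disk whose
  radius, for fixed \<open>n\<close>, is bounded below in time. A wave packet that travels with \<open>x_c\<close>, which is the
  speed of light, stays inside this disk and sees nothing else of the coefficient. With the
  coordinates \<open>\<theta>\<close> along and \<open>\<eta>\<close> across the motion, the field \<open>E\<^sub>2 = b = m(t) F'(\<theta>) g(\<eta>)\<close> is a
  free travelling wave apart from the variation of \<open>m\<close> and \<open>g\<close>, and Ohm's law acts on it as
  \<open>j\<^sub>2 = \<sigma> (E\<^sub>2 - A b)\<close>. The drift \<open>A > 1\<close> thus pumps energy into the packet: its amplitude obeys
  \<open>2 m' = \<sigma> (A - 1) m\<close>, which for \<open>A = 1 + 2 / (\<sigma> (t + \<delta>))\<close> is solved by \<open>m = c (t + \<delta>)\<close>. The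
  packet grows from \<open>c \<delta>\<close>, which tends to zero, to at least \<open>1 / 2\<close> at time \<open>T\<close> when
  \<open>c = 1 / (2 T)\<close>. So the initial values converge to the constant field while the final values stay away
  from the damped constant field.

  In the current of the packet the factor \<open>A\<close>, unbounded in \<open>n\<close>, is compensated by the amplitude: \<open>j\<^sub>2\<close> is
  \<open>\<sigma> (1 - A) m F' g = - 2 c F' g\<close> up to small terms, which is bounded in \<open>L\<^sup>2\<close>. The Lorentz force
  \<open>b R j\<close> is then \<open>- 2 c m (F' g)\<^sup>2 w\<close> to leading order, and with \<open>F'\<close> and \<open>g\<close> normalised in \<open>L\<^sup>2\<close> and
  supported in shrinking intervals, \<open>(F' g)\<^sup>2\<close> tends to the point mass at \<open>x_c\<close>, with weight
  \<open>- 2 c (c t) = - t / (2 T\<^sup>2)\<close>.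

  The packet has the shape of a pancake: if \<open>F'\<close> is normalised on an interval of length \<open>2 \<nu>\<close>, then
  \<open>F\<close> itself is of size \<open>sqrt \<nu>\<close> (\<open>thin_profile_exists\<close>). With correctors added to \<open>E\<close>, all that the
  packet fails to solve contains the undifferentiated \<open>F\<close> (\<open>residual_identity\<close>), and \<open>\<nu>\<close> may be chosen
  after everything else. The difference to the exact solution solves the same linear system with this
  small source and zero initial value, so by Gronwall's inequality it is small even after multiplication
  by the coefficient (\<open>exact_solution\<close>). The limits are read off from the explicit packet
  (\<open>initial_estimate\<close>, \<open>final_estimate\<close>, \<open>norm_current_le\<close>, \<open>lorentz_estimate\<close>).

  Exact solutions are mild solutions, which presupposes the semigroup of the Maxwell--Ohm operator on
  its maximal domain. On a single frequency the system is an ordinary differential equation, and the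
  trigonometric modes are dense (\<open>closed_subspace_eq_UNIV_if_modes\<close>); dissipativity extends the resulting
  flow to the whole space (\<open>flow_exists\<close>). The same applies to the formally adjoint system, and the
  duality between the two flows shows that the generator is the adjoint of the adjoint system on test
  functions, which is the operator defined by weak derivatives (\<open>maxwell_ohm_op_iff_weak\<close>). Duality also
  gives the Duhamel formula for the packet, whose profiles are only of class \<open>C\<^sup>2\<close> (\<open>weak_duhamel\<close>).
\<close>

section \<open>Semigroups from a dense set of classical solutions\<close>

lemma extend_contraction:
  fixes V :: "'a::real_normed_vector set" and s :: "'a \<Rightarrow> 'b::banach"
  assumes V: "subspace V" "closure V = UNIV"
    and add: "\<And>x y. x \<in> V \<Longrightarrow> y \<in> V \<Longrightarrow> s (x + y) = s x + s y"
    and scale: "\<And>c x. x \<in> V \<Longrightarrow> s (c *\<^sub>R x) = c *\<^sub>R s x"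
    and bound: "\<And>x. x \<in> V \<Longrightarrow> norm (s x) \<le> norm x"
  obtains T where "bounded_linear T" "\<And>x. x \<in> V \<Longrightarrow> T x = s x" "\<And>x. norm (T x) \<le> norm x"
proof -
  have diff: "s x - s y = s (x - y)" if "x \<in> V" "y \<in> V" for x y
    using add[OF that(1), of "- y"] scale[OF that(2), of "- 1"] that subspace_neg[OF V(1)] by simp
  have "uniformly_continuous_on V s"
    unfolding uniformly_continuous_on_def
  proof (intro allI impI)
    fix e :: real assume "e > 0"
    then show "\<exists>d>0. \<forall>x\<in>V. \<forall>x'\<in>V. dist x' x < d \<longrightarrow> dist (s x') (s x) < e"
    proof (intro exI[of _ e] conjI ballI impI)
      fix x x' assume x: "x \<in> V" "x' \<in> V" and "dist x' x < e"
      moreover have "norm (s x' - s x) \<le> norm (x' - x)"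
        unfolding diff[OF x(2,1)] by (rule bound[OF subspace_diff[OF V(1) x(2,1)]])
      ultimately show "dist (s x') (s x) < e" by (simp add: dist_norm)
    qed
  qed
  from uniformly_continuous_on_extension_on_closure[OF this]
  obtain T where T: "uniformly_continuous_on (closure V) T" "\<And>x. x \<in> V \<Longrightarrow> s x = T x" by metis
  have cont: "isCont T x" for x
    using uniformly_continuous_imp_continuous[OF T(1)] V(2) by (simp add: continuous_on_eq_continuous_at)
  have approx: "\<exists>v. (\<forall>n. v n \<in> V) \<and> v \<longlonglongrightarrow> x" for x
    using closure_sequential[of x V] V(2) by auto
  have lim: "(\<lambda>n. s (v n)) \<longlonglongrightarrow> T x" if "\<forall>n. v n \<in> V" "v \<longlonglongrightarrow> x" for v x
    using isCont_tendsto_compose[OF cont that(2)] T(2) that(1) by simp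
  have Tadd: "T (x + y) = T x + T y" for x y
  proof -
    obtain v v' where v: "\<forall>n. v n \<in> V" "v \<longlonglongrightarrow> x" "\<forall>n. v' n \<in> V" "v' \<longlonglongrightarrow> y"
      using approx by metis
    have "(\<lambda>n. s (v n + v' n)) \<longlonglongrightarrow> T (x + y)"
      by (rule lim) (use v subspace_add[OF V(1)] in \<open>auto intro: tendsto_add\<close>)
    moreover have "(\<lambda>n. s (v n + v' n)) \<longlonglongrightarrow> T x + T y"
      using tendsto_add[OF lim[OF v(1,2)] lim[OF v(3,4)]] add v by simp
    ultimately show ?thesis by (rule LIMSEQ_unique)
  qed
  have Tscale: "T (c *\<^sub>R x) = c *\<^sub>R T x" for c x
  proof -
    obtain v where v: "\<forall>n. v n \<in> V" "v \<longlonglongrightarrow> x" using approx by metis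
    have "(\<lambda>n. s (c *\<^sub>R v n)) \<longlonglongrightarrow> T (c *\<^sub>R x)"
      by (rule lim) (use v subspace_scale[OF V(1)] in \<open>auto intro: tendsto_intros\<close>)
    moreover have "(\<lambda>n. s (c *\<^sub>R v n)) \<longlonglongrightarrow> c *\<^sub>R T x"
      using tendsto_scaleR[OF tendsto_const lim[OF v(1,2)]] scale v by simp
    ultimately show ?thesis by (rule LIMSEQ_unique)
  qed
  have Tnorm: "norm (T x) \<le> norm x" for x
  proof -
    obtain v where v: "\<forall>n. v n \<in> V" "v \<longlonglongrightarrow> x" using approx by metis
    show ?thesis
      by (rule LIMSEQ_le[OF tendsto_norm[OF lim[OF v]] tendsto_norm[OF v(2)]]) (use bound v in auto)
  qed
  have "bounded_linear T"
    by (rule bounded_linear_intro[of T 1]) (use Tadd Tscale Tnorm in auto)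
  then show thesis using that T(2) Tnorm by metis
qed

text \<open>
  Relations \<open>G X Y\<close> stand for unbounded operators that are only given on a core: \<open>Y\<close> is the image
  of \<open>X\<close>. A flow curve is then a classical solution of \<open>X' = G X\<close> that never leaves the core.
\<close>

definition flow_curve :: "('h::real_inner \<Rightarrow> 'h \<Rightarrow> bool) \<Rightarrow> (real \<Rightarrow> 'h) \<Rightarrow> bool" where
  "flow_curve G \<gamma> \<longleftrightarrow> (\<exists>\<gamma>'. \<forall>t\<ge>0. (\<gamma> has_vector_derivative \<gamma>' t) (at t within {0..}) \<and> G (\<gamma> t) (\<gamma>' t))"

lemma has_vector_derivative_at_pos:
  "t > 0 \<Longrightarrow> (f has_vector_derivative d) (at t within {0..}) \<longleftrightarrow> (f has_vector_derivative d) (at t)"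
  for t :: real
  unfolding has_vector_derivative_def
  using at_within_interior[of t "{0..}"] by simp

lemma flow_curve_continuous: "flow_curve G \<gamma> \<Longrightarrow> continuous_on {0..} \<gamma>"
  unfolding flow_curve_def continuous_on_eq_continuous_within
  by (meson atLeast_iff has_vector_derivative_continuous)

locale dissipative_relation =
  fixes G :: "'h::{real_inner,banach} \<Rightarrow> 'h \<Rightarrow> bool"
  assumes G_add: "G X Y \<Longrightarrow> G X' Y' \<Longrightarrow> G (X + X') (Y + Y')"
    and G_scale: "G X Y \<Longrightarrow> G (c *\<^sub>R X) (c *\<^sub>R Y)"
    and G_dissipative: "G X Y \<Longrightarrow> Y \<bullet> X \<le> 0"
begin

lemma flow_curve_add: "flow_curve G \<gamma> \<Longrightarrow> flow_curve G \<eta> \<Longrightarrow> flow_curve G (\<lambda>t. \<gamma> t + \<eta> t)"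
  unfolding flow_curve_def
proof (elim exE)
  fix \<gamma>' \<eta>'
  assume "\<forall>t\<ge>0. (\<gamma> has_vector_derivative \<gamma>' t) (at t within {0..}) \<and> G (\<gamma> t) (\<gamma>' t)"
    "\<forall>t\<ge>0. (\<eta> has_vector_derivative \<eta>' t) (at t within {0..}) \<and> G (\<eta> t) (\<eta>' t)"
  then show "\<exists>\<gamma>'. \<forall>t\<ge>0. ((\<lambda>t. \<gamma> t + \<eta> t) has_vector_derivative \<gamma>' t) (at t within {0..}) \<and> G (\<gamma> t + \<eta> t) (\<gamma>' t)"
    by (intro exI[of _ "\<lambda>t. \<gamma>' t + \<eta>' t"]) (auto intro: G_add has_vector_derivative_add)
qed

lemma flow_curve_scale: "flow_curve G \<gamma> \<Longrightarrow> flow_curve G (\<lambda>t. c *\<^sub>R \<gamma> t)"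
  unfolding flow_curve_def
proof (elim exE)
  fix \<gamma>'
  assume "\<forall>t\<ge>0. (\<gamma> has_vector_derivative \<gamma>' t) (at t within {0..}) \<and> G (\<gamma> t) (\<gamma>' t)"
  then show "\<exists>\<gamma>'. \<forall>t\<ge>0. ((\<lambda>t. c *\<^sub>R \<gamma> t) has_vector_derivative \<gamma>' t) (at t within {0..}) \<and> G (c *\<^sub>R \<gamma> t) (\<gamma>' t)"
    by (intro exI[of _ "\<lambda>t. c *\<^sub>R \<gamma>' t"])
      (auto intro: G_scale bounded_linear.has_vector_derivative[OF bounded_linear_scaleR_right])
qed

lemma flow_curve_shift:
  assumes "flow_curve G \<gamma>" "0 \<le> a"
  shows "flow_curve G (\<lambda>t. \<gamma> (t + a))"
proof -
  obtain \<gamma>' where d: "\<And>t. 0 \<le> t \<Longrightarrow> (\<gamma> has_vector_derivative \<gamma>' t) (at t within {0..})"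
    and g: "\<And>t. 0 \<le> t \<Longrightarrow> G (\<gamma> t) (\<gamma>' t)"
    using assms(1) unfolding flow_curve_def by metis
  have "((\<lambda>t. \<gamma> (t + a)) has_vector_derivative \<gamma>' (t + a)) (at t within {0..})" if "0 \<le> t" for t
  proof -
    have 1: "((\<lambda>t. t + a) has_vector_derivative 1) (at t within {0..})"
      by (auto intro!: derivative_eq_intros)
    have "(\<gamma> has_vector_derivative \<gamma>' (t + a)) (at (t + a) within (\<lambda>t. t + a) ` {0..})"
      by (rule has_vector_derivative_within_subset[OF d]) (use that assms(2) in auto)
    from vector_diff_chain_within[OF 1 this] show ?thesis by (simp add: o_def)
  qed
  then show ?thesis
    unfolding flow_curve_def using g assms(2) by (intro exI[of _ "\<lambda>t. \<gamma>' (t + a)"]) auto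
qed

text \<open>
  The derivative of \<open>\<parallel>\<gamma> t\<parallel>\<^sup>2\<close> is \<open>2 \<gamma>' \<bullet> \<gamma> \<le> 0\<close>. Linearity turns this bound into uniqueness
  of flow curves.
\<close>

lemma flow_curve_norm_le:
  assumes "flow_curve G \<gamma>" "0 \<le> t"
  shows "norm (\<gamma> t) \<le> norm (\<gamma> 0)"
proof -
  obtain \<gamma>' where d: "\<And>t. 0 \<le> t \<Longrightarrow> (\<gamma> has_vector_derivative \<gamma>' t) (at t within {0..})"
    and g: "\<And>t. 0 \<le> t \<Longrightarrow> G (\<gamma> t) (\<gamma>' t)"
    using assms(1) unfolding flow_curve_def by metis
  have "\<gamma> t \<bullet> \<gamma> t \<le> \<gamma> 0 \<bullet> \<gamma> 0"
  proof (rule DERIV_nonpos_imp_decreasing_open[where f = "\<lambda>s. \<gamma> s \<bullet> \<gamma> s", OF assms(2)])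
    fix x assume "0 < x" "x < t"
    then have "(\<gamma> has_derivative (\<lambda>h. h *\<^sub>R \<gamma>' x)) (at x)"
      using d[of x] has_vector_derivative_at_pos[of x \<gamma>] by (simp add: has_vector_derivative_def)
    from has_derivative_inner[OF this this]
    moreover have "(\<lambda>h. \<gamma> x \<bullet> (h *\<^sub>R \<gamma>' x) + (h *\<^sub>R \<gamma>' x) \<bullet> \<gamma> x) = (*) (2 * (\<gamma>' x \<bullet> \<gamma> x))"
      by (auto simp: fun_eq_iff inner_commute algebra_simps)
    ultimately have "((\<lambda>s. \<gamma> s \<bullet> \<gamma> s) has_real_derivative 2 * (\<gamma>' x \<bullet> \<gamma> x)) (at x)"
      by (simp add: has_field_derivative_def)
    then show "\<exists>y. ((\<lambda>s. \<gamma> s \<bullet> \<gamma> s) has_real_derivative y) (at x) \<and> y \<le> 0"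
      using G_dissipative[OF g[of x]] \<open>0 < x\<close>
      by (intro exI[of _ "2 * (\<gamma>' x \<bullet> \<gamma> x)"] conjI) auto
  next
    show "continuous_on {0..t} (\<lambda>s. \<gamma> s \<bullet> \<gamma> s)"
      using continuous_on_subset[OF flow_curve_continuous[OF assms(1)], of "{0..t}"]
      by (auto intro!: continuous_intros)
  qed
  then show ?thesis by (simp add: norm_eq_sqrt_inner)
qed

lemma flow_curve_unique:
  assumes "flow_curve G \<gamma>" "flow_curve G \<eta>" "\<gamma> 0 = \<eta> 0" "0 \<le> t"
  shows "\<gamma> t = \<eta> t"
  using flow_curve_norm_le[OF flow_curve_add[OF assms(1) flow_curve_scale[OF assms(2), of "- 1"]] assms(4)]
    assms(3) by simp

end

locale dissipative = dissipative_relation +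
  assumes G_dense: "closure {\<gamma> 0 |\<gamma>. flow_curve G \<gamma>} = UNIV"
begin

text \<open>
  Following the flow curves defines linear contractions on the dense subspace of their initial values;
  the semigroup law and the continuity in time survive the passage to the closure because all maps involved are contractions.
\<close>

lemma flow_exists:
  "\<exists>S. contraction_semigroup S \<and> (\<forall>\<gamma> t. flow_curve G \<gamma> \<longrightarrow> 0 \<le> t \<longrightarrow> S t (\<gamma> 0) = \<gamma> t)"
proof -
  define V where "V = {\<gamma> 0 |\<gamma>. flow_curve G \<gamma>}"
  \<comment> \<open>At nonnegative times a flow curve is determined by its initial value, hence the choice is linear in \<open>X\<close>.\<close>
  define c where "c X = (SOME \<gamma>. flow_curve G \<gamma> \<and> \<gamma> 0 = X)" for X
  have c: "flow_curve G (c X) \<and> c X 0 = X" if "X \<in> V" for X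
  proof -
    have "\<exists>\<gamma>. flow_curve G \<gamma> \<and> \<gamma> 0 = X" using that by (auto simp: V_def)
    from someI_ex[OF this] show ?thesis by (simp add: c_def)
  qed
  have ne: "V \<noteq> {}" using G_dense unfolding V_def by force
  have sub: "subspace V"
  proof -
    have add: "X + Y \<in> V" if "X \<in> V" "Y \<in> V" for X Y
      unfolding V_def using flow_curve_add[of "c X" "c Y"] c[OF that(1)] c[OF that(2)]
      by (intro CollectI exI[of _ "\<lambda>t. c X t + c Y t"]) auto
    have sc: "a *\<^sub>R X \<in> V" if "X \<in> V" for X a
      unfolding V_def using flow_curve_scale[of "c X" a] c[OF that(1)]
      by (intro CollectI exI[of _ "\<lambda>t. a *\<^sub>R c X t"]) auto
    show ?thesis unfolding subspace_def using add sc ne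
      by (metis all_not_in_conv scale_zero_left)
  qed
  have dense: "closure V = UNIV" using G_dense by (simp add: V_def)
  have "\<exists>T. bounded_linear T \<and> (\<forall>X\<in>V. T X = c X t) \<and> (\<forall>X. norm (T X) \<le> norm X)" if t: "t \<ge> 0" for t
  proof -
    have 1: "c (X + Y) t = c X t + c Y t" if "X \<in> V" "Y \<in> V" for X Y
      using c[OF that(1)] c[OF that(2)] c[OF subspace_add[OF sub that]] t
        flow_curve_unique[of "c (X + Y)" "\<lambda>t. c X t + c Y t" t] flow_curve_add[of "c X" "c Y"] by auto
    have 2: "c (a *\<^sub>R X) t = a *\<^sub>R c X t" if "X \<in> V" for X a
      using c[OF that(1)] c[OF subspace_scale[OF sub that]] t
        flow_curve_unique[of "c (a *\<^sub>R X)" "\<lambda>t. a *\<^sub>R c X t" t] flow_curve_scale[of "c X" a] by auto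
    have 3: "norm (c X t) \<le> norm X" if "X \<in> V" for X
      using flow_curve_norm_le[of "c X" t] c[OF that] t by simp
    show ?thesis
      using extend_contraction[of V "\<lambda>X. c X t", OF sub dense 1 2 3] by metis
  qed
  then obtain S where S: "\<And>t. t \<ge> 0 \<Longrightarrow> bounded_linear (S t)"
    "\<And>t X. t \<ge> 0 \<Longrightarrow> X \<in> V \<Longrightarrow> S t X = c X t" "\<And>t X. t \<ge> 0 \<Longrightarrow> norm (S t X) \<le> norm X"
    by metis
  have Scurve: "S t (\<gamma> 0) = \<gamma> t" if "flow_curve G \<gamma>" "0 \<le> t" for \<gamma> t
  proof -
    have "\<gamma> 0 \<in> V" using that by (auto simp: V_def)
    then show ?thesis using S(2) flow_curve_unique[of "c (\<gamma> 0)" \<gamma> t] c that by auto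
  qed
  have Scont: "isCont (S t) X" if "t \<ge> 0" for t X
    using S(1)[OF that] by (simp add: linear_continuous_at)
  have approx: "\<exists>v. (\<forall>n. v n \<in> V) \<and> v \<longlonglongrightarrow> X" for X
    using closure_sequential[of X V] dense by auto
  have lim: "(\<lambda>n. S t (v n)) \<longlonglongrightarrow> S t X" if "t \<ge> 0" "v \<longlonglongrightarrow> X" for t v X
    using isCont_tendsto_compose[OF Scont[OF that(1)] that(2)] .
  have S0: "S 0 X = X" for X
  proof -
    obtain v where v: "\<forall>n. v n \<in> V" "v \<longlonglongrightarrow> X" using approx by metis
    have "(\<lambda>n. S 0 (v n)) = v" using S(2)[of 0] v c by auto
    then show ?thesis using lim[OF order_refl v(2)] v(2) LIMSEQ_unique by metis
  qed
  have Sadd: "S (s + t) X = S s (S t X)" if st: "s \<ge> 0" "t \<ge> 0" for s t X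
  proof -
    obtain v where v: "\<forall>n. v n \<in> V" "v \<longlonglongrightarrow> X" using approx by metis
    have eq: "S (s + t) (v n) = S s (S t (v n))" for n
    proof -
      have f: "flow_curve G (c (v n))" and n: "c (v n) 0 = v n" using c v by auto
      have "S s ((\<lambda>r. c (v n) (r + t)) 0) = c (v n) (s + t)"
        by (rule Scurve[OF flow_curve_shift[OF f st(2)] st(1)])
      then show ?thesis
        using Scurve[OF f, of "s + t"] Scurve[OF f st(2)] n st by simp
    qed
    have "(\<lambda>n. S (s + t) (v n)) \<longlonglongrightarrow> S s (S t X)"
      unfolding eq by (rule lim[OF st(1) lim[OF st(2) v(2)]])
    moreover have "(\<lambda>n. S (s + t) (v n)) \<longlonglongrightarrow> S (s + t) X"
      using lim[OF _ v(2)] st by simp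
    ultimately show ?thesis using LIMSEQ_unique by metis
  qed
  have Sc: "continuous_on {0..} (\<lambda>t. S t X)" for X
  proof -
    obtain v where v: "\<forall>n. v n \<in> V" "v \<longlonglongrightarrow> X" using approx by metis
    have "uniform_limit {0..} (\<lambda>n t. S t (v n)) (\<lambda>t. S t X) sequentially"
    proof (rule uniform_limitI)
      fix e :: real assume "e > 0"
      then have "\<forall>\<^sub>F n in sequentially. dist (v n) X < e" using v(2) by (simp add: tendstoD)
      then show "\<forall>\<^sub>F n in sequentially. \<forall>t\<in>{0..}. dist (S t (v n)) (S t X) < e"
      proof eventually_elim
        case (elim n)
        have "dist (S t (v n)) (S t X) \<le> dist (v n) X" if "t \<ge> 0" for t
          using S(3)[OF that, of "v n - X"] linear_diff[OF bounded_linear.linear[OF S(1)[OF that]]]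
          by (simp add: dist_norm)
        then show ?case using elim by force
      qed
    qed
    then show ?thesis
    proof (rule uniform_limit_theorem[rotated])
      show "\<forall>\<^sub>F n in sequentially. continuous_on {0..} (\<lambda>t. S t (v n))"
      proof (rule always_eventually, rule allI)
        fix n
        have "continuous_on {0..} (c (v n))" using flow_curve_continuous c v by auto
        then show "continuous_on {0..} (\<lambda>t. S t (v n))"
          by (rule continuous_on_eq) (use S(2) v in auto)
      qed
    qed auto
  qed
  have "contraction_semigroup S"
    unfolding contraction_semigroup_def using S S0 Sadd Sc by blast
  then show ?thesis using Scurve by blast
qed

definition flow :: "real \<Rightarrow> 'a \<Rightarrow> 'a" where
  "flow = (SOME S. contraction_semigroup S \<and> (\<forall>\<gamma> t. flow_curve G \<gamma> \<longrightarrow> 0 \<le> t \<longrightarrow> S t (\<gamma> 0) = \<gamma> t))"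

lemma flow_semigroup: "contraction_semigroup flow"
  and flow_on_curve: "flow_curve G \<gamma> \<Longrightarrow> 0 \<le> t \<Longrightarrow> flow t (\<gamma> 0) = \<gamma> t"
  using someI_ex[OF flow_exists] unfolding flow_def by blast+

end

section \<open>Duhamel integrals\<close>

lemma contraction_semigroupD:
  assumes "contraction_semigroup S"
  shows "t \<ge> 0 \<Longrightarrow> bounded_linear (S t)" "S 0 X = X"
    "s \<ge> 0 \<Longrightarrow> t \<ge> 0 \<Longrightarrow> S (s + t) X = S s (S t X)" "t \<ge> 0 \<Longrightarrow> norm (S t X) \<le> norm X"
    "continuous_on {0..} (\<lambda>t. S t X)"
  using assms unfolding contraction_semigroup_def by auto

lemma contraction_semigroup_tendsto:
  assumes S: "contraction_semigroup S"
    and f: "(f \<longlongrightarrow> t) F" "\<forall>\<^sub>F a in F. f a \<ge> 0" "t \<ge> 0" and Y: "(Y \<longlongrightarrow> X) F"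
  shows "((\<lambda>a. S (f a) (Y a)) \<longlongrightarrow> S t X) F"
proof -
  note S = contraction_semigroupD[OF S]
  have 1: "((\<lambda>a. S (f a) X) \<longlongrightarrow> S t X) F"
    by (rule continuous_on_tendsto_compose[OF S(5) f(1)]) (use f in auto)
  have 2: "((\<lambda>a. S (f a) (Y a - X)) \<longlongrightarrow> 0) F"
  proof (rule Lim_null_comparison)
    show "\<forall>\<^sub>F a in F. norm (S (f a) (Y a - X)) \<le> norm (Y a - X)"
      using f(2) by eventually_elim (rule S(4))
    show "((\<lambda>a. norm (Y a - X)) \<longlongrightarrow> 0) F"
      using Y by (simp add: LIM_zero_iff tendsto_norm_zero)
  qed
  have "\<forall>\<^sub>F a in F. S (f a) X + S (f a) (Y a - X) = S (f a) (Y a)"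
    using f(2) by eventually_elim (simp add: linear_diff[OF bounded_linear.linear[OF S(1)]])
  then show ?thesis
    using tendsto_add[OF 1 2] by (auto intro: Lim_transform_eventually)
qed

lemma contraction_semigroup_continuous_on:
  fixes f :: "'a::topological_space \<Rightarrow> real"
  assumes S: "contraction_semigroup S" and "continuous_on A f" "\<And>a. a \<in> A \<Longrightarrow> f a \<ge> 0" "continuous_on A Y"
  shows "continuous_on A (\<lambda>a. S (f a) (Y a))"
  using assms(2,4) unfolding continuous_on_def
proof (intro ballI contraction_semigroup_tendsto[OF S])
  fix a assume "a \<in> A"
  show "\<forall>\<^sub>F a in at a within A. f a \<ge> 0"
    by (rule eventually_at_topological[THEN iffD2]) (use assms(3) in blast)
qed (use assms(3) in auto)

lemma duhamel_integrable:
  fixes Y :: "real \<Rightarrow> 'h::banach"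
  assumes S: "contraction_semigroup S" and Y: "continuous_on {0..t} Y"
  shows "(\<lambda>s. S (t - s) (Y s)) integrable_on {0..t}"
  by (rule integrable_continuous_interval, rule contraction_semigroup_continuous_on[OF S])
    (use Y in \<open>auto intro!: continuous_intros\<close>)

lemma duhamel_norm_le:
  fixes Y :: "real \<Rightarrow> 'h::banach"
  assumes S: "contraction_semigroup S" and Y: "continuous_on {0..t} Y"
    and g: "g integrable_on {0..t}" "\<And>s. 0 \<le> s \<Longrightarrow> s \<le> t \<Longrightarrow> norm (Y s) \<le> g s"
  shows "norm (integral {0..t} (\<lambda>s. S (t - s) (Y s))) \<le> integral {0..t} g"
proof (rule integral_norm_bound_integral[OF duhamel_integrable[OF S Y] g(1)])
  fix s assume "s \<in> {0..t}"
  then show "norm (S (t - s) (Y s)) \<le> g s"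
    using contraction_semigroupD(4)[OF S, of "t - s" "Y s"] g(2)[of s] by force
qed

text \<open>
  The substitution \<open>s = t r\<close> moves the dependence on \<open>t\<close> from the domain of integration into an
  integrand that is jointly continuous.
\<close>

lemma duhamel_continuous:
  fixes Y :: "real \<Rightarrow> 'h::banach"
  assumes S: "contraction_semigroup S" and Y: "continuous_on {0..} Y"
  shows "continuous_on {0..} (\<lambda>t. integral {0..t} (\<lambda>s. S (t - s) (Y s)))"
proof -
  let ?f = "\<lambda>t r. S (t - t * r) (Y (t * r))"
  have c: "continuous_on ({0..} \<times> cbox 0 1) (\<lambda>(t, r). ?f t r)"
  proof -
    have "continuous_on ({0..} \<times> {0..1}) (\<lambda>p. Y (fst p * snd p))"
      by (rule continuous_on_compose2[OF Y]) (auto intro!: continuous_intros)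
    moreover have "fst p - fst p * snd p \<ge> 0" if "p \<in> {0..} \<times> {0..1}" for p :: "real \<times> real"
      using that mult_left_le[of "snd p" "fst p"] by auto
    ultimately have "continuous_on ({0..} \<times> {0..1}) (\<lambda>p. ?f (fst p) (snd p))"
      by (intro contraction_semigroup_continuous_on[OF S]) (auto intro!: continuous_intros)
    then show ?thesis by (simp add: case_prod_unfold)
  qed
  have "continuous_on {0..} (\<lambda>t. integral (cbox 0 1) (?f t))"
    by (rule integral_continuous_on_param[OF c])
  then have "continuous_on {0..} (\<lambda>t. t *\<^sub>R integral {0..1} (?f t))"
    by (auto intro!: continuous_intros)
  moreover have "t *\<^sub>R integral {0..1} (?f t) = integral {0..t} (\<lambda>s. S (t - s) (Y s))" if "t \<in> {0..}" for t
  proof (cases "t = 0")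
    case False
    with that have t: "t > 0" by auto
    have "continuous_on {0..t} Y" by (rule continuous_on_subset[OF Y]) auto
    from integrable_integral[OF duhamel_integrable[OF S this]]
    have I: "((\<lambda>s. S (t - s) (Y s)) has_integral integral {0..t} (\<lambda>s. S (t - s) (Y s))) (cbox 0 t)" by simp
    have "((\<lambda>r. ?f t r) has_integral (1 / \<bar>t\<bar>) *\<^sub>R integral {0..t} (\<lambda>s. S (t - s) (Y s)))
       ((\<lambda>x. (1 / t) *\<^sub>R x + - ((1 / t) *\<^sub>R 0)) ` cbox 0 t)"
      using has_integral_affinity[OF I, of t 0] t by simp
    moreover have "((\<lambda>x. (1 / t) *\<^sub>R x + - ((1 / t) *\<^sub>R 0)) ` cbox 0 t) = {0..1}"
      using t by (simp add: image_mult_atLeastAtMost[of "1/t", simplified])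
    ultimately show ?thesis using t by (simp add: integral_unique)
  qed auto
  ultimately show ?thesis by (rule continuous_on_eq)
qed

section \<open>Adjoint semigroups and the maximal generator\<close>

text \<open>
  Two dissipative relations in formal duality, each with dense flow curves. Their semigroups turn out
  to be adjoint to each other, and the generator of the first is the full Hilbert space adjoint of the
  second relation. This is what identifies a generator on a maximal domain while only classical
  solutions are ever computed.
\<close>

locale dual_dissipative = A: dissipative G + B: dissipative G'
  for G G' :: "'h::{real_inner,banach} \<Rightarrow> 'h \<Rightarrow> bool" +
  assumes dual: "G X Y \<Longrightarrow> G' Z Z' \<Longrightarrow> Y \<bullet> Z = X \<bullet> Z'"
begin

lemma dual_dissipative_swap: "dual_dissipative G' G"
proof (unfold_locales)
  show "G' X Y \<Longrightarrow> G Z Z' \<Longrightarrow> Y \<bullet> Z = X \<bullet> Z'" for X Y Z Z'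
    by (metis dual inner_commute)
qed

text \<open>
  The function \<open>s \<mapsto> \<gamma> s \<bullet> \<zeta> (t - s)\<close> has derivative zero by duality; its values at the end points
  are the two sides.
\<close>

lemma flow_adjoint_curves:
  assumes "flow_curve G \<gamma>" "flow_curve G' \<zeta>" and t: "0 \<le> t"
  shows "\<gamma> t \<bullet> \<zeta> 0 = \<gamma> 0 \<bullet> \<zeta> t"
proof -
  obtain \<gamma>' where d: "\<And>t. 0 \<le> t \<Longrightarrow> (\<gamma> has_vector_derivative \<gamma>' t) (at t within {0..})"
    and g: "\<And>t. 0 \<le> t \<Longrightarrow> G (\<gamma> t) (\<gamma>' t)"
    using assms(1) unfolding flow_curve_def by metis
  obtain \<zeta>' where d': "\<And>t. 0 \<le> t \<Longrightarrow> (\<zeta> has_vector_derivative \<zeta>' t) (at t within {0..})"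
    and g': "\<And>t. 0 \<le> t \<Longrightarrow> G' (\<zeta> t) (\<zeta>' t)"
    using assms(2) unfolding flow_curve_def by metis
  have "((\<lambda>s. \<gamma> s \<bullet> \<zeta> (t - s)) has_derivative (\<lambda>h. 0)) (at s within {0..t})" if s: "s \<in> {0..t}" for s
  proof -
    have 1: "(\<gamma> has_derivative (\<lambda>h. h *\<^sub>R \<gamma>' s)) (at s within {0..t})"
      using has_vector_derivative_within_subset[OF d[of s], of "{0..t}"] s
      by (auto simp: has_vector_derivative_def)
    have r: "((\<lambda>s. t - s) has_vector_derivative - 1) (at s within {0..t})"
      by (auto intro!: derivative_eq_intros)
    have "(\<zeta> has_vector_derivative \<zeta>' (t - s)) (at (t - s) within (\<lambda>s. t - s) ` {0..t})"
      by (rule has_vector_derivative_within_subset[OF d'[of "t - s"]]) (use s in auto)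
    from vector_diff_chain_within[OF r this]
    have 2: "((\<lambda>s. \<zeta> (t - s)) has_derivative (\<lambda>h. h *\<^sub>R - \<zeta>' (t - s))) (at s within {0..t})"
      by (simp add: o_def has_vector_derivative_def)
    have "\<gamma> s \<bullet> \<zeta>' (t - s) = \<gamma>' s \<bullet> \<zeta> (t - s)"
      using dual[OF g[of s] g'[of "t - s"]] s by simp
    then show ?thesis
      using has_derivative_inner[OF 1 2] by (simp add: inner_scaleR_right)
  qed
  from has_derivative_zero_constant[OF convex_real_interval(5) this]
  obtain c where c: "\<forall>s\<in>{0..t}. \<gamma> s \<bullet> \<zeta> (t - s) = c" by (rule exE)
  then have "\<gamma> t \<bullet> \<zeta> (t - t) = c" "\<gamma> 0 \<bullet> \<zeta> (t - 0) = c" using t by (meson atLeastAtMost_iff order_refl)+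
  then show ?thesis by simp
qed

lemma dense_eqI:
  assumes "\<And>\<zeta>. flow_curve G' \<zeta> \<Longrightarrow> X \<bullet> \<zeta> 0 = Y \<bullet> \<zeta> 0"
  shows "X = Y"
proof -
  have "X - Y \<in> closure {\<zeta> 0 |\<zeta>. flow_curve G' \<zeta>}" using B.G_dense by simp
  then obtain v where v: "\<And>n. v n \<in> {\<zeta> 0 |\<zeta>. flow_curve G' \<zeta>}" "v \<longlonglongrightarrow> X - Y"
    unfolding closure_sequential by blast
  have "(X - Y) \<bullet> v n = 0" for n
    using v(1)[of n] assms by (auto simp: inner_diff_left)
  then have "(\<lambda>n. 0) \<longlonglongrightarrow> (X - Y) \<bullet> (X - Y)"
    using tendsto_inner[OF tendsto_const v(2), of "X - Y"] by simp
  then have "0 = (X - Y) \<bullet> (X - Y)" by (rule LIMSEQ_unique[OF tendsto_const])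
  then show ?thesis by simp
qed

lemma flow_adjoint:
  assumes t: "0 \<le> t"
  shows "A.flow t X \<bullet> Z = X \<bullet> B.flow t Z"
proof -
  have "X \<in> closure {\<gamma> 0 |\<gamma>. flow_curve G \<gamma>}" using A.G_dense by simp
  then obtain v where v: "\<And>n. v n \<in> {\<gamma> 0 |\<gamma>. flow_curve G \<gamma>}" "v \<longlonglongrightarrow> X"
    unfolding closure_sequential by blast
  have "Z \<in> closure {\<gamma> 0 |\<gamma>. flow_curve G' \<gamma>}" using B.G_dense by simp
  then obtain z where z: "\<And>n. z n \<in> {\<gamma> 0 |\<gamma>. flow_curve G' \<gamma>}" "z \<longlonglongrightarrow> Z"
    unfolding closure_sequential by blast
  have eq: "A.flow t (v n) \<bullet> z n = v n \<bullet> B.flow t (z n)" for n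
  proof -
    obtain \<gamma> \<zeta> where \<gamma>: "flow_curve G \<gamma>" "v n = \<gamma> 0" and \<zeta>: "flow_curve G' \<zeta>" "z n = \<zeta> 0"
      using v(1)[of n] z(1)[of n] by blast
    show ?thesis
      unfolding \<gamma>(2) \<zeta>(2) A.flow_on_curve[OF \<gamma>(1) t] B.flow_on_curve[OF \<zeta>(1) t]
      by (rule flow_adjoint_curves[OF \<gamma>(1) \<zeta>(1) t])
  qed
  have 1: "(\<lambda>n. A.flow t (v n) \<bullet> z n) \<longlonglongrightarrow> A.flow t X \<bullet> Z"
    by (intro tendsto_inner z contraction_semigroup_tendsto[OF A.flow_semigroup tendsto_const] v t)
      (use t in auto)
  have 2: "(\<lambda>n. v n \<bullet> B.flow t (z n)) \<longlonglongrightarrow> X \<bullet> B.flow t Z"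
    by (intro tendsto_inner v contraction_semigroup_tendsto[OF B.flow_semigroup tendsto_const] z t)
      (use t in auto)
  show ?thesis using LIMSEQ_unique[OF 1] 2 eq by simp
qed

text \<open>
  A differentiable curve \<open>X\<close> on which the adjoint of \<open>G'\<close> acts as \<open>Y\<close> solves the Duhamel formula with
  source \<open>X' - Y\<close>, although its values need not lie in the domain of \<open>G\<close>. Tested against a dual flow
  curve \<open>\<zeta>\<close>, the Duhamel integral is the integral of the derivative of \<open>s \<mapsto> X s \<bullet> \<zeta> (t - s)\<close>.
\<close>

lemma weak_duhamel:
  assumes t: "0 \<le> t"
    and X: "\<And>s. 0 \<le> s \<Longrightarrow> s \<le> t \<Longrightarrow> (X has_vector_derivative X' s) (at s within {0..t})"
    and X'c: "continuous_on {0..t} X'" and Yc: "continuous_on {0..t} Y"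
    and weak: "\<And>s Z Z'. 0 \<le> s \<Longrightarrow> s \<le> t \<Longrightarrow> G' Z Z' \<Longrightarrow> Y s \<bullet> Z = X s \<bullet> Z'"
  shows "((\<lambda>s. A.flow (t - s) (X' s - Y s)) has_integral X t - A.flow t (X 0)) {0..t}"
proof -
  let ?I = "integral {0..t} (\<lambda>s. A.flow (t - s) (X' s - Y s))"
  have I: "((\<lambda>s. A.flow (t - s) (X' s - Y s)) has_integral ?I) {0..t}"
    by (rule integrable_integral[OF duhamel_integrable[OF A.flow_semigroup continuous_on_diff[OF X'c Yc]]])
  have "?I = X t - A.flow t (X 0)"
  proof (rule dense_eqI)
    fix \<zeta> assume \<zeta>: "flow_curve G' \<zeta>"
    obtain \<zeta>' where d': "\<And>t. 0 \<le> t \<Longrightarrow> (\<zeta> has_vector_derivative \<zeta>' t) (at t within {0..})"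
      and g': "\<And>t. 0 \<le> t \<Longrightarrow> G' (\<zeta> t) (\<zeta>' t)"
      using \<zeta> unfolding flow_curve_def by metis
    have "((\<lambda>s. X s \<bullet> \<zeta> (t - s)) has_vector_derivative A.flow (t - s) (X' s - Y s) \<bullet> \<zeta> 0) (at s within {0..t})"
      if s: "s \<in> {0..t}" for s
    proof -
      have 1: "(X has_derivative (\<lambda>h. h *\<^sub>R X' s)) (at s within {0..t})"
        using X[of s] s by (auto simp: has_vector_derivative_def)
      have r: "((\<lambda>s. t - s) has_vector_derivative - 1) (at s within {0..t})"
        by (auto intro!: derivative_eq_intros)
      have "(\<zeta> has_vector_derivative \<zeta>' (t - s)) (at (t - s) within (\<lambda>s. t - s) ` {0..t})"
        by (rule has_vector_derivative_within_subset[OF d'[of "t - s"]]) (use s in auto)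
      from vector_diff_chain_within[OF r this]
      have 2: "((\<lambda>s. \<zeta> (t - s)) has_derivative (\<lambda>h. h *\<^sub>R - \<zeta>' (t - s))) (at s within {0..t})"
        by (simp add: o_def has_vector_derivative_def)
      have "A.flow (t - s) (X' s - Y s) \<bullet> \<zeta> 0 = (X' s - Y s) \<bullet> \<zeta> (t - s)"
        using s by (simp add: flow_adjoint B.flow_on_curve[OF \<zeta>, of "t - s"])
      also have "\<dots> = X' s \<bullet> \<zeta> (t - s) - X s \<bullet> \<zeta>' (t - s)"
        using weak[OF _ _ g'[of "t - s"], of s] s by (simp add: inner_diff_left)
      finally have eq: "A.flow (t - s) (X' s - Y s) \<bullet> \<zeta> 0 = X' s \<bullet> \<zeta> (t - s) - X s \<bullet> \<zeta>' (t - s)" .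
      have "(\<lambda>h. X s \<bullet> (h *\<^sub>R - \<zeta>' (t - s)) + (h *\<^sub>R X' s) \<bullet> \<zeta> (t - s))
        = (\<lambda>h. h *\<^sub>R (A.flow (t - s) (X' s - Y s) \<bullet> \<zeta> 0))"
        unfolding eq by (simp add: fun_eq_iff right_diff_distrib)
      then show ?thesis
        using has_derivative_inner[OF 1 2] by (simp add: has_vector_derivative_def)
    qed
    from fundamental_theorem_of_calculus[OF t this]
    have "((\<lambda>s. A.flow (t - s) (X' s - Y s) \<bullet> \<zeta> 0) has_integral X t \<bullet> \<zeta> 0 - X 0 \<bullet> \<zeta> t) {0..t}"
      by simp
    moreover have "((\<lambda>s. A.flow (t - s) (X' s - Y s) \<bullet> \<zeta> 0) has_integral ?I \<bullet> \<zeta> 0) {0..t}"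
      using has_integral_linear[OF I bounded_linear_inner_left[of "\<zeta> 0"]] by (simp add: o_def)
    ultimately have "?I \<bullet> \<zeta> 0 = X t \<bullet> \<zeta> 0 - X 0 \<bullet> \<zeta> t"
      by (rule has_integral_unique[symmetric])
    then show "?I \<bullet> \<zeta> 0 = (X t - A.flow t (X 0)) \<bullet> \<zeta> 0"
      by (simp add: inner_diff_left flow_adjoint[OF t] B.flow_on_curve[OF \<zeta> t])
  qed
  then show ?thesis using I by simp
qed

text \<open>
  The Duhamel formula for the constant curve \<open>X\<close> gives \<open>S t X - X = \<integral>\<^sub>0\<^sup>t S s Y ds\<close>, and the right-hand
  side has derivative \<open>Y\<close> at time zero.
\<close>

lemma generator_if_weak:
  assumes "\<And>Z Z'. G' Z Z' \<Longrightarrow> Y \<bullet> Z = X \<bullet> Z'"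
  shows "generator A.flow X Y"
proof -
  let ?f = "\<lambda>s. A.flow s Y"
  have c: "continuous_on {0..} ?f" by (rule contraction_semigroupD(5)[OF A.flow_semigroup])
  have "integral {0..t} ?f = A.flow t X - X" if t: "0 \<le> t" for t
  proof -
    have "((\<lambda>s. A.flow (t - s) (0 - Y)) has_integral X - A.flow t X) {0..t}"
      by (rule weak_duhamel[OF t, where X = "\<lambda>s. X" and X' = "\<lambda>s. 0" and Y = "\<lambda>s. Y"])
        (auto intro: assms simp del: inner_commute)
    then have "((\<lambda>s. - A.flow (t - s) (0 - Y)) has_integral - (X - A.flow t X)) {0..t}"
      by (rule has_integral_neg)
    moreover have eq: "- A.flow (t - s) (0 - Y) = A.flow (t - s) Y" if "s \<in> {0..t}" for s
      using that linear_neg[OF bounded_linear.linear[OF contraction_semigroupD(1)[OF A.flow_semigroup, of "t - s"]], of Y]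
      by simp
    ultimately have "((\<lambda>s. A.flow (t - s) Y) has_integral A.flow t X - X) {0..t}"
      using has_integral_eq[of "{0..t}" "\<lambda>s. - A.flow (t - s) (0 - Y)" "\<lambda>s. A.flow (t - s) Y"] by simp
    then have "((\<lambda>s. A.flow (t - s) Y) has_integral A.flow t X - X) (cbox 0 t)" by simp
    from has_integral_affinity[OF this, of "- 1" t]
    have "((\<lambda>s. A.flow s Y) has_integral A.flow t X - X) ((\<lambda>x. t - x) ` {0..t})"
      by (simp add: o_def)
    then show ?thesis by (simp add: integral_unique)
  qed
  note I = this
  have "((\<lambda>t. integral {0..t} ?f) has_vector_derivative ?f 0) (at 0 within {0..1})"
    by (rule integral_has_vector_derivative) (auto intro: continuous_on_subset[OF c])
  then have "((\<lambda>t. (1 / norm (t - 0)) *\<^sub>R (integral {0..t} ?f - (integral {0..0} ?f + (t - 0) *\<^sub>R ?f 0))) \<longlongrightarrow> 0) (at 0 within {0..1})"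
    unfolding has_vector_derivative_def has_derivative_within by (rule conjunct2)
  then have "((\<lambda>t. (1 / norm (t - 0)) *\<^sub>R (integral {0..t} ?f - (integral {0..0} ?f + (t - 0) *\<^sub>R ?f 0))) \<longlongrightarrow> 0) (at_right 0)"
    using at_within_Icc_at_right[of 0 "1::real"] by simp
  moreover have "\<forall>\<^sub>F t in at_right 0. (1 / norm (t - 0)) *\<^sub>R (integral {0..t} ?f - (integral {0..0} ?f + (t - 0) *\<^sub>R ?f 0))
     = (A.flow t X - X) /\<^sub>R t - Y"
    unfolding eventually_at_right_field
  proof (intro exI[of _ 1] conjI allI impI)
    fix t :: real assume t: "0 < t" "t < 1"
    have "integral {0..t} ?f - (integral {0..0} ?f + (t - 0) *\<^sub>R ?f 0) = A.flow t X - X - t *\<^sub>R Y"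
      using I[of t] t contraction_semigroupD(2)[OF A.flow_semigroup] by simp
    then show "(1 / norm (t - 0)) *\<^sub>R (integral {0..t} ?f - (integral {0..0} ?f + (t - 0) *\<^sub>R ?f 0))
     = (A.flow t X - X) /\<^sub>R t - Y"
      using t by (simp add: scaleR_diff_right divide_inverse)
  qed simp
  ultimately have "((\<lambda>t. (A.flow t X - X) /\<^sub>R t - Y) \<longlongrightarrow> 0) (at_right 0)"
    by (rule Lim_transform_eventually)
  then show ?thesis unfolding generator_def by (simp add: LIM_zero_iff)
qed

lemma generator_weak:
  assumes "generator B.flow Z Z'" and "generator A.flow X Y"
  shows "Y \<bullet> Z = X \<bullet> Z'"
proof -
  have 1: "((\<lambda>h. ((A.flow h X - X) /\<^sub>R h) \<bullet> Z) \<longlongrightarrow> Y \<bullet> Z) (at_right 0)"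
    using assms(2) unfolding generator_def by (intro tendsto_intros)
  have 2: "((\<lambda>h. X \<bullet> ((B.flow h Z - Z) /\<^sub>R h)) \<longlongrightarrow> X \<bullet> Z') (at_right 0)"
    using assms(1) unfolding generator_def by (intro tendsto_intros)
  have "\<forall>\<^sub>F h in at_right 0. ((A.flow h X - X) /\<^sub>R h) \<bullet> Z = X \<bullet> ((B.flow h Z - Z) /\<^sub>R h)"
    unfolding eventually_at_right_field
    by (intro exI[of _ 1]) (auto simp: flow_adjoint inner_diff_left inner_diff_right)
  from Lim_transform_eventually[OF 1 this] show ?thesis
    using 2 tendsto_unique trivial_limit_at_right_real by blast
qed

lemma generator_iff_weak: "generator A.flow X Y \<longleftrightarrow> (\<forall>Z Z'. G' Z Z' \<longrightarrow> Y \<bullet> Z = X \<bullet> Z')"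
proof
  assume X: "generator A.flow X Y"
  show "\<forall>Z Z'. G' Z Z' \<longrightarrow> Y \<bullet> Z = X \<bullet> Z'"
  proof (intro allI impI)
    fix Z Z' assume "G' Z Z'"
    then have "Z' \<bullet> V = Z \<bullet> V'" if "G V V'" for V V'
      using dual[OF that] by (metis inner_commute)
    then have "generator B.flow Z Z'"
      by (rule dual_dissipative.generator_if_weak[OF dual_dissipative_swap])
    then show "Y \<bullet> Z = X \<bullet> Z'" using X by (rule generator_weak)
  qed
next
  assume "\<forall>Z Z'. G' Z Z' \<longrightarrow> Y \<bullet> Z = X \<bullet> Z'"
  then show "generator A.flow X Y" by (intro generator_if_weak) blast
qed

end

section \<open>Bounded time-dependent perturbations\<close>

lemma exp_term_derivative:
  fixes B M s :: real
  shows "((\<lambda>s. B * ((M * s) ^ Suc k / fact (Suc k))) has_real_derivative M * (B * ((M * s) ^ k / fact k))) (at s within A)"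
proof -
  have "((\<lambda>s. B * M ^ Suc k / fact (Suc k) * s ^ Suc k) has_real_derivative
          B * M ^ Suc k / fact (Suc k) * (real (Suc k) * s ^ (Suc k - 1))) (at s within A)"
    using DERIV_pow[of "Suc k" s A] by (intro DERIV_cmult) (simp only: One_nat_def)
  moreover have "B * M ^ Suc k / fact (Suc k) * (real (Suc k) * s ^ (Suc k - 1)) = M * (B * ((M * s) ^ k / fact k))"
  proof -
    have "fact (Suc k) = real (Suc k) * fact k" by simp
    then show ?thesis by (simp only: power_mult_distrib power_Suc diff_Suc_1) simp
  qed
  moreover have "(\<lambda>s. B * M ^ Suc k / fact (Suc k) * s ^ Suc k) = (\<lambda>s. B * ((M * s) ^ Suc k / fact (Suc k)))"
    by (simp only: power_mult_distrib times_divide_eq_right times_divide_eq_left mult.assoc)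
  ultimately show ?thesis by (simp only:)
qed

text \<open>
  The Picard series. Its \<open>k\<close>-th term is at most \<open>B (M t)\<^sup>k / k!\<close>, so that it converges locally uniformly
  and yields the Gronwall bound \<open>B exp (M t)\<close> at the same time. The bound is stated for every \<open>T\<close> and
  \<open>B\<close>, since the solution itself does not depend on the time interval.
\<close>

lemma mild_solution_exists:
  fixes S :: "real \<Rightarrow> 'h::banach \<Rightarrow> 'h" and P :: "real \<Rightarrow> 'h \<Rightarrow> 'h" and f :: "real \<Rightarrow> 'h"
  assumes S: "contraction_semigroup S"
    and P: "\<And>s. 0 \<le> s \<Longrightarrow> linear (P s)" "\<And>s X. 0 \<le> s \<Longrightarrow> norm (P s X) \<le> M * norm X"
      "\<And>Y. continuous_on {0..} Y \<Longrightarrow> continuous_on {0..} (\<lambda>s. P s (Y s))"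
    and M: "0 \<le> M" and f: "continuous_on {0..} f"
  obtains X where "continuous_on {0..} X"
    "\<And>t. 0 \<le> t \<Longrightarrow> ((\<lambda>s. S (t - s) (P s (X s))) has_integral X t - f t) {0..t}"
    "\<And>T B t. (\<And>t. 0 \<le> t \<Longrightarrow> t \<le> T \<Longrightarrow> norm (f t) \<le> B) \<Longrightarrow> 0 \<le> t \<Longrightarrow> t \<le> T \<Longrightarrow> norm (X t) \<le> B * exp (M * t)"
proof -
  define Y where "Y = rec_nat f (\<lambda>k Z t. integral {0..t} (\<lambda>s. S (t - s) (P s (Z s))))"
  have Y0: "Y 0 = f" and YS: "Y (Suc k) = (\<lambda>t. integral {0..t} (\<lambda>s. S (t - s) (P s (Y k s))))" for k
    by (simp_all add: Y_def)
  have cont: "continuous_on {0..} (Y k)" for k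
    by (induction k) (auto simp: Y0 YS f intro!: duhamel_continuous[OF S] P(3))
  have cont': "continuous_on {0..t} (\<lambda>s. P s (Y k s))" for k t
    by (rule continuous_on_subset[OF P(3)[OF cont]]) auto
  have bound: "norm (Y k t) \<le> B * ((M * t) ^ k / fact k)"
    if B: "\<And>t. 0 \<le> t \<Longrightarrow> t \<le> T \<Longrightarrow> norm (f t) \<le> B" and t: "0 \<le> t" "t \<le> T" for T B k t
    using t
  proof (induction k arbitrary: t)
    case 0
    then show ?case using B by (simp add: Y0)
  next
    case (Suc k)
    let ?g = "\<lambda>s. M * (B * ((M * s) ^ k / fact k))"
    let ?G = "\<lambda>s. B * ((M * s) ^ Suc k / fact (Suc k))"
    have "(?G has_vector_derivative ?g s) (at s within {0..t})" for s
      using exp_term_derivative by (simp only: has_real_derivative_iff_has_vector_derivative)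
    then have "(?g has_integral ?G t - ?G 0) {0..t}"
      using Suc.prems by (intro fundamental_theorem_of_calculus) auto
    then have I: "(?g has_integral ?G t) {0..t}" by simp
    have "norm (Y (Suc k) t) \<le> integral {0..t} ?g"
      unfolding YS
    proof (rule duhamel_norm_le[OF S cont'])
      show "?g integrable_on {0..t}" using I by blast
      fix s assume s: "0 \<le> s" "s \<le> t"
      have "norm (P s (Y k s)) \<le> M * norm (Y k s)" using P(2) s by simp
      also have "\<dots> \<le> ?g s" using Suc.IH[of s] Suc.prems s M by (intro mult_left_mono) auto
      finally show "norm (P s (Y k s)) \<le> ?g s" .
    qed
    then show ?case using integral_unique[OF I] by simp
  qed
  have fb: "\<exists>B. \<forall>t\<in>{0..T}. norm (f t) \<le> B" for T
  proof -
    have "bounded (f ` {0..T})"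
      by (intro compact_imp_bounded compact_continuous_image continuous_on_subset[OF f]) auto
    then show ?thesis by (auto simp: bounded_iff)
  qed
  define X where "X t = (\<Sum>k. Y k t)" for t
  have unif: "uniform_limit {0..T} (\<lambda>n t. \<Sum>k<n. Y k t) X sequentially" if "T \<ge> 0" for T
  proof -
    obtain B where B: "\<And>t. 0 \<le> t \<Longrightarrow> t \<le> T \<Longrightarrow> norm (f t) \<le> B" using fb by fastforce
    have B0: "B \<ge> 0" using B[of 0] that norm_ge_zero order_trans by blast
    show ?thesis unfolding X_def
    proof (rule Weierstrass_m_test)
      show "norm (Y k t) \<le> B * ((M * T) ^ k / fact k)" if "t \<in> {0..T}" for k t
      proof -
        have "norm (Y k t) \<le> B * ((M * t) ^ k / fact k)" using bound[OF B] that by auto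
        also have "\<dots> \<le> B * ((M * T) ^ k / fact k)"
          using that M B0 by (intro mult_left_mono divide_right_mono power_mono mult_nonneg_nonneg) auto
        finally show ?thesis .
      qed
      show "summable (\<lambda>k. B * ((M * T) ^ k / fact k))"
        using summable_exp[of "M * T"] by (intro summable_mult) (simp add: field_simps)
    qed
  qed
  have XcT: "continuous_on {0..T} X" if "T \<ge> 0" for T
    by (rule uniform_limit_theorem[OF always_eventually unif[OF that]])
      (auto intro!: continuous_on_sum continuous_on_subset[OF cont])
  have Xc: "continuous_on {0..} X"
    unfolding continuous_on_eq_continuous_within
  proof
    fix t :: real assume t: "t \<in> {0..}"
    have "continuous (at t within {0..t+1}) X"
      using XcT[of "t + 1"] t by (auto simp: continuous_on_eq_continuous_within)
    moreover have "at t within {0..t+1} = at t within {0..}"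
      by (rule at_within_nhd[of _ "{..<t+1}"]) (use t in auto)
    ultimately show "continuous (at t within {0..}) X" by simp
  qed
  have sums: "(\<lambda>k. Y k t) sums X t" if "t \<ge> 0" for t
    using tendsto_uniform_limitI[OF unif[OF that], of t] that by (simp add: sums_def)
  have I: "((\<lambda>s. S (t - s) (P s (X s))) has_integral X t - f t) {0..t}" if t: "t \<ge> 0" for t
  proof -
    let ?h = "\<lambda>n s. S (t - s) (P s (\<Sum>k<n. Y k s))"
    have lin: "?h n s = (\<Sum>k<n. S (t - s) (P s (Y k s)))" if "s \<in> {0..t}" for n s
      using that by (simp add: linear_sum[OF P(1)] linear_sum[OF bounded_linear.linear[OF contraction_semigroupD(1)[OF S]]])
    have hI: "(?h n has_integral (\<Sum>k<n. Y (Suc k) t)) {0..t}" for n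
    proof -
      have "((\<lambda>s. \<Sum>k<n. S (t - s) (P s (Y k s))) has_integral (\<Sum>k<n. Y (Suc k) t)) {0..t}"
        unfolding YS by (intro has_integral_sum integrable_integral duhamel_integrable[OF S cont']) auto
      then show ?thesis by (rule has_integral_eq[rotated]) (simp add: lin)
    qed
    have ul: "uniform_limit {0..t} ?h (\<lambda>s. S (t - s) (P s (X s))) sequentially"
    proof (rule uniform_limitI)
      fix e :: real assume e: "e > 0"
      define d where "d = e / (M + 1)"
      have d: "d > 0" "M * d < e" using e M by (auto simp: d_def field_simps)
      have "\<forall>\<^sub>F n in sequentially. \<forall>s\<in>{0..t}. dist (\<Sum>k<n. Y k s) (X s) < d"
        using uniform_limitD[OF unif[OF t] d(1)] .
      then show "\<forall>\<^sub>F n in sequentially. \<forall>s\<in>{0..t}. dist (?h n s) (S (t - s) (P s (X s))) < e"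
      proof eventually_elim
        case (elim n)
        have "dist (?h n s) (S (t - s) (P s (X s))) < e" if s: "s \<in> {0..t}" for s
        proof -
          let ?Z = "(\<Sum>k<n. Y k s) - X s"
          have "dist (?h n s) (S (t - s) (P s (X s))) = norm (S (t - s) (P s ?Z))"
            using s by (simp add: dist_norm linear_diff[OF P(1)]
                linear_diff[OF bounded_linear.linear[OF contraction_semigroupD(1)[OF S]]])
          also have "\<dots> \<le> norm (P s ?Z)" using contraction_semigroupD(4)[OF S] s by simp
          also have "\<dots> \<le> M * norm ?Z" using P(2) s by simp
          also have "\<dots> \<le> M * d" using elim s M by (intro mult_left_mono) (auto simp: dist_norm less_imp_le)
          finally show ?thesis using d by simp
        qed
        then show ?case by blast
      qed
    qed
    have c: "(\<lambda>n. \<Sum>k<n. Y (Suc k) t) \<longlonglongrightarrow> X t - f t"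
      using sums[OF t] sums_Suc_iff[of "\<lambda>k. Y k t" "X t - f t"] by (simp add: sums_def Y0)
    have "((\<lambda>s. S (t - s) (P s (X s))) has_integral integral {0..t} (\<lambda>s. S (t - s) (P s (X s)))) {0..t}"
      by (intro integrable_integral duhamel_integrable[OF S] continuous_on_subset[OF P(3)[OF Xc]]) auto
    moreover obtain I J where IJ: "\<And>n. (?h n has_integral I n) {0..t}"
      "((\<lambda>s. S (t - s) (P s (X s))) has_integral J) {0..t}" "(I \<longlongrightarrow> J) sequentially"
    proof (rule uniform_limit_integral[OF ul])
      show "continuous_on {0..t} (?h n)" for n
        by (intro contraction_semigroup_continuous_on[OF S])
          (auto intro!: continuous_intros continuous_on_subset[OF P(3)] continuous_on_subset[OF cont]
             continuous_on_subset[OF P(3)[OF continuous_on_sum[OF cont]]])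
    qed auto
    moreover have "I = (\<lambda>n. \<Sum>k<n. Y (Suc k) t)"
      using IJ(1) hI has_integral_unique by blast
    ultimately show ?thesis using c LIMSEQ_unique by metis
  qed
  have b: "norm (X t) \<le> B * exp (M * t)"
    if B: "\<And>t. 0 \<le> t \<Longrightarrow> t \<le> T \<Longrightarrow> norm (f t) \<le> B" and t: "0 \<le> t" "t \<le> T" for T B t
  proof -
    have s: "(\<lambda>k. B * ((M * t) ^ k / fact k)) sums (B * exp (M * t))"
      using exp_converges[of "M * t"] by (intro sums_mult) (simp add: field_simps)
    have "norm (X t) \<le> (\<Sum>k. B * ((M * t) ^ k / fact k))"
      unfolding X_def
      by (rule norm_suminf_le[OF _ sums_summable[OF s]]) (use bound[OF B t] in auto)
    then show ?thesis using sums_unique[OF s] by simp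
  qed
  show thesis by (rule that[OF Xc I b])
qed

section \<open>The energy space as a Hilbert space\<close>

type_synonym field = "(real^2) \<times> real"

lemma sets_torus_measure [measurable_cong]: "sets torus_measure = sets (restrict_space borel (cbox 0 (vec (2 * pi))))"
  unfolding torus_measure_def by (rule sets_restrict_space_cong) simp

lemma space_torus_measure: "space torus_measure = cbox 0 (vec (2 * pi))"
  by (simp add: torus_measure_def space_restrict_space)

lemma emeasure_torus_finite: "emeasure torus_measure (space torus_measure) < \<infinity>"
  using emeasure_lborel_cbox_finite[of 0 "vec (2 * pi) :: real^2"]
  by (simp add: torus_measure_def emeasure_restrict_space space_restrict_space)

interpretation torus: finite_measure torus_measure
  by (rule finite_measureI, rule less_imp_neq[OF emeasure_torus_finite])

lemma measurable_torus: "f \<in> borel_measurable borel \<Longrightarrow> f \<in> borel_measurable torus_measure"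
  unfolding torus_measure_def by (rule measurable_restrict_space1) simp

lemma l2_eq_self: "l2_eq f f \<longleftrightarrow> square_integrable f"
  by (simp add: l2_eq_def)

lemma square_integrable_rep: "square_integrable (rep_h2 X)"
  using Quotient_rep_reflp[OF Quotient_h2] by (simp add: l2_eq_self)

lemma abs_rep_h2: "abs_h2 (rep_h2 X) = X"
  by (rule Quotient_abs_rep[OF Quotient_h2])

lemma abs_h2_eqI:
  assumes "square_integrable f" "square_integrable g" "AE x in torus_measure. f x = g x"
  shows "abs_h2 f = abs_h2 g"
  using Quotient_rel_abs[OF Quotient_h2, of f g] assms by (simp add: l2_eq_def)

lemma rep_abs_h2:
  assumes "square_integrable f"
  shows "AE x in torus_measure. rep_h2 (abs_h2 f) x = f x"
proof -
  have "l2_eq (rep_h2 (abs_h2 f)) f"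
    using Quotient_rep_abs[OF Quotient_h2] assms l2_eq_self by blast
  then show ?thesis by (simp add: l2_eq_def)
qed

lemma abs_h2_add:
  "square_integrable f \<Longrightarrow> square_integrable g \<Longrightarrow> abs_h2 f + abs_h2 g = abs_h2 (\<lambda>x. f x + g x)"
  by (rule plus_h2.abs_eq) (simp_all add: l2_eq_self)

lemma abs_h2_scale: "square_integrable f \<Longrightarrow> c *\<^sub>R abs_h2 f = abs_h2 (\<lambda>x. c *\<^sub>R f x)"
  by (rule scaleR_h2.abs_eq) (simp add: l2_eq_self)

lemma abs_h2_inner:
  "square_integrable f \<Longrightarrow> square_integrable g \<Longrightarrow> abs_h2 f \<bullet> abs_h2 g = (\<integral>x. f x \<bullet> g x \<partial>torus_measure)"
  by (rule inner_h2.abs_eq) (simp_all add: l2_eq_self)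

lemma abs_h2_zero: "abs_h2 (\<lambda>x. 0) = 0"
  by (rule zero_h2.abs_eq[symmetric])

lemma square_integrable_diff:
  assumes "square_integrable f" "square_integrable g"
  shows "square_integrable (\<lambda>x. f x - g x)"
  using square_integrable_add[OF assms(1) square_integrable_scaleR[OF assms(2), of "- 1"]] by simp

lemma abs_h2_diff:
  assumes "square_integrable f" "square_integrable g"
  shows "abs_h2 f - abs_h2 g = abs_h2 (\<lambda>x. f x - g x)"
  using abs_h2_add[OF assms(1) square_integrable_scaleR[OF assms(2), of "- 1"]]
    abs_h2_scale[OF assms(2), of "- 1"]
  by (simp add: diff_conv_add_uminus del: add_uminus_conv_diff)

lemma norm_abs_h2:
  assumes "square_integrable f"
  shows "(norm (abs_h2 f))\<^sup>2 = (\<integral>x. (norm (f x))\<^sup>2 \<partial>torus_measure)"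
  using abs_h2_inner[OF assms assms] by (simp add: power2_norm_eq_inner)

lemma nn_integral_norm_abs_h2:
  assumes "square_integrable f"
  shows "(\<integral>\<^sup>+x. ennreal ((norm (f x))\<^sup>2) \<partial>torus_measure) = ennreal ((norm (abs_h2 f))\<^sup>2)"
  using assms unfolding norm_abs_h2[OF assms]
  by (intro nn_integral_eq_integral) (auto simp: square_integrable_def)

lemma square_integrable_bound:
  assumes "f \<in> borel_measurable torus_measure" "integrable torus_measure (\<lambda>x. (g x)\<^sup>2)"
    and "AE x in torus_measure. norm (f x) \<le> g x"
  shows "square_integrable f"
  unfolding square_integrable_def
proof (rule conjI[OF assms(1)], rule Bochner_Integration.integrable_bound[OF assms(2)])
  show "(\<lambda>x. (norm (f x))\<^sup>2) \<in> borel_measurable torus_measure" using assms(1) by measurable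
  show "AE x in torus_measure. norm ((norm (f x))\<^sup>2) \<le> norm ((g x)\<^sup>2)"
    using assms(3) by eventually_elim (simp add: power_mono)
qed

lemma square_integrable_bounded:
  assumes "f \<in> borel_measurable torus_measure" "\<And>x. x \<in> cbox 0 (vec (2 * pi)) \<Longrightarrow> norm (f x) \<le> K"
  shows "square_integrable f"
  by (rule square_integrable_bound[where g = "\<lambda>x. K"]) (use assms in \<open>auto simp: space_torus_measure\<close>)

lemma abs_h2_tendsto:
  assumes f: "\<And>n. f n \<in> borel_measurable torus_measure" and F: "F \<in> borel_measurable torus_measure"
    and g: "integrable torus_measure (\<lambda>x. (g x)\<^sup>2)"
    and fg: "\<And>n. AE x in torus_measure. norm (f n x) \<le> g x"
    and lim: "AE x in torus_measure. (\<lambda>n. f n x) \<longlonglongrightarrow> F x"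
  shows "(\<lambda>n. abs_h2 (f n)) \<longlonglongrightarrow> abs_h2 F"
proof -
  have fgA: "AE x in torus_measure. \<forall>n. norm (f n x) \<le> g x" using fg by (simp add: AE_all_countable)
  have Fg: "AE x in torus_measure. norm (F x) \<le> g x"
    using lim fgA
  proof eventually_elim
    case (elim x)
    show ?case by (rule LIMSEQ_le_const2[OF tendsto_norm[OF elim(1)]]) (use elim(2) in auto)
  qed
  have sf: "square_integrable (f n)" for n by (rule square_integrable_bound[OF f g fg])
  have sF: "square_integrable F" by (rule square_integrable_bound[OF F g Fg])
  have "(\<lambda>n. \<integral>x. (norm (f n x - F x))\<^sup>2 \<partial>torus_measure) \<longlonglongrightarrow> (\<integral>x. 0 \<partial>torus_measure)"
  proof (rule integral_dominated_convergence[where w = "\<lambda>x. 4 * (g x)\<^sup>2"])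
    show "AE x in torus_measure. (\<lambda>n. (norm (f n x - F x))\<^sup>2) \<longlonglongrightarrow> 0"
      using lim by eventually_elim (auto intro!: tendsto_eq_intros simp: LIM_zero_iff tendsto_norm_zero_iff)
    show "AE x in torus_measure. norm ((norm (f n x - F x))\<^sup>2) \<le> 4 * (g x)\<^sup>2" for n
      using fg[of n] Fg
    proof eventually_elim
      case (elim x)
      have "norm (f n x - F x) \<le> 2 * g x" using norm_triangle_ineq4[of "f n x" "F x"] elim by linarith
      from power_mono[OF this, of 2] show ?case by (simp add: power_mult_distrib)
    qed
  qed (use f F g in auto)
  then have "(\<lambda>n. (norm (abs_h2 (f n) - abs_h2 F))\<^sup>2) \<longlonglongrightarrow> 0"
    by (simp add: abs_h2_diff[OF sf sF] norm_abs_h2[OF square_integrable_diff[OF sf sF]])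
  from tendsto_real_sqrt[OF this] have "(\<lambda>n. norm (abs_h2 (f n) - abs_h2 F)) \<longlonglongrightarrow> 0" by simp
  then show ?thesis by (simp add: LIM_zero_iff tendsto_norm_zero_iff)
qed

text \<open>
  The Cauchy--Schwarz inequality against the constant function, with the free parameter \<open>a\<close> of Young's
  inequality in place of the optimal choice.
\<close>

lemma integral_le_L2:
  fixes f :: "'a \<Rightarrow> real"
  assumes "finite_measure M" "integrable M f" "integrable M (\<lambda>x. (f x)\<^sup>2)" "a > 0"
  shows "(\<integral>x. f x \<partial>M) \<le> (a * measure M (space M) + (\<integral>x. (f x)\<^sup>2 \<partial>M) / a) / 2"
proof -
  interpret finite_measure M by fact
  have "(\<integral>x. f x \<partial>M) \<le> (\<integral>x. (a + (f x)\<^sup>2 / a) / 2 \<partial>M)"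
  proof (rule integral_mono)
    fix x
    have "0 \<le> (f x - a)\<^sup>2 / (2 * a)" using assms(4) by simp
    also have "\<dots> = (a + (f x)\<^sup>2 / a) / 2 - f x" using assms(4) by (simp add: power2_eq_square field_simps)
    finally show "f x \<le> (a + (f x)\<^sup>2 / a) / 2" by simp
  qed (use assms in auto)
  also have "\<dots> = (a * measure M (space M) + (\<integral>x. (f x)\<^sup>2 \<partial>M) / a) / 2"
    using assms(3) by simp
  finally show ?thesis .
qed

text \<open>
  Riesz--Fischer. Along a subsequence with \<open>\<parallel>X (r (k + 1)) - X (r k)\<parallel> < 1 / 2\<^sup>k\<close> the sum of the pointwise
  increments is integrable, so that the representatives converge almost everywhere; Fatou's lemma shows
  that the pointwise limit is also the limit in norm.
\<close>

lemma h2_Cauchy_convergent: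
  fixes X :: "nat \<Rightarrow> h2"
  assumes "Cauchy X"
  shows "convergent X"
proof -
  define f where "f n = rep_h2 (X n)" for n
  have sf: "square_integrable (f n)" and Xf: "X n = abs_h2 (f n)" for n
    by (simp_all add: f_def square_integrable_rep abs_rep_h2)
  have mf [measurable]: "f n \<in> borel_measurable torus_measure" for n
    using sf by (simp add: square_integrable_def)
  have nX: "(norm (X m - X n))\<^sup>2 = (\<integral>x. (norm (f m x - f n x))\<^sup>2 \<partial>torus_measure)" for m n
    by (simp add: Xf abs_h2_diff sf norm_abs_h2 square_integrable_diff)
  have "\<forall>k. \<exists>N. \<forall>m\<ge>N. \<forall>n\<ge>N. norm (X m - X n) < (1 / 2) ^ k"
    using assms unfolding Cauchy_iff by simp
  then obtain N where N: "\<And>k m n. m \<ge> N k \<Longrightarrow> n \<ge> N k \<Longrightarrow> norm (X m - X n) < (1 / 2) ^ k" by metis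
  define r where "r n = n + (\<Sum>k\<le>n. N k)" for n
  have rm: "strict_mono r" by (rule strict_monoI_Suc) (simp add: r_def)
  have rN: "N k \<le> r n" if "k \<le> n" for k n
    using member_le_sum[of k "{..n}" N] that by (simp add: r_def)
  define h where "h k x = norm (f (r (Suc k)) x - f (r k) x)" for k x
  have mh [measurable]: "h k \<in> borel_measurable torus_measure" for k
  proof -
    have "h k = (\<lambda>x. norm (f (r (Suc k)) x - f (r k) x))" by (simp add: h_def fun_eq_iff)
    then show ?thesis by simp
  qed
  have sh: "square_integrable (\<lambda>x. f (r (Suc k)) x - f (r k) x)" for k by (rule square_integrable_diff[OF sf sf])
  then have ih2: "integrable torus_measure (\<lambda>x. (h k x)\<^sup>2)" for k by (simp add: square_integrable_def h_def)
  have ih: "integrable torus_measure (h k)" for k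
    by (rule torus.square_integrable_imp_integrable) (use ih2 mh in auto)
  have hle: "(\<integral>x. h k x \<partial>torus_measure) \<le> (measure torus_measure (space torus_measure) + 1) * (1 / 2) ^ k" for k
  proof -
    \<comment> \<open>The choice for which both terms of Young's inequality are of order \<open>1 / 2\<^sup>k\<close>.\<close>
    define a :: real where "a = (1 / 2) ^ k"
    have a: "a > 0" by (simp add: a_def)
    have "(\<integral>x. (h k x)\<^sup>2 \<partial>torus_measure) = (norm (X (r (Suc k)) - X (r k)))\<^sup>2"
      by (simp add: nX h_def)
    also have "\<dots> \<le> a\<^sup>2"
      using N[of k "r (Suc k)" "r k"] rN[of k k] rN[of k "Suc k"] unfolding a_def by (intro power_mono) auto
    finally have "(\<integral>x. (h k x)\<^sup>2 \<partial>torus_measure) / a \<le> a"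
      using a by (simp add: divide_le_eq power2_eq_square)
    moreover have "(\<integral>x. h k x \<partial>torus_measure) \<le> (a * measure torus_measure (space torus_measure)
         + (\<integral>x. (h k x)\<^sup>2 \<partial>torus_measure) / a) / 2"
      by (rule integral_le_L2[OF torus.finite_measure_axioms ih ih2 a])
    ultimately have "(\<integral>x. h k x \<partial>torus_measure) \<le> (a * measure torus_measure (space torus_measure) + a) / 2"
      by (elim order_trans) (intro divide_right_mono add_left_mono; simp)
    also have "\<dots> \<le> a * measure torus_measure (space torus_measure) + a" using a by simp
    finally show ?thesis by (simp add: algebra_simps a_def)
  qed
  have "(\<integral>\<^sup>+x. (\<Sum>k. ennreal (h k x)) \<partial>torus_measure) = (\<Sum>k. \<integral>\<^sup>+x. ennreal (h k x) \<partial>torus_measure)"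
    by (rule nn_integral_suminf) measurable
  also have "\<dots> = (\<Sum>k. ennreal (\<integral>x. h k x \<partial>torus_measure))"
    by (intro suminf_cong nn_integral_eq_integral ih) (simp add: h_def)
  also have "\<dots> \<le> (\<Sum>k. ennreal ((measure torus_measure (space torus_measure) + 1) * (1 / 2) ^ k))"
    by (intro suminf_le summableI ennreal_leI hle)
  also have "\<dots> = ennreal (\<Sum>k. (measure torus_measure (space torus_measure) + 1) * (1 / 2) ^ k)"
    by (intro suminf_ennreal2 summable_mult) (auto simp: summable_geometric)
  also have "\<dots> < \<infinity>" by simp
  finally have "AE x in torus_measure. (\<Sum>k. ennreal (h k x)) \<noteq> \<infinity>"
    by (intro nn_integral_PInf_AE) auto
  then have conv: "AE x in torus_measure. convergent (\<lambda>n. f (r n) x)"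
  proof eventually_elim
    case (elim x)
    have "summable (\<lambda>k. h k x)"
      using elim by (intro summable_suminf_not_top) (auto simp: h_def)
    then have "summable (\<lambda>k. f (r (Suc k)) x - f (r k) x)"
      unfolding h_def by (rule summable_norm_cancel)
    then have "convergent (\<lambda>n. f (r n) x - f (r 0) x)"
      by (simp add: summable_iff_convergent sum_lessThan_telescope[of "\<lambda>n. f (r n) x"])
    then show ?case by (simp only: convergent_diff_const_right_iff)
  qed
  define F where "F x = lim (\<lambda>n. f (r n) x)" for x
  have mF [measurable]: "F \<in> borel_measurable torus_measure"
    unfolding F_def by (rule borel_measurable_lim_metric) measurable
  have lim: "AE x in torus_measure. (\<lambda>n. f (r n) x) \<longlonglongrightarrow> F x"
    using conv by eventually_elim (simp add: F_def convergent_LIMSEQ_iff)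
  have bound: "(\<integral>\<^sup>+x. ennreal ((norm (F x - f (r m) x))\<^sup>2) \<partial>torus_measure) \<le> ennreal (((1 / 2) ^ k)\<^sup>2)"
    if m: "m \<ge> k" for m k
  proof -
    have "(\<integral>\<^sup>+x. ennreal ((norm (F x - f (r m) x))\<^sup>2) \<partial>torus_measure)
       = (\<integral>\<^sup>+x. liminf (\<lambda>n. ennreal ((norm (f (r n) x - f (r m) x))\<^sup>2)) \<partial>torus_measure)"
    proof (rule nn_integral_cong_AE)
      show "AE x in torus_measure. ennreal ((norm (F x - f (r m) x))\<^sup>2)
          = liminf (\<lambda>n. ennreal ((norm (f (r n) x - f (r m) x))\<^sup>2))"
        using lim
      proof eventually_elim
        case (elim x)
        have "(\<lambda>n. ennreal ((norm (f (r n) x - f (r m) x))\<^sup>2)) \<longlonglongrightarrow> ennreal ((norm (F x - f (r m) x))\<^sup>2)"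
          by (intro tendsto_intros elim)
        from lim_imp_Liminf[OF _ this] show ?case by simp
      qed
    qed
    also have "\<dots> \<le> liminf (\<lambda>n. \<integral>\<^sup>+x. ennreal ((norm (f (r n) x - f (r m) x))\<^sup>2) \<partial>torus_measure)"
      by (rule nn_integral_liminf) measurable
    also have "\<dots> \<le> ennreal (((1 / 2) ^ k)\<^sup>2)"
    proof (rule Liminf_le)
      show "\<forall>\<^sub>F n in sequentially. (\<integral>\<^sup>+x. ennreal ((norm (f (r n) x - f (r m) x))\<^sup>2) \<partial>torus_measure) \<le> ennreal (((1 / 2) ^ k)\<^sup>2)"
        using eventually_ge_at_top[of k]
      proof eventually_elim
        case (elim n)
        have "(\<integral>\<^sup>+x. ennreal ((norm (f (r n) x - f (r m) x))\<^sup>2) \<partial>torus_measure) = ennreal ((norm (X (r n) - X (r m)))\<^sup>2)"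
          unfolding Xf abs_h2_diff[OF sf sf] by (rule nn_integral_norm_abs_h2[OF square_integrable_diff[OF sf sf]])
        also have "\<dots> \<le> ennreal (((1 / 2) ^ k)\<^sup>2)"
          using N[of k "r n" "r m"] rN[OF elim] rN[OF m] by (intro ennreal_leI power_mono) auto
        finally show ?case .
      qed
    qed simp
    finally show ?thesis .
  qed
  have sd: "square_integrable (\<lambda>x. F x - f (r m) x)" for m
    unfolding square_integrable_def
  proof (rule conjI)
    show "integrable torus_measure (\<lambda>x. (norm (F x - f (r m) x))\<^sup>2)"
      using bound[of 0 m] by (intro integrableI_bounded) (auto intro: le_less_trans)
  qed measurable
  have sF: "square_integrable F"
    using square_integrable_add[OF sd[of 0] sf[of "r 0"]] by simp
  have le: "norm (abs_h2 F - X (r m)) \<le> (1 / 2) ^ m" for m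
  proof -
    have "ennreal ((norm (abs_h2 F - X (r m)))\<^sup>2) \<le> ennreal (((1 / 2) ^ m)\<^sup>2)"
      using bound[of m m] unfolding Xf abs_h2_diff[OF sF sf] nn_integral_norm_abs_h2[OF sd] by simp
    then have "(norm (abs_h2 F - X (r m)))\<^sup>2 \<le> ((1 / 2) ^ m)\<^sup>2" by (simp add: ennreal_le_iff)
    then show ?thesis by (rule power2_le_imp_le) simp
  qed
  have "(\<lambda>m. X (r m)) \<longlonglongrightarrow> abs_h2 F"
  proof (rule LIM_zero_cancel, rule Lim_null_comparison)
    show "\<forall>\<^sub>F m in sequentially. norm (X (r m) - abs_h2 F) \<le> (1 / 2) ^ m"
      using le by (simp add: norm_minus_commute)
    show "(\<lambda>m. (1 / 2 :: real) ^ m) \<longlonglongrightarrow> 0" by (rule LIMSEQ_power_zero) simp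
  qed
  then have "(X \<circ> r) \<longlonglongrightarrow> abs_h2 F" by (simp add: o_def)
  from Cauchy_converges_subseq[OF assms rm this] show ?thesis by (auto simp: convergent_def)
qed

instance h2 :: banach
  by standard (rule h2_Cauchy_convergent)

section \<open>Multiplication operators\<close>

text \<open>
  The Ohmic coupling, the current and the density of the Lorentz force all arise by applying a linear
  map \<open>M x\<close> to the values of a state, hence this common notion.
\<close>

definition mult_op :: "(real^2 \<Rightarrow> field \<Rightarrow> field) \<Rightarrow> h2 \<Rightarrow> h2" where
  "mult_op M X = abs_h2 (\<lambda>x. M x (rep_h2 X x))"

definition multiplier :: "real \<Rightarrow> (real^2 \<Rightarrow> field \<Rightarrow> field) \<Rightarrow> bool" where
  "multiplier K M \<longleftrightarrow> 0 \<le> K \<and> (\<forall>x. linear (M x)) \<and> (\<forall>x p. norm (M x p) \<le> K * norm p) \<and>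
     (\<forall>p. (\<lambda>x. M x p) \<in> borel_measurable borel)"

lemma multiplierD:
  assumes "multiplier K M"
  shows "0 \<le> K" "linear (M x)" "norm (M x p) \<le> K * norm p" "(\<lambda>x. M x p) \<in> borel_measurable borel"
  using assms unfolding multiplier_def by blast+

lemma multiplier_measurable:
  assumes "multiplier K M" and [measurable]: "f \<in> borel_measurable torus_measure"
  shows "(\<lambda>x. M x (f x)) \<in> borel_measurable torus_measure"
proof -
  have "M x (f x) = (\<Sum>b\<in>Basis. (f x \<bullet> b) *\<^sub>R M x b)" for x
  proof -
    have "M x (f x) = M x (\<Sum>b\<in>Basis. (f x \<bullet> b) *\<^sub>R b)" by (simp add: euclidean_representation)
    also have "\<dots> = (\<Sum>b\<in>Basis. (f x \<bullet> b) *\<^sub>R M x b)"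
      using multiplierD(2)[OF assms(1)] by (simp add: linear_sum linear_cmul)
    finally show ?thesis .
  qed
  moreover have [measurable]: "(\<lambda>x. M x b) \<in> borel_measurable torus_measure" for b
    by (intro measurable_torus multiplierD(4)[OF assms(1)])
  ultimately show ?thesis by simp
qed

lemma multiplier_square_integrable:
  assumes "multiplier K M" "square_integrable f"
  shows "square_integrable (\<lambda>x. M x (f x))"
proof (rule square_integrable_bound)
  show "(\<lambda>x. M x (f x)) \<in> borel_measurable torus_measure"
    by (rule multiplier_measurable[OF assms(1)]) (use assms(2) in \<open>simp add: square_integrable_def\<close>)
  show "integrable torus_measure (\<lambda>x. (K * norm (f x))\<^sup>2)"
    using assms(2) by (simp add: square_integrable_def power_mult_distrib)
  show "AE x in torus_measure. norm (M x (f x)) \<le> K * norm (f x)"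
    by (intro always_eventually allI multiplierD(3)[OF assms(1)])
qed

lemma mult_op_abs:
  assumes "multiplier K M" "square_integrable f"
  shows "mult_op M (abs_h2 f) = abs_h2 (\<lambda>x. M x (f x))"
  unfolding mult_op_def
proof (rule abs_h2_eqI)
  show "AE x in torus_measure. M x (rep_h2 (abs_h2 f) x) = M x (f x)"
    using rep_abs_h2[OF assms(2)] by eventually_elim simp
qed (rule multiplier_square_integrable[OF assms(1)], simp add: square_integrable_rep assms(2))+

lemma linear_mult_op:
  assumes "multiplier K M"
  shows "linear (mult_op M)"
proof (rule linearI)
  fix X Y :: h2 and c
  have M: "linear (M x)" for x by (rule multiplierD(2)[OF assms])
  have s: "square_integrable (\<lambda>x. M x (rep_h2 X x))" for X
    by (rule multiplier_square_integrable[OF assms square_integrable_rep])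
  have "mult_op M (X + Y) = mult_op M (abs_h2 (\<lambda>x. rep_h2 X x + rep_h2 Y x))"
    by (simp add: abs_h2_add[symmetric] square_integrable_rep abs_rep_h2)
  also have "\<dots> = abs_h2 (\<lambda>x. M x (rep_h2 X x) + M x (rep_h2 Y x))"
    by (simp add: mult_op_abs[OF assms] square_integrable_add square_integrable_rep linear_add[OF M])
  also have "\<dots> = mult_op M X + mult_op M Y" by (simp add: mult_op_def abs_h2_add s)
  finally show "mult_op M (X + Y) = mult_op M X + mult_op M Y" .
  have "mult_op M (c *\<^sub>R X) = mult_op M (abs_h2 (\<lambda>x. c *\<^sub>R rep_h2 X x))"
    by (simp add: abs_h2_scale[symmetric] square_integrable_rep abs_rep_h2)
  also have "\<dots> = abs_h2 (\<lambda>x. c *\<^sub>R M x (rep_h2 X x))"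
    by (simp add: mult_op_abs[OF assms] square_integrable_scaleR square_integrable_rep linear_cmul[OF M])
  also have "\<dots> = c *\<^sub>R mult_op M X" by (simp add: mult_op_def abs_h2_scale s)
  finally show "mult_op M (c *\<^sub>R X) = c *\<^sub>R mult_op M X" .
qed

lemma norm_mult_op_le:
  assumes "multiplier K M"
  shows "norm (mult_op M X) \<le> K * norm X"
proof -
  have "(norm (mult_op M X))\<^sup>2 = (\<integral>x. (norm (M x (rep_h2 X x)))\<^sup>2 \<partial>torus_measure)"
    unfolding mult_op_def by (rule norm_abs_h2[OF multiplier_square_integrable[OF assms square_integrable_rep]])
  also have "\<dots> \<le> (\<integral>x. K\<^sup>2 * (norm (rep_h2 X x))\<^sup>2 \<partial>torus_measure)"
  proof (rule integral_mono)
    show "integrable torus_measure (\<lambda>x. (norm (M x (rep_h2 X x)))\<^sup>2)"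
      using multiplier_square_integrable[OF assms square_integrable_rep] by (simp add: square_integrable_def)
    show "integrable torus_measure (\<lambda>x. K\<^sup>2 * (norm (rep_h2 X x))\<^sup>2)"
      using square_integrable_rep by (simp add: square_integrable_def)
    show "(norm (M x (rep_h2 X x)))\<^sup>2 \<le> K\<^sup>2 * (norm (rep_h2 X x))\<^sup>2" for x
      unfolding power_mult_distrib[symmetric]
      by (intro power_mono multiplierD(3)[OF assms]) simp
  qed
  also have "\<dots> = (K * norm X)\<^sup>2"
    using norm_abs_h2[OF square_integrable_rep, of X] by (simp add: abs_rep_h2 power_mult_distrib)
  finally show ?thesis by (rule power2_le_imp_le) (simp add: multiplierD(1)[OF assms])
qed

lemma continuous_on_mult_op:
  fixes A :: "real set"
  assumes M: "\<And>t. t \<in> A \<Longrightarrow> multiplier K (M t)"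
    and cont: "\<And>x p. continuous_on A (\<lambda>t. M t x p)"
    and Y: "continuous_on A Y"
  shows "continuous_on A (\<lambda>t. mult_op (M t) (Y t))"
  unfolding continuous_on_sequentially
proof (intro allI ballI impI, elim conjE)
  fix t a assume t: "\<forall>n. t n \<in> A" and a: "a \<in> A" and lim: "t \<longlonglongrightarrow> a"
  have Mt: "multiplier K (M (t n))" for n using M t by blast
  have Ma: "multiplier K (M a)" using M a by blast
  have "(\<lambda>n. Y (t n)) \<longlonglongrightarrow> Y a"
    by (rule continuous_on_tendsto_compose[OF Y lim a]) (use t in auto)
  then have "(\<lambda>n. K * norm (Y (t n) - Y a)) \<longlonglongrightarrow> 0"
    by (intro tendsto_mult_right_zero tendsto_norm_zero) (simp add: LIM_zero_iff)
  then have 1: "(\<lambda>n. mult_op (M (t n)) (Y (t n) - Y a)) \<longlonglongrightarrow> 0"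
  proof (rule Lim_null_comparison[rotated])
    show "\<forall>\<^sub>F n in sequentially. norm (mult_op (M (t n)) (Y (t n) - Y a)) \<le> K * norm (Y (t n) - Y a)"
      by (rule always_eventually, rule allI, rule norm_mult_op_le[OF Mt])
  qed
  have 2: "(\<lambda>n. mult_op (M (t n)) (Y a)) \<longlonglongrightarrow> mult_op (M a) (Y a)"
    unfolding mult_op_def
  proof (rule abs_h2_tendsto[where g = "\<lambda>x. K * norm (rep_h2 (Y a) x)"])
    have m: "rep_h2 (Y a) \<in> borel_measurable torus_measure"
      using square_integrable_rep[of "Y a"] unfolding square_integrable_def by (rule conjunct1)
    show "(\<lambda>x. M (t n) x (rep_h2 (Y a) x)) \<in> borel_measurable torus_measure" for n
      by (rule multiplier_measurable[OF Mt m])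
    show "(\<lambda>x. M a x (rep_h2 (Y a) x)) \<in> borel_measurable torus_measure"
      by (rule multiplier_measurable[OF Ma m])
    show "integrable torus_measure (\<lambda>x. (K * norm (rep_h2 (Y a) x))\<^sup>2)"
      using square_integrable_rep by (simp add: square_integrable_def power_mult_distrib)
    show "AE x in torus_measure. norm (M (t n) x (rep_h2 (Y a) x)) \<le> K * norm (rep_h2 (Y a) x)" for n
      by (intro always_eventually allI multiplierD(3)[OF Mt])
    show "AE x in torus_measure. (\<lambda>n. M (t n) x (rep_h2 (Y a) x)) \<longlonglongrightarrow> M a x (rep_h2 (Y a) x)"
      by (rule always_eventually, rule allI, rule continuous_on_tendsto_compose[OF cont lim a]) (use t in auto)
  qed
  have "mult_op (M (t n)) (Y (t n) - Y a) + mult_op (M (t n)) (Y a) = mult_op (M (t n)) (Y (t n))" for n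
    by (simp add: linear_diff[OF linear_mult_op[OF Mt]])
  then show "((\<lambda>t. mult_op (M t) (Y t)) \<circ> t) \<longlonglongrightarrow> mult_op (M a) (Y a)"
    using tendsto_add[OF 1 2] by (simp add: o_def)
qed

section \<open>Integration over the torus\<close>

lemma vec2_eqI: "x $ 1 = y $ 1 \<Longrightarrow> x $ 2 = y $ 2 \<Longrightarrow> x = y" for x y :: "'a^2"
  by (simp add: vec_eq_iff forall_2)

lemma inner_vec2: "x \<bullet> y = x $ 1 * y $ 1 + x $ 2 * y $ 2" for x y :: "real^2"
  by (simp add: inner_vec_def sum_2)

lemma linear_vector2: "bounded_linear (\<lambda>p. vector [fst p, snd p] :: real^2)"
proof -
  have "linear (\<lambda>p. vector [fst p, snd p] :: real^2)"
    by (rule linearI) (simp_all add: vec_eq_iff forall_2)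
  then show ?thesis by (rule linear_linear[THEN iffD2])
qed

lemma continuous_on_vector2:
  "continuous_on A f \<Longrightarrow> continuous_on A g \<Longrightarrow> continuous_on A (\<lambda>x. vector [f x, g x] :: real^2)"
  using bounded_linear.continuous_on[OF linear_vector2 continuous_on_Pair] by fastforce

lemma lborel_vec2: "lborel = distr (lborel :: (real \<times> real) measure) borel (\<lambda>p. vector [fst p, snd p] :: real^2)"
proof (rule lborel_eqI)
  fix l u :: "real^2"
  assume lu: "\<And>b. b \<in> Basis \<Longrightarrow> l \<bullet> b \<le> u \<bullet> b"
  have b: "axis 1 1 \<in> (Basis :: (real^2) set)" "axis 2 1 \<in> (Basis :: (real^2) set)"
    by (auto simp: Basis_vec_def)
  have le: "l $ 1 \<le> u $ 1" "l $ 2 \<le> u $ 2"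
    using lu[OF b(1)] lu[OF b(2)] by (simp_all add: inner_axis)
  have m: "(\<lambda>p. vector [fst p, snd p] :: real^2) \<in> borel_measurable lborel"
    by (simp add: borel_measurable_continuous_onI linear_continuous_on linear_vector2)
  have "(\<lambda>p. vector [fst p, snd p] :: real^2) -` box l u = box (l $ 1, l $ 2) (u $ 1, u $ 2)"
    by (auto simp: mem_box_cart forall_2 box_prod box_real)
  then have "emeasure (distr lborel borel (\<lambda>p. vector [fst p, snd p] :: real^2)) (box l u)
      = emeasure lborel (box (l $ 1, l $ 2) (u $ 1, u $ 2))"
    using m by (simp add: emeasure_distr)
  also have "\<dots> = (\<Prod>b\<in>Basis. ((u $ 1, u $ 2) - (l $ 1, l $ 2)) \<bullet> b)"
    by (rule emeasure_lborel_box) (use le in \<open>auto simp: Basis_prod_def\<close>)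
  also have "(\<Prod>b\<in>Basis. ((u $ 1, u $ 2) - (l $ 1, l $ 2)) \<bullet> b) = (u $ 1 - l $ 1) * (u $ 2 - l $ 2)"
    unfolding Basis_prod_def by (subst prod.union_disjoint) auto
  also have "\<dots> = (\<Prod>b\<in>Basis. (u - l) \<bullet> b)"
  proof -
    have B: "(Basis :: (real^2) set) = {axis 1 1, axis 2 1}" by (auto simp: Basis_vec_def UNIV_2)
    have ne: "axis 1 (1::real) \<noteq> (axis 2 1 :: real^2)" by (simp add: axis_eq_axis)
    have "(\<Prod>b\<in>Basis. (u - l) \<bullet> b) = ((u - l) \<bullet> axis 1 1) * ((u - l) \<bullet> axis 2 1)"
      unfolding B using ne by simp
    then show ?thesis by (simp only: inner_axis) simp
  qed
  finally show "emeasure (distr lborel borel (\<lambda>p. vector [fst p, snd p] :: real^2)) (box l u) = ennreal (\<Prod>b\<in>Basis. (u - l) \<bullet> b)" .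
qed simp

lemma continuous_torus_integrable:
  fixes f :: "real^2 \<Rightarrow> real"
  assumes f: "continuous_on UNIV f"
  shows "integrable torus_measure f"
proof -
  have "set_integrable lborel (cbox 0 (vec (2 * pi))) f"
    unfolding set_integrable_def
    by (rule borel_integrable_compact) (auto intro: continuous_on_subset[OF f])
  then show ?thesis unfolding torus_measure_def
    by (subst integrable_restrict_space) (auto simp: set_integrable_def)
qed

text \<open>
  The fundamental cell is a rectangle, and the coordinate isomorphism between pairs and vectors
  preserves Lebesgue measure (\<open>lborel_vec2\<close>), so that Fubini's theorem for rectangles applies.
\<close>

lemma torus_integral_iterated:
  fixes f :: "real^2 \<Rightarrow> real"
  assumes f: "continuous_on UNIV f"
  shows "(\<integral>x. f x \<partial>torus_measure) = integral {0..2*pi} (\<lambda>a. integral {0..2*pi} (\<lambda>b. f (vector [a, b])))"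
proof -
  let ?v = "\<lambda>p. vector [fst p, snd p] :: real^2"
  have mv: "?v \<in> borel_measurable borel"
    by (simp add: borel_measurable_continuous_onI linear_continuous_on linear_vector2)
  have vf: "continuous_on UNIV (\<lambda>p. f (?v p))"
    by (rule continuous_on_compose2[OF f linear_continuous_on[OF linear_vector2]]) auto
  have ind: "indicator (cbox 0 (vec (2 * pi))) (?v p) = (indicator (cbox (0, 0) (2*pi, 2*pi)) p :: real)" for p
    by (cases p) (auto simp: indicator_def mem_box_cart forall_2 cbox_Pair_eq)
  have "(\<integral>x. f x \<partial>torus_measure) = (\<integral>x. indicator (cbox 0 (vec (2 * pi))) x *\<^sub>R f x \<partial>lborel)"
    unfolding torus_measure_def by (subst integral_restrict_space) (auto simp: set_lebesgue_integral_def)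
  also have "\<dots> = (\<integral>p. indicator (cbox 0 (vec (2 * pi))) (?v p) *\<^sub>R f (?v p) \<partial>lborel)"
  proof (subst lborel_vec2, rule integral_distr)
    show "?v \<in> measurable lborel borel" using mv by simp
    have [measurable]: "f \<in> borel_measurable borel" by (rule borel_measurable_continuous_onI[OF f])
    show "(\<lambda>x. indicator (cbox 0 (vec (2 * pi))) x *\<^sub>R f x) \<in> borel_measurable borel" by measurable
  qed
  also have "\<dots> = (LINT p:cbox (0, 0) (2*pi, 2*pi)|lborel. f (?v p))"
    by (simp add: ind set_lebesgue_integral_def)
  also have "\<dots> = integral (cbox (0, 0) (2*pi, 2*pi)) (\<lambda>p. f (?v p))"
    by (rule set_borel_integral_eq_integral(2), unfold set_integrable_def, rule borel_integrable_compact)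
      (auto intro: continuous_on_subset[OF vf])
  also have "\<dots> = integral (cbox 0 (2*pi)) (\<lambda>a. integral (cbox 0 (2*pi)) (\<lambda>b. f (?v (a, b))))"
    by (rule integral_prod_continuous) (auto intro: continuous_on_subset[OF vf])
  finally show ?thesis by simp
qed

lemma torus_integral_iterated':
  fixes f :: "real^2 \<Rightarrow> real"
  assumes f: "continuous_on UNIV f"
  shows "(\<integral>x. f x \<partial>torus_measure) = integral {0..2*pi} (\<lambda>b. integral {0..2*pi} (\<lambda>a. f (vector [a, b])))"
proof -
  have "continuous_on (cbox (0, 0) (2*pi, 2*pi)) (\<lambda>(a, b). f (vector [a, b]))"
    unfolding case_prod_unfold
    by (rule continuous_on_compose2[OF f linear_continuous_on[OF linear_vector2]]) auto
  from integral_swap_continuous[OF this]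
  show ?thesis unfolding torus_integral_iterated[OF f] by simp
qed

lemma torus_integral_product:
  fixes f g :: "real \<Rightarrow> real"
  assumes "continuous_on UNIV f" "continuous_on UNIV g"
  shows "(\<integral>x. f (x $ 1) * g (x $ 2) \<partial>torus_measure) = integral {0..2*pi} f * integral {0..2*pi} g"
proof -
  have "continuous_on UNIV (\<lambda>x::real^2. f (x $ 1) * g (x $ 2))"
    by (intro continuous_intros continuous_on_compose2[OF assms(1)] continuous_on_compose2[OF assms(2)]) auto
  from torus_integral_iterated[OF this] show ?thesis by simp
qed

text \<open>
  The regularity at which integration by parts holds and the operators act classically. It includes the
  packets below, which are not test functions.
\<close>

definition C1_periodic :: "(real^2 \<Rightarrow> real) \<Rightarrow> bool" where
  "C1_periodic f \<longleftrightarrow> (\<forall>x. f differentiable (at x)) \<and> (\<forall>i. continuous_on UNIV (pd i f)) \<and> periodic f"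

lemma has_derivative_pd:
  assumes "f differentiable (at x)"
  shows "(f has_derivative (\<lambda>h. pd 1 f x * h $ 1 + pd 2 f x * h $ 2)) (at x)"
proof -
  have d: "(f has_derivative frechet_derivative f (at x)) (at x)"
    using assms by (simp add: frechet_derivative_works)
  have "frechet_derivative f (at x) h = pd 1 f x * h $ 1 + pd 2 f x * h $ 2" for h
  proof -
    have h: "h = (h $ 1) *\<^sub>R axis 1 1 + (h $ 2) *\<^sub>R axis 2 1"
      by (rule vec2_eqI) (simp_all add: axis_def)
    interpret D: bounded_linear "frechet_derivative f (at x)" using d by (rule has_derivative_bounded_linear)
    show ?thesis by (subst h) (simp only: D.add D.scaleR pd_def real_scaleR_def mult.commute)
  qed
  then have "frechet_derivative f (at x) = (\<lambda>h. pd 1 f x * h $ 1 + pd 2 f x * h $ 2)" by (rule ext)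
  then show ?thesis using d by simp
qed

lemma pd_eqI:
  assumes "(f has_derivative (\<lambda>h. a * h $ 1 + b * h $ 2)) (at x)"
  shows "pd 1 f x = a" "pd 2 f x = b"
  unfolding pd_def frechet_derivative_at[OF assms, symmetric] by (simp_all add: axis_def)

lemma C1_periodicI:
  assumes d: "\<And>x. (f has_derivative (\<lambda>h. f1 x * h $ 1 + f2 x * h $ 2)) (at x)"
    and c: "continuous_on UNIV f1" "continuous_on UNIV f2" and p: "periodic f"
  shows "C1_periodic f" "pd 1 f = f1" "pd 2 f = f2"
proof -
  show 1: "pd 1 f = f1" and 2: "pd 2 f = f2" using pd_eqI[OF d] by auto
  show "C1_periodic f" unfolding C1_periodic_def
    using d c p 1 2 by (auto simp: differentiable_def forall_2)
qed

lemma C1_periodicD: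
  assumes "C1_periodic f"
  shows "(f has_derivative (\<lambda>h. pd 1 f x * h $ 1 + pd 2 f x * h $ 2)) (at x)"
    "continuous_on UNIV f" "continuous_on UNIV (pd i f)" "periodic f"
  using assms has_derivative_pd unfolding C1_periodic_def
  by (auto simp: continuous_on_eq_continuous_at intro: differentiable_imp_continuous_within)

lemma C1_periodic_mult:
  assumes f: "C1_periodic f" and g: "C1_periodic g"
  shows "C1_periodic (\<lambda>x. f x * g x)" "pd i (\<lambda>x. f x * g x) = (\<lambda>x. f x * pd i g x + pd i f x * g x)"
proof -
  have d: "((\<lambda>x. f x * g x) has_derivative (\<lambda>h. (f x * pd 1 g x + pd 1 f x * g x) * h $ 1 + (f x * pd 2 g x + pd 2 f x * g x) * h $ 2)) (at x)" for x
    by (rule has_derivative_eq_rhs[OF has_derivative_mult[OF C1_periodicD(1)[OF f] C1_periodicD(1)[OF g]]])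
      (simp add: fun_eq_iff algebra_simps)
  have p: "periodic (\<lambda>x. f x * g x)"
    using C1_periodicD(4)[OF f] C1_periodicD(4)[OF g] by (simp add: periodic_def)
  have c: "continuous_on UNIV (\<lambda>x. f x * pd i g x + pd i f x * g x)" for i
    using C1_periodicD(2,3)[OF f] C1_periodicD(2,3)[OF g] by (auto intro!: continuous_intros)
  note * = C1_periodicI[OF d c c p]
  show "C1_periodic (\<lambda>x. f x * g x)" by (rule *(1))
  have "\<forall>i. pd i (\<lambda>x. f x * g x) = (\<lambda>x. f x * pd i g x + pd i f x * g x)"
    unfolding forall_2 using *(2,3) by simp
  then show "pd i (\<lambda>x. f x * g x) = (\<lambda>x. f x * pd i g x + pd i f x * g x)" ..
qed

text \<open>
  Integrating first in the direction of the derivative leaves a difference of two values of \<open>f\<close> one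
  period apart.
\<close>

lemma torus_integral_pd:
  assumes f: "C1_periodic f"
  shows "(\<integral>x. pd i f x \<partial>torus_measure) = 0"
proof -
  have per: "f (x + axis i (2 * pi)) = f x" for x i
    using C1_periodicD(4)[OF f] by (simp add: periodic_def)
  have 1: "(\<integral>x. pd 1 f x \<partial>torus_measure) = 0"
  proof -
    have "integral {0..2*pi} (\<lambda>a. pd 1 f (vector [a, b])) = 0" for b
    proof (rule integral_unique)
      have v: "((\<lambda>a. vector [a, b] :: real^2) has_derivative (\<lambda>h. vector [h, 0])) (at a within {0..2*pi})" for a
        using has_derivative_compose[of "\<lambda>a. (a, b)" "\<lambda>h. (h, 0)" a "{0..2*pi}" "\<lambda>p. vector [fst p, snd p] :: real^2" "\<lambda>p. vector [fst p, snd p]"]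
        by (simp add: bounded_linear_imp_has_derivative linear_vector2 has_derivative_Pair has_derivative_ident)
      have "((\<lambda>a. f (vector [a, b])) has_vector_derivative pd 1 f (vector [a, b])) (at a within {0..2*pi})" for a
        using has_derivative_compose[OF v C1_periodicD(1)[OF f]]
        by (simp add: has_vector_derivative_def mult.commute)
      then have "((\<lambda>a. pd 1 f (vector [a, b])) has_integral f (vector [2*pi, b]) - f (vector [0, b])) {0..2*pi}"
        by (intro fundamental_theorem_of_calculus) auto
      moreover have "vector [2*pi, b] = vector [0, b] + (axis 1 (2*pi) :: real^2)"
        by (rule vec2_eqI) (simp_all add: axis_def)
      ultimately show "((\<lambda>a. pd 1 f (vector [a, b])) has_integral 0) {0..2*pi}" by (simp add: per)
    qed
    then show ?thesis using torus_integral_iterated'[OF C1_periodicD(3)[OF f, of 1]] by simp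
  qed
  have 2: "(\<integral>x. pd 2 f x \<partial>torus_measure) = 0"
  proof -
    have "integral {0..2*pi} (\<lambda>b. pd 2 f (vector [a, b])) = 0" for a
    proof (rule integral_unique)
      have v: "((\<lambda>b. vector [a, b] :: real^2) has_derivative (\<lambda>h. vector [0, h])) (at b within {0..2*pi})" for b
        using has_derivative_compose[of "\<lambda>b. (a, b)" "\<lambda>h. (0, h)" b "{0..2*pi}" "\<lambda>p. vector [fst p, snd p] :: real^2" "\<lambda>p. vector [fst p, snd p]"]
        by (simp add: bounded_linear_imp_has_derivative linear_vector2 has_derivative_Pair has_derivative_ident)
      have "((\<lambda>b. f (vector [a, b])) has_vector_derivative pd 2 f (vector [a, b])) (at b within {0..2*pi})" for b
        using has_derivative_compose[OF v C1_periodicD(1)[OF f]]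
        by (simp add: has_vector_derivative_def mult.commute)
      then have "((\<lambda>b. pd 2 f (vector [a, b])) has_integral f (vector [a, 2*pi]) - f (vector [a, 0])) {0..2*pi}"
        by (intro fundamental_theorem_of_calculus) auto
      moreover have "vector [a, 2*pi] = vector [a, 0] + (axis 2 (2*pi) :: real^2)"
        by (rule vec2_eqI) (simp_all add: axis_def)
      ultimately show "((\<lambda>b. pd 2 f (vector [a, b])) has_integral 0) {0..2*pi}" by (simp add: per)
    qed
    then show ?thesis using torus_integral_iterated[OF C1_periodicD(3)[OF f, of 2]] by simp
  qed
  from 1 2 have "\<forall>i. (\<integral>x. pd i f x \<partial>torus_measure) = 0" unfolding forall_2 by simp
  then show ?thesis ..
qed

lemma torus_integral_by_parts:
  assumes f: "C1_periodic f" and g: "C1_periodic g"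
  shows "(\<integral>x. pd i f x * g x \<partial>torus_measure) = - (\<integral>x. f x * pd i g x \<partial>torus_measure)"
proof -
  have "integrable torus_measure (\<lambda>x. pd i f x * g x)" "integrable torus_measure (\<lambda>x. f x * pd i g x)"
    using C1_periodicD(2,3)[OF f] C1_periodicD(2,3)[OF g]
    by (auto intro!: continuous_torus_integrable continuous_intros)
  then have "(\<integral>x. f x * pd i g x + pd i f x * g x \<partial>torus_measure)
     = (\<integral>x. f x * pd i g x \<partial>torus_measure) + (\<integral>x. pd i f x * g x \<partial>torus_measure)" by simp
  then show ?thesis
    using torus_integral_pd[OF C1_periodic_mult(1)[OF f g], of i] unfolding C1_periodic_mult(2)[OF f g] by simp
qed

lemma test_function_C1: "test_function \<phi> \<Longrightarrow> C1_periodic \<phi>"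
proof -
  assume t: "test_function \<phi>"
  then have "C_k (Suc 0) \<phi>" by (simp add: test_function_def smooth_def)
  moreover have "axis i 1 \<in> (Basis :: (real^2) set)" for i by (auto simp: Basis_vec_def)
  ultimately show ?thesis using t
    by (auto simp: C1_periodic_def test_function_def pd_def[abs_def])
qed

text \<open>
  For an antiderivative \<open>F\<close> of \<open>f\<close> the integral over a shifted period is \<open>F (2 \<pi> - a) - F (- a)\<close>, whose
  derivative in \<open>a\<close> vanishes by periodicity.
\<close>

lemma integral_periodic_shift:
  fixes f :: "real \<Rightarrow> real"
  assumes f: "continuous_on UNIV f" and p: "\<And>x. f (x + 2 * pi) = f x"
  shows "integral {0..2*pi} (\<lambda>s. f (s - a)) = integral {0..2*pi} f"
proof -
  \<comment> \<open>An interval that contains every point of the shifted periods in its interior.\<close>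
  define M where "M = \<bar>a\<bar> + 2 * pi + 1"
  have "continuous_on {-M..M} f" by (rule continuous_on_subset[OF f]) simp
  from antiderivative_continuous[OF this] obtain F
    where F: "\<And>x. x \<in> {-M..M} \<Longrightarrow> (F has_vector_derivative f x) (at x within {-M..M})" by blast
  have F': "(F has_real_derivative f x) (at x)" if "-M < x" "x < M" for x
    using F[of x] that by (simp add: at_within_Icc_at has_real_derivative_iff_has_vector_derivative)
  have shift: "integral {0..2*pi} (\<lambda>s. f (s - c)) = F (2 * pi - c) - F (- c)" if "\<bar>c\<bar> \<le> \<bar>a\<bar>" for c
  proof (rule integral_unique, rule fundamental_theorem_of_calculus[of 0 "2*pi" "\<lambda>s. F (s - c)", simplified])
    fix s assume s: "0 \<le> s \<and> s \<le> 2 * pi"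
    have "((\<lambda>s. F (s - c)) has_real_derivative f (s - c) * 1) (at s)"
      by (rule DERIV_chain2[OF F']) (use s that in \<open>auto simp: M_def intro!: derivative_eq_intros\<close>)
    then show "((\<lambda>s. F (s - c)) has_vector_derivative f (s - c)) (at s within {0..2*pi})"
      by (simp add: has_real_derivative_iff_has_vector_derivative has_vector_derivative_at_within)
  qed
  have "\<exists>k. \<forall>x\<in>{-\<bar>a\<bar>..\<bar>a\<bar>}. F (2 * pi - x) - F (- x) = k"
  proof (rule has_derivative_zero_constant)
    fix x assume x: "x \<in> {-\<bar>a\<bar>..\<bar>a\<bar>}"
    have "((\<lambda>x. F (2 * pi - x) - F (- x)) has_real_derivative f (2 * pi - x) * (- 1) - f (- x) * (- 1)) (at x)"
      by (intro DERIV_diff DERIV_chain2[OF F']) (use x pi_gt_zero in \<open>auto simp: M_def simp del: pi_gt_zero intro!: derivative_eq_intros\<close>)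
    moreover have "f (2 * pi - x) * (- 1) - f (- x) * (- 1) = 0" using p[of "- x"] by (simp add: add.commute)
    ultimately have "((\<lambda>x. F (2 * pi - x) - F (- x)) has_derivative (*) 0) (at x)"
      by (simp only: has_field_derivative_def)
    moreover have "(*) 0 = (\<lambda>h::real. 0::real)" by auto
    ultimately show "((\<lambda>x. F (2 * pi - x) - F (- x)) has_derivative (\<lambda>h. 0)) (at x within {-\<bar>a\<bar>..\<bar>a\<bar>})"
      by (simp only: has_derivative_at_withinI)
  qed simp
  then obtain k where k: "\<forall>x\<in>{-\<bar>a\<bar>..\<bar>a\<bar>}. F (2 * pi - x) - F (- x) = k" ..
  have "a \<in> {-\<bar>a\<bar>..\<bar>a\<bar>}" "0 \<in> {-\<bar>a\<bar>..\<bar>a\<bar>}"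
    unfolding atLeastAtMost_iff by (intro conjI; linarith)+
  from bspec[OF k this(1)] bspec[OF k this(2)] show ?thesis using shift[of a] shift[of 0] by simp
qed

section \<open>Density of trigonometric modes\<close>

definition phase :: "int \<Rightarrow> int \<Rightarrow> real^2 \<Rightarrow> real" where
  "phase m n x = of_int m * x $ 1 + of_int n * x $ 2"

lemma phase_add: "phase m n x + phase m' n' x = phase (m + m') (n + n') x"
  and phase_diff: "phase m n x - phase m' n' x = phase (m - m') (n - n') x"
  by (simp_all add: phase_def algebra_simps)

text \<open>
  Real trigonometric polynomials as a linear span. They form an algebra because of the addition
  theorems, which is what the Stone--Weierstrass theorem requires.
\<close>

inductive trig :: "(real^2 \<Rightarrow> real) \<Rightarrow> bool" where
  trig_cos: "trig (\<lambda>x. cos (phase m n x))"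
| trig_sin: "trig (\<lambda>x. sin (phase m n x))"
| trig_add: "trig f \<Longrightarrow> trig g \<Longrightarrow> trig (\<lambda>x. f x + g x)"
| trig_scale: "trig f \<Longrightarrow> trig (\<lambda>x. c * f x)"

lemma trig_const: "trig (\<lambda>x. c)"
  using trig_scale[OF trig_cos[of 0 0], of c] by (simp add: phase_def)

lemma trig_half_add: "trig f \<Longrightarrow> trig g \<Longrightarrow> trig (\<lambda>x. (f x + g x) / 2)"
  using trig_scale[OF trig_add, of f g "1 / 2"] by simp

lemma trig_half_diff: "trig f \<Longrightarrow> trig g \<Longrightarrow> trig (\<lambda>x. (f x - g x) / 2)"
  using trig_half_add[OF _ trig_scale[of g "- 1"], of f] by simp

lemma trig_mult: "trig f \<Longrightarrow> trig g \<Longrightarrow> trig (\<lambda>x. f x * g x)"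
proof (induction f rule: trig.induct)
  case (trig_cos m n)
  then show ?case
  proof (induction g rule: trig.induct)
    case (trig_cos m' n')
    show ?case unfolding cos_times_cos phase_add phase_diff by (intro trig_half_add trig.trig_cos)
  next
    case (trig_sin m' n')
    show ?case unfolding cos_times_sin phase_add phase_diff by (intro trig_half_diff trig.trig_sin)
  next
    case (trig_add f g)
    then show ?case unfolding distrib_left by (intro trig.trig_add)
  next
    case (trig_scale f c)
    then show ?case using trig.trig_scale[of _ c] by (simp add: mult.left_commute)
  qed
next
  case (trig_sin m n)
  then show ?case
  proof (induction g rule: trig.induct)
    case (trig_cos m' n')
    show ?case unfolding sin_times_cos phase_add phase_diff by (intro trig_half_add trig.trig_sin)
  next
    case (trig_sin m' n')
    show ?case unfolding sin_times_sin phase_add phase_diff by (intro trig_half_diff trig.trig_cos)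
  next
    case (trig_add f g)
    then show ?case unfolding distrib_left by (intro trig.trig_add)
  next
    case (trig_scale f c)
    then show ?case using trig.trig_scale[of _ c] by (simp add: mult.left_commute)
  qed
next
  case (trig_add f f')
  then show ?case unfolding distrib_right by (intro trig.trig_add)
next
  case (trig_scale f c)
  then show ?case using trig.trig_scale[of _ c] by (simp add: mult.assoc)
qed

lemma continuous_on_phase [continuous_intros]: "continuous_on A (phase m n)"
  unfolding phase_def by (intro continuous_intros)

lemma trig_continuous: "trig f \<Longrightarrow> continuous_on UNIV f"
  by (induction rule: trig.induct) (auto intro!: continuous_intros)

lemma square_integrable_continuous:
  fixes f :: "real^2 \<Rightarrow> field"
  assumes "continuous_on UNIV f"
  shows "square_integrable f"
  unfolding square_integrable_def
  using assms by (auto intro!: continuous_torus_integrable continuous_intros measurable_torus borel_measurable_continuous_onI)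

text \<open>
  The torus as a compact subset of \<open>\<complex>\<^sup>2\<close>: polynomials in the four real coordinates of this point are
  trigonometric polynomials in \<open>x\<close>.
\<close>

definition circle_pair :: "real^2 \<Rightarrow> complex \<times> complex" where
  "circle_pair x = (cis (x $ 1), cis (x $ 2))"

lemma continuous_circle_pair: "continuous_on A circle_pair"
  unfolding circle_pair_def cis_conv_exp by (intro continuous_intros)

lemma trig_polynomial:
  assumes "real_polynomial_function p"
  shows "trig (\<lambda>x. p (circle_pair x))"
  using assms
proof induction
  case (linear f)
  interpret bounded_linear f by fact
  have "f (circle_pair x) = (f (1, 0) * cos (phase 1 0 x) + f (\<i>, 0) * sin (phase 1 0 x))
     + (f (0, 1) * cos (phase 0 1 x) + f (0, \<i>) * sin (phase 0 1 x))" for x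
  proof -
    have "circle_pair x = (cos (x $ 1) *\<^sub>R (1, 0) + sin (x $ 1) *\<^sub>R (\<i>, 0)) + (cos (x $ 2) *\<^sub>R (0, 1) + sin (x $ 2) *\<^sub>R (0, \<i>))"
      by (simp add: circle_pair_def complex_eq_iff)
    then show ?thesis by (simp only: add scaleR) (simp add: phase_def)
  qed
  then show ?case by (simp only:) (intro trig.intros)
next
  case (const c)
  show ?case by (rule trig_const)
next
  case (add f g)
  then show ?case by (intro trig.trig_add)
next
  case (mult f g)
  then show ?case by (intro trig_mult)
qed

lemma AE_torus_interior: "AE x in torus_measure. x \<in> box 0 (vec (2 * pi))"
proof -
  have "cbox 0 (vec (2 * pi)) - box 0 (vec (2 * pi) :: real^2) \<in> null_sets lborel"
    using negligible_frontier_interval[of 0 "vec (2 * pi) :: real^2"]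
    by (simp add: negligible_iff_null_sets null_sets_completion_iff)
  then have "AE x in lborel. x \<notin> cbox 0 (vec (2 * pi)) - box 0 (vec (2 * pi) :: real^2)" by (rule AE_not_in)
  then show ?thesis unfolding torus_measure_def
    by (subst AE_restrict_space_iff) (auto elim: eventually_mono)
qed

text \<open>
  The open sector that cuts the arc with angles between \<open>a\<close> and \<open>b\<close> out of the unit circle. It avoids
  the nonnegative real axis because \<open>Arg2pi\<close> is continuous only off that axis.
\<close>

definition arc :: "real \<Rightarrow> real \<Rightarrow> complex set" where
  "arc a b = (- \<real>\<^sub>\<ge>\<^sub>0) \<inter> Arg2pi -` {a<..<b}"

lemma open_arc: "open (arc a b)"
  unfolding arc_def
  by (rule continuous_open_preimage) (auto intro: continuous_at_Arg2pi continuous_at_imp_continuous_on simp: open_Compl)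

lemma cis_in_arc:
  assumes "0 \<le> a" "b \<le> 2 * pi" "0 \<le> s" "s \<le> 2 * pi"
  shows "cis s \<in> arc a b \<longleftrightarrow> a < s \<and> s < b"
proof (cases "s = 0 \<or> s = 2 * pi")
  case True
  then have "cis s = 1" by auto
  then show ?thesis using assms True by (auto simp: arc_def)
next
  case False
  then have s: "0 < s" "s < 2 * pi" using assms by auto
  have A: "Arg2pi (cis s) = s"
    using Arg2pi_unique[of 1 s "cis s"] s by (simp add: cis_conv_exp mult.commute)
  have "cis s \<notin> \<real>\<^sub>\<ge>\<^sub>0"
  proof
    assume "cis s \<in> \<real>\<^sub>\<ge>\<^sub>0"
    then have "Arg2pi (cis s) = 0" by (auto simp: Arg2pi_eq_0 nonneg_Reals_def complex_is_Real_iff complex_eq_iff)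
    then show False using A s by simp
  qed
  then show ?thesis by (simp add: arc_def A)
qed

text \<open>
  The closed subspace absorbs ever larger classes of scalar functions times fixed vectors: trigonometric
  polynomials, continuous functions of \<open>circle_pair\<close> by Stone--Weierstrass, indicators of open sets as
  increasing limits of continuous functions, indicators of boxes, of Borel sets by Dynkin's
  \<open>\<pi>\<close>-\<open>\<lambda>\<close>-theorem, and at last simple functions and their limits.
\<close>

lemma closed_subspace_eq_UNIV_if_modes:
  assumes C: "closed C" "subspace C"
    and cosC: "\<And>m n e. abs_h2 (\<lambda>x. cos (phase m n x) *\<^sub>R e) \<in> C"
    and sinC: "\<And>m n e. abs_h2 (\<lambda>x. sin (phase m n x) *\<^sub>R e) \<in> C"
  shows "C = UNIV"
proof -
  have lim: "abs_h2 F \<in> C" if "\<And>n. abs_h2 (f n) \<in> C" "(\<lambda>n. abs_h2 (f n)) \<longlonglongrightarrow> abs_h2 F" for f F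
    by (rule closed_sequentially[OF C(1), of "\<lambda>n. abs_h2 (f n)"]) (use that in auto)
  have trigC: "abs_h2 (\<lambda>x. f x *\<^sub>R e) \<in> C" if "trig f" for f e
    using that
  proof induction
    case (trig_add f g)
    have "square_integrable (\<lambda>x. f x *\<^sub>R e)" "square_integrable (\<lambda>x. g x *\<^sub>R e)"
      using trig_add.hyps by (auto intro!: square_integrable_continuous continuous_intros trig_continuous)
    from abs_h2_add[OF this] show ?case
      using subspace_add[OF C(2) trig_add.IH] by (simp add: scaleR_add_left)
  next
    case (trig_scale f c)
    have "square_integrable (\<lambda>x. f x *\<^sub>R e)"
      using trig_scale.hyps by (auto intro!: square_integrable_continuous continuous_intros trig_continuous)
    from abs_h2_scale[OF this, of c] show ?case
      using subspace_scale[OF C(2) trig_scale.IH, of c] by simp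
  qed (rule cosC sinC)+
  have contC: "abs_h2 (\<lambda>x. g (circle_pair x) *\<^sub>R e) \<in> C" if g: "continuous_on UNIV g" for g e
  proof -
    let ?K = "sphere (0::complex) 1 \<times> sphere (0::complex) 1"
    have K: "compact ?K" by (intro compact_Times compact_sphere)
    have cK: "circle_pair x \<in> ?K" for x by (simp add: circle_pair_def)
    have "\<exists>p. real_polynomial_function p \<and> (\<forall>z\<in>?K. \<bar>g z - p z\<bar> < 1 / real (Suc n))" for n
      by (rule Stone_Weierstrass_real_polynomial_function[OF K continuous_on_subset[OF g], of "1 / real (Suc n)"]) auto
    then obtain p where p: "\<And>n. real_polynomial_function (p n)"
      "\<And>n z. z \<in> ?K \<Longrightarrow> \<bar>g z - p n z\<bar> < 1 / real (Suc n)" by metis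
    have gc: "continuous_on UNIV (\<lambda>x. g (circle_pair x))"
      by (rule continuous_on_compose2[OF g continuous_circle_pair]) auto
    have pc: "continuous_on UNIV (\<lambda>x. p n (circle_pair x))" for n
      by (rule trig_continuous[OF trig_polynomial[OF p(1)]])
    obtain B where B: "\<And>z. z \<in> ?K \<Longrightarrow> \<bar>g z\<bar> \<le> B"
      using compact_imp_bounded[OF compact_continuous_image[OF continuous_on_subset[OF g] K]]
      by (auto simp: bounded_iff)
    show ?thesis
    proof (rule lim)
      show "abs_h2 (\<lambda>x. p n (circle_pair x) *\<^sub>R e) \<in> C" for n by (rule trigC[OF trig_polynomial[OF p(1)]])
      show "(\<lambda>n. abs_h2 (\<lambda>x. p n (circle_pair x) *\<^sub>R e)) \<longlonglongrightarrow> abs_h2 (\<lambda>x. g (circle_pair x) *\<^sub>R e)"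
      proof (rule abs_h2_tendsto[where g = "\<lambda>x. (B + 1) * norm e"])
        show "(\<lambda>x. p n (circle_pair x) *\<^sub>R e) \<in> borel_measurable torus_measure" for n
          by (intro measurable_torus borel_measurable_continuous_onI continuous_intros pc)
        show "(\<lambda>x. g (circle_pair x) *\<^sub>R e) \<in> borel_measurable torus_measure"
          by (intro measurable_torus borel_measurable_continuous_onI continuous_intros gc)
        show "AE x in torus_measure. norm (p n (circle_pair x) *\<^sub>R e) \<le> (B + 1) * norm e" for n
        proof (rule always_eventually, rule allI)
          fix x
          have "\<bar>g (circle_pair x) - p n (circle_pair x)\<bar> < 1 / real (Suc n)" "\<bar>g (circle_pair x)\<bar> \<le> B"
            using p(2)[OF cK] B[OF cK] by auto
          moreover have "1 / real (Suc n) \<le> 1" by simp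
          ultimately have "\<bar>p n (circle_pair x)\<bar> \<le> B + 1" by linarith
          then show "norm (p n (circle_pair x) *\<^sub>R e) \<le> (B + 1) * norm e" by (simp add: mult_right_mono)
        qed
        show "AE x in torus_measure. (\<lambda>n. p n (circle_pair x) *\<^sub>R e) \<longlonglongrightarrow> g (circle_pair x) *\<^sub>R e"
        proof (rule always_eventually, rule allI)
          fix x
          have "(\<lambda>n. p n (circle_pair x) - g (circle_pair x)) \<longlonglongrightarrow> 0"
          proof (rule Lim_null_comparison)
            show "\<forall>\<^sub>F n in sequentially. norm (p n (circle_pair x) - g (circle_pair x)) \<le> 1 / real (Suc n)"
              using p(2)[OF cK] by (intro always_eventually allI) (simp add: abs_minus_commute less_imp_le)
            show "(\<lambda>n. 1 / real (Suc n)) \<longlonglongrightarrow> 0" by (rule LIMSEQ_Suc[OF lim_1_over_n])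
          qed
          then have "(\<lambda>n. p n (circle_pair x)) \<longlonglongrightarrow> g (circle_pair x)" by (rule LIM_zero_cancel)
          then show "(\<lambda>n. p n (circle_pair x) *\<^sub>R e) \<longlonglongrightarrow> g (circle_pair x) *\<^sub>R e" by (intro tendsto_intros)
        qed
      qed simp
    qed
  qed
  have openC: "abs_h2 (\<lambda>x. indicator U (circle_pair x) *\<^sub>R e) \<in> C" if U: "open U" "U \<noteq> UNIV" for U e
  proof -
    \<comment> \<open>Continuous functions increasing to the indicator of \<open>U\<close>.\<close>
    define g where "g n z = min 1 (real n * infdist z (- U))" for n z
    have gc: "continuous_on UNIV (g n)" for n unfolding g_def by (intro continuous_intros)
    have gcp: "continuous_on UNIV (\<lambda>x. g n (circle_pair x))" for n
      by (rule continuous_on_compose2[OF gc continuous_circle_pair]) auto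
    have g01: "0 \<le> g n z" "g n z \<le> 1" for n z by (auto simp: g_def infdist_nonneg)
    have glim: "(\<lambda>n. g n z) \<longlonglongrightarrow> indicator U z" for z
    proof (cases "z \<in> U")
      case True
      have "- U \<noteq> {}" "closed (- U)" using U by (auto simp: closed_Compl)
      then have d: "infdist z (- U) > 0"
        using True in_closed_iff_infdist_zero[of "- U" z] infdist_nonneg[of z "- U"] by fastforce
      obtain N where N: "real N * infdist z (- U) > 1"
        using d reals_Archimedean3[OF d] by blast
      have "g n z = 1" if "n \<ge> N" for n
      proof -
        have "real N * infdist z (- U) \<le> real n * infdist z (- U)" using that d by (intro mult_right_mono) auto
        then show ?thesis using N by (simp add: g_def)
      qed
      then have "\<forall>\<^sub>F n in sequentially. g n z = indicator U z"
        using True by (auto simp: eventually_sequentially)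
      then show ?thesis by (rule tendsto_eventually)
    next
      case False
      then have "g n z = indicator U z" for n by (simp add: g_def)
      then show ?thesis by simp
    qed
    have [measurable]: "U \<in> sets borel" using U by simp
    have [measurable]: "circle_pair \<in> borel_measurable borel"
      by (rule borel_measurable_continuous_onI[OF continuous_circle_pair])
    show ?thesis
    proof (rule lim)
      show "abs_h2 (\<lambda>x. g n (circle_pair x) *\<^sub>R e) \<in> C" for n by (rule contC[OF gc])
      show "(\<lambda>n. abs_h2 (\<lambda>x. g n (circle_pair x) *\<^sub>R e)) \<longlonglongrightarrow> abs_h2 (\<lambda>x. indicator U (circle_pair x) *\<^sub>R e)"
      proof (rule abs_h2_tendsto[where g = "\<lambda>x. norm e"])
        show "(\<lambda>x. g n (circle_pair x) *\<^sub>R e) \<in> borel_measurable torus_measure" for n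
          by (intro measurable_torus borel_measurable_continuous_onI continuous_intros gcp)
        show "(\<lambda>x. indicator U (circle_pair x) *\<^sub>R e) \<in> borel_measurable torus_measure"
          by (intro measurable_torus) measurable
        show "AE x in torus_measure. norm (g n (circle_pair x) *\<^sub>R e) \<le> norm e" for n
          using g01 by (intro always_eventually allI) (simp add: mult_left_le_one_le)
        show "AE x in torus_measure. (\<lambda>n. g n (circle_pair x) *\<^sub>R e) \<longlonglongrightarrow> indicator U (circle_pair x) *\<^sub>R e"
          by (intro always_eventually allI tendsto_intros glim)
      qed simp
    qed
  qed
  have si: "square_integrable (\<lambda>x. indicator A x *\<^sub>R e)" if "A \<in> sets borel" for A and e :: field
  proof (rule square_integrable_bounded)
    show "(\<lambda>x. indicator A x *\<^sub>R e) \<in> borel_measurable torus_measure"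
      using that by (intro measurable_torus borel_measurable_scaleR borel_measurable_indicator) auto
    show "norm (indicator A x *\<^sub>R e) \<le> norm e" for x by (simp add: indicator_def)
  qed
  have boxC: "abs_h2 (\<lambda>x. indicator (box l u) x *\<^sub>R e) \<in> C" for l u e
  proof -
    let ?a = "\<lambda>i. max 0 (l $ i)" and ?b = "\<lambda>i. min (2 * pi) (u $ i)"
    let ?U = "arc (?a 1) (?b 1) \<times> arc (?a 2) (?b 2)"
    \<comment> \<open>Almost every point of the cell has both angles in \<open>(0, 2 \<pi>)\<close>, where a box in the angles is
      a product of open arcs.\<close>
    have "open ?U" by (intro open_Times open_arc)
    moreover have "(0, 0) \<notin> ?U" by (simp add: arc_def)
    then have "?U \<noteq> UNIV" by blast
    ultimately have "abs_h2 (\<lambda>x. indicator ?U (circle_pair x) *\<^sub>R e) \<in> C" by (rule openC)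
    moreover have "abs_h2 (\<lambda>x. indicator ?U (circle_pair x) *\<^sub>R e) = abs_h2 (\<lambda>x. indicator (box l u) x *\<^sub>R e)"
    proof (rule abs_h2_eqI)
      have [measurable]: "?U \<in> sets borel" using \<open>open ?U\<close> by simp
      have [measurable]: "circle_pair \<in> borel_measurable borel"
        by (rule borel_measurable_continuous_onI[OF continuous_circle_pair])
      show "square_integrable (\<lambda>x. indicator ?U (circle_pair x) *\<^sub>R e)"
      proof (rule square_integrable_bounded)
        show "(\<lambda>x. indicator ?U (circle_pair x) *\<^sub>R e) \<in> borel_measurable torus_measure"
          by (intro measurable_torus) measurable
        show "norm (indicator ?U (circle_pair x) *\<^sub>R e) \<le> norm e" for x by (simp add: indicator_def)
      qed
      show "AE x in torus_measure. indicator ?U (circle_pair x) *\<^sub>R e = indicator (box l u) x *\<^sub>R e"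
        using AE_torus_interior
      proof eventually_elim
        case (elim x)
        then have "0 < x $ 1" "x $ 1 < 2 * pi" "0 < x $ 2" "x $ 2 < 2 * pi" by (auto simp: mem_box_cart forall_2)
        then have "circle_pair x \<in> ?U \<longleftrightarrow> x \<in> box l u"
          by (simp add: circle_pair_def cis_in_arc mem_box_cart forall_2)
        then show ?case by (simp add: indicator_def)
      qed
    qed (rule si, simp)
    ultimately show ?thesis by simp
  qed
  have borelC: "\<forall>e. abs_h2 (\<lambda>x. indicator A x *\<^sub>R e) \<in> C" if A: "A \<in> sets borel" for A
  proof -
    have gen: "sets (borel :: (real^2) measure) = sigma_sets UNIV (range (\<lambda>(a, b). box a b))"
      by (simp add: borel_eq_box)
    have sig: "A \<in> sigma_sets UNIV (range (\<lambda>(a, b). box a b :: (real^2) set))" using A gen by simp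
    have stable: "Int_stable (range (\<lambda>(a, b). box a b :: (real^2) set))"
    proof -
      have "box a b \<inter> box c d = box (\<chi> i. max (a $ i) (c $ i)) (\<chi> i. min (b $ i) (d $ i))" for a b c d :: "real^2"
        by (auto simp: mem_box_cart)
      then show ?thesis unfolding Int_stable_def by auto
    qed
    have sub: "range (\<lambda>(a, b). box a b :: (real^2) set) \<subseteq> Pow UNIV" by simp
    from stable sub sig show ?thesis
    proof (induction rule: sigma_sets_induct_disjoint)
      case (basic A)
      then show ?case using boxC by auto
    next
      case empty
      have "abs_h2 (\<lambda>x. 0) \<in> C" using subspace_0[OF C(2)] by (simp add: abs_h2_zero)
      then show ?case by simp
    next
      case (compl A)
      then have Ab: "A \<in> sets borel" using gen by simp
      show ?case
      proof
        fix e :: field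
        have "abs_h2 (\<lambda>x. 1 *\<^sub>R e) - abs_h2 (\<lambda>x. indicator A x *\<^sub>R e) \<in> C"
          by (intro subspace_diff[OF C(2)] trigC[OF trig_const] compl.IH[rule_format])
        moreover have "abs_h2 (\<lambda>x. 1 *\<^sub>R e) - abs_h2 (\<lambda>x. indicator A x *\<^sub>R e) = abs_h2 (\<lambda>x. indicator (UNIV - A) x *\<^sub>R e)"
        proof (subst abs_h2_diff[OF square_integrable_continuous si[OF Ab]])
          have "(\<lambda>x. 1 *\<^sub>R e - indicator A x *\<^sub>R e) = (\<lambda>x. indicator (UNIV - A) x *\<^sub>R e)"
            by (auto simp: fun_eq_iff indicator_def)
          then show "abs_h2 (\<lambda>x. 1 *\<^sub>R e - indicator A x *\<^sub>R e) = abs_h2 (\<lambda>x. indicator (UNIV - A) x *\<^sub>R e)" by simp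
        qed simp
        ultimately show "abs_h2 (\<lambda>x. indicator (UNIV - A) x *\<^sub>R e) \<in> C" by simp
      qed
    next
      case (union A)
      then have Ab: "A i \<in> sets borel" for i using gen by auto
      show ?case
      proof
        fix e :: field
        have s: "abs_h2 (\<lambda>x. (\<Sum>i<n. indicator (A i) x *\<^sub>R e)) \<in> C \<and> square_integrable (\<lambda>x. (\<Sum>i<n. indicator (A i) x *\<^sub>R e))" for n
        proof (induction n)
          case 0
          then show ?case using subspace_0[OF C(2)] by (simp add: abs_h2_zero square_integrable_zero)
        next
          case (Suc n)
          then show ?case using si[OF Ab, of n e] union.IH[rule_format, of n e]
            by (auto simp: abs_h2_add[symmetric] intro: square_integrable_add subspace_add[OF C(2)])
        qed
        have eq: "(\<Sum>i<n. indicator (A i) x *\<^sub>R e) = indicator (\<Union>i<n. A i) x *\<^sub>R e" for n x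
        proof -
          have "disjoint_family_on A {..<n}" using union.hyps by (auto simp: disjoint_family_on_def)
          then have "(indicator (\<Union>i<n. A i) x :: real) = (\<Sum>i<n. indicator (A i) x)"
            by (intro indicator_UN_disjoint) auto
          then show ?thesis by (simp add: scaleR_sum_left)
        qed
        show "abs_h2 (\<lambda>x. indicator (\<Union>i. A i) x *\<^sub>R e) \<in> C"
        proof (rule lim)
          show "abs_h2 (\<lambda>x. indicator (\<Union>i<n. A i) x *\<^sub>R e) \<in> C" for n using s[of n] by (simp add: eq)
          show "(\<lambda>n. abs_h2 (\<lambda>x. indicator (\<Union>i<n. A i) x *\<^sub>R e)) \<longlonglongrightarrow> abs_h2 (\<lambda>x. indicator (\<Union>i. A i) x *\<^sub>R e)"
          proof (rule abs_h2_tendsto[where g = "\<lambda>x. norm e"])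
            show "(\<lambda>x. indicator (\<Union>i<n. A i) x *\<^sub>R e) \<in> borel_measurable torus_measure" for n
              using Ab by (intro measurable_torus borel_measurable_scaleR borel_measurable_indicator) auto
            show "(\<lambda>x. indicator (\<Union>i. A i) x *\<^sub>R e) \<in> borel_measurable torus_measure"
              using Ab by (intro measurable_torus borel_measurable_scaleR borel_measurable_indicator) auto
            show "AE x in torus_measure. norm (indicator (\<Union>i<n. A i) x *\<^sub>R e) \<le> norm e" for n
              by (simp add: indicator_def)
            show "AE x in torus_measure. (\<lambda>n. indicator (\<Union>i<n. A i) x *\<^sub>R e) \<longlonglongrightarrow> indicator (\<Union>i. A i) x *\<^sub>R e"
              by (intro always_eventually allI tendsto_scaleR tendsto_const LIMSEQ_indicator_UN)
          qed simp
        qed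
      qed
    qed
  qed
  have "X \<in> C" for X
  proof -
    define f where "f = rep_h2 X"
    have f: "square_integrable f" and X: "X = abs_h2 f"
      by (simp_all add: f_def square_integrable_rep abs_rep_h2)
    have "f \<in> borel_measurable torus_measure" using f by (simp add: square_integrable_def)
    from borel_measurable_implies_sequence_metric[OF this, of 0] obtain s where
      s: "\<And>i. simple_function torus_measure (s i)"
        "\<And>x. x \<in> space torus_measure \<Longrightarrow> (\<lambda>i. s i x) \<longlonglongrightarrow> f x"
        "\<And>i x. x \<in> space torus_measure \<Longrightarrow> dist (s i x) 0 \<le> 2 * dist (f x) 0" by blast
    have sm: "s i \<in> borel_measurable torus_measure" for i by (rule borel_measurable_simple_function[OF s(1)])
    have ss: "square_integrable (s i)" for i
      by (rule square_integrable_bound[OF sm, where g = "\<lambda>x. 2 * norm (f x)"])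
        (use f s(3) in \<open>auto simp: square_integrable_def power_mult_distrib\<close>)
    have sC: "abs_h2 (s i) \<in> C" for i
    proof -
      let ?S = "\<lambda>y. s i -` {y} \<inter> space torus_measure"
      have fin: "finite (s i ` space torus_measure)" using s(1) by (rule simple_functionD)
      have Sb: "?S y \<in> sets borel" for y
      proof -
        have "?S y \<in> sets torus_measure" using s(1) by (rule simple_functionD)
        then show ?thesis unfolding sets_torus_measure by (auto simp: sets_restrict_space)
      qed
      have *: "abs_h2 (\<lambda>x. \<Sum>y\<in>Y. indicator (?S y) x *\<^sub>R y) \<in> C \<and> square_integrable (\<lambda>x. \<Sum>y\<in>Y. indicator (?S y) x *\<^sub>R y)"
        if "finite Y" for Y
        using that
      proof (induction Y)
        case empty
        then show ?case using subspace_0[OF C(2)] by (simp add: abs_h2_zero square_integrable_zero)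
      next
        case (insert y Y)
        note 1 = si[OF Sb, of y y] and 2 = borelC[OF Sb, rule_format, of y y]
        note 3 = insert.IH[THEN conjunct2] and 4 = insert.IH[THEN conjunct1]
        show ?case
          unfolding sum.insert[OF insert.hyps] abs_h2_add[OF 1 3, symmetric]
          by (intro conjI subspace_add[OF C(2) 2 4] square_integrable_add[OF 1 3])
      qed
      have "abs_h2 (s i) = abs_h2 (\<lambda>x. \<Sum>y\<in>s i ` space torus_measure. indicator (?S y) x *\<^sub>R y)"
      proof (rule abs_h2_eqI[OF ss])
        show "AE x in torus_measure. s i x = (\<Sum>y\<in>s i ` space torus_measure. indicator (?S y) x *\<^sub>R y)"
        proof (rule AE_I2)
          fix x assume x: "x \<in> space torus_measure"
          have "(\<Sum>y\<in>s i ` space torus_measure. indicator (?S y) x *\<^sub>R y) = (\<Sum>y\<in>s i ` space torus_measure. if y = s i x then y else 0)"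
            using x by (intro sum.cong) (auto simp: indicator_def)
          also have "\<dots> = s i x" using fin x by (subst sum.delta) auto
          finally show "s i x = (\<Sum>y\<in>s i ` space torus_measure. indicator (?S y) x *\<^sub>R y)" by simp
        qed
      qed (use *[OF fin] in blast)
      then show ?thesis using *[OF fin] by simp
    qed
    show "X \<in> C" unfolding X
    proof (rule lim[OF sC], rule abs_h2_tendsto[where g = "\<lambda>x. 2 * norm (f x)"])
      show "f \<in> borel_measurable torus_measure" using f by (simp add: square_integrable_def)
      show "integrable torus_measure (\<lambda>x. (2 * norm (f x))\<^sup>2)"
        using f by (simp add: square_integrable_def power_mult_distrib)
      show "AE x in torus_measure. norm (s n x) \<le> 2 * norm (f x)" for n
        using s(3) by (intro AE_I2) simp
      show "AE x in torus_measure. (\<lambda>n. s n x) \<longlonglongrightarrow> f x" using s(2) by (rule AE_I2)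
    qed (rule sm)
  qed
  then show ?thesis by auto
qed

section \<open>The Maxwell--Ohm system on trigonometric modes\<close>

lemma C_k_add: "C_k k f \<Longrightarrow> C_k k g \<Longrightarrow> C_k k (\<lambda>x. f x + g x)"
proof (induction k arbitrary: f g)
  case 0
  then show ?case by (simp add: continuous_on_add)
next
  case (Suc k)
  have "frechet_derivative (\<lambda>x. f x + g x) (at x) = (\<lambda>h. frechet_derivative f (at x) h + frechet_derivative g (at x) h)" for x
    using Suc.prems by (intro frechet_derivative_at[symmetric] has_derivative_add) (simp_all add: frechet_derivative_works[symmetric])
  then show ?case using Suc by simp
qed

lemma C_k_scale: "C_k k f \<Longrightarrow> C_k k (\<lambda>x. c * f x)"
proof (induction k arbitrary: f)
  case 0
  then show ?case by (simp add: continuous_on_mult_left)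
next
  case (Suc k)
  have "frechet_derivative (\<lambda>x. c * f x) (at x) = (\<lambda>h. c * frechet_derivative f (at x) h)" for x
    using Suc.prems by (intro frechet_derivative_at[symmetric] has_derivative_mult_right) (simp_all add: frechet_derivative_works[symmetric])
  then show ?case using Suc by simp
qed

lemma has_derivative_phase: "(phase m n has_derivative (\<lambda>h. of_int m * h $ 1 + of_int n * h $ 2)) (at x)"
  unfolding phase_def[abs_def]
  by (intro bounded_linear_imp_has_derivative bounded_linear_add bounded_linear_const_mult bounded_linear_vec_nth)

lemma has_derivative_trig:
  "((\<lambda>x. a * cos (phase m n x) + b * sin (phase m n x)) has_derivative
     (\<lambda>h. (of_int m * (b * cos (phase m n x) - a * sin (phase m n x))) * h $ 1
        + (of_int n * (b * cos (phase m n x) - a * sin (phase m n x))) * h $ 2)) (at x)"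
proof -
  have "((\<lambda>x. a * cos (phase m n x) + b * sin (phase m n x)) has_derivative
     (\<lambda>h. a * ((of_int m * h $ 1 + of_int n * h $ 2) * - sin (phase m n x))
        + b * ((of_int m * h $ 1 + of_int n * h $ 2) * cos (phase m n x)))) (at x)"
    by (intro has_derivative_add has_derivative_mult_right DERIV_cos[THEN DERIV_compose_FDERIV]
        DERIV_sin[THEN DERIV_compose_FDERIV] has_derivative_phase)
  then show ?thesis by (rule has_derivative_eq_rhs) (simp add: fun_eq_iff algebra_simps)
qed

lemma test_function_trig: "test_function (\<lambda>x. a * cos (phase m n x) + b * sin (phase m n x))"
proof -
  have "C_k k (\<lambda>x. a * cos (phase m n x) + b * sin (phase m n x))" for k
  proof (induction k arbitrary: a b)
    case 0
    then show ?case by (auto intro!: continuous_intros)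
  next
    case (Suc k)
    have f: "frechet_derivative (\<lambda>x. a * cos (phase m n x) + b * sin (phase m n x)) (at x) e
       = (b * (of_int m * e $ 1 + of_int n * e $ 2)) * cos (phase m n x) + (- a * (of_int m * e $ 1 + of_int n * e $ 2)) * sin (phase m n x)" for x e
      unfolding frechet_derivative_at[OF has_derivative_trig, symmetric] by (simp add: algebra_simps)
    show ?case unfolding C_k.simps f
    proof (intro conjI allI ballI Suc.IH)
      show "(\<lambda>x. a * cos (phase m n x) + b * sin (phase m n x)) differentiable at x" for x
        unfolding differentiable_def by (rule exI, rule has_derivative_trig)
    qed
  qed
  moreover have "periodic (\<lambda>x. a * cos (phase m n x) + b * sin (phase m n x))"
  proof -
    have "phase m n (x + axis 1 (2 * pi)) = phase m n x + of_int m * (2 * pi)"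
      "phase m n (x + axis 2 (2 * pi)) = phase m n x + of_int n * (2 * pi)" for x
      by (simp_all add: phase_def axis_def algebra_simps)
    moreover have "cos (y + of_int k * (2 * pi)) = cos y" "sin (y + of_int k * (2 * pi)) = sin y" for y k
      using sin_int_2pin[of k] cos_int_2pin[of k] by (simp_all add: cos_add sin_add mult.commute)
    ultimately show ?thesis by (simp add: periodic_def forall_2)
  qed
  ultimately show ?thesis by (simp add: test_function_def smooth_def)
qed

lemma test_function_add: "test_function f \<Longrightarrow> test_function g \<Longrightarrow> test_function (\<lambda>x. f x + g x)"
  by (auto simp: test_function_def smooth_def periodic_def intro: C_k_add)

lemma test_function_scale: "test_function f \<Longrightarrow> test_function (\<lambda>x. c * f x)"
  by (auto simp: test_function_def smooth_def periodic_def intro: C_k_scale)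

lemma test_function_zero: "test_function (\<lambda>x. 0)"
  using test_function_trig[of 0 0 0 0] by simp

lemma C1_periodic_add:
  assumes f: "C1_periodic f" and g: "C1_periodic g"
  shows "pd i (\<lambda>x. f x + g x) = (\<lambda>x. pd i f x + pd i g x)"
proof -
  have "((\<lambda>x. f x + g x) has_derivative (\<lambda>h. (pd 1 f x + pd 1 g x) * h $ 1 + (pd 2 f x + pd 2 g x) * h $ 2)) (at x)" for x
    by (rule has_derivative_eq_rhs[OF has_derivative_add[OF C1_periodicD(1)[OF f] C1_periodicD(1)[OF g]]])
      (simp add: fun_eq_iff algebra_simps)
  from pd_eqI[OF this] have "\<forall>i. pd i (\<lambda>x. f x + g x) = (\<lambda>x. pd i f x + pd i g x)"
    unfolding forall_2 by (simp add: fun_eq_iff)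
  then show ?thesis ..
qed

lemma C1_periodic_scale:
  assumes f: "C1_periodic f"
  shows "pd i (\<lambda>x. c * f x) = (\<lambda>x. c * pd i f x)"
proof -
  have "((\<lambda>x. c * f x) has_derivative (\<lambda>h. (c * pd 1 f x) * h $ 1 + (c * pd 2 f x) * h $ 2)) (at x)" for x
    by (rule has_derivative_eq_rhs[OF has_derivative_mult_right[OF C1_periodicD(1)[OF f]]])
      (simp add: fun_eq_iff algebra_simps)
  from pd_eqI[OF this] have "\<forall>i. pd i (\<lambda>x. c * f x) = (\<lambda>x. c * pd i f x)"
    unfolding forall_2 by (simp add: fun_eq_iff)
  then show ?thesis ..
qed

definition field_of :: "(real^2 \<Rightarrow> real) \<Rightarrow> (real^2 \<Rightarrow> real) \<Rightarrow> (real^2 \<Rightarrow> real) \<Rightarrow> real^2 \<Rightarrow> field" where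
  "field_of E1 E2 b x = (vector [E1 x, E2 x], b x)"

lemma continuous_field_of:
  "continuous_on A E1 \<Longrightarrow> continuous_on A E2 \<Longrightarrow> continuous_on A b \<Longrightarrow> continuous_on A (field_of E1 E2 b)"
  unfolding field_of_def by (intro continuous_on_Pair continuous_on_vector2)

lemma inner_field_of:
  assumes "continuous_on UNIV E1" "continuous_on UNIV E2" "continuous_on UNIV b"
    and "continuous_on UNIV E1'" "continuous_on UNIV E2'" "continuous_on UNIV b'"
  shows "abs_h2 (field_of E1 E2 b) \<bullet> abs_h2 (field_of E1' E2' b')
    = (\<integral>x. E1 x * E1' x \<partial>torus_measure) + (\<integral>x. E2 x * E2' x \<partial>torus_measure) + (\<integral>x. b x * b' x \<partial>torus_measure)"
proof -
  have "abs_h2 (field_of E1 E2 b) \<bullet> abs_h2 (field_of E1' E2' b')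
    = (\<integral>x. E1 x * E1' x + E2 x * E2' x + b x * b' x \<partial>torus_measure)"
    using assms by (subst abs_h2_inner)
      (auto intro!: square_integrable_continuous continuous_field_of simp: field_of_def inner_vec2)
  also have "\<dots> = (\<integral>x. E1 x * E1' x \<partial>torus_measure) + (\<integral>x. E2 x * E2' x \<partial>torus_measure) + (\<integral>x. b x * b' x \<partial>torus_measure)"
  proof -
    have "integrable torus_measure (\<lambda>x. E1 x * E1' x)" "integrable torus_measure (\<lambda>x. E2 x * E2' x)" "integrable torus_measure (\<lambda>x. b x * b' x)"
      using assms by (auto intro!: continuous_torus_integrable continuous_intros)
    then show ?thesis by simp
  qed
  finally show ?thesis .
qed

text \<open>
  For \<open>\<tau> = 1\<close> this is the Maxwell--Ohm operator, for \<open>\<tau> = - 1\<close> its formal adjoint: the curl and gradient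
  part is skew, the damping is symmetric. Keeping \<open>\<tau>\<close> as a parameter treats both at once.
\<close>

definition maxwell :: "real \<Rightarrow> real \<Rightarrow> (real^2 \<Rightarrow> real) \<Rightarrow> (real^2 \<Rightarrow> real) \<Rightarrow> (real^2 \<Rightarrow> real) \<Rightarrow> real^2 \<Rightarrow> field" where
  "maxwell \<tau> \<sigma> E1 E2 b = field_of (\<lambda>x. \<tau> * pd 2 b x - \<sigma> * E1 x) (\<lambda>x. - \<tau> * pd 1 b x - \<sigma> * E2 x)
     (\<lambda>x. - \<tau> * (pd 1 E2 x - pd 2 E1 x))"

lemma continuous_maxwell:
  "C1_periodic E1 \<Longrightarrow> C1_periodic E2 \<Longrightarrow> C1_periodic b \<Longrightarrow> continuous_on UNIV (maxwell \<tau> \<sigma> E1 E2 b)"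
  unfolding maxwell_def by (intro continuous_field_of continuous_intros C1_periodicD)

lemma maxwell_dual:
  assumes E: "C1_periodic E1" "C1_periodic E2" "C1_periodic b"
    and E': "C1_periodic E1'" "C1_periodic E2'" "C1_periodic b'"
  shows "abs_h2 (maxwell \<tau> \<sigma> E1 E2 b) \<bullet> abs_h2 (field_of E1' E2' b')
    = abs_h2 (field_of E1 E2 b) \<bullet> abs_h2 (maxwell (- \<tau>) \<sigma> E1' E2' b')"
proof -
  note c = C1_periodicD(2)[OF E(1)] C1_periodicD(2)[OF E(2)] C1_periodicD(2)[OF E(3)]
    C1_periodicD(2)[OF E'(1)] C1_periodicD(2)[OF E'(2)] C1_periodicD(2)[OF E'(3)]
    C1_periodicD(3)[OF E(1)] C1_periodicD(3)[OF E(2)] C1_periodicD(3)[OF E(3)]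
    C1_periodicD(3)[OF E'(1)] C1_periodicD(3)[OF E'(2)] C1_periodicD(3)[OF E'(3)]
  have int: "integrable torus_measure (\<lambda>x. f x * g x)" if "continuous_on UNIV f" "continuous_on UNIV g" for f g :: "real^2 \<Rightarrow> real"
    using that by (intro continuous_torus_integrable continuous_intros)
  note i = int[OF c(1) c(4)] int[OF c(2) c(5)] int[OF c(9) c(4), of 2] int[OF c(9) c(5), of 1]
    int[OF c(8) c(6), of 1] int[OF c(7) c(6), of 2] int[OF c(3) c(10), of 2] int[OF c(3) c(11), of 1]
    int[OF c(2) c(12), of 1] int[OF c(1) c(12), of 2]
  have "abs_h2 (maxwell \<tau> \<sigma> E1 E2 b) \<bullet> abs_h2 (field_of E1' E2' b')
    = (\<integral>x. \<tau> * (pd 2 b x * E1' x) - \<sigma> * (E1 x * E1' x) \<partial>torus_measure)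
    + (\<integral>x. - \<tau> * (pd 1 b x * E2' x) - \<sigma> * (E2 x * E2' x) \<partial>torus_measure)
    + (\<integral>x. - \<tau> * (pd 1 E2 x * b' x) + \<tau> * (pd 2 E1 x * b' x) \<partial>torus_measure)"
    unfolding maxwell_def by (subst inner_field_of) (auto intro!: continuous_intros c simp: algebra_simps)
  also have "\<dots> = \<tau> * (\<integral>x. pd 2 b x * E1' x \<partial>torus_measure) - \<sigma> * (\<integral>x. E1 x * E1' x \<partial>torus_measure)
    + (- \<tau> * (\<integral>x. pd 1 b x * E2' x \<partial>torus_measure) - \<sigma> * (\<integral>x. E2 x * E2' x \<partial>torus_measure))
    + (- \<tau> * (\<integral>x. pd 1 E2 x * b' x \<partial>torus_measure) + \<tau> * (\<integral>x. pd 2 E1 x * b' x \<partial>torus_measure))"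
    using i by simp
  also have "\<dots> = - \<tau> * (\<integral>x. b x * pd 2 E1' x \<partial>torus_measure) - \<sigma> * (\<integral>x. E1 x * E1' x \<partial>torus_measure)
    + (\<tau> * (\<integral>x. b x * pd 1 E2' x \<partial>torus_measure) - \<sigma> * (\<integral>x. E2 x * E2' x \<partial>torus_measure))
    + (\<tau> * (\<integral>x. E2 x * pd 1 b' x \<partial>torus_measure) - \<tau> * (\<integral>x. E1 x * pd 2 b' x \<partial>torus_measure))"
    by (simp add: torus_integral_by_parts[OF E(3) E'(1)] torus_integral_by_parts[OF E(3) E'(2)]
        torus_integral_by_parts[OF E(1) E'(3)] torus_integral_by_parts[OF E(2) E'(3)])
  also have "\<dots> = (\<integral>x. - \<tau> * (E1 x * pd 2 b' x) - \<sigma> * (E1 x * E1' x) \<partial>torus_measure)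
    + (\<integral>x. \<tau> * (E2 x * pd 1 b' x) - \<sigma> * (E2 x * E2' x) \<partial>torus_measure)
    + (\<integral>x. \<tau> * (b x * pd 1 E2' x) - \<tau> * (b x * pd 2 E1' x) \<partial>torus_measure)"
    using i by simp
  also have "\<dots> = abs_h2 (field_of E1 E2 b) \<bullet> abs_h2 (maxwell (- \<tau>) \<sigma> E1' E2' b')"
    unfolding maxwell_def by (subst inner_field_of) (auto intro!: continuous_intros c simp: algebra_simps)
  finally show ?thesis .
qed

text \<open>
  By duality the quadratic form of the operator is that of its symmetric part, which is the damping of
  \<open>E\<close> alone.
\<close>

lemma maxwell_dissipative:
  assumes E: "C1_periodic E1" "C1_periodic E2" "C1_periodic b" and "\<sigma> \<ge> 0"
  shows "abs_h2 (maxwell \<tau> \<sigma> E1 E2 b) \<bullet> abs_h2 (field_of E1 E2 b) \<le> 0"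
proof -
  let ?X = "abs_h2 (field_of E1 E2 b)"
  note c = C1_periodicD(2)[OF E(1)] C1_periodicD(2)[OF E(2)] C1_periodicD(2)[OF E(3)]
  have s: "square_integrable (maxwell \<tau> \<sigma> E1 E2 b)" for \<tau>
    by (intro square_integrable_continuous continuous_maxwell E)
  have "2 * (abs_h2 (maxwell \<tau> \<sigma> E1 E2 b) \<bullet> ?X) = (abs_h2 (maxwell \<tau> \<sigma> E1 E2 b) + abs_h2 (maxwell (- \<tau>) \<sigma> E1 E2 b)) \<bullet> ?X"
    using maxwell_dual[OF E E, of \<tau> \<sigma>] inner_commute[of ?X "abs_h2 (maxwell (- \<tau>) \<sigma> E1 E2 b)"]
    by (simp add: inner_add_left)
  also have "abs_h2 (maxwell \<tau> \<sigma> E1 E2 b) + abs_h2 (maxwell (- \<tau>) \<sigma> E1 E2 b) = abs_h2 (field_of (\<lambda>x. - 2 * \<sigma> * E1 x) (\<lambda>x. - 2 * \<sigma> * E2 x) (\<lambda>x. 0))"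
    unfolding abs_h2_add[OF s s]
    by (intro arg_cong[of _ _ abs_h2]) (simp add: maxwell_def field_of_def fun_eq_iff vec_eq_iff forall_2)
  also have "\<dots> \<bullet> ?X = (\<integral>x. - 2 * \<sigma> * (E1 x * E1 x) \<partial>torus_measure) + (\<integral>x. - 2 * \<sigma> * (E2 x * E2 x) \<partial>torus_measure)"
    by (subst inner_field_of) (auto intro!: continuous_intros c simp: mult.assoc)
  also have "\<dots> \<le> 0"
    using \<open>\<sigma> \<ge> 0\<close> by (intro add_nonpos_nonpos) (auto intro!: mult_nonneg_nonneg integral_nonneg)
  finally show ?thesis by simp
qed

text \<open>
  The operator on the core of test functions, that is, on exactly the fields against which the weak
  gradient and the weak curl are tested.
\<close>

definition classical :: "real \<Rightarrow> real \<Rightarrow> h2 \<Rightarrow> h2 \<Rightarrow> bool" where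
  "classical \<tau> \<sigma> X Y \<longleftrightarrow> (\<exists>E1 E2 b. test_function E1 \<and> test_function E2 \<and> test_function b \<and>
     X = abs_h2 (field_of E1 E2 b) \<and> Y = abs_h2 (maxwell \<tau> \<sigma> E1 E2 b))"

lemma classicalI: "test_function E1 \<Longrightarrow> test_function E2 \<Longrightarrow> test_function b \<Longrightarrow>
  classical \<tau> \<sigma> (abs_h2 (field_of E1 E2 b)) (abs_h2 (maxwell \<tau> \<sigma> E1 E2 b))"
  unfolding classical_def by blast

lemma classicalE:
  assumes "classical \<tau> \<sigma> X Y"
  obtains E1 E2 b where "test_function E1" "test_function E2" "test_function b"
    "C1_periodic E1" "C1_periodic E2" "C1_periodic b"
    "X = abs_h2 (field_of E1 E2 b)" "Y = abs_h2 (maxwell \<tau> \<sigma> E1 E2 b)"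
  using assms test_function_C1 unfolding classical_def by blast

lemma dissipative_relation_classical:
  assumes "\<sigma> \<ge> 0"
  shows "dissipative_relation (classical \<tau> \<sigma>)"
proof
  fix X Y X' Y' assume "classical \<tau> \<sigma> X Y" "classical \<tau> \<sigma> X' Y'"
  from classicalE[OF this(1)] obtain E1 E2 b where
    t: "test_function E1" "test_function E2" "test_function b" and E: "C1_periodic E1" "C1_periodic E2" "C1_periodic b"
    and X: "X = abs_h2 (field_of E1 E2 b)" "Y = abs_h2 (maxwell \<tau> \<sigma> E1 E2 b)" by metis
  from classicalE[OF \<open>classical \<tau> \<sigma> X' Y'\<close>] obtain E1' E2' b' where
    t': "test_function E1'" "test_function E2'" "test_function b'" and E': "C1_periodic E1'" "C1_periodic E2'" "C1_periodic b'"
    and X': "X' = abs_h2 (field_of E1' E2' b')" "Y' = abs_h2 (maxwell \<tau> \<sigma> E1' E2' b')" by metis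
  have 1: "X + X' = abs_h2 (field_of (\<lambda>x. E1 x + E1' x) (\<lambda>x. E2 x + E2' x) (\<lambda>x. b x + b' x))"
    unfolding X X'
    by (subst abs_h2_add)
      (auto intro!: square_integrable_continuous continuous_field_of C1_periodicD(2) E E' arg_cong[of _ _ abs_h2]
        simp: field_of_def fun_eq_iff vec_eq_iff forall_2)
  have 2: "Y + Y' = abs_h2 (maxwell \<tau> \<sigma> (\<lambda>x. E1 x + E1' x) (\<lambda>x. E2 x + E2' x) (\<lambda>x. b x + b' x))"
    unfolding X X'
      abs_h2_add[OF square_integrable_continuous[OF continuous_maxwell[OF E]] square_integrable_continuous[OF continuous_maxwell[OF E']]]
    unfolding maxwell_def C1_periodic_add[OF E(1) E'(1)] C1_periodic_add[OF E(2) E'(2)] C1_periodic_add[OF E(3) E'(3)]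
    by (intro arg_cong[of _ _ abs_h2]) (simp add: field_of_def fun_eq_iff vec_eq_iff forall_2 algebra_simps)
  show "classical \<tau> \<sigma> (X + X') (Y + Y')"
    unfolding 1 2 by (intro classicalI test_function_add t t')
next
  fix X Y c assume "classical \<tau> \<sigma> X Y"
  from classicalE[OF this] obtain E1 E2 b where
    t: "test_function E1" "test_function E2" "test_function b" and E: "C1_periodic E1" "C1_periodic E2" "C1_periodic b"
    and X: "X = abs_h2 (field_of E1 E2 b)" "Y = abs_h2 (maxwell \<tau> \<sigma> E1 E2 b)" by metis
  have 1: "c *\<^sub>R X = abs_h2 (field_of (\<lambda>x. c * E1 x) (\<lambda>x. c * E2 x) (\<lambda>x. c * b x))"
    unfolding X
    by (subst abs_h2_scale)
      (auto intro!: square_integrable_continuous continuous_field_of C1_periodicD(2) E arg_cong[of _ _ abs_h2]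
        simp: field_of_def fun_eq_iff vec_eq_iff forall_2)
  have 2: "c *\<^sub>R Y = abs_h2 (maxwell \<tau> \<sigma> (\<lambda>x. c * E1 x) (\<lambda>x. c * E2 x) (\<lambda>x. c * b x))"
    unfolding X abs_h2_scale[OF square_integrable_continuous[OF continuous_maxwell[OF E]]]
    unfolding maxwell_def C1_periodic_scale[OF E(1)] C1_periodic_scale[OF E(2)] C1_periodic_scale[OF E(3)]
    by (intro arg_cong[of _ _ abs_h2]) (simp add: field_of_def fun_eq_iff vec_eq_iff forall_2 algebra_simps)
  show "classical \<tau> \<sigma> (c *\<^sub>R X) (c *\<^sub>R Y)"
    unfolding 1 2 by (intro classicalI test_function_scale t)
next
  fix X Y assume "classical \<tau> \<sigma> X Y"
  from classicalE[OF this] obtain E1 E2 b where E: "C1_periodic E1" "C1_periodic E2" "C1_periodic b"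
    and X: "X = abs_h2 (field_of E1 E2 b)" "Y = abs_h2 (maxwell \<tau> \<sigma> E1 E2 b)" by metis
  show "Y \<bullet> X \<le> 0" unfolding X by (rule maxwell_dissipative[OF E assms])
qed

text \<open>
  The Duhamel equation of the trivial semigroup is the integral equation of the differential equation.
\<close>

lemma linear_ode_exists:
  fixes M :: "'a::banach \<Rightarrow> 'a" and z0 :: 'a
  assumes M: "bounded_linear M"
  obtains z where "z 0 = z0" "\<And>t. 0 \<le> t \<Longrightarrow> (z has_vector_derivative M (z t)) (at t within {0..})"
proof -
  obtain K where K: "K > 0" "\<And>x. norm (M x) \<le> norm x * K" using bounded_linear.pos_bounded[OF M] by blast
  have S: "contraction_semigroup (\<lambda>t x. x :: 'a)"
    by (simp add: contraction_semigroup_def bounded_linear_ident)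
  have c: "continuous_on {0..} (\<lambda>s. M (Y s))" if "continuous_on {0..} Y" for Y :: "real \<Rightarrow> 'a"
    by (rule bounded_linear.continuous_on[OF M that])
  have K': "norm (M x) \<le> K * norm x" for x using K(2)[of x] by (simp add: mult.commute)
  obtain z :: "real \<Rightarrow> 'a" where zc: "continuous_on {0..} z"
    and z: "\<And>t. 0 \<le> t \<Longrightarrow> ((\<lambda>s. M (z s)) has_integral z t - z0) {0..t}"
    by (rule mild_solution_exists[OF S bounded_linear.linear[OF M] K' c less_imp_le[OF K(1)] continuous_on_const[of _ z0]])
      (assumption, rule that)
  have z0: "z 0 = z0" using integral_unique[OF z, of 0] by simp
  have "(z has_vector_derivative M (z t)) (at t within {0..})" if t: "0 \<le> t" for t
  proof -
    have "((\<lambda>u. integral {0..u} (\<lambda>s. M (z s))) has_vector_derivative M (z t)) (at t within {0..t+1})"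
      by (rule integral_has_vector_derivative) (use t in \<open>auto intro: continuous_on_subset[OF c[OF zc]]\<close>)
    moreover have "at t within {0..t+1} = at t within {0..}"
      by (rule at_within_nhd[of _ "{..<t+1}"]) (use t in auto)
    ultimately have "((\<lambda>u. z0 + integral {0..u} (\<lambda>s. M (z s))) has_vector_derivative 0 + M (z t)) (at t within {0..})"
      by (intro has_vector_derivative_add has_vector_derivative_const) simp
    then have "((\<lambda>u. z0 + integral {0..u} (\<lambda>s. M (z s))) has_vector_derivative M (z t)) (at t within {0..})" by simp
    then show ?thesis
    proof (rule has_vector_derivative_transform[rotated -1])
      show "z u = z0 + integral {0..u} (\<lambda>s. M (z s))" if "u \<in> {0..}" for u
        using integral_unique[OF z, of u] that by simp
    qed (use t in simp)
  qed
  with z0 show thesis by (rule that)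
qed

text \<open>
  Fields with a single frequency \<open>(m, n)\<close>, parametrised by their cosine and sine amplitudes. The
  operator acts on these amplitudes as the constant matrix \<open>mode_matrix\<close>.
\<close>

definition mode_map :: "int \<Rightarrow> int \<Rightarrow> field \<times> field \<Rightarrow> h2" where
  "mode_map m n z = abs_h2 (\<lambda>x. cos (phase m n x) *\<^sub>R fst z + sin (phase m n x) *\<^sub>R snd z)"

lemma mode_map_field:
  "mode_map m n ((P, \<beta>), (Q, \<beta>')) = abs_h2 (field_of
     (\<lambda>x. P $ 1 * cos (phase m n x) + Q $ 1 * sin (phase m n x))
     (\<lambda>x. P $ 2 * cos (phase m n x) + Q $ 2 * sin (phase m n x))
     (\<lambda>x. \<beta> * cos (phase m n x) + \<beta>' * sin (phase m n x)))"
  unfolding mode_map_def field_of_def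
  by (intro arg_cong[of _ _ abs_h2]) (simp add: fun_eq_iff vec_eq_iff forall_2)

lemma bounded_linear_mode_map: "bounded_linear (mode_map m n)"
proof -
  have s: "square_integrable (\<lambda>x. cos (phase m n x) *\<^sub>R p + sin (phase m n x) *\<^sub>R q)" for p q :: field
    by (intro square_integrable_continuous continuous_intros)
  have "linear (mode_map m n)"
  proof (rule linearI)
    show "mode_map m n (z + z') = mode_map m n z + mode_map m n z'" for z z'
      unfolding mode_map_def abs_h2_add[OF s s]
      by (intro arg_cong[of _ _ abs_h2]) (simp add: fun_eq_iff scaleR_add_right)
    show "mode_map m n (c *\<^sub>R z) = c *\<^sub>R mode_map m n z" for c z
      unfolding mode_map_def abs_h2_scale[OF s]
      by (intro arg_cong[of _ _ abs_h2]) (simp add: fun_eq_iff scaleR_add_right mult.commute)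
  qed
  then show ?thesis by (rule linear_conv_bounded_linear[THEN iffD1])
qed

definition mode_matrix :: "real \<Rightarrow> real \<Rightarrow> int \<Rightarrow> int \<Rightarrow> field \<times> field \<Rightarrow> field \<times> field" where
  "mode_matrix \<tau> \<sigma> m n = (\<lambda>((P, \<beta>), (Q, \<beta>')).
     ((vector [\<tau> * (of_int n * \<beta>') - \<sigma> * P $ 1, - \<tau> * (of_int m * \<beta>') - \<sigma> * P $ 2],
       - \<tau> * (of_int m * Q $ 2 - of_int n * Q $ 1)),
      (vector [- \<tau> * (of_int n * \<beta>) - \<sigma> * Q $ 1, \<tau> * (of_int m * \<beta>) - \<sigma> * Q $ 2],
       \<tau> * (of_int m * P $ 2 - of_int n * P $ 1))))"

lemma bounded_linear_mode_matrix: "bounded_linear (mode_matrix \<tau> \<sigma> m n)"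
proof -
  have "linear (mode_matrix \<tau> \<sigma> m n)"
    by (rule linearI) (auto simp: mode_matrix_def vec_eq_iff forall_2 algebra_simps)
  then show ?thesis by (rule linear_conv_bounded_linear[THEN iffD1])
qed

lemma classical_mode: "classical \<tau> \<sigma> (mode_map m n z) (mode_map m n (mode_matrix \<tau> \<sigma> m n z))"
proof -
  obtain P \<beta> Q \<beta>' where z: "z = ((P, \<beta>), (Q, \<beta>'))" by (metis surj_pair)
  have pd: "pd 1 (\<lambda>x. a * cos (phase m n x) + b * sin (phase m n x)) = (\<lambda>x. of_int m * (b * cos (phase m n x) - a * sin (phase m n x)))"
    "pd 2 (\<lambda>x. a * cos (phase m n x) + b * sin (phase m n x)) = (\<lambda>x. of_int n * (b * cos (phase m n x) - a * sin (phase m n x)))" for a b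
    using pd_eqI[OF has_derivative_trig] by auto
  have "mode_map m n (mode_matrix \<tau> \<sigma> m n z) = abs_h2 (maxwell \<tau> \<sigma>
     (\<lambda>x. P $ 1 * cos (phase m n x) + Q $ 1 * sin (phase m n x))
     (\<lambda>x. P $ 2 * cos (phase m n x) + Q $ 2 * sin (phase m n x))
     (\<lambda>x. \<beta> * cos (phase m n x) + \<beta>' * sin (phase m n x)))"
    unfolding z mode_matrix_def prod.case mode_map_field maxwell_def pd
    by (intro arg_cong[of _ _ abs_h2]) (simp add: field_of_def fun_eq_iff algebra_simps)
  then show ?thesis unfolding z mode_map_field by (simp only:) (intro classicalI test_function_trig)
qed

lemma mode_flow_curve:
  obtains \<gamma> where "flow_curve (classical \<tau> \<sigma>) \<gamma>" "\<gamma> 0 = mode_map m n z"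
proof -
  obtain \<zeta> where \<zeta>: "\<zeta> 0 = z"
    "\<And>t. 0 \<le> t \<Longrightarrow> (\<zeta> has_vector_derivative mode_matrix \<tau> \<sigma> m n (\<zeta> t)) (at t within {0..})"
    by (rule linear_ode_exists[OF bounded_linear_mode_matrix]) (rule that)
  have "flow_curve (classical \<tau> \<sigma>) (\<lambda>t. mode_map m n (\<zeta> t))"
    unfolding flow_curve_def
    by (rule exI[of _ "\<lambda>t. mode_map m n (mode_matrix \<tau> \<sigma> m n (\<zeta> t))"])
      (auto intro: classical_mode bounded_linear.has_vector_derivative[OF bounded_linear_mode_map \<zeta>(2)])
  then show thesis by (rule that) (simp add: \<zeta>)
qed

text \<open>
  On each frequency the evolution is a linear ordinary differential equation in finitely many unknowns,
  so every mode lies on a flow curve; sums of modes are dense.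
\<close>

lemma dissipative_classical:
  assumes "\<sigma> \<ge> 0"
  shows "dissipative (classical \<tau> \<sigma>)"
proof -
  interpret dissipative_relation "classical \<tau> \<sigma>" by (rule dissipative_relation_classical[OF assms])
  let ?V = "{\<gamma> 0 |\<gamma>. flow_curve (classical \<tau> \<sigma>) \<gamma>}"
  have mode: "mode_map m n z \<in> ?V" for m n z
    by (rule mode_flow_curve[of \<tau> \<sigma> m n z]) (metis (mono_tags, lifting) mem_Collect_eq)
  have add: "X + Y \<in> ?V" if XY: "X \<in> ?V" "Y \<in> ?V" for X Y
  proof -
    obtain \<gamma> \<eta> where "flow_curve (classical \<tau> \<sigma>) \<gamma>" "X = \<gamma> 0" "flow_curve (classical \<tau> \<sigma>) \<eta>" "Y = \<eta> 0"
      using XY by blast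
    then show ?thesis using flow_curve_add[of \<gamma> \<eta>] by (intro CollectI exI[of _ "\<lambda>t. \<gamma> t + \<eta> t"]) simp
  qed
  have scale: "c *\<^sub>R X \<in> ?V" if X: "X \<in> ?V" for X c
  proof -
    obtain \<gamma> where "flow_curve (classical \<tau> \<sigma>) \<gamma>" "X = \<gamma> 0" using X by blast
    then show ?thesis using flow_curve_scale[of \<gamma> c] by (intro CollectI exI[of _ "\<lambda>t. c *\<^sub>R \<gamma> t"]) simp
  qed
  have zero: "0 \<in> ?V"
    using mode[of 0 0 0] by (simp add: linear_0[OF bounded_linear.linear[OF bounded_linear_mode_map]])
  have sub: "subspace ?V" unfolding subspace_def using zero add scale by blast
  have "closure ?V = UNIV"
  proof (rule closed_subspace_eq_UNIV_if_modes)
    show "subspace (closure ?V)"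
      unfolding subspace_def
    proof (intro conjI ballI allI)
      show "0 \<in> closure ?V" by (rule subsetD[OF closure_subset zero])
      fix X assume X: "X \<in> closure ?V"
      then obtain v where v: "\<And>n. v n \<in> ?V" "v \<longlonglongrightarrow> X" unfolding closure_sequential by blast
      show "c *\<^sub>R X \<in> closure ?V" for c
        unfolding closure_sequential
        by (rule exI[of _ "\<lambda>n. c *\<^sub>R v n"], rule conjI, rule allI, rule scale[OF v(1)], intro tendsto_scaleR tendsto_const v(2))
      fix Y assume Y: "Y \<in> closure ?V"
      then obtain z where z: "\<And>n. z n \<in> ?V" "z \<longlonglongrightarrow> Y" unfolding closure_sequential by blast
      show "X + Y \<in> closure ?V"
        unfolding closure_sequential
        by (rule exI[of _ "\<lambda>n. v n + z n"], rule conjI, rule allI, rule add[OF v(1) z(1)], intro tendsto_add v(2) z(2))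
    qed
    show "abs_h2 (\<lambda>x. cos (phase m n x) *\<^sub>R e) \<in> closure ?V" for m n e
      using subsetD[OF closure_subset mode[of m n "(e, 0)"]] by (simp only: mode_map_def) simp
    show "abs_h2 (\<lambda>x. sin (phase m n x) *\<^sub>R e) \<in> closure ?V" for m n e
      using subsetD[OF closure_subset mode[of m n "(0, e)"]] by (simp only: mode_map_def) simp
  qed simp
  then show ?thesis by unfold_locales
qed

lemma dual_dissipative_classical:
  assumes "\<sigma> \<ge> 0"
  shows "dual_dissipative (classical 1 \<sigma>) (classical (- 1) \<sigma>)"
proof -
  interpret A: dissipative "classical 1 \<sigma>" by (rule dissipative_classical[OF assms])
  interpret B: dissipative "classical (- 1) \<sigma>" by (rule dissipative_classical[OF assms])
  show ?thesis
  proof unfold_locales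
    fix X Y Z Z' assume "classical 1 \<sigma> X Y" "classical (- 1) \<sigma> Z Z'"
    then show "Y \<bullet> Z = X \<bullet> Z'"
      by (elim classicalE) (simp add: maxwell_dual)
  qed
qed

section \<open>The generator is the weak operator\<close>

lemma square_integrable_components:
  fixes f :: "real^2 \<Rightarrow> field"
  assumes "square_integrable f"
  shows "square_integrable (\<lambda>x. fst (f x) $ i)" "square_integrable (\<lambda>x. snd (f x))" "square_integrable (\<lambda>x. fst (f x))"
proof -
  have m: "f \<in> borel_measurable torus_measure" and i: "integrable torus_measure (\<lambda>x. (norm (f x))\<^sup>2)"
    using assms by (auto simp: square_integrable_def)
  have c: "continuous_on UNIV (\<lambda>p::field. fst p $ i)" "continuous_on UNIV (snd :: field \<Rightarrow> real)" "continuous_on UNIV (fst :: field \<Rightarrow> real^2)"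
    by (intro continuous_intros)+
  have n1: "norm (fst p) \<le> norm p" and n2: "norm (snd p) \<le> norm p" for p :: field
    using norm_fst_le[of "fst p" "snd p"] norm_snd_le[of "snd p" "fst p"] by simp_all
  have n3: "norm (fst p $ i) \<le> norm p" for p :: field
    using order_trans[OF component_le_norm_cart n1] by simp
  show "square_integrable (\<lambda>x. fst (f x) $ i)"
    by (rule square_integrable_bound[OF measurable_compose[OF m borel_measurable_continuous_onI[OF c(1)]] i])
      (intro always_eventually allI n3)
  show "square_integrable (\<lambda>x. snd (f x))"
    by (rule square_integrable_bound[OF measurable_compose[OF m borel_measurable_continuous_onI[OF c(2)]] i])
      (intro always_eventually allI n2)
  show "square_integrable (\<lambda>x. fst (f x))"
    by (rule square_integrable_bound[OF measurable_compose[OF m borel_measurable_continuous_onI[OF c(3)]] i])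
      (intro always_eventually allI n1)
qed

lemma square_integrable_real_product:
  fixes f g :: "real^2 \<Rightarrow> real"
  assumes "square_integrable f" "square_integrable g"
  shows "integrable torus_measure (\<lambda>x. f x * g x)"
  using square_integrable_inner[OF assms] by simp

lemma square_integrable_continuous_real:
  fixes f :: "real^2 \<Rightarrow> real"
  assumes "continuous_on UNIV f"
  shows "square_integrable f"
  unfolding square_integrable_def
  using assms by (auto intro!: continuous_torus_integrable continuous_intros measurable_torus borel_measurable_continuous_onI)

lemma inner_field_of_general:
  fixes f :: "real^2 \<Rightarrow> field"
  assumes f: "square_integrable f"
    and c: "continuous_on UNIV E1" "continuous_on UNIV E2" "continuous_on UNIV b"
  shows "abs_h2 f \<bullet> abs_h2 (field_of E1 E2 b)
    = (\<integral>x. fst (f x) $ 1 * E1 x \<partial>torus_measure) + (\<integral>x. fst (f x) $ 2 * E2 x \<partial>torus_measure) + (\<integral>x. snd (f x) * b x \<partial>torus_measure)"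
proof -
  note i = square_integrable_real_product[OF square_integrable_components(1)[OF f, of 1] square_integrable_continuous_real[OF c(1)]]
    square_integrable_real_product[OF square_integrable_components(1)[OF f, of 2] square_integrable_continuous_real[OF c(2)]]
    square_integrable_real_product[OF square_integrable_components(2)[OF f] square_integrable_continuous_real[OF c(3)]]
  have "abs_h2 f \<bullet> abs_h2 (field_of E1 E2 b) = (\<integral>x. f x \<bullet> field_of E1 E2 b x \<partial>torus_measure)"
    by (rule abs_h2_inner[OF f square_integrable_continuous[OF continuous_field_of[OF c]]])
  also have "\<dots> = (\<integral>x. fst (f x) $ 1 * E1 x + fst (f x) $ 2 * E2 x + snd (f x) * b x \<partial>torus_measure)"
    by (simp add: field_of_def inner_prod_def inner_vec2)
  finally show ?thesis using i by simp
qed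

lemma rot_component: "rot z $ 1 = z $ 2" "rot z $ 2 = - z $ 1"
  by (simp_all add: rot_def)

lemma rot_linear: "rot (x + y) = rot x + rot y" "rot (c *\<^sub>R x) = c *\<^sub>R rot x" "rot (- x) = - rot x" "rot 0 = 0"
  by (simp_all add: rot_def vec_eq_iff forall_2)

lemma norm_rot: "norm (rot x) = norm x"
  by (simp add: norm_eq_sqrt_inner inner_vec2 rot_def power2_eq_square add.commute)

lemma rot_rot: "rot (rot x) = - x"
  by (simp add: rot_def vec_eq_iff forall_2)

lemma continuous_on_rot: "continuous_on A f \<Longrightarrow> continuous_on A (\<lambda>x. rot (f x))"
  unfolding rot_def by (intro continuous_on_vector2 continuous_intros)

text \<open>
  The maximal domain is that of the adjoint of the formal adjoint on test functions. Testing with one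
  component of \<open>(E\<^sub>1, E\<^sub>2, b)\<close> at a time separates the duality identity into the defining identities of
  the weak gradient and the weak curl, where the partial derivatives of \<open>b\<close> are read off from the
  electric components of \<open>Y + \<sigma> X\<close>.
\<close>

lemma maxwell_ohm_op_iff_weak:
  "maxwell_ohm_op \<sigma> X Y \<longleftrightarrow> (\<forall>Z Z'. classical (- 1) \<sigma> Z Z' \<longrightarrow> Y \<bullet> Z = X \<bullet> Z')"
proof -
  define f where "f = rep_h2 X"
  have f: "square_integrable f" and X: "X = abs_h2 f"
    by (simp_all add: f_def square_integrable_rep abs_rep_h2)
  have el: "electric X = (\<lambda>x. fst (f x))" and ma: "magnetic X = (\<lambda>x. snd (f x))"
    by (simp_all add: electric_def magnetic_def f_def fun_eq_iff)
  have sE: "square_integrable (\<lambda>x. fst (f x) $ i)" for i by (rule square_integrable_components(1)[OF f])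
  have sb: "square_integrable (\<lambda>x. snd (f x))" by (rule square_integrable_components(2)[OF f])
  have Xpair: "X \<bullet> abs_h2 (maxwell (- 1) \<sigma> E1 E2 b)
     = (\<integral>x. snd (f x) * pd 1 E2 x \<partial>torus_measure) - (\<integral>x. snd (f x) * pd 2 E1 x \<partial>torus_measure)
       + (\<integral>x. fst (f x) $ 2 * pd 1 b x - fst (f x) $ 1 * pd 2 b x \<partial>torus_measure)
       - \<sigma> * (\<integral>x. fst (f x) $ 1 * E1 x \<partial>torus_measure) - \<sigma> * (\<integral>x. fst (f x) $ 2 * E2 x \<partial>torus_measure)"
    if C: "C1_periodic E1" "C1_periodic E2" "C1_periodic b" for E1 E2 b
  proof -
    note c = C1_periodicD(2)[OF C(1)] C1_periodicD(2)[OF C(2)] C1_periodicD(2)[OF C(3)]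
      C1_periodicD(3)[OF C(1)] C1_periodicD(3)[OF C(2)] C1_periodicD(3)[OF C(3)]
    note ii = square_integrable_real_product[OF _ square_integrable_continuous_real]
    note i = ii[OF sE c(1), of 1] ii[OF sE c(2), of 2] ii[OF sE c(6), of 1 2] ii[OF sE c(6), of 2 1]
      ii[OF sb c(5), of 1] ii[OF sb c(4), of 2]
    have "X \<bullet> abs_h2 (maxwell (- 1) \<sigma> E1 E2 b)
       = (\<integral>x. fst (f x) $ 1 * (- 1 * pd 2 b x - \<sigma> * E1 x) \<partial>torus_measure)
       + (\<integral>x. fst (f x) $ 2 * (- (- 1) * pd 1 b x - \<sigma> * E2 x) \<partial>torus_measure)
       + (\<integral>x. snd (f x) * (- (- 1) * (pd 1 E2 x - pd 2 E1 x)) \<partial>torus_measure)"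
      unfolding X maxwell_def by (intro inner_field_of_general f continuous_intros c)
    also have "\<dots> = (\<integral>x. - (fst (f x) $ 1 * pd 2 b x) - \<sigma> * (fst (f x) $ 1 * E1 x) \<partial>torus_measure)
       + (\<integral>x. fst (f x) $ 2 * pd 1 b x - \<sigma> * (fst (f x) $ 2 * E2 x) \<partial>torus_measure)
       + (\<integral>x. snd (f x) * pd 1 E2 x - snd (f x) * pd 2 E1 x \<partial>torus_measure)"
      by (simp add: algebra_simps)
    also have "\<dots> = (\<integral>x. snd (f x) * pd 1 E2 x \<partial>torus_measure) - (\<integral>x. snd (f x) * pd 2 E1 x \<partial>torus_measure)
       + (\<integral>x. fst (f x) $ 2 * pd 1 b x - fst (f x) $ 1 * pd 2 b x \<partial>torus_measure)
       - \<sigma> * (\<integral>x. fst (f x) $ 1 * E1 x \<partial>torus_measure) - \<sigma> * (\<integral>x. fst (f x) $ 2 * E2 x \<partial>torus_measure)"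
      using i by simp
    finally show ?thesis .
  qed
  show ?thesis
  proof
    assume "maxwell_ohm_op \<sigma> X Y"
    then obtain g c where g: "square_integrable g" and c: "square_integrable c"
      and wg: "has_weak_gradient (\<lambda>x. snd (f x)) g" and wc: "has_weak_curl (\<lambda>x. fst (f x)) c"
      and Y: "Y = abs_h2 (\<lambda>x. (rot (g x) - \<sigma> *\<^sub>R fst (f x), - c x))"
      unfolding maxwell_ohm_op_def el ma state_def by blast
    have sg: "square_integrable (\<lambda>x. g x $ i)" for i
    proof (rule square_integrable_bound)
      have "g \<in> borel_measurable torus_measure" using g by (simp add: square_integrable_def)
      then show "(\<lambda>x. g x $ i) \<in> borel_measurable torus_measure"
        by (rule measurable_compose) (intro borel_measurable_continuous_onI continuous_intros)
      show "integrable torus_measure (\<lambda>x. (norm (g x))\<^sup>2)" using g by (simp add: square_integrable_def)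
    qed (simp add: component_le_norm_cart)
    have sY: "square_integrable (\<lambda>x. (rot (g x) - \<sigma> *\<^sub>R fst (f x), - c x))"
    proof -
      have mg: "g \<in> borel_measurable torus_measure" and mf: "f \<in> borel_measurable torus_measure" and mc: "c \<in> borel_measurable torus_measure"
        using g f c by (auto simp: square_integrable_def)
      have "continuous_on UNIV (\<lambda>z. rot z)" by (rule continuous_on_rot[OF continuous_on_id])
      then have mr: "(\<lambda>x. rot (g x)) \<in> borel_measurable torus_measure"
        by (intro measurable_compose[OF mg borel_measurable_continuous_onI])
      have sr: "square_integrable (\<lambda>x. rot (g x))"
        using g mr by (simp add: square_integrable_def norm_rot)
      have "square_integrable (\<lambda>x. rot (g x) - \<sigma> *\<^sub>R fst (f x))"
        by (intro square_integrable_diff sr square_integrable_scaleR square_integrable_components(3)[OF f])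
      then show ?thesis
        using c by (auto simp: square_integrable_def norm_Pair intro: borel_measurable_Pair)
    qed
    show "\<forall>Z Z'. classical (- 1) \<sigma> Z Z' \<longrightarrow> Y \<bullet> Z = X \<bullet> Z'"
    proof (intro allI impI)
      fix Z Z' assume "classical (- 1) \<sigma> Z Z'"
      then obtain E1 E2 b where t: "test_function E1" "test_function E2" "test_function b"
        and C: "C1_periodic E1" "C1_periodic E2" "C1_periodic b"
        and Z: "Z = abs_h2 (field_of E1 E2 b)" "Z' = abs_h2 (maxwell (- 1) \<sigma> E1 E2 b)" by (rule classicalE)
      note cc = C1_periodicD(2)[OF C(1)] C1_periodicD(2)[OF C(2)] C1_periodicD(2)[OF C(3)]
      note ii = square_integrable_real_product[OF _ square_integrable_continuous_real]
      note i = ii[OF sE cc(1), of 1] ii[OF sE cc(2), of 2] ii[OF sg cc(1), of 2] ii[OF sg cc(2), of 1] ii[OF c cc(3)]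
      have "Y \<bullet> Z = (\<integral>x. (g x $ 2 - \<sigma> * fst (f x) $ 1) * E1 x \<partial>torus_measure)
         + (\<integral>x. (- g x $ 1 - \<sigma> * fst (f x) $ 2) * E2 x \<partial>torus_measure) + (\<integral>x. - c x * b x \<partial>torus_measure)"
        unfolding Y Z inner_field_of_general[OF sY cc] by (simp add: rot_component)
      also have "\<dots> = (\<integral>x. g x $ 2 * E1 x - \<sigma> * (fst (f x) $ 1 * E1 x) \<partial>torus_measure)
         + (\<integral>x. - (g x $ 1 * E2 x) - \<sigma> * (fst (f x) $ 2 * E2 x) \<partial>torus_measure) + (\<integral>x. - (c x * b x) \<partial>torus_measure)"
        by (simp add: algebra_simps)
      also have "\<dots> = (\<integral>x. g x $ 2 * E1 x \<partial>torus_measure) - (\<integral>x. g x $ 1 * E2 x \<partial>torus_measure) - (\<integral>x. c x * b x \<partial>torus_measure)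
         - \<sigma> * (\<integral>x. fst (f x) $ 1 * E1 x \<partial>torus_measure) - \<sigma> * (\<integral>x. fst (f x) $ 2 * E2 x \<partial>torus_measure)"
        using i by simp
      also have "(\<integral>x. g x $ 2 * E1 x \<partial>torus_measure) = - (\<integral>x. snd (f x) * pd 2 E1 x \<partial>torus_measure)"
        using wg t(1) unfolding has_weak_gradient_def by blast
      also have "(\<integral>x. g x $ 1 * E2 x \<partial>torus_measure) = - (\<integral>x. snd (f x) * pd 1 E2 x \<partial>torus_measure)"
        using wg t(2) unfolding has_weak_gradient_def by blast
      also have "(\<integral>x. c x * b x \<partial>torus_measure) = - (\<integral>x. fst (f x) $ 2 * pd 1 b x - fst (f x) $ 1 * pd 2 b x \<partial>torus_measure)"
        using wc t(3) unfolding has_weak_curl_def by blast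
      finally show "Y \<bullet> Z = X \<bullet> Z'" unfolding Z(2) Xpair[OF C] by simp
    qed
  next
    assume weak: "\<forall>Z Z'. classical (- 1) \<sigma> Z Z' \<longrightarrow> Y \<bullet> Z = X \<bullet> Z'"
    define h where "h = rep_h2 Y"
    have h: "square_integrable h" and Y: "Y = abs_h2 h"
      by (simp_all add: h_def square_integrable_rep abs_rep_h2)
    have sh: "square_integrable (\<lambda>x. fst (h x) $ i)" for i by (rule square_integrable_components(1)[OF h])
    have shb: "square_integrable (\<lambda>x. snd (h x))" by (rule square_integrable_components(2)[OF h])
    have id: "(\<integral>x. fst (h x) $ 1 * E1 x \<partial>torus_measure) + (\<integral>x. fst (h x) $ 2 * E2 x \<partial>torus_measure) + (\<integral>x. snd (h x) * b x \<partial>torus_measure)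
       = (\<integral>x. snd (f x) * pd 1 E2 x \<partial>torus_measure) - (\<integral>x. snd (f x) * pd 2 E1 x \<partial>torus_measure)
       + (\<integral>x. fst (f x) $ 2 * pd 1 b x - fst (f x) $ 1 * pd 2 b x \<partial>torus_measure)
       - \<sigma> * (\<integral>x. fst (f x) $ 1 * E1 x \<partial>torus_measure) - \<sigma> * (\<integral>x. fst (f x) $ 2 * E2 x \<partial>torus_measure)"
      if t: "test_function E1" "test_function E2" "test_function b" for E1 E2 b
    proof -
      note C = test_function_C1[OF t(1)] test_function_C1[OF t(2)] test_function_C1[OF t(3)]
      note cc = C1_periodicD(2)[OF C(1)] C1_periodicD(2)[OF C(2)] C1_periodicD(2)[OF C(3)]
      show ?thesis
        using weak[rule_format, OF classicalI[OF t]]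
        unfolding Xpair[OF C] unfolding Y inner_field_of_general[OF h cc] .
    qed
    have pd0: "pd i (\<lambda>x. 0) = (\<lambda>x. 0)" for i
      unfolding pd_def by (rule ext) (simp add: frechet_derivative_const)
    \<comment> \<open>Solving \<open>R g = Y\<^sub>E + \<sigma> E\<close> for the gradient, with \<open>R (R z) = - z\<close>.\<close>
    define g where "g x = (vector [- (fst (h x) $ 2 + \<sigma> * fst (f x) $ 2), fst (h x) $ 1 + \<sigma> * fst (f x) $ 1] :: real^2)" for x
    have g': "g x = - rot (fst (h x) + \<sigma> *\<^sub>R fst (f x))" for x
      by (rule vec2_eqI) (simp_all add: g_def rot_component)
    have sg: "square_integrable g"
    proof -
      have s: "square_integrable (\<lambda>x. fst (h x) + \<sigma> *\<^sub>R fst (f x))"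
        by (intro square_integrable_add square_integrable_scaleR square_integrable_components(3) f h)
      have "continuous_on UNIV (\<lambda>z. - rot z)"
        by (intro continuous_on_minus continuous_on_rot continuous_on_id)
      then have m: "g \<in> borel_measurable torus_measure"
        unfolding g'[abs_def] using s
        by (intro measurable_compose[OF _ borel_measurable_continuous_onI, of _ _ "\<lambda>z. - rot z"]) (auto simp: square_integrable_def)
      show ?thesis using s m by (simp add: square_integrable_def g' norm_rot)
    qed
    have wg: "has_weak_gradient (\<lambda>x. snd (f x)) g"
      unfolding has_weak_gradient_def forall_2
    proof (intro allI impI conjI)
      fix \<phi> assume t: "test_function \<phi>"
      note ii = square_integrable_real_product[OF _ square_integrable_continuous_real[OF C1_periodicD(2)[OF test_function_C1[OF t]]]]
      show "(\<integral>x. g x $ 1 * \<phi> x \<partial>torus_measure) = - (\<integral>x. snd (f x) * pd 1 \<phi> x \<partial>torus_measure)"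
      proof -
        have "(\<integral>x. g x $ 1 * \<phi> x \<partial>torus_measure) = (\<integral>x. - (fst (h x) $ 2 * \<phi> x) - \<sigma> * (fst (f x) $ 2 * \<phi> x) \<partial>torus_measure)"
          by (simp add: g_def algebra_simps)
        also have "\<dots> = - (\<integral>x. fst (h x) $ 2 * \<phi> x \<partial>torus_measure) - \<sigma> * (\<integral>x. fst (f x) $ 2 * \<phi> x \<partial>torus_measure)"
          using ii[OF sh, of 2] ii[OF sE, of 2] by simp
        finally show ?thesis using id[OF test_function_zero t test_function_zero] by (simp add: pd0)
      qed
      show "(\<integral>x. g x $ 2 * \<phi> x \<partial>torus_measure) = - (\<integral>x. snd (f x) * pd 2 \<phi> x \<partial>torus_measure)"
      proof -
        have "(\<integral>x. g x $ 2 * \<phi> x \<partial>torus_measure) = (\<integral>x. fst (h x) $ 1 * \<phi> x + \<sigma> * (fst (f x) $ 1 * \<phi> x) \<partial>torus_measure)"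
          by (simp add: g_def algebra_simps)
        also have "\<dots> = (\<integral>x. fst (h x) $ 1 * \<phi> x \<partial>torus_measure) + \<sigma> * (\<integral>x. fst (f x) $ 1 * \<phi> x \<partial>torus_measure)"
          using ii[OF sh, of 1] ii[OF sE, of 1] by simp
        finally show ?thesis using id[OF t test_function_zero test_function_zero] by (simp add: pd0)
      qed
    qed
    have wc: "has_weak_curl (\<lambda>x. fst (f x)) (\<lambda>x. - snd (h x))"
      unfolding has_weak_curl_def
    proof (intro allI impI)
      fix \<phi> assume t: "test_function \<phi>"
      show "(\<integral>x. - snd (h x) * \<phi> x \<partial>torus_measure) = - (\<integral>x. fst (f x) $ 2 * pd 1 \<phi> x - fst (f x) $ 1 * pd 2 \<phi> x \<partial>torus_measure)"
        using id[OF test_function_zero test_function_zero t] by (simp add: pd0)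
    qed
    have sc: "square_integrable (\<lambda>x. - snd (h x))" using square_integrable_scaleR[OF shb, of "- 1"] by simp
    have "Y = state (\<lambda>x. rot (g x) - \<sigma> *\<^sub>R fst (f x)) (\<lambda>x. - (- snd (h x)))"
    proof -
      have "rot (g x) - \<sigma> *\<^sub>R fst (f x) = fst (h x)" for x
        by (rule vec2_eqI) (simp_all add: rot_component g_def)
      then show ?thesis by (simp add: state_def Y)
    qed
    then show "maxwell_ohm_op \<sigma> X Y"
      unfolding maxwell_ohm_op_def el ma using sg sc wg wc by blast
  qed
qed

text \<open>
  The semigroup is fixed once and for all as the one carried by the classical solutions; the following
  lemmas show that it is the one asked for.
\<close>

definition ohm_flow :: "real \<Rightarrow> real \<Rightarrow> h2 \<Rightarrow> h2" where
  "ohm_flow \<sigma> = dissipative.flow (classical 1 \<sigma>)"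

lemma ohm_flow_semigroup: "\<sigma> \<ge> 0 \<Longrightarrow> contraction_semigroup (ohm_flow \<sigma>)"
  unfolding ohm_flow_def by (rule dissipative.flow_semigroup[OF dissipative_classical])

lemma generator_ohm_flow: "\<sigma> \<ge> 0 \<Longrightarrow> generator (ohm_flow \<sigma>) = maxwell_ohm_op \<sigma>"
  unfolding ohm_flow_def
  by (intro ext) (simp add: dual_dissipative.generator_iff_weak[OF dual_dissipative_classical] maxwell_ohm_op_iff_weak)

lemma ohm_flow_duhamel:
  assumes "\<sigma> \<ge> 0" "0 \<le> t"
    and C: "\<And>s. C1_periodic (E1 s)" "\<And>s. C1_periodic (E2 s)" "\<And>s. C1_periodic (b s)"
    and X: "\<And>s. ((\<lambda>s. abs_h2 (field_of (E1 s) (E2 s) (b s))) has_vector_derivative X' s) (at s)"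
    and X': "continuous_on UNIV X'" and Y: "continuous_on UNIV (\<lambda>s. abs_h2 (maxwell 1 \<sigma> (E1 s) (E2 s) (b s)))"
  shows "((\<lambda>s. ohm_flow \<sigma> (t - s) (X' s - abs_h2 (maxwell 1 \<sigma> (E1 s) (E2 s) (b s)))) has_integral
    abs_h2 (field_of (E1 t) (E2 t) (b t)) - ohm_flow \<sigma> t (abs_h2 (field_of (E1 0) (E2 0) (b 0)))) {0..t}"
  unfolding ohm_flow_def
proof (rule dual_dissipative.weak_duhamel[OF dual_dissipative_classical[OF assms(1)] assms(2)])
  show "abs_h2 (maxwell 1 \<sigma> (E1 s) (E2 s) (b s)) \<bullet> Z = abs_h2 (field_of (E1 s) (E2 s) (b s)) \<bullet> Z'"
    if "classical (- 1) \<sigma> Z Z'" for s Z Z'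
    using that by (elim classicalE) (simp add: maxwell_dual C)
qed (use X X' Y in \<open>auto intro: has_vector_derivative_at_within continuous_on_subset\<close>)

section \<open>The coefficients\<close>

lemma grad_eqI:
  assumes "(f has_derivative (\<lambda>h. g \<bullet> h)) (at x)"
  shows "grad f x = g"
  unfolding grad_def pd_def frechet_derivative_at[OF assms, symmetric]
  by (simp add: vec_eq_iff inner_axis)

lemma norm_w: "norm w = 1" by (simp add: w_def)

lemma torus_rep_component:
  "torus_rep x $ i = x $ i - 2 * pi * of_int \<lfloor>(x $ i + pi) / (2 * pi)\<rfloor>"
  by (simp add: torus_rep_def)

lemma torus_rep_bounds: "- pi \<le> torus_rep x $ i" "torus_rep x $ i < pi"
proof -
  let ?q = "(x $ i + pi) / (2 * pi)"
  have q: "of_int \<lfloor>?q\<rfloor> \<le> ?q" "?q < of_int \<lfloor>?q\<rfloor> + 1" by linarith+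
  then have "of_int \<lfloor>?q\<rfloor> * (2 * pi) \<le> x $ i + pi" "x $ i + pi < (of_int \<lfloor>?q\<rfloor> + 1) * (2 * pi)"
    by (simp_all only: pos_le_divide_eq pos_divide_less_eq pi_gt_zero mult_pos_pos zero_less_numeral)
  then show "- pi \<le> torus_rep x $ i" "torus_rep x $ i < pi"
    unfolding torus_rep_component by (simp_all add: algebra_simps)
qed

lemma cos_torus_rep: "cos (torus_rep x $ i) = cos (x $ i)"
  unfolding torus_rep_component by (simp add: cos_diff cos_int_2pin sin_int_2pin)

lemma abs_torus_rep_le: "\<bar>torus_rep x $ i\<bar> \<le> pi"
  using torus_rep_bounds[of x i] by linarith

text \<open>
  Smallness of the reduced coordinate is a condition on a cosine, which is periodic and continuous.
  This is the way in which the jumps of \<open>torus_rep\<close> are avoided throughout.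
\<close>

lemma abs_torus_rep_less_iff:
  assumes "0 \<le> r" "r \<le> pi"
  shows "\<bar>torus_rep x $ i\<bar> < r \<longleftrightarrow> cos r < cos (x $ i)"
  using cos_mono_less_eq[of r "\<bar>torus_rep x $ i\<bar>"] assms abs_torus_rep_le[of x i]
  by (simp add: cos_torus_rep)

lemma continuous_on_torus_rep: "continuous_on {x. \<forall>i. cos (x $ i) > - 1} torus_rep"
proof -
  have "isCont (\<lambda>x. x $ i - 2 * pi * of_int \<lfloor>(x $ i + pi) / (2 * pi)\<rfloor>) x" if "cos (x $ i) > - 1" for x :: "real^2" and i
  proof -
    have "(x $ i + pi) / (2 * pi) \<notin> \<int>"
    proof
      assume "(x $ i + pi) / (2 * pi) \<in> \<int>"
      then obtain k where "(x $ i + pi) / (2 * pi) = of_int k" by (rule Ints_cases)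
      then have "x $ i = of_int k * (2 * pi) - pi" by (simp add: field_simps)
      then have "cos (x $ i) = - 1" using cos_int_2pin[of k] sin_int_2pin[of k] by (simp add: cos_diff mult.commute[of "of_int k"])
      then show False using that by simp
    qed
    then have "isCont (real_of_int \<circ> floor) ((x $ i + pi) / (2 * pi))" by (rule continuous_floor)
    moreover have "isCont (\<lambda>x::real^2. (x $ i + pi) / (2 * pi)) x" by (intro continuous_intros) auto
    ultimately have "isCont (\<lambda>x. (real_of_int \<circ> floor) ((x $ i + pi) / (2 * pi))) x"
      by (rule isCont_o2[rotated])
    then have c: "isCont (\<lambda>x. real_of_int \<lfloor>(x $ i + pi) / (2 * pi)\<rfloor>) x" by (simp add: o_def)
    show ?thesis by (intro continuous_intros c)
  qed
  then show ?thesis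
    unfolding torus_rep_def
    by (intro continuous_on_vec_lambda continuous_at_imp_continuous_on ballI) auto
qed

text \<open>
  The properties of the logarithmic cutoff that matter for the packet: it equals one near the origin,
  it vanishes outside the disk, and it varies slowly in the logarithm of the radius.
\<close>

locale cutoff =
  fixes \<Theta> :: "real \<Rightarrow> real" and r0 C :: real
  assumes r0: "0 < r0" "r0 < pi"
    and smooth_Theta: "smooth \<Theta>"
    and Theta01: "0 \<le> \<Theta> z" "\<Theta> z \<le> 1"
    and Theta0: "z \<le> 0 \<Longrightarrow> \<Theta> z = 0"
    and Theta1: "1 \<le> z \<Longrightarrow> \<Theta> z = 1"
    and dTheta: "\<bar>deriv \<Theta> z\<bar> \<le> C"
begin

lemma C_nonneg: "0 \<le> C" using dTheta[of 0] by linarith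

lemma Theta_deriv: "(\<Theta> has_real_derivative deriv \<Theta> z) (at z)"
  and continuous_deriv: "continuous_on UNIV (deriv \<Theta>)"
proof -
  have C1: "C_k (Suc 0) \<Theta>" using smooth_Theta by (simp add: smooth_def)
  then show d: "(\<Theta> has_real_derivative deriv \<Theta> z) (at z)" for z
    by (simp add: DERIV_deriv_iff_real_differentiable)
  have "frechet_derivative \<Theta> (at z) 1 = deriv \<Theta> z" for z
    using fun_cong[OF frechet_derivative_at[OF d[of z, unfolded has_field_derivative_def]], of 1] by simp
  then show "continuous_on UNIV (deriv \<Theta>)" using C1 by simp
qed

lemma continuous_Theta: "continuous_on UNIV \<Theta>"
  by (intro continuous_at_imp_continuous_on ballI DERIV_isCont[OF Theta_deriv])

lemma deriv_Theta_eq_0: "z < 0 \<or> 1 < z \<Longrightarrow> deriv \<Theta> z = 0"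
proof -
  assume z: "z < 0 \<or> 1 < z"
  define c :: real where "c = (if z < 0 then 0 else 1)"
  define S where "S = (if z < 0 then {..<0} else {1<..} :: real set)"
  have "(\<Theta> has_real_derivative 0) (at z)"
    by (rule has_field_derivative_transform_within_open[of "\<lambda>_. c" 0 z S]) (use z Theta0 Theta1 in \<open>auto simp: S_def c_def\<close>)
  then show ?thesis by (rule DERIV_imp_deriv)
qed

text \<open>
  The gradient of \<open>psi\<close> by the product rule, where \<open>\<nabla> ln (r0 / |x|) = - x / |x|\<^sup>2\<close>. At \<open>r0 \<le> |x|\<close> the
  argument of \<open>\<Theta>\<close> is not positive, so that the formula covers the extension by zero.
\<close>

definition grad_psi :: "real \<Rightarrow> real \<Rightarrow> real^2 \<Rightarrow> real^2" where
  "grad_psi A L x = (if x = 0 then - A *\<^sub>R rot w else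
     - A *\<^sub>R (\<Theta> (ln (r0 / norm x) / L) *\<^sub>R rot w - ((rot w \<bullet> x) / (x \<bullet> x) * (deriv \<Theta> (ln (r0 / norm x) / L) / L)) *\<^sub>R x))"

lemma ln_ratio_gt: "0 < L \<Longrightarrow> x \<noteq> 0 \<Longrightarrow> norm x < r0 * exp (- L) \<Longrightarrow> 1 < ln (r0 / norm x) / L"
  for x :: "real^2"
proof -
  assume L: "0 < L" and x: "x \<noteq> 0" "norm x < r0 * exp (- L)"
  have "exp L * norm x < exp L * (r0 * exp (- L))" using x(2) by (intro mult_strict_left_mono) auto
  then have "exp L < r0 / norm x" using x(1) by (simp add: pos_less_divide_eq exp_minus field_simps)
  then have "ln (exp L) < ln (r0 / norm x)" using x(1) r0 by (subst ln_less_cancel_iff) auto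
  then have "L < ln (r0 / norm x)" by simp
  then show ?thesis using L by simp
qed

lemma grad_psi_core: "0 < L \<Longrightarrow> norm x < r0 * exp (- L) \<Longrightarrow> grad_psi A L x = - A *\<^sub>R rot w"
  using ln_ratio_gt[of L x] by (auto simp: grad_psi_def Theta1 deriv_Theta_eq_0)

lemma grad_psi_outside:
  assumes "0 < L" "r0 < norm x"
  shows "grad_psi A L x = 0"
proof -
  have "x \<noteq> 0" using assms r0 by auto
  moreover have "ln (r0 / norm x) < 0"
    by (rule ln_less_zero) (use \<open>x \<noteq> 0\<close> assms r0 in \<open>simp_all add: pos_divide_less_eq\<close>)
  then have "ln (r0 / norm x) / L < 0" using assms(1) by (rule divide_neg_pos)
  ultimately show ?thesis by (simp add: grad_psi_def Theta0 deriv_Theta_eq_0)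
qed

lemma psi_eq:
  assumes "0 < L" "x \<noteq> 0"
  shows "psi \<Theta> r0 A L x = - A * (rot w \<bullet> x) * \<Theta> (ln (r0 / norm x) / L)"
proof (cases "norm x < r0")
  case False
  then have "r0 / norm x \<le> 1" using assms by (simp add: pos_divide_le_eq)
  then have "ln (r0 / norm x) \<le> 0" using ln_le_minus_one[of "r0 / norm x"] assms r0 by simp
  then have "ln (r0 / norm x) / L \<le> 0" using assms(1) by (rule divide_nonpos_pos)
  then show ?thesis using False assms by (simp add: psi_def chi_cut_def Theta0)
qed (use assms in \<open>simp add: psi_def chi_cut_def\<close>)

lemma grad_psi:
  assumes L: "0 < L"
  shows "grad (psi \<Theta> r0 A L) x = grad_psi A L x"
proof (cases "x = 0")
  case True
  have "((\<lambda>x. - A * (rot w \<bullet> x)) has_derivative (\<lambda>h. (- A *\<^sub>R rot w) \<bullet> h)) (at x)"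
    by (auto intro!: derivative_eq_intros)
  then have "(psi \<Theta> r0 A L has_derivative (\<lambda>h. (- A *\<^sub>R rot w) \<bullet> h)) (at x)"
  proof (rule has_derivative_transform_within_open)
    show "open (ball (0 :: real^2) (r0 * exp (- L)))" by simp
    show "x \<in> ball 0 (r0 * exp (- L))" using True r0 by simp
    fix y :: "real^2" assume y: "y \<in> ball 0 (r0 * exp (- L))"
    show "- A * (rot w \<bullet> y) = psi \<Theta> r0 A L y"
    proof (cases "y = 0")
      case False
      then show ?thesis using ln_ratio_gt[OF L False] y by (simp add: psi_eq[OF L False] Theta1)
    qed (simp add: psi_def)
  qed
  from grad_eqI[OF this] show ?thesis using True by (simp add: grad_psi_def)
next
  case False
  let ?z = "\<lambda>x::real^2. (ln r0 - ln (x \<bullet> x) * (1 / 2)) * (1 / L)"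
  have zeq: "?z y = ln (r0 / norm y) / L" if "y \<noteq> 0" for y
    using that r0 by (simp add: ln_div norm_eq_sqrt_inner ln_sqrt)
  have xx: "x \<bullet> x > 0" using False by simp
  have d1: "((\<lambda>x::real^2. x \<bullet> x) has_derivative (\<lambda>h. 2 * (x \<bullet> h))) (at x)"
    by (rule has_derivative_eq_rhs[OF has_derivative_inner[OF has_derivative_ident has_derivative_ident]])
      (simp add: fun_eq_iff inner_commute)
  have d2: "((\<lambda>x. ln (x \<bullet> x)) has_derivative (\<lambda>h. (2 * (x \<bullet> h)) * (1 / (x \<bullet> x)))) (at x)"
    using DERIV_compose_FDERIV[OF DERIV_ln_divide[OF xx] d1] .
  have "(?z has_derivative (\<lambda>h. (0 - (2 * (x \<bullet> h)) * (1 / (x \<bullet> x)) * (1 / 2)) * (1 / L))) (at x)"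
    by (intro has_derivative_mult_left has_derivative_diff has_derivative_const d2)
  then have d3: "(?z has_derivative (\<lambda>h. - (x \<bullet> h) / ((x \<bullet> x) * L))) (at x)"
    by (rule has_derivative_eq_rhs) (simp add: fun_eq_iff)
  have d4: "((\<lambda>x. \<Theta> (?z x)) has_derivative (\<lambda>h. (- (x \<bullet> h) / ((x \<bullet> x) * L)) * deriv \<Theta> (?z x))) (at x)"
    by (rule DERIV_compose_FDERIV[OF Theta_deriv d3])
  have d5: "((\<lambda>x. - A * (rot w \<bullet> x)) has_derivative (\<lambda>h. - A * (rot w \<bullet> h))) (at x)"
    by (auto intro!: derivative_eq_intros)
  have "((\<lambda>x. - A * (rot w \<bullet> x) * \<Theta> (?z x)) has_derivative (\<lambda>h. grad_psi A L x \<bullet> h)) (at x)"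
    by (rule has_derivative_eq_rhs[OF has_derivative_mult[OF d5 d4]])
      (use False in \<open>simp add: fun_eq_iff grad_psi_def zeq[symmetric] inner_diff_left algebra_simps\<close>)
  then have "(psi \<Theta> r0 A L has_derivative (\<lambda>h. grad_psi A L x \<bullet> h)) (at x)"
  proof (rule has_derivative_transform_within_open)
    show "open (- {0 :: real^2})" by auto
    show "- A * (rot w \<bullet> y) * \<Theta> (?z y) = psi \<Theta> r0 A L y" if "y \<in> - {0}" for y
      unfolding psi_eq[OF L ComplD[OF that, simplified]] by (subst zeq) (use that in auto)
  qed (use False in auto)
  from grad_eqI[OF this] show ?thesis .
qed

text \<open>
  The factor \<open>rot w \<bullet> x\<close> compensates the singularity \<open>1 / |x|\<close> of the gradient of the cutoff. Hence the
  bound does not see the scale on which the cutoff varies.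
\<close>

lemma norm_grad_psi_le:
  assumes "1 \<le> L"
  shows "norm (grad_psi A L x) \<le> \<bar>A\<bar> * (1 + C)"
proof (cases "x = 0")
  case True
  then show ?thesis using C_nonneg by (simp add: grad_psi_def norm_rot norm_w mult_left_le algebra_simps)
next
  case False
  let ?z = "ln (r0 / norm x) / L"
  have "norm (\<Theta> ?z *\<^sub>R rot w) \<le> 1" using Theta01[of ?z] by (simp add: norm_rot norm_w)
  moreover have "norm (((rot w \<bullet> x) / (x \<bullet> x) * (deriv \<Theta> ?z / L)) *\<^sub>R x) \<le> C"
  proof -
    have "\<bar>rot w \<bullet> x\<bar> \<le> norm x" using Cauchy_Schwarz_ineq2[of "rot w" x] by (simp add: norm_rot norm_w)
    then have "\<bar>rot w \<bullet> x\<bar> * norm x \<le> x \<bullet> x"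
      using mult_right_mono[of "\<bar>rot w \<bullet> x\<bar>" "norm x" "norm x"] by (simp add: power2_norm_eq_inner[symmetric] power2_eq_square)
    then have 1: "\<bar>rot w \<bullet> x\<bar> * norm x / (x \<bullet> x) \<le> 1" using False by (simp add: pos_divide_le_eq)
    have 2: "\<bar>deriv \<Theta> ?z\<bar> / L \<le> C"
      using dTheta[of ?z] assms C_nonneg mult_left_mono[of 1 L C]
      by (simp add: pos_divide_le_eq)
    have "norm (((rot w \<bullet> x) / (x \<bullet> x) * (deriv \<Theta> ?z / L)) *\<^sub>R x)
       = (\<bar>rot w \<bullet> x\<bar> * norm x / (x \<bullet> x)) * (\<bar>deriv \<Theta> ?z\<bar> / L)"
      using assms by (simp add: abs_mult)
    also have "\<dots> \<le> 1 * C"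
      using 1 2 C_nonneg assms by (intro mult_mono) auto
    finally show ?thesis by simp
  qed
  ultimately have "norm (\<Theta> ?z *\<^sub>R rot w - ((rot w \<bullet> x) / (x \<bullet> x) * (deriv \<Theta> ?z / L)) *\<^sub>R x) \<le> 1 + C"
    using norm_triangle_ineq4 order_trans add_mono by meson
  then have "\<bar>A\<bar> * norm (\<Theta> ?z *\<^sub>R rot w - ((rot w \<bullet> x) / (x \<bullet> x) * (deriv \<Theta> ?z / L)) *\<^sub>R x) \<le> \<bar>A\<bar> * (1 + C)"
    by (intro mult_left_mono) auto
  then show ?thesis using False by (simp add: grad_psi_def)
qed

text \<open>
  The formula is continuous away from the origin, and near the origin the function is constant in \<open>x\<close>;
  both domains are open.
\<close>

lemma continuous_on_grad_psi:
  "continuous_on {(A, L, x). 0 < L} (\<lambda>(A, L, x). grad_psi A L x)"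
proof -
  let ?O1 = "{p :: real \<times> real \<times> (real^2). 0 < fst (snd p) \<and> snd (snd p) \<noteq> 0}"
  let ?O2 = "{p :: real \<times> real \<times> (real^2). 0 < fst (snd p) \<and> norm (snd (snd p)) < r0 * exp (- fst (snd p))}"
  have o1: "open ?O1"
    by (intro open_Collect_conj open_Collect_less open_Collect_neq continuous_intros)
  have o2: "open ?O2"
    by (intro open_Collect_conj open_Collect_less continuous_intros)
  have c1: "continuous_on ?O1 (\<lambda>p. grad_psi (fst p) (fst (snd p)) (snd (snd p)))"
  proof (rule continuous_on_eq)
    let ?z = "\<lambda>p :: real \<times> real \<times> (real^2). ln (r0 / norm (snd (snd p))) / fst (snd p)"
    have z: "continuous_on ?O1 ?z" using r0 by (intro continuous_intros) auto
    show "continuous_on ?O1 (\<lambda>p. - fst p *\<^sub>R (\<Theta> (?z p) *\<^sub>R rot w - ((rot w \<bullet> snd (snd p)) / (snd (snd p) \<bullet> snd (snd p)) * (deriv \<Theta> (?z p) / fst (snd p))) *\<^sub>R snd (snd p)))"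
      by (intro continuous_intros continuous_on_compose2[OF continuous_Theta z] continuous_on_compose2[OF continuous_deriv z]) auto
  qed (simp add: grad_psi_def)
  have c2: "continuous_on ?O2 (\<lambda>p. grad_psi (fst p) (fst (snd p)) (snd (snd p)))"
  proof (rule continuous_on_eq)
    show "continuous_on ?O2 (\<lambda>p. - fst p *\<^sub>R rot w)" by (intro continuous_intros)
  qed (simp add: grad_psi_core)
  have "{(A, L, x). 0 < L} = ?O1 \<union> ?O2" using r0 by auto
  then show ?thesis
    using continuous_on_open_Un[OF o1 o2 c1 c2] by (simp add: case_prod_unfold)
qed

text \<open>
  The jumps of \<open>torus_rep\<close> lie outside the disk of radius \<open>r0\<close>, where the field vanishes.
\<close>

lemma continuous_on_grad_psi_torus:
  "continuous_on {(A, L, x). 0 < L} (\<lambda>(A, L, x). grad_psi A L (torus_rep x))"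
proof -
  \<comment> \<open>Any radius strictly between \<open>r0\<close> and \<open>\<pi>\<close>: the two open regions then overlap.\<close>
  define R where "R = (r0 + pi) / 2"
  have R: "r0 < R" "R < pi" "0 \<le> R" using r0 by (auto simp: R_def)
  let ?O1 = "{p :: real \<times> real \<times> (real^2). 0 < fst (snd p) \<and> (\<forall>i. cos (snd (snd p) $ i) > - 1)}"
  let ?O2 = "{p :: real \<times> real \<times> (real^2). 0 < fst (snd p) \<and> (\<exists>i. cos (snd (snd p) $ i) < cos R)}"
  have o1: "open ?O1" unfolding forall_2
    by (intro open_Collect_conj open_Collect_less continuous_intros)
  have o2: "open ?O2"
    by (intro open_Collect_conj open_Collect_ex open_Collect_less continuous_intros)
  have c1: "continuous_on ?O1 (\<lambda>p. grad_psi (fst p) (fst (snd p)) (torus_rep (snd (snd p))))"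
  proof -
    have t: "continuous_on ?O1 (\<lambda>p. torus_rep (snd (snd p)))"
      by (rule continuous_on_compose2[OF continuous_on_torus_rep]) (auto intro!: continuous_intros)
    have "continuous_on ?O1 (\<lambda>p. (\<lambda>(A, L, x). grad_psi A L x) (fst p, fst (snd p), torus_rep (snd (snd p))))"
      by (rule continuous_on_compose2[OF continuous_on_grad_psi]) (auto intro!: continuous_intros t)
    then show ?thesis by simp
  qed
  have c2: "continuous_on ?O2 (\<lambda>p. grad_psi (fst p) (fst (snd p)) (torus_rep (snd (snd p))))"
  proof (rule continuous_on_eq[OF continuous_on_const])
    fix p :: "real \<times> real \<times> (real^2)" assume p: "p \<in> ?O2"
    then obtain i where i: "cos (snd (snd p) $ i) < cos R" by auto
    have "\<not> \<bar>torus_rep (snd (snd p)) $ i\<bar> < R" using abs_torus_rep_less_iff[of R] R i by auto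
    then have "r0 < norm (torus_rep (snd (snd p)))"
      using component_le_norm_cart[of "torus_rep (snd (snd p))" i] R by linarith
    then show "0 = grad_psi (fst p) (fst (snd p)) (torus_rep (snd (snd p)))"
      using p by (simp add: grad_psi_outside)
  qed
  have "- 1 < cos R" using cos_monotone_0_pi[of R pi] R by simp
  then have "cos y > - 1 \<or> cos y < cos R" for y by linarith
  then have "{(A, L, x). 0 < L} = ?O1 \<union> ?O2" by (simp add: set_eq_iff) blast
  then show ?thesis
    using continuous_on_open_Un[OF o1 o2 c1 c2] by (simp add: case_prod_unfold)
qed

context
  fixes \<sigma> :: real and n :: nat
  assumes sigma: "0 < \<sigma>"
begin

lemma A_coef_bounds: "0 \<le> t \<Longrightarrow> 1 \<le> A_coef \<sigma> n t" "0 \<le> t \<Longrightarrow> A_coef \<sigma> n t \<le> A_coef \<sigma> n 0"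
  using sigma by (auto simp: A_coef_def intro!: divide_left_mono mult_left_mono add_nonneg_pos mult_pos_pos)

lemma L_coef_ge_1: "0 \<le> t \<Longrightarrow> 1 \<le> L_coef \<sigma> n t"
  using power_mono[OF A_coef_bounds(1), of t 2] by (simp add: L_coef_def)

lemma L_coef_le: "0 \<le> t \<Longrightarrow> L_coef \<sigma> n t \<le> L_coef \<sigma> n 0"
  using A_coef_bounds[of t] by (simp add: L_coef_def power_mono)

lemma u_eq: "0 \<le> t \<Longrightarrow> u \<Theta> r0 \<sigma> x0 n t x = rot (grad_psi (A_coef \<sigma> n t) (L_coef \<sigma> n t) (torus_rep (x - x_c x0 t)))"
  using L_coef_ge_1[of t] by (simp add: u_def W_def grad_psi)

lemma norm_u_le: "0 \<le> t \<Longrightarrow> norm (u \<Theta> r0 \<sigma> x0 n t x) \<le> A_coef \<sigma> n 0 * (1 + C)"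
proof -
  assume t: "0 \<le> t"
  have "norm (u \<Theta> r0 \<sigma> x0 n t x) \<le> \<bar>A_coef \<sigma> n t\<bar> * (1 + C)"
    using norm_grad_psi_le[OF L_coef_ge_1[OF t]] by (simp add: u_eq[OF t] norm_rot)
  also have "\<dots> \<le> A_coef \<sigma> n 0 * (1 + C)"
    using A_coef_bounds[OF t] C_nonneg by (intro mult_right_mono) auto
  finally show ?thesis .
qed

text \<open>
  Around the moving centre the coefficient is spatially constant. For fixed \<open>n\<close> the radius of this core
  is bounded below uniformly in time, as \<open>L_coef\<close> is largest at time zero.
\<close>

lemma u_core:
  assumes t: "0 \<le> t" and x: "norm (torus_rep (x - x_c x0 t)) < r0 * exp (- L_coef \<sigma> n 0)"
  shows "u \<Theta> r0 \<sigma> x0 n t x = A_coef \<sigma> n t *\<^sub>R w"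
proof -
  have "r0 * exp (- L_coef \<sigma> n 0) \<le> r0 * exp (- L_coef \<sigma> n t)" using r0 L_coef_le[OF t] by simp
  then have "norm (torus_rep (x - x_c x0 t)) < r0 * exp (- L_coef \<sigma> n t)" using x by linarith
  then show ?thesis
    using L_coef_ge_1[OF t] by (simp add: u_eq[OF t] grad_psi_core rot_linear rot_rot)
qed

lemma continuous_on_u: "continuous_on ({0..} \<times> UNIV) (\<lambda>(t, x). u \<Theta> r0 \<sigma> x0 n t x)"
proof -
  have nz: "\<sigma> * (t + exp (- real n)) \<noteq> 0" if "0 \<le> t" for t
    using sigma that add_nonneg_pos[OF that exp_gt_zero, of "- real n"] by simp
  have A: "continuous_on ({0..} \<times> (UNIV :: (real^2) set)) (\<lambda>p. A_coef \<sigma> n (fst p))"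
    unfolding A_coef_def using nz by (intro continuous_intros) auto
  then have L: "continuous_on ({0..} \<times> (UNIV :: (real^2) set)) (\<lambda>p. L_coef \<sigma> n (fst p))"
    unfolding L_coef_def by (intro continuous_intros)
  have Y: "continuous_on ({0..} \<times> (UNIV :: (real^2) set)) (\<lambda>p. snd p - x_c x0 (fst p))"
    unfolding x_c_def by (intro continuous_intros)
  have "continuous_on ({0..} \<times> UNIV) (\<lambda>p. (\<lambda>(A, L, x). grad_psi A L (torus_rep x)) (A_coef \<sigma> n (fst p), L_coef \<sigma> n (fst p), snd p - x_c x0 (fst p)))"
  proof (rule continuous_on_compose2[OF continuous_on_grad_psi_torus])
    show "(\<lambda>p. (A_coef \<sigma> n (fst p), L_coef \<sigma> n (fst p), snd p - x_c x0 (fst p))) ` ({0..} \<times> UNIV) \<subseteq> {(A, L, x). 0 < L}"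
      using L_coef_ge_1 by fastforce
  qed (intro continuous_on_Pair A L Y)
  from continuous_on_rot[OF this] show ?thesis
    by (rule continuous_on_eq) (auto simp: u_eq)
qed

end

end

section \<open>Pancake profiles\<close>

lemma DERIV_positive_part_power:
  "((\<lambda>y::real. max 0 y ^ Suc (Suc k)) has_real_derivative real (Suc (Suc k)) * max 0 y ^ Suc k) (at y)"
proof (cases y "0::real" rule: linorder_cases)
  case less
  have "((\<lambda>y::real. 0) has_real_derivative 0) (at y)" by simp
  then have "((\<lambda>y::real. max 0 y ^ Suc (Suc k)) has_real_derivative 0) (at y)"
    by (rule has_field_derivative_transform_within_open[of _ _ _ "{..<0}"]) (use less in auto)
  then show ?thesis using less by simp
next
  case greater
  have "((\<lambda>y::real. y ^ Suc (Suc k)) has_real_derivative real (Suc (Suc k)) * y ^ Suc k) (at y)"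
    using DERIV_pow[of "Suc (Suc k)" y UNIV] by (simp only: One_nat_def diff_Suc_Suc diff_zero)
  then have "((\<lambda>y::real. max 0 y ^ Suc (Suc k)) has_real_derivative real (Suc (Suc k)) * y ^ Suc k) (at y)"
    by (rule has_field_derivative_transform_within_open[of _ _ _ "{0<..}"]) (use greater in auto)
  then show ?thesis using greater by simp
next
  case equal
  have "((\<lambda>h::real. (max 0 (0 + h) ^ Suc (Suc k) - max 0 0 ^ Suc (Suc k)) / h) \<longlongrightarrow> 0) (at 0)"
  proof (rule Lim_null_comparison)
    show "\<forall>\<^sub>F h::real in at 0. norm ((max 0 (0 + h) ^ Suc (Suc k) - max 0 0 ^ Suc (Suc k)) / h) \<le> \<bar>h\<bar> ^ Suc k"
    proof (rule always_eventually, rule allI)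
      fix h :: real
      show "norm ((max 0 (0 + h) ^ Suc (Suc k) - max 0 0 ^ Suc (Suc k)) / h) \<le> \<bar>h\<bar> ^ Suc k"
      proof (cases "h \<le> 0")
        case True
        have "0 \<le> \<bar>h\<bar> ^ Suc k" by (rule zero_le_power) simp
        then show ?thesis using True by (simp add: max_def)
      qed (simp add: max_def)
    qed
    have "((\<lambda>h::real. \<bar>h\<bar> ^ Suc k) \<longlongrightarrow> \<bar>0\<bar> ^ Suc k) (at 0)" by (intro tendsto_intros)
    then show "((\<lambda>h::real. \<bar>h\<bar> ^ Suc k) \<longlongrightarrow> 0) (at 0)" by simp
  qed
  then show ?thesis using equal by (simp add: DERIV_def)
qed

text \<open>
  A \<open>2 \<pi>\<close>-periodic function of class \<open>C\<^sup>2\<close> supported where \<open>|s| \<le> \<nu>\<close> modulo \<open>2 \<pi>\<close>. Writing the support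
  condition through the cosine makes periodicity automatic; the third power provides the two
  derivatives.
\<close>

definition bump :: "real \<Rightarrow> real \<Rightarrow> real" where
  "bump \<nu> s = max 0 (cos s - cos \<nu>) ^ 3"

definition bump' :: "real \<Rightarrow> real \<Rightarrow> real" where
  "bump' \<nu> s = - sin s * (3 * max 0 (cos s - cos \<nu>) ^ 2)"

definition bump'' :: "real \<Rightarrow> real \<Rightarrow> real" where
  "bump'' \<nu> s = - cos s * (3 * max 0 (cos s - cos \<nu>) ^ 2) + sin s * (sin s * (6 * max 0 (cos s - cos \<nu>)))"

lemma DERIV_bump: "(bump \<nu> has_real_derivative bump' \<nu> s) (at s)"
proof -
  have "((\<lambda>s. cos s - cos \<nu>) has_real_derivative - sin s) (at s)" by (auto intro!: derivative_eq_intros)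
  from DERIV_chain2[OF DERIV_positive_part_power[of 1] this]
  show ?thesis unfolding bump_def bump'_def by (simp add: numeral_3_eq_3 numeral_2_eq_2 mult.commute)
qed

lemma DERIV_bump': "(bump' \<nu> has_real_derivative bump'' \<nu> s) (at s)"
proof -
  have d: "((\<lambda>s. cos s - cos \<nu>) has_real_derivative - sin s) (at s)" by (auto intro!: derivative_eq_intros)
  have d2: "((\<lambda>s. max 0 (cos s - cos \<nu>) ^ 2) has_real_derivative (2 * max 0 (cos s - cos \<nu>)) * - sin s) (at s)"
    using DERIV_chain2[OF DERIV_positive_part_power[of 0] d] by (simp add: numeral_2_eq_2)
  have "((\<lambda>s. - sin s * (3 * max 0 (cos s - cos \<nu>) ^ 2)) has_real_derivative
     (- cos s * (3 * max 0 (cos s - cos \<nu>) ^ 2) + (3 * ((2 * max 0 (cos s - cos \<nu>)) * - sin s)) * - sin s)) (at s)"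
    by (intro DERIV_mult DERIV_minus DERIV_sin DERIV_cmult d2)
  then show ?thesis unfolding bump'_def bump''_def by (simp add: algebra_simps)
qed

lemma bump_support: "cos s \<le> cos \<nu> \<Longrightarrow> bump \<nu> s = 0 \<and> bump' \<nu> s = 0 \<and> bump'' \<nu> s = 0"
  by (simp add: bump_def bump'_def bump''_def)

lemma bump_periodic: "bump \<nu> (s + 2 * pi) = bump \<nu> s" "bump' \<nu> (s + 2 * pi) = bump' \<nu> s" "bump'' \<nu> (s + 2 * pi) = bump'' \<nu> s"
  by (simp_all add: bump_def bump'_def bump''_def)

lemma continuous_bump: "continuous_on A (bump \<nu>)" "continuous_on A (bump' \<nu>)" "continuous_on A (bump'' \<nu>)"
  unfolding bump_def bump'_def bump''_def by (intro continuous_intros)+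

lemma integral_square_pos:
  fixes f :: "real \<Rightarrow> real"
  assumes "continuous_on {a..b} f" "a < b" "s \<in> {a..b}" "f s \<noteq> 0"
  shows "0 < integral {a..b} (\<lambda>s. (f s)\<^sup>2)"
proof -
  have c: "continuous_on {a..b} (\<lambda>s. (f s)\<^sup>2)" using assms(1) by (intro continuous_intros)
  have "0 \<le> integral {a..b} (\<lambda>s. (f s)\<^sup>2)" by (rule integral_nonneg[OF integrable_continuous_interval[OF c]]) simp
  moreover have "integral {a..b} (\<lambda>s. (f s)\<^sup>2) \<noteq> 0"
    using integral_eq_0_iff[OF c assms(2)] assms(3,4) by auto
  ultimately show ?thesis by linarith
qed

text \<open>
  What a packet needs of a one-dimensional profile and its first two derivatives. The last condition
  but one says that the profile is even up to periodicity.
\<close>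

definition profile :: "real \<Rightarrow> (real \<Rightarrow> real) \<Rightarrow> (real \<Rightarrow> real) \<Rightarrow> (real \<Rightarrow> real) \<Rightarrow> bool" where
  "profile \<nu> f f' f'' \<longleftrightarrow>
     (\<forall>s. (f has_real_derivative f' s) (at s)) \<and> (\<forall>s. (f' has_real_derivative f'' s) (at s)) \<and>
     continuous_on UNIV f'' \<and>
     (\<forall>s. f (s + 2 * pi) = f s \<and> f' (s + 2 * pi) = f' s \<and> f'' (s + 2 * pi) = f'' s) \<and>
     (\<forall>s. cos s \<le> cos \<nu> \<longrightarrow> f s = 0 \<and> f' s = 0 \<and> f'' s = 0) \<and>
     (\<forall>s t. cos s = cos t \<longrightarrow> f s = f t) \<and>
     (\<exists>K. \<forall>s. \<bar>f s\<bar> \<le> K \<and> \<bar>f' s\<bar> \<le> K \<and> \<bar>f'' s\<bar> \<le> K)"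

lemma profileD:
  assumes "profile \<nu> f f' f''"
  shows "(f has_real_derivative f' s) (at s)" "(f' has_real_derivative f'' s) (at s)"
    "continuous_on UNIV f''" "f (s + 2 * pi) = f s" "f' (s + 2 * pi) = f' s" "f'' (s + 2 * pi) = f'' s"
    "cos s \<le> cos \<nu> \<Longrightarrow> f s = 0" "cos s \<le> cos \<nu> \<Longrightarrow> f' s = 0"
    "cos s = cos t \<Longrightarrow> f s = f t" "\<exists>K. \<forall>s. \<bar>f s\<bar> \<le> K \<and> \<bar>f' s\<bar> \<le> K \<and> \<bar>f'' s\<bar> \<le> K"
  using assms unfolding profile_def by blast+

lemma bump_bounds: "\<bar>bump \<nu> s\<bar> \<le> 24" "\<bar>bump' \<nu> s\<bar> \<le> 24" "\<bar>bump'' \<nu> s\<bar> \<le> 24"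
proof -
  let ?y = "max 0 (cos s - cos \<nu>)"
  have y: "0 \<le> ?y" "?y \<le> 2" using cos_le_one[of s] cos_ge_minus_one[of \<nu>] unfolding max_def
    by (simp_all only: split: if_splits) linarith+
  have y2: "?y ^ 2 \<le> 4" "?y ^ 3 \<le> 8" using power_mono[OF y(2,1), of 2] power_mono[OF y(2,1), of 3] by auto
  have sc: "\<bar>sin s\<bar> \<le> 1" "\<bar>cos s\<bar> \<le> 1" by auto
  show "\<bar>bump \<nu> s\<bar> \<le> 24" unfolding bump_def using y y2 by simp
  have 1: "\<bar>sin s\<bar> * (3 * ?y ^ 2) \<le> 1 * 12" "\<bar>cos s\<bar> * (3 * ?y ^ 2) \<le> 1 * 12"
    using sc y2 by (intro mult_mono; simp)+
  have 2: "\<bar>sin s\<bar> * (\<bar>sin s\<bar> * (6 * ?y)) \<le> 1 * (1 * 12)"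
    using sc y by (intro mult_mono) auto
  show "\<bar>bump' \<nu> s\<bar> \<le> 24" unfolding bump'_def using 1(1) by (simp add: abs_mult)
  have "\<bar>bump'' \<nu> s\<bar> \<le> \<bar>- cos s * (3 * ?y ^ 2)\<bar> + \<bar>sin s * (sin s * (6 * ?y))\<bar>"
    unfolding bump''_def by (rule abs_triangle_ineq)
  also have "\<dots> = \<bar>cos s\<bar> * (3 * ?y ^ 2) + \<bar>sin s\<bar> * (\<bar>sin s\<bar> * (6 * ?y))"
    using y by (simp only: abs_mult abs_minus_cancel) simp
  finally show "\<bar>bump'' \<nu> s\<bar> \<le> 24" using 1(2) 2 by linarith
qed

lemma profile_bump: "profile \<nu> (\<lambda>s. k * bump \<nu> s) (\<lambda>s. k * bump' \<nu> s) (\<lambda>s. k * bump'' \<nu> s)"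
  unfolding profile_def
proof (intro conjI allI impI)
  show "\<exists>K. \<forall>s. \<bar>k * bump \<nu> s\<bar> \<le> K \<and> \<bar>k * bump' \<nu> s\<bar> \<le> K \<and> \<bar>k * bump'' \<nu> s\<bar> \<le> K"
    by (intro exI[of _ "\<bar>k\<bar> * 24"] allI conjI) (simp_all only: abs_mult mult_left_mono bump_bounds abs_ge_zero)
  show "k * bump \<nu> s = k * bump \<nu> t" if "cos s = cos t" for s t using that by (simp add: bump_def)
qed (auto intro!: DERIV_cmult DERIV_bump DERIV_bump' continuous_intros continuous_bump simp: bump_periodic bump_support)

lemma profile_exists:
  assumes "0 < \<nu>" "\<nu> < pi"
  obtains g g' g'' where "profile \<nu> g g' g''" "integral {0..2*pi} (\<lambda>s. (g s)\<^sup>2) = 1"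
proof -
  define I where "I = integral {0..2*pi} (\<lambda>s. (bump \<nu> s)\<^sup>2)"
  have "cos \<nu> < 1" using cos_monotone_0_pi[of 0 \<nu>] assms by simp
  then have I: "I > 0"
    unfolding I_def by (intro integral_square_pos[of _ _ _ 0] continuous_bump) (auto simp: bump_def)
  have "integral {0..2*pi} (\<lambda>s. (1 / sqrt I * bump \<nu> s)\<^sup>2) = 1"
    using I by (simp add: power_mult_distrib power_divide I_def[symmetric])
  then show thesis using profile_bump that by blast
qed

lemma integral_abs_le_L2:
  fixes f :: "real \<Rightarrow> real"
  assumes "continuous_on {a..b} f" "a \<le> b" "k > 0"
  shows "integral {a..b} (\<lambda>s. \<bar>f s\<bar>) \<le> (k * (b - a) + integral {a..b} (\<lambda>s. (f s)\<^sup>2) / k) / 2"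
proof -
  have c: "continuous_on {a..b} (\<lambda>s. \<bar>f s\<bar>)" "continuous_on {a..b} (\<lambda>s. (f s)\<^sup>2)"
    by (intro continuous_intros assms(1))+
  have "integral {a..b} (\<lambda>s. \<bar>f s\<bar>) \<le> integral {a..b} (\<lambda>s. (k + (f s)\<^sup>2 / k) / 2)"
  proof (rule integral_le)
    fix s
    have "0 \<le> (\<bar>f s\<bar> - k)\<^sup>2 / (2 * k)" using assms(3) by simp
    also have "\<dots> = (k + (f s)\<^sup>2 / k) / 2 - \<bar>f s\<bar>" using assms(3) by (simp add: power2_eq_square field_simps)
    finally show "\<bar>f s\<bar> \<le> (k + (f s)\<^sup>2 / k) / 2" by simp
  qed (use assms c in \<open>auto intro!: integrable_continuous_interval continuous_intros\<close>)
  also have "\<dots> = (k * (b - a) + integral {a..b} (\<lambda>s. (f s)\<^sup>2) / k) / 2"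
    using assms c by (simp add: integral_add integrable_continuous_interval integrable_on_divide)
  finally show ?thesis .
qed

text \<open>
  Normalising the derivative in \<open>L\<^sup>2\<close> on a support of length \<open>2 \<nu>\<close> makes its \<open>L\<^sup>1\<close> norm of order
  \<open>sqrt \<nu>\<close> by Cauchy--Schwarz, and therefore also the supremum of the profile itself. This gap between
  \<open>F\<close> and \<open>F'\<close> is the source of all smallness in the construction.
\<close>

lemma thin_profile_exists:
  assumes "0 < \<nu>" "\<nu> < pi"
  obtains F F' F'' where "profile \<nu> F F' F''" "integral {0..2*pi} (\<lambda>s. (F' s)\<^sup>2) = 1"
    "integral {0..2*pi} (\<lambda>s. \<bar>F' s\<bar>) \<le> 2 * sqrt \<nu>" "\<And>s. \<bar>F s\<bar> \<le> 2 * sqrt \<nu>"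
proof -
  define I where "I = integral {0..2*pi} (\<lambda>s. (bump' \<nu> s)\<^sup>2)"
  have "cos \<nu> < cos (\<nu> / 2)" "sin (\<nu> / 2) > 0"
    using cos_monotone_0_pi[of "\<nu> / 2" \<nu>] sin_gt_zero[of "\<nu> / 2"] assms by auto
  then have I: "I > 0"
    unfolding I_def using assms by (intro integral_square_pos[of _ _ _ "\<nu> / 2"] continuous_bump) (auto simp: bump'_def)
  define F F' F'' where "F = (\<lambda>s. 1 / sqrt I * bump \<nu> s)" and "F' = (\<lambda>s. 1 / sqrt I * bump' \<nu> s)"
    and "F'' = (\<lambda>s. 1 / sqrt I * bump'' \<nu> s)"
  have P: "profile \<nu> F F' F''" unfolding F_def F'_def F''_def by (rule profile_bump)
  have I1: "integral {0..2*pi} (\<lambda>s. (F' s)\<^sup>2) = 1"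
    using I by (simp add: F'_def power_mult_distrib power_divide I_def[symmetric])
  have c: "continuous_on A F'" for A unfolding F'_def by (intro continuous_intros continuous_bump)
  have ca: "continuous_on A (\<lambda>s. \<bar>F' s\<bar>)" "continuous_on A (\<lambda>s. (F' s)\<^sup>2)" for A by (intro continuous_intros c)+
  have part: "integral {a..b} (\<lambda>s. (F' s)\<^sup>2) \<le> 1" if "0 \<le> a" "b \<le> 2 * pi" for a b
    unfolding I1[symmetric] by (rule integral_subset_le) (use that in \<open>auto intro!: integrable_continuous_interval ca\<close>)
  have bound: "integral {a..b} (\<lambda>s. \<bar>F' s\<bar>) \<le> sqrt \<nu>" if "0 \<le> a" "b \<le> 2 * pi" "b - a = \<nu>" for a b
  proof -
    have "integral {a..b} (\<lambda>s. \<bar>F' s\<bar>) \<le> (1 / sqrt \<nu> * (b - a) + integral {a..b} (\<lambda>s. (F' s)\<^sup>2) / (1 / sqrt \<nu>)) / 2"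
      using that assms by (intro integral_abs_le_L2 c) auto
    also have "\<dots> \<le> (1 / sqrt \<nu> * \<nu> + 1 / (1 / sqrt \<nu>)) / 2"
      unfolding that(3) using part[OF that(1,2)] assms by (intro divide_right_mono add_left_mono) auto
    also have "\<dots> = sqrt \<nu>" using assms by (simp add: real_div_sqrt)
    finally show ?thesis .
  qed
  have zero: "integral {\<nu>..2*pi - \<nu>} (\<lambda>s. \<bar>F' s\<bar>) = 0"
  proof -
    have "F' s = 0" if "s \<in> {\<nu>..2*pi - \<nu>}" for s
    proof -
      have "cos s \<le> cos \<nu>"
      proof (cases "s \<le> pi")
        case True
        then show ?thesis using that assms by (intro cos_monotone_0_pi_le) auto
      next
        case False
        then have "cos (2 * pi - s) \<le> cos \<nu>" using that assms by (intro cos_monotone_0_pi_le) auto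
        then show ?thesis by (simp add: cos_diff)
      qed
      then show ?thesis using P by (simp add: profile_def)
    qed
    then have "integral {\<nu>..2*pi - \<nu>} (\<lambda>s. \<bar>F' s\<bar>) = integral {\<nu>..2*pi - \<nu>} (\<lambda>s. 0)"
      by (intro integral_cong) simp
    then show ?thesis by simp
  qed
  have total: "integral {0..2*pi} (\<lambda>s. \<bar>F' s\<bar>) \<le> 2 * sqrt \<nu>"
  proof -
    have "integral {0..2*pi} (\<lambda>s. \<bar>F' s\<bar>) = integral {0..\<nu>} (\<lambda>s. \<bar>F' s\<bar>) + integral {\<nu>..2*pi} (\<lambda>s. \<bar>F' s\<bar>)"
      by (rule Henstock_Kurzweil_Integration.integral_combine[symmetric]) (use assms in \<open>auto intro!: integrable_continuous_interval ca\<close>)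
    also have "integral {\<nu>..2*pi} (\<lambda>s. \<bar>F' s\<bar>) = integral {\<nu>..2*pi - \<nu>} (\<lambda>s. \<bar>F' s\<bar>) + integral {2*pi - \<nu>..2*pi} (\<lambda>s. \<bar>F' s\<bar>)"
      by (rule Henstock_Kurzweil_Integration.integral_combine[symmetric]) (use assms in \<open>auto intro!: integrable_continuous_interval ca\<close>)
    finally show ?thesis using zero bound[of 0 \<nu>] bound[of "2*pi - \<nu>" "2*pi"] assms by simp
  qed
  have sup: "\<bar>F s\<bar> \<le> 2 * sqrt \<nu>" for s
  proof -
    \<comment> \<open>By evenness it suffices to integrate from a point of \<open>[0, \<pi>]\<close> up to \<open>\<pi>\<close>, where \<open>F\<close> vanishes.\<close>
    define r where "r = arccos (cos s)"
    have r: "0 \<le> r" "r \<le> pi" "cos r = cos s" by (auto simp: r_def arccos_lbound arccos_ubound)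
    have "(F' has_integral F pi - F r) {r..pi}"
    proof (rule fundamental_theorem_of_calculus[OF r(2)])
      have "(F has_real_derivative F' s) (at s)" for s using P unfolding profile_def by blast
      note this[unfolded has_real_derivative_iff_has_vector_derivative]
      then show "(F has_vector_derivative F' s) (at s within {r..pi})" for s
        by (rule has_vector_derivative_at_within)
    qed
    moreover have "F pi = 0"
    proof -
      have "cos pi \<le> cos \<nu>" by simp
      then show ?thesis using P unfolding profile_def by blast
    qed
    ultimately have "\<bar>F r\<bar> = norm (integral {r..pi} F')" by (simp add: integral_unique)
    also have "\<dots> \<le> integral {r..pi} (\<lambda>s. \<bar>F' s\<bar>)"
      by (rule integral_norm_bound_integral) (auto intro!: integrable_continuous_interval c ca)
    also have "\<dots> \<le> integral {0..2*pi} (\<lambda>s. \<bar>F' s\<bar>)"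
      using r by (intro integral_subset_le integrable_continuous_interval ca) auto
    finally have "\<bar>F r\<bar> \<le> 2 * sqrt \<nu>" using total by linarith
    moreover have "F r = F s" using P r(3) unfolding profile_def by blast
    ultimately show ?thesis by simp
  qed
  show thesis by (rule that[OF P I1 total sup])
qed

section \<open>Differentiable curves in the energy space\<close>

lemma continuous_on_abs_h2:
  fixes \<Phi>' :: "real \<Rightarrow> real^2 \<Rightarrow> field"
  assumes c': "continuous_on UNIV (\<lambda>(t, x). \<Phi>' t x)"
  shows "continuous_on UNIV (\<lambda>t. abs_h2 (\<Phi>' t))"
proof -
  have c'x: "continuous_on UNIV (\<Phi>' t)" for t
    using continuous_on_compose2[OF c', of UNIV "\<lambda>x. (t, x)"] by (simp add: continuous_on_Pair continuous_on_id)
  have c't: "continuous_on UNIV (\<lambda>t. \<Phi>' t x)" for x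
    using continuous_on_compose2[OF c', of UNIV "\<lambda>t. (t, x)"] by (simp add: continuous_on_Pair continuous_on_id)
  have bound: "\<exists>K. \<forall>s\<in>{t-1..t+1}. \<forall>x\<in>cbox 0 (vec (2*pi)). norm (\<Phi>' s x) \<le> K" for t
  proof -
    have "compact ((\<lambda>(s, x). \<Phi>' s x) ` ({t-1..t+1} \<times> cbox 0 (vec (2*pi))))"
      by (intro compact_continuous_image compact_Times continuous_on_subset[OF c']) auto
    from compact_imp_bounded[OF this] show ?thesis by (fastforce simp: bounded_iff)
  qed
  have m: "f \<in> borel_measurable torus_measure" if "continuous_on UNIV f" for f :: "real^2 \<Rightarrow> field"
    by (intro measurable_torus borel_measurable_continuous_onI that)
  show ?thesis
    unfolding continuous_on_def
  proof
    fix t :: real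
    have "((\<lambda>t. abs_h2 (\<Phi>' t)) \<longlongrightarrow> abs_h2 (\<Phi>' t)) (at t within {t-1<..<t+1})"
      unfolding tendsto_at_iff_sequentially o_def
    proof (intro allI impI)
      fix X assume X: "\<forall>i. X i \<in> {t-1<..<t+1} - {t}" and lim: "X \<longlonglongrightarrow> t"
      obtain K where K: "\<And>s x. s \<in> {t-1..t+1} \<Longrightarrow> x \<in> cbox 0 (vec (2*pi)) \<Longrightarrow> norm (\<Phi>' s x) \<le> K" using bound by blast
      show "(\<lambda>n. abs_h2 (\<Phi>' (X n))) \<longlonglongrightarrow> abs_h2 (\<Phi>' t)"
      proof (rule abs_h2_tendsto[where g = "\<lambda>x. K"])
        show "AE x in torus_measure. norm (\<Phi>' (X n) x) \<le> K" for n
          by (rule AE_I2, rule K) (use X[rule_format, of n] in \<open>auto simp: space_torus_measure\<close>)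
        show "AE x in torus_measure. (\<lambda>n. \<Phi>' (X n) x) \<longlonglongrightarrow> \<Phi>' t x"
          by (rule AE_I2, rule continuous_on_tendsto_compose[OF c't lim]) auto
      qed (simp_all add: m c'x)
    qed
    then show "((\<lambda>t. abs_h2 (\<Phi>' t)) \<longlongrightarrow> abs_h2 (\<Phi>' t)) (at t within UNIV)"
      using at_within_open[of t "{t-1<..<t+1}"] by simp
  qed
qed

text \<open>
  Pointwise time derivatives are derivatives in the energy norm by dominated convergence of the
  difference quotients, which the mean value inequality bounds on the compact cell.
\<close>

lemma abs_h2_has_vector_derivative:
  fixes \<Phi> \<Phi>' :: "real \<Rightarrow> real^2 \<Rightarrow> field"
  assumes c: "\<And>t. continuous_on UNIV (\<Phi> t)" and c': "continuous_on UNIV (\<lambda>(t, x). \<Phi>' t x)"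
    and d: "\<And>t x. ((\<lambda>t. \<Phi> t x) has_vector_derivative \<Phi>' t x) (at t)"
  shows "((\<lambda>t. abs_h2 (\<Phi> t)) has_vector_derivative abs_h2 (\<Phi>' t)) (at t)"
proof -
  have c'x: "continuous_on UNIV (\<Phi>' t)" for t
    using continuous_on_compose2[OF c', of UNIV "\<lambda>x. (t, x)"] by (simp add: continuous_on_Pair continuous_on_id)
  have c't: "continuous_on UNIV (\<lambda>t. \<Phi>' t x)" for x
    using continuous_on_compose2[OF c', of UNIV "\<lambda>t. (t, x)"] by (simp add: continuous_on_Pair continuous_on_id)
  have bound: "\<exists>K. \<forall>s\<in>{t-1..t+1}. \<forall>x\<in>cbox 0 (vec (2*pi)). norm (\<Phi>' s x) \<le> K" for t
  proof -
    have "compact ((\<lambda>(s, x). \<Phi>' s x) ` ({t-1..t+1} \<times> cbox 0 (vec (2*pi))))"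
      by (intro compact_continuous_image compact_Times continuous_on_subset[OF c']) auto
    from compact_imp_bounded[OF this] show ?thesis by (fastforce simp: bounded_iff)
  qed
  have m: "f \<in> borel_measurable torus_measure" if "continuous_on UNIV f" for f :: "real^2 \<Rightarrow> field"
    by (intro measurable_torus borel_measurable_continuous_onI that)
  have s: "square_integrable (\<Phi> t)" "square_integrable (\<Phi>' t)" for t
    by (intro square_integrable_continuous c c'x)+
  show "((\<lambda>t. abs_h2 (\<Phi> t)) has_vector_derivative abs_h2 (\<Phi>' t)) (at t)"
  proof -
    let ?U = "{t-1<..<t+1}"
    obtain K where K: "\<And>s x. s \<in> {t-1..t+1} \<Longrightarrow> x \<in> cbox 0 (vec (2*pi)) \<Longrightarrow> norm (\<Phi>' s x) \<le> K" using bound by blast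
    have "((\<lambda>y. (1 / norm (y - t)) *\<^sub>R (abs_h2 (\<Phi> y) - (abs_h2 (\<Phi> t) + (y - t) *\<^sub>R abs_h2 (\<Phi>' t)))) \<longlongrightarrow> 0) (at t within ?U)"
      unfolding tendsto_at_iff_sequentially o_def
    proof (intro allI impI)
      fix X assume X: "\<forall>i. X i \<in> ?U - {t}" and lim: "X \<longlonglongrightarrow> t"
      let ?q = "\<lambda>n x. (1 / norm (X n - t)) *\<^sub>R (\<Phi> (X n) x - (\<Phi> t x + (X n - t) *\<^sub>R \<Phi>' t x))"
      have eq: "(1 / norm (X n - t)) *\<^sub>R (abs_h2 (\<Phi> (X n)) - (abs_h2 (\<Phi> t) + (X n - t) *\<^sub>R abs_h2 (\<Phi>' t))) = abs_h2 (?q n)" for n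
        by (simp only: abs_h2_scale s abs_h2_add square_integrable_scaleR abs_h2_diff square_integrable_add square_integrable_diff)
      have "(\<lambda>n. abs_h2 (?q n)) \<longlonglongrightarrow> abs_h2 (\<lambda>x. 0)"
      proof (rule abs_h2_tendsto[where g = "\<lambda>x. 2 * K"])
        show "?q n \<in> borel_measurable torus_measure" for n
          by (intro m continuous_intros c c'x)
        show "AE x in torus_measure. norm (?q n x) \<le> 2 * K" for n
        proof (rule AE_I2)
          fix x assume "x \<in> space torus_measure"
          then have x: "x \<in> cbox 0 (vec (2*pi))" by (simp add: space_torus_measure)
          have XU: "X n \<in> ?U" "X n \<noteq> t" using X by auto
          have "norm (\<Phi> (X n) x - \<Phi> t x) \<le> K * norm (X n - t)"
          proof (rule differentiable_bound[of ?U])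
            show "((\<lambda>t. \<Phi> t x) has_derivative (\<lambda>h. h *\<^sub>R \<Phi>' s x)) (at s within ?U)" for s
              using d[of x s] by (auto simp: has_vector_derivative_def intro: has_derivative_at_withinI)
            show "onorm (\<lambda>h. h *\<^sub>R \<Phi>' s x) \<le> K" if "s \<in> ?U" for s
            proof (rule onorm_le)
              fix h :: real
              have "norm (\<Phi>' s x) \<le> K" using K[of s x] x that by simp
              then show "norm (h *\<^sub>R \<Phi>' s x) \<le> K * norm h"
                using mult_left_mono[of "norm (\<Phi>' s x)" K "\<bar>h\<bar>"] by (simp add: mult.commute[of K])
            qed
          qed (use XU in auto)
          moreover have "norm ((X n - t) *\<^sub>R \<Phi>' t x) \<le> K * norm (X n - t)"
            using mult_left_mono[OF K[OF _ x, of t], of "\<bar>X n - t\<bar>"] by (simp add: mult.commute[of K])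
          ultimately have "norm (\<Phi> (X n) x - \<Phi> t x - (X n - t) *\<^sub>R \<Phi>' t x) \<le> 2 * K * norm (X n - t)"
            using norm_triangle_ineq4[of "\<Phi> (X n) x - \<Phi> t x" "(X n - t) *\<^sub>R \<Phi>' t x"] by linarith
          then show "norm (?q n x) \<le> 2 * K"
            using XU by (simp add: diff_diff_eq pos_divide_le_eq)
        qed
        show "AE x in torus_measure. (\<lambda>n. ?q n x) \<longlonglongrightarrow> 0"
        proof (rule AE_I2)
          fix x
          have "((\<lambda>y. (1 / norm (y - t)) *\<^sub>R (\<Phi> y x - (\<Phi> t x + (y - t) *\<^sub>R \<Phi>' t x))) \<longlongrightarrow> 0) (at t)"
            using d[of x t] unfolding has_vector_derivative_def has_derivative_within by (rule conjunct2)
          moreover have "\<forall>i. X i \<in> UNIV - {t}" using X by auto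
          ultimately show "(\<lambda>n. ?q n x) \<longlonglongrightarrow> 0"
            using lim unfolding tendsto_at_iff_sequentially o_def by blast
        qed
      qed simp_all
      then show "(\<lambda>n. (1 / norm (X n - t)) *\<^sub>R (abs_h2 (\<Phi> (X n)) - (abs_h2 (\<Phi> t) + (X n - t) *\<^sub>R abs_h2 (\<Phi>' t)))) \<longlonglongrightarrow> 0"
        unfolding eq abs_h2_zero .
    qed
    moreover have "at t within ?U = at t" by (rule at_within_open) auto
    ultimately show ?thesis
      unfolding has_vector_derivative_def has_derivative_within by (simp add: bounded_linear_scaleR_left)
  qed
qed

lemma measure_torus_measure: "measure torus_measure (space torus_measure) = (2 * pi)\<^sup>2"
  using torus_integral_product[of "\<lambda>_. 1" "\<lambda>_. 1"] by (simp add: power2_eq_square)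

lemma norm_abs_h2_bounded:
  assumes c: "continuous_on UNIV f" and K: "\<And>x. norm (f x) \<le> K"
  shows "norm (abs_h2 f) \<le> 2 * pi * K"
proof -
  have K0: "0 \<le> K" using K[of 0] norm_ge_zero order_trans by blast
  have s: "square_integrable f" by (rule square_integrable_continuous[OF c])
  have "(norm (abs_h2 f))\<^sup>2 \<le> (\<integral>x. K\<^sup>2 \<partial>torus_measure)"
    unfolding norm_abs_h2[OF s]
    by (rule integral_mono) (use s K in \<open>auto simp: square_integrable_def intro: power_mono\<close>)
  also have "\<dots> = (2 * pi * K)\<^sup>2" by (simp add: measure_torus_measure power_mult_distrib)
  finally show ?thesis by (rule power2_le_imp_le) (use K0 in simp)
qed

lemma norm_field_of_le: "norm (field_of a b c x) \<le> \<bar>a x\<bar> + \<bar>b x\<bar> + \<bar>c x\<bar>"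
proof -
  have "norm (field_of a b c x) \<le> norm (vector [a x, b x] :: real^2) + norm (c x)"
    unfolding field_of_def by (rule norm_Pair_le)
  also have "norm (vector [a x, b x] :: real^2) \<le> \<bar>a x\<bar> + \<bar>b x\<bar>"
    using norm_le_l1_cart[of "vector [a x, b x] :: real^2"] by (simp add: sum_2)
  finally show ?thesis by simp
qed

section \<open>The light-speed packet\<close>

text \<open>
  The packet rides on the curve \<open>x_c\<close> with light speed. In the coordinates \<open>th\<close> along and \<open>et\<close> across
  the direction of motion, the leading part is the plane-wave like field \<open>E\<^sub>2 = b = m(t) F'(th) g(et)\<close>
  with \<open>m(t) = c (t + \<delta>)\<close>. The two correctors cancel what this ansatz leaves behind: \<open>- m F g'\<close> in
  \<open>E\<^sub>1\<close> balances the transverse derivative of \<open>b\<close>, and \<open>- c F g\<close> in \<open>E\<^sub>2\<close> balances the growth \<open>m' = c\<close>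
  in the equation for \<open>b\<close>. The constant field \<open>Es\<close> decays on top of it by itself.
\<close>

locale packet =
  fixes \<nu> \<mu> \<sigma> c \<delta> :: real and F F' F'' g g' g'' :: "real \<Rightarrow> real" and x0 Es :: "real^2"
  assumes F: "profile \<nu> F F' F''" and g: "profile \<mu> g g' g''"
begin

definition th :: "real \<Rightarrow> real^2 \<Rightarrow> real" where "th t x = x $ 1 - x0 $ 1 - t"
definition et :: "real^2 \<Rightarrow> real" where "et x = x $ 2 - x0 $ 2"

definition E1 :: "real \<Rightarrow> real^2 \<Rightarrow> real" where
  "E1 t x = exp (- \<sigma> * t) * Es $ 1 - c * (t + \<delta>) * (F (th t x) * g' (et x))"
definition E2 :: "real \<Rightarrow> real^2 \<Rightarrow> real" where
  "E2 t x = exp (- \<sigma> * t) * Es $ 2 + c * (t + \<delta>) * (F' (th t x) * g (et x)) - c * (F (th t x) * g (et x))"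
definition b :: "real \<Rightarrow> real^2 \<Rightarrow> real" where
  "b t x = c * (t + \<delta>) * (F' (th t x) * g (et x))"

definition dE1 :: "real \<Rightarrow> real^2 \<Rightarrow> real" where
  "dE1 t x = - \<sigma> * exp (- \<sigma> * t) * Es $ 1 - c * (F (th t x) * g' (et x)) + c * (t + \<delta>) * (F' (th t x) * g' (et x))"
definition dE2 :: "real \<Rightarrow> real^2 \<Rightarrow> real" where
  "dE2 t x = - \<sigma> * exp (- \<sigma> * t) * Es $ 2 + 2 * c * (F' (th t x) * g (et x)) - c * (t + \<delta>) * (F'' (th t x) * g (et x))"
definition db :: "real \<Rightarrow> real^2 \<Rightarrow> real" where
  "db t x = c * (F' (th t x) * g (et x)) - c * (t + \<delta>) * (F'' (th t x) * g (et x))"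

lemma th_derivative: "(th t has_derivative (\<lambda>h. h $ 1)) (at x)"
  unfolding th_def[abs_def] by (auto intro!: derivative_eq_intros bounded_linear_imp_has_derivative bounded_linear_vec_nth)

lemma et_derivative: "(et has_derivative (\<lambda>h. h $ 2)) (at x)"
  unfolding et_def[abs_def] by (auto intro!: derivative_eq_intros bounded_linear_imp_has_derivative bounded_linear_vec_nth)

lemma product_derivative:
  assumes "\<And>s. (f has_real_derivative f' s) (at s)" "\<And>s. (h has_real_derivative h' s) (at s)"
  shows "((\<lambda>x. f (th t x) * h (et x)) has_derivative
    (\<lambda>k. (f' (th t x) * h (et x)) * k $ 1 + (f (th t x) * h' (et x)) * k $ 2)) (at x)"
  by (rule has_derivative_eq_rhs[OF has_derivative_mult[OF DERIV_compose_FDERIV[OF assms(1) th_derivative]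
        DERIV_compose_FDERIV[OF assms(2) et_derivative]]]) (simp add: fun_eq_iff algebra_simps)

lemma continuous_profiles:
  "continuous_on UNIV F" "continuous_on UNIV F'" "continuous_on UNIV F''"
  "continuous_on UNIV g" "continuous_on UNIV g'" "continuous_on UNIV g''"
  by (intro continuous_at_imp_continuous_on ballI DERIV_isCont[OF profileD(1)[OF F]] DERIV_isCont[OF profileD(2)[OF F]]
      DERIV_isCont[OF profileD(1)[OF g]] DERIV_isCont[OF profileD(2)[OF g]] profileD(3)[OF F] profileD(3)[OF g])+

lemma continuous_on_product:
  fixes f h :: "real \<Rightarrow> real"
  assumes "continuous_on UNIV f" "continuous_on UNIV h"
  shows "continuous_on UNIV (\<lambda>p. f (th (fst p) (snd p)) * h (et (snd p)))"
  unfolding th_def et_def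
  by (intro continuous_on_mult continuous_on_compose2[OF assms(1)] continuous_on_compose2[OF assms(2)] continuous_intros) auto

lemma continuous_on_product_space:
  fixes f h :: "real \<Rightarrow> real"
  assumes "continuous_on UNIV f" "continuous_on UNIV h"
  shows "continuous_on UNIV (\<lambda>x. f (th t x) * h (et x))"
  unfolding th_def et_def
  by (intro continuous_on_mult continuous_on_compose2[OF assms(1)] continuous_on_compose2[OF assms(2)] continuous_intros) auto

lemma periodic_product:
  fixes f h :: "real \<Rightarrow> real"
  assumes "\<And>s. f (s + 2 * pi) = f s" "\<And>s. h (s + 2 * pi) = h s"
  shows "f (th t (x + axis i (2 * pi))) * h (et (x + axis i (2 * pi))) = f (th t x) * h (et x)"
proof -
  have "th t (x + axis 1 (2 * pi)) = th t x + 2 * pi" "et (x + axis 1 (2 * pi)) = et x"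
    "th t (x + axis 2 (2 * pi)) = th t x" "et (x + axis 2 (2 * pi)) = et x + 2 * pi"
    by (simp_all add: th_def et_def axis_def)
  then have "\<forall>i. f (th t (x + axis i (2 * pi))) * h (et (x + axis i (2 * pi))) = f (th t x) * h (et x)"
    unfolding forall_2 by (simp only: assms)
  then show ?thesis ..
qed

lemmas Fper = profileD(4-6)[OF F] and gper = profileD(4-6)[OF g]

lemma C1_b: "C1_periodic (b t)" "pd 1 (b t) = (\<lambda>x. c * (t + \<delta>) * (F'' (th t x) * g (et x)))"
  "pd 2 (b t) = (\<lambda>x. c * (t + \<delta>) * (F' (th t x) * g' (et x)))"
proof -
  have d: "(b t has_derivative (\<lambda>k. (c * (t + \<delta>) * (F'' (th t x) * g (et x))) * k $ 1 + (c * (t + \<delta>) * (F' (th t x) * g' (et x))) * k $ 2)) (at x)" for x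
    unfolding b_def[abs_def]
    by (rule has_derivative_eq_rhs[OF has_derivative_mult_right[OF product_derivative[OF profileD(2)[OF F] profileD(1)[OF g]]]])
      (simp add: fun_eq_iff algebra_simps)
  have p: "periodic (b t)" unfolding periodic_def b_def by (simp only: periodic_product Fper gper simp_thms)
  note * = C1_periodicI[OF d _ _ p]
  show "C1_periodic (b t)" "pd 1 (b t) = (\<lambda>x. c * (t + \<delta>) * (F'' (th t x) * g (et x)))"
    "pd 2 (b t) = (\<lambda>x. c * (t + \<delta>) * (F' (th t x) * g' (et x)))"
    by (intro * continuous_on_mult continuous_on_const continuous_on_product_space continuous_profiles)+
qed

lemma C1_E1: "C1_periodic (E1 t)" "pd 1 (E1 t) = (\<lambda>x. - (c * (t + \<delta>) * (F' (th t x) * g' (et x))))"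
  "pd 2 (E1 t) = (\<lambda>x. - (c * (t + \<delta>) * (F (th t x) * g'' (et x))))"
proof -
  have d: "(E1 t has_derivative (\<lambda>k. (- (c * (t + \<delta>) * (F' (th t x) * g' (et x)))) * k $ 1 + (- (c * (t + \<delta>) * (F (th t x) * g'' (et x)))) * k $ 2)) (at x)" for x
    unfolding E1_def[abs_def]
    by (rule has_derivative_eq_rhs[OF has_derivative_diff[OF has_derivative_const
        has_derivative_mult_right[OF product_derivative[OF profileD(1)[OF F] profileD(2)[OF g]]]]])
      (simp add: fun_eq_iff algebra_simps)
  have p: "periodic (E1 t)" unfolding periodic_def E1_def by (simp only: periodic_product Fper gper simp_thms)
  note * = C1_periodicI[OF d _ _ p]
  show "C1_periodic (E1 t)" "pd 1 (E1 t) = (\<lambda>x. - (c * (t + \<delta>) * (F' (th t x) * g' (et x))))"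
    "pd 2 (E1 t) = (\<lambda>x. - (c * (t + \<delta>) * (F (th t x) * g'' (et x))))"
    by (intro * continuous_on_minus continuous_on_mult continuous_on_const continuous_on_product_space continuous_profiles)+
qed

lemma C1_E2: "C1_periodic (E2 t)"
  "pd 1 (E2 t) = (\<lambda>x. c * (t + \<delta>) * (F'' (th t x) * g (et x)) - c * (F' (th t x) * g (et x)))"
  "pd 2 (E2 t) = (\<lambda>x. c * (t + \<delta>) * (F' (th t x) * g' (et x)) - c * (F (th t x) * g' (et x)))"
proof -
  have d: "(E2 t has_derivative (\<lambda>k. (c * (t + \<delta>) * (F'' (th t x) * g (et x)) - c * (F' (th t x) * g (et x))) * k $ 1
      + (c * (t + \<delta>) * (F' (th t x) * g' (et x)) - c * (F (th t x) * g' (et x))) * k $ 2)) (at x)" for x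
    unfolding E2_def[abs_def]
    by (rule has_derivative_eq_rhs[OF has_derivative_diff[OF has_derivative_add[OF has_derivative_const
        has_derivative_mult_right[OF product_derivative[OF profileD(2)[OF F] profileD(1)[OF g]]]]
        has_derivative_mult_right[OF product_derivative[OF profileD(1)[OF F] profileD(1)[OF g]]]]])
      (simp add: fun_eq_iff algebra_simps)
  have p: "periodic (E2 t)" unfolding periodic_def E2_def by (simp only: periodic_product Fper gper simp_thms)
  note * = C1_periodicI[OF d _ _ p]
  show "C1_periodic (E2 t)"
    "pd 1 (E2 t) = (\<lambda>x. c * (t + \<delta>) * (F'' (th t x) * g (et x)) - c * (F' (th t x) * g (et x)))"
    "pd 2 (E2 t) = (\<lambda>x. c * (t + \<delta>) * (F' (th t x) * g' (et x)) - c * (F (th t x) * g' (et x)))"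
    by (intro * continuous_on_diff continuous_on_mult continuous_on_const continuous_on_product_space continuous_profiles)+
qed

definition Phi :: "real \<Rightarrow> real^2 \<Rightarrow> field" where "Phi t = field_of (E1 t) (E2 t) (b t)"
definition dPhi :: "real \<Rightarrow> real^2 \<Rightarrow> field" where "dPhi t = field_of (dE1 t) (dE2 t) (db t)"
definition APhi :: "real \<Rightarrow> real^2 \<Rightarrow> field" where "APhi t = maxwell 1 \<sigma> (E1 t) (E2 t) (b t)"
text \<open>
  What the packet fails to solve. Every term carries the undifferentiated profile \<open>F\<close>.
\<close>

definition rho :: "real \<Rightarrow> real^2 \<Rightarrow> field" where
  "rho t = field_of (\<lambda>x. - (c + \<sigma> * (c * (t + \<delta>))) * (F (th t x) * g' (et x)))
     (\<lambda>x. - (\<sigma> * c) * (F (th t x) * g (et x))) (\<lambda>x. c * (t + \<delta>) * (F (th t x) * g'' (et x)))"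

lemma continuous_on_field_of_pair:
  assumes "continuous_on UNIV (\<lambda>p. a (fst p) (snd p))" "continuous_on UNIV (\<lambda>p. a' (fst p) (snd p))"
    "continuous_on UNIV (\<lambda>p. a'' (fst p) (snd p))"
  shows "continuous_on UNIV (\<lambda>(t, x). field_of (a t) (a' t) (a'' t) x)"
  unfolding field_of_def case_prod_unfold by (intro continuous_on_Pair continuous_on_vector2 assms)

lemma continuous_joint: "continuous_on UNIV (\<lambda>(t, x). Phi t x)" "continuous_on UNIV (\<lambda>(t, x). dPhi t x)"
  "continuous_on UNIV (\<lambda>(t, x). APhi t x)" "continuous_on UNIV (\<lambda>(t, x). rho t x)"
  unfolding Phi_def dPhi_def APhi_def maxwell_def C1_b C1_E1 C1_E2 rho_def E1_def E2_def b_def dE1_def dE2_def db_def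
  by (intro continuous_on_field_of_pair continuous_on_diff continuous_on_minus continuous_on_mult continuous_on_add continuous_on_exp
      continuous_on_fst continuous_on_snd continuous_on_id continuous_on_const continuous_on_product continuous_profiles)+

lemma continuous_slice:
  "continuous_on UNIV (\<lambda>(t, x). \<Psi> t x) \<Longrightarrow> continuous_on UNIV (\<Psi> t)" for \<Psi> :: "real \<Rightarrow> real^2 \<Rightarrow> field"
  using continuous_on_compose2[of UNIV "\<lambda>(t, x). \<Psi> t x" UNIV "\<lambda>x. (t, x)"] by (simp add: continuous_on_Pair continuous_on_id)

lemmas continuous_space = continuous_joint[THEN continuous_slice]

lemma Phi_derivative: "((\<lambda>t. Phi t x) has_vector_derivative dPhi t x) (at t)"
proof -
  have th: "((\<lambda>t. th t x) has_real_derivative - 1) (at t)"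
    unfolding th_def by (auto intro!: derivative_eq_intros)
  have pF: "((\<lambda>t. f (th t x) * k) has_real_derivative - f' (th t x) * k) (at t)"
    if "\<And>s. (f has_real_derivative f' s) (at s)" for f f' k
    using DERIV_cmult_right[OF DERIV_chain2[OF that th], of k] by simp
  note p0 = pF[OF profileD(1)[OF F]] and p1 = pF[OF profileD(2)[OF F]]
  have m: "((\<lambda>t. c * (t + \<delta>)) has_real_derivative c) (at t)" by (auto intro!: derivative_eq_intros)
  have e: "((\<lambda>t. exp (- \<sigma> * t) * k) has_real_derivative - \<sigma> * exp (- \<sigma> * t) * k) (at t)" for k
    by (auto intro!: derivative_eq_intros)
  have d1: "((\<lambda>t. E1 t x) has_real_derivative dE1 t x) (at t)"
    unfolding E1_def dE1_def
    by (rule DERIV_cong[OF DERIV_diff[OF e DERIV_mult[OF m p0]]]) (simp add: algebra_simps)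
  have d2: "((\<lambda>t. E2 t x) has_real_derivative dE2 t x) (at t)"
    unfolding E2_def dE2_def
    by (rule DERIV_cong[OF DERIV_diff[OF DERIV_add[OF e DERIV_mult[OF m p1]] DERIV_cmult[OF p0]]]) (simp add: algebra_simps)
  have d3: "((\<lambda>t. b t x) has_real_derivative db t x) (at t)"
    unfolding b_def db_def by (rule DERIV_cong[OF DERIV_mult[OF m p1]]) (simp add: algebra_simps)
  note d = d1[unfolded has_real_derivative_iff_has_vector_derivative] d2[unfolded has_real_derivative_iff_has_vector_derivative]
    d3[unfolded has_real_derivative_iff_has_vector_derivative]
  have "((\<lambda>t. (vector [E1 t x, E2 t x] :: real^2)) has_vector_derivative vector [dE1 t x, dE2 t x]) (at t)"
    using bounded_linear.has_vector_derivative[OF linear_vector2 has_vector_derivative_Pair[OF d(1,2)]] by simp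
  from has_vector_derivative_Pair[OF this d(3)] show ?thesis by (simp add: Phi_def dPhi_def field_of_def)
qed

definition ohm_mult :: "(real \<Rightarrow> real^2 \<Rightarrow> real^2) \<Rightarrow> real \<Rightarrow> real^2 \<Rightarrow> field \<Rightarrow> field" where
  "ohm_mult v t x p = (- (\<sigma> * snd p) *\<^sub>R rot (v t x), 0)"

text \<open>
  On the support of the packet the coefficient is \<open>A w\<close> with \<open>A = 1 + 2 / (\<sigma> (t + \<delta>))\<close>, so that the
  Ohmic coupling is \<open>\<sigma> A b\<close> in the direction of \<open>E\<^sub>2\<close>. The leading terms then balance if and only if
  \<open>2 m' = \<sigma> (A - 1) m\<close>, which is solved by \<open>m = c (t + \<delta>)\<close>.
\<close>

lemma residual_identity:
  assumes "\<sigma> > 0" "t + \<delta> > 0"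
    and v: "\<And>x. cos \<nu> < cos (th t x) \<Longrightarrow> cos \<mu> < cos (et x) \<Longrightarrow> v t x = (1 + 2 / (\<sigma> * (t + \<delta>))) *\<^sub>R w"
  shows "dPhi t x - APhi t x = ohm_mult v t x (Phi t x) + rho t x"
proof -
  have v': "(F' (th t x) * g (et x)) *\<^sub>R v t x = (F' (th t x) * g (et x)) *\<^sub>R ((1 + 2 / (\<sigma> * (t + \<delta>))) *\<^sub>R w)"
  proof (cases "cos \<nu> < cos (th t x) \<and> cos \<mu> < cos (et x)")
    case False
    then have "F' (th t x) * g (et x) = 0" using profileD(8)[OF F] profileD(7)[OF g] by (auto simp: not_less)
    then show ?thesis by (simp only: scaleR_zero_left)
  qed (simp add: v)
  have "(F' (th t x) * g (et x)) *\<^sub>R rot (v t x) = rot ((F' (th t x) * g (et x)) *\<^sub>R v t x)" by (simp add: rot_linear)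
  also have "\<dots> = ((F' (th t x) * g (et x)) * (1 + 2 / (\<sigma> * (t + \<delta>)))) *\<^sub>R rot w" unfolding v' by (simp add: rot_linear)
  finally have r: "(F' (th t x) * g (et x)) *\<^sub>R rot (v t x) = ((F' (th t x) * g (et x)) * (1 + 2 / (\<sigma> * (t + \<delta>)))) *\<^sub>R rot w" .
  have "- (\<sigma> * b t x) *\<^sub>R rot (v t x) = (- (\<sigma> * (c * (t + \<delta>)))) *\<^sub>R ((F' (th t x) * g (et x)) *\<^sub>R rot (v t x))"
    by (simp add: b_def)
  also have "\<dots> = (- (\<sigma> * (c * (t + \<delta>))) * ((F' (th t x) * g (et x)) * (1 + 2 / (\<sigma> * (t + \<delta>))))) *\<^sub>R rot w"
    unfolding r by simp
  also have "- (\<sigma> * (c * (t + \<delta>))) * ((F' (th t x) * g (et x)) * (1 + 2 / (\<sigma> * (t + \<delta>))))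
     = - (\<sigma> * (c * (t + \<delta>)) + 2 * c) * (F' (th t x) * g (et x))"
  proof -
    define \<tau> where "\<tau> = t + \<delta>"
    have "\<sigma> * (c * \<tau>) * (1 + 2 / (\<sigma> * \<tau>)) = \<sigma> * (c * \<tau>) + 2 * c"
      using assms(1,2) by (simp add: \<tau>_def[symmetric] distrib_left)
    then have "- (\<sigma> * (c * \<tau>)) * (G * (1 + 2 / (\<sigma> * \<tau>))) = - (\<sigma> * (c * \<tau>) + 2 * c) * G" for G
      by (metis (no_types, opaque_lifting) minus_mult_commute mult.commute mult.left_commute mult_minus_left)
    then show ?thesis unfolding \<tau>_def .
  qed
  finally have B: "- (\<sigma> * b t x) *\<^sub>R rot (v t x) = (- (\<sigma> * (c * (t + \<delta>)) + 2 * c) * (F' (th t x) * g (et x))) *\<^sub>R rot w" .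
  have om: "ohm_mult v t x (Phi t x) = ((- (\<sigma> * (c * (t + \<delta>)) + 2 * c) * (F' (th t x) * g (et x))) *\<^sub>R rot w, 0)"
    unfolding ohm_mult_def by (simp add: Phi_def field_of_def B[simplified])
  have rw: "rot w $ 1 = 0" "rot w $ 2 = - 1" by (simp_all add: rot_def w_def axis_def)
  show ?thesis
    unfolding om
  proof (rule prod_eqI)
    show "fst (dPhi t x - APhi t x) = fst (((- (\<sigma> * (c * (t + \<delta>)) + 2 * c) * (F' (th t x) * g (et x))) *\<^sub>R rot w, 0) + rho t x)"
      by (rule vec2_eqI)
        (simp_all add: rw dPhi_def APhi_def maxwell_def rho_def field_of_def C1_b C1_E1 C1_E2 dE1_def dE2_def E1_def E2_def algebra_simps)
    show "snd (dPhi t x - APhi t x) = snd (((- (\<sigma> * (c * (t + \<delta>)) + 2 * c) * (F' (th t x) * g (et x))) *\<^sub>R rot w, 0) + rho t x)"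
      by (simp add: dPhi_def APhi_def maxwell_def rho_def field_of_def C1_E1 C1_E2 db_def algebra_simps)
  qed
qed

lemma norm_rho_le:
  assumes "0 \<le> \<sigma>" "0 \<le> c" "0 \<le> \<delta>" "0 \<le> t" "t \<le> T"
    and K: "\<And>s. \<bar>F s\<bar> \<le> \<kappa>" and G: "\<And>s. \<bar>g s\<bar> \<le> B" "\<And>s. \<bar>g' s\<bar> \<le> B" "\<And>s. \<bar>g'' s\<bar> \<le> B"
  shows "norm (abs_h2 (rho t)) \<le> 2 * pi * (3 * (c * (1 + \<sigma>) * (1 + T + \<delta>) * (\<kappa> * B)))"
proof (rule norm_abs_h2_bounded[OF continuous_space(4)])
  fix x
  let ?Q = "c * (1 + \<sigma>) * (1 + T + \<delta>)"
  have p: "\<bar>F (th t x) * g (et x)\<bar> \<le> \<kappa> * B" "\<bar>F (th t x) * g' (et x)\<bar> \<le> \<kappa> * B" "\<bar>F (th t x) * g'' (et x)\<bar> \<le> \<kappa> * B"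
    unfolding abs_mult by (intro mult_mono K G order_trans[OF abs_ge_zero K] abs_ge_zero)+
  have t0: "0 \<le> \<sigma> * t" "0 \<le> \<sigma> * \<delta>" "0 \<le> \<sigma> * T" "\<sigma> * t \<le> \<sigma> * T" "0 \<le> \<sigma> * c" "0 \<le> T"
    using assms by (auto intro: mult_left_mono)
  have q: "1 + \<sigma> * (t + \<delta>) \<le> (1 + \<sigma>) * (1 + T + \<delta>)" "\<sigma> \<le> (1 + \<sigma>) * (1 + T + \<delta>)" "t + \<delta> \<le> (1 + \<sigma>) * (1 + T + \<delta>)"
  proof -
    have e: "(1 + \<sigma>) * (1 + T + \<delta>) = 1 + T + \<delta> + \<sigma> + \<sigma> * T + \<sigma> * \<delta>" "\<sigma> * (t + \<delta>) = \<sigma> * t + \<sigma> * \<delta>"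
      by (simp_all add: algebra_simps)
    show "1 + \<sigma> * (t + \<delta>) \<le> (1 + \<sigma>) * (1 + T + \<delta>)" "\<sigma> \<le> (1 + \<sigma>) * (1 + T + \<delta>)" "t + \<delta> \<le> (1 + \<sigma>) * (1 + T + \<delta>)"
      unfolding e using t0 assms(1,3,4,5) by linarith+
  qed
  have Q: "\<bar>- (c + \<sigma> * (c * (t + \<delta>)))\<bar> \<le> ?Q" "\<bar>- (\<sigma> * c)\<bar> \<le> ?Q" "\<bar>c * (t + \<delta>)\<bar> \<le> ?Q"
  proof -
    have e: "c + \<sigma> * (c * (t + \<delta>)) = c * (1 + \<sigma> * (t + \<delta>))" "\<sigma> * c = c * \<sigma>" "?Q = c * ((1 + \<sigma>) * (1 + T + \<delta>))"
      by (simp_all add: algebra_simps)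
    have n: "0 \<le> c * (1 + \<sigma> * (t + \<delta>))" "0 \<le> c * \<sigma>" "0 \<le> c * (t + \<delta>)" using assms by auto
    show "\<bar>- (c + \<sigma> * (c * (t + \<delta>)))\<bar> \<le> ?Q" "\<bar>- (\<sigma> * c)\<bar> \<le> ?Q" "\<bar>c * (t + \<delta>)\<bar> \<le> ?Q"
      unfolding abs_minus_cancel e abs_of_nonneg[OF n(1)] abs_of_nonneg[OF n(2)] abs_of_nonneg[OF n(3)]
      by (intro mult_left_mono q assms(2))+
  qed
  have mm: "\<bar>u * v\<bar> \<le> ?Q * (\<kappa> * B)" if "\<bar>u\<bar> \<le> ?Q" "\<bar>v\<bar> \<le> \<kappa> * B" for u v :: real
    unfolding abs_mult by (intro mult_mono that order_trans[OF abs_ge_zero that(1)] abs_ge_zero)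
  have "norm (rho t x) \<le> ?Q * (\<kappa> * B) + ?Q * (\<kappa> * B) + ?Q * (\<kappa> * B)"
    unfolding rho_def by (rule order_trans[OF norm_field_of_le]) (intro add_mono mm Q p)
  then show "norm (rho t x) \<le> 3 * (?Q * (\<kappa> * B))" by linarith
qed

end

section \<open>The exact solution near the packet\<close>

text \<open>
  A packet inside the core of the coefficient, and so thin that all error terms are at most \<open>\<epsilon>\<close>. The
  factor in the last assumption is the Gronwall constant of the Duhamel formula for the error, times
  \<open>1 + U\<close>, because the current multiplies the error by the coefficient, whose bound \<open>U\<close> grows with
  \<open>n\<close>.
\<close>

locale driven_packet = cutoff \<Theta> r0 C + packet \<nu> \<mu> \<sigma> c \<delta> F F' F'' g g' g'' x0 Es
  for \<Theta> r0 C \<nu> \<mu> \<sigma> c \<delta> F F' F'' g g' g'' x0 Es +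
  fixes n :: nat and T \<epsilon> :: real
  assumes sigma: "0 < \<sigma>" and T: "0 < T" and c: "c = 1 / (2 * T)" and delta: "\<delta> = exp (- real n)"
    and nu: "0 < \<nu>" "\<nu> < pi" and mu: "0 < \<mu>" "\<mu> < pi"
    and core: "\<nu> + \<mu> \<le> r0 * exp (- L_coef \<sigma> n 0)"
    and eps: "0 \<le> \<epsilon>" "\<epsilon> \<le> 1"
    and Fg: "\<And>s t. \<bar>F s * g t\<bar> \<le> \<epsilon>" "\<And>s t. \<bar>F s * g' t\<bar> \<le> \<epsilon>"
    and F'_L1: "integral {0..2*pi} (\<lambda>s. \<bar>F' s\<bar>) \<le> \<epsilon>"
    and F'_L2: "integral {0..2*pi} (\<lambda>s. (F' s)\<^sup>2) = 1" and g_L2: "integral {0..2*pi} (\<lambda>s. (g s)\<^sup>2) = 1"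
    and rho_small: "\<And>t. 0 \<le> t \<Longrightarrow> t \<le> T \<Longrightarrow>
      norm (abs_h2 (rho t)) * (T * exp (\<sigma> * (A_coef \<sigma> n 0 * (1 + C)) * T) * (1 + A_coef \<sigma> n 0 * (1 + C))) \<le> \<epsilon>"
begin

abbreviation v :: "real \<Rightarrow> real^2 \<Rightarrow> real^2" where "v \<equiv> u \<Theta> r0 \<sigma> x0 n"
abbreviation U :: real where "U \<equiv> A_coef \<sigma> n 0 * (1 + C)"

lemma delta_pos: "0 < \<delta>" and delta_le_1: "\<delta> \<le> 1"
  by (simp_all add: delta)

lemma c_pos: "0 < c" using T by (simp add: c)

lemma U_nonneg: "0 \<le> U"
  using A_coef_bounds(1)[OF sigma, of 0 n] C_nonneg by simp

lemma norm_v_le: "0 \<le> t \<Longrightarrow> norm (v t x) \<le> U"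
  by (rule norm_u_le[OF sigma])

lemma continuous_v_time: "continuous_on {0..} (\<lambda>t. v t x)"
  using continuous_on_compose2[OF continuous_on_u[OF sigma, of x0 n], of "{0..}" "\<lambda>t. (t, x)"]
  by (auto simp: continuous_on_Pair continuous_on_id)

lemma continuous_v_space: "0 \<le> t \<Longrightarrow> continuous_on UNIV (v t)"
  using continuous_on_compose2[OF continuous_on_u[OF sigma, of x0 n], of UNIV "\<lambda>x. (t, x)"]
  by (auto simp: continuous_on_Pair continuous_on_id)

lemma x_c_component: "(x - x_c x0 t) $ 1 = th t x" "(x - x_c x0 t) $ 2 = et x"
  by (simp_all add: x_c_def th_def et_def w_def axis_def)

lemma norm_torus_rep_less:
  assumes "cos \<nu> < cos (th t x)" "cos \<mu> < cos (et x)"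
  shows "norm (torus_rep (x - x_c x0 t)) < \<nu> + \<mu>"
proof -
  have "\<bar>torus_rep (x - x_c x0 t) $ 1\<bar> < \<nu>" "\<bar>torus_rep (x - x_c x0 t) $ 2\<bar> < \<mu>"
    using nu mu assms by (simp_all only: abs_torus_rep_less_iff x_c_component less_imp_le)
  then show ?thesis
    using norm_le_l1_cart[of "torus_rep (x - x_c x0 t)"] by (simp add: sum_2)
qed

lemma v_on_packet:
  assumes "0 \<le> t" "cos \<nu> < cos (th t x)" "cos \<mu> < cos (et x)"
  shows "v t x = (1 + 2 / (\<sigma> * (t + \<delta>))) *\<^sub>R w"
proof -
  have "norm (torus_rep (x - x_c x0 t)) < r0 * exp (- L_coef \<sigma> n 0)"
    using norm_torus_rep_less[OF assms(2,3)] core by linarith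
  from u_core[OF sigma assms(1) this] show ?thesis by (simp add: A_coef_def delta)
qed

lemma norm_snd_field: "\<bar>snd p\<bar> \<le> norm p" "norm (fst p) \<le> norm p" for p :: field
  using norm_snd_le[of "snd p" "fst p"] norm_fst_le[of "fst p" "snd p"] by simp_all

lemma multiplier_ohm:
  assumes t: "0 \<le> t"
  shows "multiplier (\<sigma> * U) (ohm_mult v t)"
  unfolding multiplier_def
proof (intro conjI allI)
  show "0 \<le> \<sigma> * U" using sigma U_nonneg by simp
  show "linear (ohm_mult v t x)" for x
    by (rule linearI) (simp_all add: ohm_mult_def algebra_simps)
  show "norm (ohm_mult v t x p) \<le> \<sigma> * U * norm p" for x p
  proof -
    have "norm (ohm_mult v t x p) = \<sigma> * (norm (v t x) * \<bar>snd p\<bar>)"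
      using sigma by (simp add: ohm_mult_def norm_Pair norm_rot abs_mult)
    also have "\<dots> \<le> \<sigma> * (U * norm p)"
      by (rule mult_left_mono[OF mult_mono[OF norm_v_le[OF t] norm_snd_field(1) U_nonneg abs_ge_zero] less_imp_le[OF sigma]])
    finally show ?thesis by (simp add: mult.assoc)
  qed
  show "(\<lambda>x. ohm_mult v t x p) \<in> borel_measurable borel" for p
    unfolding ohm_mult_def
    by (intro borel_measurable_continuous_onI continuous_on_Pair continuous_on_scaleR continuous_on_rot continuous_v_space[OF t] continuous_on_const)
qed

lemma continuous_ohm:
  assumes "continuous_on {0..} Y"
  shows "continuous_on {0..} (\<lambda>s. mult_op (ohm_mult v s) (Y s))"
proof (rule continuous_on_mult_op[where K = "\<sigma> * U"])
  show "continuous_on {0..} (\<lambda>s. ohm_mult v s x p)" for x p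
    unfolding ohm_mult_def
    by (intro continuous_on_Pair continuous_on_scaleR continuous_on_rot continuous_v_time continuous_on_const)
qed (auto intro: multiplier_ohm assms)

lemma state_ohm: "state (\<lambda>x. - (\<sigma> * magnetic X x) *\<^sub>R rot (v s x)) (\<lambda>x. 0) = mult_op (ohm_mult v s) X"
  by (simp add: state_def mult_op_def ohm_mult_def magnetic_def)

abbreviation Y :: "real \<Rightarrow> h2" where "Y t \<equiv> abs_h2 (Phi t)"

lemma square_integrable_Phi: "square_integrable (Phi t)"
  by (rule square_integrable_continuous[OF continuous_space(1)])

lemma approximate_duhamel:
  assumes t: "0 \<le> t"
  shows "((\<lambda>s. ohm_flow \<sigma> (t - s) (mult_op (ohm_mult v s) (Y s) + abs_h2 (rho s))) has_integral
     Y t - ohm_flow \<sigma> t (Y 0)) {0..t}"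
proof -
  have "((\<lambda>s. ohm_flow \<sigma> (t - s) (abs_h2 (dPhi s) - abs_h2 (APhi s))) has_integral Y t - ohm_flow \<sigma> t (Y 0)) {0..t}"
    unfolding Phi_def APhi_def
  proof (rule ohm_flow_duhamel[OF less_imp_le[OF sigma] t C1_E1(1) C1_E2(1) C1_b(1)])
    show "((\<lambda>s. abs_h2 (field_of (E1 s) (E2 s) (b s))) has_vector_derivative abs_h2 (dPhi s)) (at s)" for s
      unfolding Phi_def[symmetric]
      by (rule abs_h2_has_vector_derivative[OF continuous_space(1) continuous_joint(2) Phi_derivative])
    show "continuous_on UNIV (\<lambda>t. abs_h2 (dPhi t))" by (rule continuous_on_abs_h2[OF continuous_joint(2)])
    show "continuous_on UNIV (\<lambda>s. abs_h2 (maxwell 1 \<sigma> (E1 s) (E2 s) (b s)))"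
      unfolding APhi_def[symmetric] by (rule continuous_on_abs_h2[OF continuous_joint(3)])
  qed
  moreover have "abs_h2 (dPhi s) - abs_h2 (APhi s) = mult_op (ohm_mult v s) (Y s) + abs_h2 (rho s)" if "s \<in> {0..t}" for s
  proof -
    have s: "0 \<le> s" using that by simp
    have "abs_h2 (dPhi s) - abs_h2 (APhi s) = abs_h2 (\<lambda>x. dPhi s x - APhi s x)"
      by (intro abs_h2_diff square_integrable_continuous continuous_space)
    also have "(\<lambda>x. dPhi s x - APhi s x) = (\<lambda>x. ohm_mult v s x (Phi s x) + rho s x)"
      by (rule ext, rule residual_identity[OF sigma])
        (use s delta_pos v_on_packet[OF s] in auto)
    also have "abs_h2 \<dots> = mult_op (ohm_mult v s) (Y s) + abs_h2 (rho s)"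
      unfolding mult_op_abs[OF multiplier_ohm[OF s] square_integrable_Phi]
      by (rule abs_h2_add[symmetric, OF multiplier_square_integrable[OF multiplier_ohm[OF s] square_integrable_Phi]
            square_integrable_continuous[OF continuous_space(4)]])
    finally show ?thesis .
  qed
  ultimately show ?thesis using has_integral_eq by (smt (verit, best))
qed

text \<open>
  The correction \<open>D\<close> solves the linear equation with source \<open>- rho\<close> and zero initial value. Gronwall's
  bound \<open>T \<parallel>rho\<parallel> exp (\<sigma> U T)\<close> is below \<open>\<epsilon> / (1 + U)\<close> by assumption.
\<close>

lemma exact_solution:
  obtains D where "continuous_on {0..} D" "D 0 = 0"
    "\<And>t. 0 \<le> t \<Longrightarrow> t \<le> T \<Longrightarrow> norm (D t) * (1 + U) \<le> \<epsilon>"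
    "energy_solution \<sigma> T v (\<lambda>t. Y t + D t)"
proof -
  have S: "contraction_semigroup (ohm_flow \<sigma>)" by (rule ohm_flow_semigroup[OF less_imp_le[OF sigma]])
  have rc: "continuous_on A (\<lambda>s. - abs_h2 (rho s))" for A
    by (rule continuous_on_subset[OF continuous_on_minus[OF continuous_on_abs_h2[OF continuous_joint(4)]]]) simp
  define f where "f t = integral {0..t} (\<lambda>s. ohm_flow \<sigma> (t - s) (- abs_h2 (rho s)))" for t
  have fc: "continuous_on {0..} f" unfolding f_def by (rule duhamel_continuous[OF S rc])
  have lin: "linear (mult_op (ohm_mult v s))" if "0 \<le> s" for s by (rule linear_mult_op[OF multiplier_ohm[OF that]])
  have nrm: "norm (mult_op (ohm_mult v s) X) \<le> (\<sigma> * U) * norm X" if "0 \<le> s" for s X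
    by (rule norm_mult_op_le[OF multiplier_ohm[OF that]])
  have M: "0 \<le> \<sigma> * U" using sigma U_nonneg by simp
  obtain D :: "real \<Rightarrow> h2" where Dc: "continuous_on {0..} D"
    and D: "\<And>t. 0 \<le> t \<Longrightarrow> ((\<lambda>s. ohm_flow \<sigma> (t - s) (mult_op (ohm_mult v s) (D s))) has_integral D t - f t) {0..t}"
    and Db: "\<And>T B t. (\<And>t. 0 \<le> t \<Longrightarrow> t \<le> T \<Longrightarrow> norm (f t) \<le> B) \<Longrightarrow> 0 \<le> t \<Longrightarrow> t \<le> T \<Longrightarrow> norm (D t) \<le> B * exp (\<sigma> * U * t)"
  proof (rule mild_solution_exists[OF S lin nrm continuous_ohm M fc])
    fix X :: "real \<Rightarrow> h2"
    assume "continuous_on {0..} X"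
      "\<And>t. 0 \<le> t \<Longrightarrow> ((\<lambda>s. ohm_flow \<sigma> (t - s) (mult_op (ohm_mult v s) (X s))) has_integral X t - f t) {0..t}"
      "\<And>T B t. (\<And>t. 0 \<le> t \<Longrightarrow> t \<le> T \<Longrightarrow> norm (f t) \<le> B) \<Longrightarrow> 0 \<le> t \<Longrightarrow> t \<le> T \<Longrightarrow> norm (X t) \<le> B * exp (\<sigma> * U * t)"
    then show thesis by (rule that)
  qed
  have D0: "D 0 = 0" using integral_unique[OF D, of 0] by (simp add: f_def)
  have small: "norm (D t) * (1 + U) \<le> \<epsilon>" if t: "0 \<le> t" "t \<le> T" for t
  proof -
    let ?Q = "T * exp (\<sigma> * U * T) * (1 + U)"
    have Q: "?Q > 0" using T U_nonneg by (intro mult_pos_pos) auto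
    have r: "norm (abs_h2 (rho s)) \<le> \<epsilon> / ?Q" if "0 \<le> s" "s \<le> T" for s
      using rho_small[OF that] Q by (simp add: pos_le_divide_eq)
    have fb: "norm (f s) \<le> T * (\<epsilon> / ?Q)" if s: "0 \<le> s" "s \<le> T" for s
    proof -
      have "norm (f s) \<le> integral {0..s} (\<lambda>_. \<epsilon> / ?Q)"
        unfolding f_def by (rule duhamel_norm_le[OF S rc]) (use r s in auto)
      also have "\<dots> = s * (\<epsilon> / ?Q)" using s by simp
      also have "\<dots> \<le> T * (\<epsilon> / ?Q)" using s eps Q by (intro mult_right_mono divide_nonneg_pos) auto
      finally show ?thesis .
    qed
    have "norm (D t) \<le> T * (\<epsilon> / ?Q) * exp (\<sigma> * U * t)" by (rule Db[OF fb t])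
    also have "\<dots> \<le> T * (\<epsilon> / ?Q) * exp (\<sigma> * U * T)"
    proof (rule mult_left_mono)
      show "exp (\<sigma> * U * t) \<le> exp (\<sigma> * U * T)" using mult_left_mono[OF t(2) M] by simp
      show "0 \<le> T * (\<epsilon> / ?Q)" using T eps Q by (intro mult_nonneg_nonneg divide_nonneg_pos) auto
    qed
    finally have "norm (D t) * (1 + U) \<le> T * (\<epsilon> / ?Q) * exp (\<sigma> * U * T) * (1 + U)"
      using U_nonneg by (intro mult_right_mono) auto
    also have "\<dots> = ?Q * (\<epsilon> / ?Q)" by (simp only: mult_ac)
    also have "\<dots> = \<epsilon>" using Q by (metis less_irrefl nonzero_mult_div_cancel_left times_divide_eq_right)
    finally show ?thesis .
  qed
  have "energy_solution \<sigma> T v (\<lambda>t. Y t + D t)"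
    unfolding energy_solution_def
  proof (intro conjI exI[of _ "ohm_flow \<sigma>"] ballI)
    have Yc: "continuous_on {0..} Y"
      by (rule continuous_on_subset[OF continuous_on_abs_h2[OF continuous_joint(1)]]) simp
    show "continuous_on {0..T} (\<lambda>t. Y t + D t)"
      by (rule continuous_on_subset[OF continuous_on_add[OF Yc Dc]]) auto
    show "contraction_semigroup (ohm_flow \<sigma>)" by (rule S)
    show "generator (ohm_flow \<sigma>) = maxwell_ohm_op \<sigma>" by (rule generator_ohm_flow[OF less_imp_le[OF sigma]])
    fix t assume "t \<in> {0..T}"
    then have t: "0 \<le> t" by simp
    have I: "((\<lambda>s. ohm_flow \<sigma> (t - s) (- abs_h2 (rho s))) has_integral f t) {0..t}"
      unfolding f_def by (rule integrable_integral[OF duhamel_integrable[OF S rc]])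
    have "((\<lambda>s. ohm_flow \<sigma> (t - s) (mult_op (ohm_mult v s) (Y s) + abs_h2 (rho s))
        + ohm_flow \<sigma> (t - s) (mult_op (ohm_mult v s) (D s)) + ohm_flow \<sigma> (t - s) (- abs_h2 (rho s)))
        has_integral (Y t - ohm_flow \<sigma> t (Y 0)) + (D t - f t) + f t) {0..t}"
      by (intro has_integral_add approximate_duhamel[OF t] D[OF t] I)
    then have J: "((\<lambda>s. ohm_flow \<sigma> (t - s) (mult_op (ohm_mult v s) (Y s) + abs_h2 (rho s))
        + ohm_flow \<sigma> (t - s) (mult_op (ohm_mult v s) (D s)) + ohm_flow \<sigma> (t - s) (- abs_h2 (rho s)))
        has_integral (Y t + D t) - ohm_flow \<sigma> t (Y 0 + D 0)) {0..t}"
      by (simp add: D0 algebra_simps)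
    show "((\<lambda>s. ohm_flow \<sigma> (t - s) (state (\<lambda>x. - (\<sigma> * magnetic (Y s + D s) x) *\<^sub>R rot (v s x)) (\<lambda>x. 0)))
        has_integral (Y t + D t) - ohm_flow \<sigma> t (Y 0 + D 0)) {0..t}"
      unfolding state_ohm
    proof (rule has_integral_eq[OF _ J])
      fix s assume "s \<in> {0..t}"
      then have s: "0 \<le> s" "0 \<le> t - s" by auto
      note L = linear_add[OF bounded_linear.linear[OF contraction_semigroupD(1)[OF S s(2)]], symmetric]
      show "ohm_flow \<sigma> (t - s) (mult_op (ohm_mult v s) (Y s) + abs_h2 (rho s))
        + ohm_flow \<sigma> (t - s) (mult_op (ohm_mult v s) (D s)) + ohm_flow \<sigma> (t - s) (- abs_h2 (rho s))
        = ohm_flow \<sigma> (t - s) (mult_op (ohm_mult v s) (Y s + D s))"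
        unfolding L linear_add[OF lin[OF s(1)]] by simp
    qed
  qed
  with Dc D0 small show thesis by (rule that)
qed

lemma torus_integral_profile:
  fixes f h :: "real \<Rightarrow> real"
  assumes "continuous_on UNIV f" "continuous_on UNIV h" "\<And>s. f (s + 2 * pi) = f s" "\<And>s. h (s + 2 * pi) = h s"
  shows "(\<integral>x. f (th t x) * h (et x) \<partial>torus_measure) = integral {0..2*pi} f * integral {0..2*pi} h"
proof -
  have "(\<integral>x. f (x $ 1 - (x0 $ 1 + t)) * h (x $ 2 - x0 $ 2) \<partial>torus_measure)
     = integral {0..2*pi} (\<lambda>s. f (s - (x0 $ 1 + t))) * integral {0..2*pi} (\<lambda>s. h (s - x0 $ 2))"
    by (intro torus_integral_product continuous_on_compose2[OF assms(1)] continuous_on_compose2[OF assms(2)] continuous_intros) auto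
  then show ?thesis
    unfolding integral_periodic_shift[OF assms(1,3)] integral_periodic_shift[OF assms(2,4)]
    by (simp add: th_def et_def diff_diff_eq)
qed

text \<open>
  The common leading profile of \<open>E\<^sub>2\<close> and \<open>b\<close>. Its square has integral one and concentrates at \<open>x_c\<close>,
  while its \<open>L\<^sup>1\<close> norm is small.
\<close>

definition pulse :: "real \<Rightarrow> real^2 \<Rightarrow> real" where "pulse t x = F' (th t x) * g (et x)"

lemma continuous_pulse: "continuous_on UNIV (pulse t)"
  unfolding pulse_def by (rule continuous_on_product_space) (rule continuous_profiles)+

lemma integral_pulse_square: "(\<integral>x. pulse t x * pulse t x \<partial>torus_measure) = 1"
proof -
  have "(\<integral>x. (F' (th t x))\<^sup>2 * (g (et x))\<^sup>2 \<partial>torus_measure)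
     = integral {0..2*pi} (\<lambda>s. (F' s)\<^sup>2) * integral {0..2*pi} (\<lambda>s. (g s)\<^sup>2)"
    by (rule torus_integral_profile) (auto intro!: continuous_on_power continuous_profiles simp: Fper gper)
  then show ?thesis unfolding F'_L2 g_L2 by (simp add: pulse_def power2_eq_square mult_ac)
qed

lemma integral_abs_pulse_le: "(\<integral>x. \<bar>pulse t x\<bar> \<partial>torus_measure) \<le> 5 * \<epsilon>"
proof -
  have "(\<integral>x. \<bar>F' (th t x)\<bar> * \<bar>g (et x)\<bar> \<partial>torus_measure)
     = integral {0..2*pi} (\<lambda>s. \<bar>F' s\<bar>) * integral {0..2*pi} (\<lambda>s. \<bar>g s\<bar>)"
    by (rule torus_integral_profile) (auto intro!: continuous_on_rabs continuous_profiles simp: Fper gper)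
  also have "\<dots> \<le> \<epsilon> * 5"
  proof (rule mult_mono[OF F'_L1 _ eps(1)])
    have "integral {0..2*pi} (\<lambda>s. \<bar>g s\<bar>) \<le> (1 * (2 * pi - 0) + integral {0..2*pi} (\<lambda>s. (g s)\<^sup>2) / 1) / 2"
      by (rule integral_abs_le_L2) (auto intro: continuous_on_subset[OF continuous_profiles(4)])
    then show "integral {0..2*pi} (\<lambda>s. \<bar>g s\<bar>) \<le> 5" unfolding g_L2 using pi_less_4 by simp
    show "0 \<le> integral {0..2*pi} (\<lambda>s. \<bar>g s\<bar>)"
      by (intro integral_nonneg integrable_continuous_interval continuous_on_rabs continuous_on_subset[OF continuous_profiles(4)]) auto
  qed
  finally show ?thesis by (simp add: pulse_def abs_mult)
qed

abbreviation m :: "real \<Rightarrow> real" where "m t \<equiv> c * (t + \<delta>)"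

lemma m_bounds: "0 \<le> t \<Longrightarrow> 0 \<le> m t" "0 \<le> t \<Longrightarrow> t \<le> T \<Longrightarrow> m t \<le> c * (T + 1)"
  using c_pos delta_pos delta_le_1 by auto

definition background :: "real \<Rightarrow> h2" where
  "background t = state (\<lambda>x. exp (- \<sigma> * t) *\<^sub>R Es) (\<lambda>x. 0)"

definition small_part :: "real \<Rightarrow> real^2 \<Rightarrow> field" where
  "small_part t = field_of (\<lambda>x. - m t * (F (th t x) * g' (et x))) (\<lambda>x. - c * (F (th t x) * g (et x))) (\<lambda>x. 0)"

lemma continuous_small_part: "continuous_on UNIV (small_part t)"
  unfolding small_part_def
  by (intro continuous_field_of continuous_on_mult continuous_on_const continuous_on_product_space continuous_profiles)

lemma background_eq: "background t = abs_h2 (field_of (\<lambda>x. exp (- \<sigma> * t) * Es $ 1) (\<lambda>x. exp (- \<sigma> * t) * Es $ 2) (\<lambda>x. 0))"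
  unfolding background_def state_def
  by (intro arg_cong[of _ _ abs_h2]) (simp add: field_of_def fun_eq_iff vec_eq_iff forall_2)

lemma norm_background_le: "0 \<le> t \<Longrightarrow> norm (background t) \<le> 2 * pi * (\<bar>Es $ 1\<bar> + \<bar>Es $ 2\<bar>)"
  unfolding background_eq
proof (rule norm_abs_h2_bounded)
  fix x assume t: "0 \<le> t"
  have e: "exp (- \<sigma> * t) \<le> 1" using t sigma by simp
  have "norm (field_of (\<lambda>x. exp (- \<sigma> * t) * Es $ 1) (\<lambda>x. exp (- \<sigma> * t) * Es $ 2) (\<lambda>x. 0) x)
    \<le> \<bar>exp (- \<sigma> * t) * Es $ 1\<bar> + \<bar>exp (- \<sigma> * t) * Es $ 2\<bar> + \<bar>0\<bar>" by (rule norm_field_of_le)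
  also have "\<dots> \<le> \<bar>Es $ 1\<bar> + \<bar>Es $ 2\<bar>"
    using mult_right_mono[OF e, of "\<bar>Es $ 1\<bar>"] mult_right_mono[OF e, of "\<bar>Es $ 2\<bar>"] by (simp add: abs_mult)
  finally show "norm (field_of (\<lambda>x. exp (- \<sigma> * t) * Es $ 1) (\<lambda>x. exp (- \<sigma> * t) * Es $ 2) (\<lambda>x. 0) x) \<le> \<bar>Es $ 1\<bar> + \<bar>Es $ 2\<bar>" .
qed (intro continuous_field_of continuous_intros)

lemma norm_small_part_le:
  assumes "0 \<le> t" "t \<le> T"
  shows "norm (abs_h2 (small_part t)) \<le> 2 * pi * (c * (T + 2)) * \<epsilon>"
proof -
  have "norm (abs_h2 (small_part t)) \<le> 2 * pi * (c * (T + 2) * \<epsilon>)"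
  proof (rule norm_abs_h2_bounded[OF continuous_small_part])
    fix x
    have "norm (small_part t x) \<le> \<bar>- m t * (F (th t x) * g' (et x))\<bar> + \<bar>- c * (F (th t x) * g (et x))\<bar> + \<bar>0\<bar>"
      unfolding small_part_def by (rule norm_field_of_le)
    also have "\<dots> = m t * \<bar>F (th t x) * g' (et x)\<bar> + c * \<bar>F (th t x) * g (et x)\<bar>"
      unfolding abs_mult[of "- m t"] abs_mult[of "- c"] using m_bounds(1)[OF assms(1)] c_pos by simp
    also have "\<dots> \<le> c * (T + 1) * \<epsilon> + c * \<epsilon>"
      by (intro add_mono mult_mono[OF m_bounds(2)[OF assms] Fg(2)] mult_left_mono[OF Fg(1)] abs_ge_zero)
        (use c_pos T in auto)
    also have "\<dots> = c * (T + 2) * \<epsilon>" by (simp add: algebra_simps)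
    finally show "norm (small_part t x) \<le> c * (T + 2) * \<epsilon>" .
  qed
  then show ?thesis by (simp add: mult_ac)
qed

lemma continuous_pulse_field: "continuous_on UNIV (field_of (\<lambda>x. 0) (pulse t) (pulse t))"
  "continuous_on UNIV (field_of (\<lambda>x. 0) (pulse t) (\<lambda>x. 0))"
  by (intro continuous_field_of continuous_pulse continuous_on_const)+

lemma norm_pulse_field: "norm (abs_h2 (field_of (\<lambda>x. 0) (pulse t) (pulse t))) = sqrt 2"
  "norm (abs_h2 (field_of (\<lambda>x. 0) (pulse t) (\<lambda>x. 0))) = 1"
  by (simp_all add: norm_eq_sqrt_inner inner_field_of continuous_pulse integral_pulse_square)

text \<open>
  The pulse enters with amplitude \<open>m t\<close> and fixed norm \<open>sqrt 2\<close>: the packet is negligible at time zero,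
  where \<open>m = c \<delta>\<close>, and of order one at time \<open>T\<close>.
\<close>

lemma Y_decomposition:
  "Y t = background t + m t *\<^sub>R abs_h2 (field_of (\<lambda>x. 0) (pulse t) (pulse t)) + abs_h2 (small_part t)"
proof -
  have b: "continuous_on UNIV (field_of (\<lambda>x. exp (- \<sigma> * t) * Es $ 1) (\<lambda>x. exp (- \<sigma> * t) * Es $ 2) (\<lambda>x. 0))"
    by (intro continuous_field_of continuous_on_const)
  note s = square_integrable_continuous[OF b] square_integrable_continuous[OF continuous_pulse_field(1)]
    square_integrable_continuous[OF continuous_small_part]
  show ?thesis
    unfolding background_eq abs_h2_scale[OF s(2)] abs_h2_add[OF s(1) square_integrable_scaleR[OF s(2)]]
      abs_h2_add[OF square_integrable_add[OF s(1) square_integrable_scaleR[OF s(2)]] s(3)]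
    by (intro arg_cong[of _ _ abs_h2])
      (simp add: fun_eq_iff Phi_def E1_def E2_def b_def small_part_def pulse_def field_of_def vec_eq_iff forall_2 algebra_simps)
qed

lemma norm_Y_le:
  assumes "0 \<le> t" "t \<le> T"
  shows "norm (Y t) \<le> 2 * pi * (\<bar>Es $ 1\<bar> + \<bar>Es $ 2\<bar>) + c * (T + 1) * sqrt 2 + 2 * pi * (c * (T + 2))"
proof -
  have "norm (m t *\<^sub>R abs_h2 (field_of (\<lambda>x. 0) (pulse t) (pulse t))) \<le> c * (T + 1) * sqrt 2"
    using mult_right_mono[OF m_bounds(2)[OF assms], of "sqrt 2"] m_bounds(1)[OF assms(1)]
    by (simp only: norm_scaleR norm_pulse_field abs_of_nonneg) simp
  moreover have "2 * pi * (c * (T + 2)) * \<epsilon> \<le> 2 * pi * (c * (T + 2))"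
    using eps c_pos T by (intro mult_left_le) auto
  ultimately show ?thesis
    unfolding Y_decomposition
    by (intro norm_triangle_le add_mono order_trans[OF norm_small_part_le[OF assms]] norm_background_le assms)
qed

section \<open>Current and Lorentz force\<close>

definition current_mult :: "real \<Rightarrow> real^2 \<Rightarrow> field \<Rightarrow> field" where
  "current_mult t x p = (\<sigma> *\<^sub>R (fst p + snd p *\<^sub>R rot (v t x)), 0)"

lemma norm_current_mult_le:
  assumes t: "0 \<le> t"
  shows "norm (fst (current_mult t x p)) \<le> \<sigma> * (1 + U) * norm p"
proof -
  have "norm (fst p + snd p *\<^sub>R rot (v t x)) \<le> norm (fst p) + \<bar>snd p\<bar> * norm (v t x)"
    by (rule order_trans[OF norm_triangle_ineq]) (simp add: norm_rot)
  also have "\<dots> \<le> norm p + norm p * U"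
    by (intro add_mono mult_mono norm_snd_field norm_v_le t) auto
  finally have "\<sigma> * norm (fst p + snd p *\<^sub>R rot (v t x)) \<le> \<sigma> * (norm p + norm p * U)"
    using sigma by (intro mult_left_mono) auto
  moreover have "norm (fst (current_mult t x p)) = \<sigma> * norm (fst p + snd p *\<^sub>R rot (v t x))"
    using sigma by (simp only: current_mult_def fst_conv norm_scaleR abs_of_pos)
  moreover have "\<sigma> * (norm p + norm p * U) = \<sigma> * (1 + U) * norm p" by (simp add: algebra_simps)
  ultimately show ?thesis by simp
qed

lemma continuous_current_mult_space: "0 \<le> t \<Longrightarrow> continuous_on UNIV (\<lambda>x. fst (current_mult t x p))"
  unfolding current_mult_def fst_conv
  by (intro continuous_on_scaleR continuous_on_add continuous_on_const continuous_on_rot continuous_v_space)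

lemma continuous_current_mult_time: "continuous_on {0..} (\<lambda>t. fst (current_mult t x p))"
  unfolding current_mult_def fst_conv
  by (intro continuous_on_scaleR continuous_on_add continuous_on_const continuous_on_rot continuous_v_time)

lemma linear_current_mult: "linear (\<lambda>p. fst (current_mult t x p))"
  by (rule linearI) (simp_all add: current_mult_def algebra_simps)

lemma multiplier_current:
  assumes t: "0 \<le> t"
  shows "multiplier (\<sigma> * (1 + U)) (current_mult t)"
  unfolding multiplier_def
proof (intro conjI allI)
  show "0 \<le> \<sigma> * (1 + U)" using sigma U_nonneg by simp
  show "linear (current_mult t x)" for x
    by (rule linearI) (simp_all add: current_mult_def algebra_simps)
  show "norm (current_mult t x p) \<le> \<sigma> * (1 + U) * norm p" for x p
    using norm_current_mult_le[OF t, of x p] by (simp add: current_mult_def norm_Pair)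
  show "(\<lambda>x. current_mult t x p) \<in> borel_measurable borel" for p
  proof -
    have "continuous_on UNIV (\<lambda>x. (fst (current_mult t x p), 0 :: real))"
      by (intro continuous_on_Pair continuous_current_mult_space[OF t] continuous_on_const)
    then show ?thesis by (simp add: borel_measurable_continuous_onI current_mult_def)
  qed
qed

text \<open>
  In the current \<open>\<sigma> (E\<^sub>2 - A b)\<close> of the pulse the large factors cancel, since
  \<open>\<sigma> (1 - A) m = - 2 c\<close>. The current of the packet is therefore bounded uniformly in \<open>n\<close> although \<open>A\<close>
  is not.
\<close>

lemma current_on_Phi:
  assumes t: "0 \<le> t"
  shows "current_mult t x (Phi t x) = \<sigma> *\<^sub>R field_of (\<lambda>x. exp (- \<sigma> * t) * Es $ 1) (\<lambda>x. exp (- \<sigma> * t) * Es $ 2) (\<lambda>x. 0) x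
    + (- (2 * c)) *\<^sub>R field_of (\<lambda>x. 0) (pulse t) (\<lambda>x. 0) x + \<sigma> *\<^sub>R small_part t x"
proof -
  have P: "pulse t x *\<^sub>R v t x = pulse t x *\<^sub>R ((1 + 2 / (\<sigma> * (t + \<delta>))) *\<^sub>R w)"
  proof (cases "cos \<nu> < cos (th t x) \<and> cos \<mu> < cos (et x)")
    case False
    then have "pulse t x = 0" using profileD(8)[OF F] profileD(7)[OF g] by (auto simp: not_less pulse_def)
    then show ?thesis by (simp only: scaleR_zero_left)
  qed (simp add: v_on_packet[OF t])
  have "b t x *\<^sub>R rot (v t x) = m t *\<^sub>R rot (pulse t x *\<^sub>R v t x)"
    by (simp add: b_def pulse_def rot_linear)
  also have "\<dots> = (m t * (1 + 2 / (\<sigma> * (t + \<delta>))) * pulse t x) *\<^sub>R rot w"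
    unfolding P by (simp add: rot_linear mult_ac)
  finally have B: "b t x *\<^sub>R rot (v t x) = (m t * (1 + 2 / (\<sigma> * (t + \<delta>))) * pulse t x) *\<^sub>R rot w" .
  have k: "\<sigma> * (m t * (1 + 2 / (\<sigma> * (t + \<delta>))) * z) = \<sigma> * (m t * z) + 2 * c * z" for z
  proof -
    define \<tau> where "\<tau> = t + \<delta>"
    have "\<tau> > 0" using t delta_pos by (simp add: \<tau>_def)
    then have "\<sigma> * (c * \<tau> * (1 + 2 / (\<sigma> * \<tau>)) * z) = \<sigma> * (c * \<tau> * z) + 2 * c * z"
      using sigma by (simp add: distrib_left distrib_right)
    then show ?thesis by (simp add: \<tau>_def)
  qed
  have rw: "rot w $ 1 = 0" "rot w $ 2 = - 1" by (simp_all add: rot_def w_def axis_def)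
  have f: "fst (Phi t x) = vector [E1 t x, E2 t x]" "snd (Phi t x) = b t x" by (simp_all add: Phi_def field_of_def)
  show ?thesis
  proof (rule prod_eqI)
    show "fst (current_mult t x (Phi t x)) = fst (\<sigma> *\<^sub>R field_of (\<lambda>x. exp (- \<sigma> * t) * Es $ 1) (\<lambda>x. exp (- \<sigma> * t) * Es $ 2) (\<lambda>x. 0) x
      + (- (2 * c)) *\<^sub>R field_of (\<lambda>x. 0) (pulse t) (\<lambda>x. 0) x + \<sigma> *\<^sub>R small_part t x)"
    proof (rule vec2_eqI)
      show "fst (current_mult t x (Phi t x)) $ 1 = fst (\<sigma> *\<^sub>R field_of (\<lambda>x. exp (- \<sigma> * t) * Es $ 1) (\<lambda>x. exp (- \<sigma> * t) * Es $ 2) (\<lambda>x. 0) x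
        + (- (2 * c)) *\<^sub>R field_of (\<lambda>x. 0) (pulse t) (\<lambda>x. 0) x + \<sigma> *\<^sub>R small_part t x) $ 1"
        unfolding current_mult_def f B
        by (simp add: rw small_part_def field_of_def E1_def algebra_simps)
      have "fst (current_mult t x (Phi t x)) $ 2 = \<sigma> * E2 t x - \<sigma> * (m t * (1 + 2 / (\<sigma> * (t + \<delta>))) * pulse t x)"
        unfolding current_mult_def f B by (simp add: rw right_diff_distrib)
      also have "\<dots> = \<sigma> * E2 t x - (\<sigma> * (m t * pulse t x) + 2 * c * pulse t x)" unfolding k ..
      also have "\<dots> = fst (\<sigma> *\<^sub>R field_of (\<lambda>x. exp (- \<sigma> * t) * Es $ 1) (\<lambda>x. exp (- \<sigma> * t) * Es $ 2) (\<lambda>x. 0) x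
        + (- (2 * c)) *\<^sub>R field_of (\<lambda>x. 0) (pulse t) (\<lambda>x. 0) x + \<sigma> *\<^sub>R small_part t x) $ 2"
        by (simp add: small_part_def field_of_def E2_def pulse_def algebra_simps)
      finally show "fst (current_mult t x (Phi t x)) $ 2 = fst (\<sigma> *\<^sub>R field_of (\<lambda>x. exp (- \<sigma> * t) * Es $ 1) (\<lambda>x. exp (- \<sigma> * t) * Es $ 2) (\<lambda>x. 0) x
        + (- (2 * c)) *\<^sub>R field_of (\<lambda>x. 0) (pulse t) (\<lambda>x. 0) x + \<sigma> *\<^sub>R small_part t x) $ 2" .
    qed
  qed (simp add: current_mult_def field_of_def small_part_def)
qed

lemma current_eq: "current \<sigma> (v t) X x = fst (current_mult t x (rep_h2 X x))"
  by (simp add: current_def current_mult_def electric_def magnetic_def)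

lemma nn_integral_current:
  assumes t: "0 \<le> t"
  shows "(\<integral>\<^sup>+x. ennreal ((norm (current \<sigma> (v t) X x))\<^sup>2) \<partial>torus_measure) = ennreal ((norm (mult_op (current_mult t) X))\<^sup>2)"
  unfolding mult_op_def current_eq
    nn_integral_norm_abs_h2[OF multiplier_square_integrable[OF multiplier_current[OF t] square_integrable_rep], symmetric]
  by (simp add: current_mult_def norm_Pair)

lemma norm_current_le:
  assumes t: "0 \<le> t" "t \<le> T" and D: "norm D * (1 + U) \<le> \<epsilon>"
  shows "norm (mult_op (current_mult t) (Y t + D))
    \<le> \<sigma> * (2 * pi * (\<bar>Es $ 1\<bar> + \<bar>Es $ 2\<bar>)) + 2 * c + \<sigma> * (2 * pi * (c * (T + 2))) + \<sigma>"
proof -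
  have bc: "continuous_on UNIV (field_of (\<lambda>x. exp (- \<sigma> * t) * Es $ 1) (\<lambda>x. exp (- \<sigma> * t) * Es $ 2) (\<lambda>x. 0))"
    by (intro continuous_field_of continuous_on_const)
  note s = square_integrable_continuous[OF bc] square_integrable_continuous[OF continuous_pulse_field(2), of t]
    square_integrable_continuous[OF continuous_small_part, of t]
  have JY: "mult_op (current_mult t) (Y t) = \<sigma> *\<^sub>R background t
      + (- (2 * c)) *\<^sub>R abs_h2 (field_of (\<lambda>x. 0) (pulse t) (\<lambda>x. 0)) + \<sigma> *\<^sub>R abs_h2 (small_part t)"
    unfolding mult_op_abs[OF multiplier_current[OF t(1)] square_integrable_Phi] current_on_Phi[OF t(1)] background_eq
    by (simp only: abs_h2_scale s abs_h2_add square_integrable_scaleR square_integrable_add)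
  have "norm (\<sigma> *\<^sub>R background t) \<le> \<sigma> * (2 * pi * (\<bar>Es $ 1\<bar> + \<bar>Es $ 2\<bar>))"
    using mult_left_mono[OF norm_background_le[OF t(1)], of \<sigma>] sigma by simp
  moreover have "norm ((- (2 * c)) *\<^sub>R abs_h2 (field_of (\<lambda>x. 0) (pulse t) (\<lambda>x. 0))) \<le> 2 * c"
    using c_pos by (simp add: norm_pulse_field)
  moreover have "norm (\<sigma> *\<^sub>R abs_h2 (small_part t)) \<le> \<sigma> * (2 * pi * (c * (T + 2)))"
  proof -
    have "2 * pi * (c * (T + 2)) * \<epsilon> \<le> 2 * pi * (c * (T + 2))"
      using eps c_pos T by (intro mult_left_le) auto
    then have "norm (abs_h2 (small_part t)) \<le> 2 * pi * (c * (T + 2))"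
      using norm_small_part_le[OF t] by linarith
    then show ?thesis using sigma by (simp add: mult_left_mono)
  qed
  moreover have "norm (mult_op (current_mult t) D) \<le> \<sigma>"
  proof -
    have "norm (mult_op (current_mult t) D) \<le> \<sigma> * (1 + U) * norm D" by (rule norm_mult_op_le[OF multiplier_current[OF t(1)]])
    also have "\<dots> = \<sigma> * (norm D * (1 + U))" by (simp only: mult_ac)
    also have "\<dots> \<le> \<sigma> * 1" using D eps sigma by (intro mult_left_mono) auto
    finally show ?thesis by simp
  qed
  ultimately show ?thesis
    unfolding linear_add[OF linear_mult_op[OF multiplier_current[OF t(1)]]] JY
    by (intro norm_triangle_le add_mono)
qed

end

text \<open>
  The pointwise comparison of the Lorentz force with its limit density: with \<open>p\<close> the pulse, \<open>d\<close> the
  variation of the test field over the packet and \<open>h\<close> the bounded remainder, the first term is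
  controlled by the integral of \<open>p\<^sup>2\<close> and the second by that of \<open>|p|\<close>.
\<close>

lemma pulse_error_bound:
  fixes c M N p d \<omega> h H :: real
  assumes "0 < c" "0 \<le> M" "M \<le> N" and d: "p * p * \<bar>d\<bar> \<le> p * p * \<omega>" and h: "\<bar>h\<bar> \<le> H"
  shows "\<bar>- (2 * c * M) * (p * p * d) + M * (p * h)\<bar> \<le> 2 * c * N * \<omega> * (p * p) + N * H * \<bar>p\<bar>"
proof -
  have "\<bar>- (2 * c * M) * (p * p * d) + M * (p * h)\<bar> \<le> \<bar>- (2 * c * M) * (p * p * d)\<bar> + \<bar>M * (p * h)\<bar>"
    by (rule abs_triangle_ineq)
  also have "\<dots> = 2 * c * (M * (p * p * \<bar>d\<bar>)) + M * (\<bar>p\<bar> * \<bar>h\<bar>)"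
    using assms(1,2) by (simp add: abs_mult)
  also have "\<dots> \<le> 2 * c * (N * (p * p * \<omega>)) + N * (\<bar>p\<bar> * H)"
  proof (rule add_mono)
    have "M * (p * p * \<bar>d\<bar>) \<le> N * (p * p * \<omega>)"
      by (rule mult_mono[OF assms(3) d]) (use assms(2,3) in simp_all)
    then show "2 * c * (M * (p * p * \<bar>d\<bar>)) \<le> 2 * c * (N * (p * p * \<omega>))"
      using assms(1) by simp
    show "M * (\<bar>p\<bar> * \<bar>h\<bar>) \<le> N * (\<bar>p\<bar> * H)"
      by (rule mult_mono[OF assms(3) mult_left_mono[OF h]]) (use assms(2,3) in simp_all)
  qed
  finally show ?thesis by (simp only: mult_ac)
qed

context driven_packet
begin

text \<open>
  Pairing the Lorentz force with a test field is the quadratic form of this multiplication operator.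
  Hence an error in the state is estimated by operator norms alone.
\<close>

definition lorentz_mult :: "(real \<Rightarrow> real^2 \<Rightarrow> real^2) \<Rightarrow> real \<Rightarrow> real^2 \<Rightarrow> field \<Rightarrow> field" where
  "lorentz_mult \<Psi> t x p = (0, rot (fst (current_mult t x p)) \<bullet> \<Psi> t x)"

lemma multiplier_lorentz:
  assumes t: "0 \<le> t" and \<Psi>: "continuous_on UNIV (\<Psi> t)" "\<And>x. norm (\<Psi> t x) \<le> K"
  shows "multiplier (\<sigma> * (1 + U) * K) (lorentz_mult \<Psi> t)"
  unfolding multiplier_def
proof (intro conjI allI)
  have K: "0 \<le> K" using \<Psi>(2)[of 0] norm_ge_zero order_trans by blast
  have s: "0 \<le> \<sigma> * (1 + U)" using sigma U_nonneg by simp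
  show "0 \<le> \<sigma> * (1 + U) * K" using s K by simp
  show "linear (lorentz_mult \<Psi> t x)" for x
    by (rule linearI)
      (simp_all add: lorentz_mult_def linear_add[OF linear_current_mult] linear_cmul[OF linear_current_mult] rot_linear inner_add_left)
  show "norm (lorentz_mult \<Psi> t x p) \<le> \<sigma> * (1 + U) * K * norm p" for x p
  proof -
    have "norm (lorentz_mult \<Psi> t x p) = \<bar>rot (fst (current_mult t x p)) \<bullet> \<Psi> t x\<bar>"
      by (simp add: lorentz_mult_def norm_Pair)
    also have "\<dots> \<le> norm (fst (current_mult t x p)) * norm (\<Psi> t x)"
      using Cauchy_Schwarz_ineq2[of "rot (fst (current_mult t x p))" "\<Psi> t x"] by (simp add: norm_rot)
    also have "\<dots> \<le> \<sigma> * (1 + U) * norm p * K"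
      by (rule mult_mono[OF norm_current_mult_le[OF t] \<Psi>(2)]) (use s in auto)
    finally show ?thesis by (simp only: mult_ac)
  qed
  show "(\<lambda>x. lorentz_mult \<Psi> t x p) \<in> borel_measurable borel" for p
    unfolding lorentz_mult_def
    by (intro borel_measurable_continuous_onI continuous_on_Pair continuous_on_inner continuous_on_rot
        continuous_current_mult_space[OF t] \<Psi>(1) continuous_on_const)
qed

lemma lorentz_integral:
  assumes t: "0 \<le> t" and \<Psi>: "continuous_on UNIV (\<Psi> t)" "\<And>x. norm (\<Psi> t x) \<le> K"
  shows "(\<integral>x. lorentz_force \<sigma> (v t) X x \<bullet> \<Psi> t x \<partial>torus_measure) = X \<bullet> mult_op (lorentz_mult \<Psi> t) X"
proof -
  have "X \<bullet> mult_op (lorentz_mult \<Psi> t) X = abs_h2 (rep_h2 X) \<bullet> abs_h2 (\<lambda>x. lorentz_mult \<Psi> t x (rep_h2 X x))"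
    by (simp add: mult_op_def abs_rep_h2)
  also have "\<dots> = (\<integral>x. rep_h2 X x \<bullet> lorentz_mult \<Psi> t x (rep_h2 X x) \<partial>torus_measure)"
    by (rule abs_h2_inner[OF square_integrable_rep multiplier_square_integrable[OF multiplier_lorentz[of t \<Psi> K, OF assms] square_integrable_rep]])
  finally show ?thesis
    by (simp add: lorentz_force_def current_eq lorentz_mult_def magnetic_def inner_prod_def)
qed

lemma continuous_lorentz:
  assumes X: "continuous_on {0..T} X"
    and \<Psi>: "continuous_on ({0..T} \<times> UNIV) (\<lambda>(t, x). \<Psi> t x)" and K: "\<And>t x. t \<in> {0..T} \<Longrightarrow> norm (\<Psi> t x) \<le> K"
  shows "continuous_on {0..T} (\<lambda>t. X t \<bullet> mult_op (lorentz_mult \<Psi> t) (X t))"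
proof (intro continuous_on_inner X continuous_on_mult_op[where K = "\<sigma> * (1 + U) * K"])
  have \<Psi>x: "continuous_on UNIV (\<Psi> t)" if "t \<in> {0..T}" for t
  proof -
    have "continuous_on UNIV (\<lambda>x. (\<lambda>(t, x). \<Psi> t x) (t, x))"
      by (rule continuous_on_compose2[OF \<Psi>]) (use that in \<open>auto intro!: continuous_intros\<close>)
    then show ?thesis by simp
  qed
  show "multiplier (\<sigma> * (1 + U) * K) (lorentz_mult \<Psi> t)" if "t \<in> {0..T}" for t
    by (rule multiplier_lorentz) (use that \<Psi>x K in auto)
  have \<Psi>t: "continuous_on {0..T} (\<lambda>t. \<Psi> t x)" for x
  proof -
    have "continuous_on {0..T} (\<lambda>t. (\<lambda>(t, x). \<Psi> t x) (t, x))"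
      by (rule continuous_on_compose2[OF \<Psi>]) (auto intro!: continuous_intros)
    then show ?thesis by simp
  qed
  show "continuous_on {0..T} (\<lambda>t. lorentz_mult \<Psi> t x p)" for x p
    unfolding lorentz_mult_def
    by (intro continuous_on_Pair continuous_on_inner continuous_on_rot \<Psi>t continuous_on_const
        continuous_on_subset[OF continuous_current_mult_time]) auto
qed

text \<open>
  The first component of \<open>b R j\<close> is \<open>b j\<^sub>2\<close>, with leading part \<open>- 2 c m pulse\<^sup>2\<close>; since \<open>pulse\<^sup>2\<close> has mass
  one and lives within distance \<open>\<nu> + \<mu>\<close> of \<open>x_c\<close>, it tests like a point mass. The other products contain
  \<open>pulse\<close> only once and vanish with its \<open>L\<^sup>1\<close> norm.
\<close>

lemma lorentz_on_Phi:
  assumes t: "0 \<le> t" "t \<le> T" and \<Psi>: "continuous_on UNIV (\<Psi> t)" "\<And>x. norm (\<Psi> t x) \<le> K"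
    and \<omega>: "\<And>x. norm (torus_rep (x - x_c x0 t)) < \<nu> + \<mu> \<Longrightarrow> \<bar>\<Psi> t x $ 1 - \<Psi> t (x_c x0 t) $ 1\<bar> \<le> \<omega>" and "0 \<le> \<omega>"
  shows "\<bar>Y t \<bullet> mult_op (lorentz_mult \<Psi> t) (Y t) + 2 * c * m t * \<Psi> t (x_c x0 t) $ 1\<bar>
    \<le> 2 * c * (c * (T + 1)) * \<omega> + c * (T + 1) * (\<sigma> * K * (\<bar>Es $ 1\<bar> + \<bar>Es $ 2\<bar> + c + c * (T + 1))) * (5 * \<epsilon>)"
proof -
  let ?a = "\<Psi> t (x_c x0 t) $ 1"
  let ?H = "\<sigma> * K * (\<bar>Es $ 1\<bar> + \<bar>Es $ 2\<bar> + c + c * (T + 1))"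
  let ?e = "exp (- \<sigma> * t)"
  define q where "q x = Phi t x \<bullet> lorentz_mult \<Psi> t x (Phi t x)" for x
  define h where "h x = (\<sigma> * (?e * Es $ 2) - \<sigma> * (c * (F (th t x) * g (et x)))) * \<Psi> t x $ 1
     - (\<sigma> * (?e * Es $ 1) - \<sigma> * (m t * (F (th t x) * g' (et x)))) * \<Psi> t x $ 2" for x
  have K: "0 \<le> K" using \<Psi>(2)[of 0] norm_ge_zero order_trans by blast
  have \<Psi>c: "continuous_on UNIV (\<lambda>x. \<Psi> t x $ i)" for i by (intro continuous_intros \<Psi>(1))
  have YQ: "Y t \<bullet> mult_op (lorentz_mult \<Psi> t) (Y t) = (\<integral>x. q x \<partial>torus_measure)"
    unfolding q_def mult_op_abs[OF multiplier_lorentz[of t \<Psi> K, OF t(1) \<Psi>] square_integrable_Phi]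
    by (rule abs_h2_inner[OF square_integrable_Phi multiplier_square_integrable[OF multiplier_lorentz[of t \<Psi> K, OF t(1) \<Psi>] square_integrable_Phi]])
  have q: "q x = (- (2 * c * m t)) * (pulse t x * pulse t x) * \<Psi> t x $ 1 + m t * (pulse t x * h x)" for x
    unfolding q_def lorentz_mult_def current_on_Phi[OF t(1)]
    by (simp add: inner_vec2 rot_component small_part_def field_of_def Phi_def b_def pulse_def h_def algebra_simps)
  have hb: "\<bar>h x\<bar> \<le> ?H" for x
  proof -
    have e1: "0 \<le> ?e" "?e \<le> 1" using t sigma by auto
    have es: "\<bar>?e * Es $ i\<bar> \<le> \<bar>Es $ i\<bar>" for i
      using mult_right_mono[OF e1(2), of "\<bar>Es $ i\<bar>"] by (simp add: abs_mult)
    have f: "\<bar>c * (F (th t x) * g (et x))\<bar> \<le> c" "\<bar>m t * (F (th t x) * g' (et x))\<bar> \<le> c * (T + 1)"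
    proof -
      have "\<bar>F (th t x) * g (et x)\<bar> \<le> 1" "\<bar>F (th t x) * g' (et x)\<bar> \<le> 1"
        using Fg eps(2) order_trans by blast+
      then have 1: "\<bar>c\<bar> * \<bar>F (th t x) * g (et x)\<bar> \<le> c * 1" and 2: "\<bar>m t\<bar> * \<bar>F (th t x) * g' (et x)\<bar> \<le> c * (T + 1) * 1"
        unfolding abs_of_pos[OF c_pos] abs_of_nonneg[OF m_bounds(1)[OF t(1)]]
        by (intro mult_left_mono mult_mono m_bounds(2)[OF t]; use c_pos T in simp)+
      show "\<bar>c * (F (th t x) * g (et x))\<bar> \<le> c" "\<bar>m t * (F (th t x) * g' (et x))\<bar> \<le> c * (T + 1)"
        using 1 2 unfolding abs_mult[of c "F (th t x) * g (et x)"] abs_mult[of "m t" "F (th t x) * g' (et x)"]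
        by (simp_all only: mult_1_right)
    qed
    have p: "\<bar>\<Psi> t x $ i\<bar> \<le> K" for i using component_le_norm_cart[of "\<Psi> t x" i] \<Psi>(2)[of x] by linarith
    have z: "\<bar>(\<sigma> * y1 - \<sigma> * y2) * y\<bar> \<le> \<sigma> * (k1 + k2) * K" if "\<bar>y1\<bar> \<le> k1" "\<bar>y2\<bar> \<le> k2" "\<bar>y\<bar> \<le> K" for y1 y2 y k1 k2 :: real
    proof -
      have "\<bar>y1 - y2\<bar> \<le> k1 + k2" using that by linarith
      then have "\<sigma> * \<bar>y1 - y2\<bar> \<le> \<sigma> * (k1 + k2)" using sigma by (intro mult_left_mono) auto
      then have "\<sigma> * \<bar>y1 - y2\<bar> * \<bar>y\<bar> \<le> \<sigma> * (k1 + k2) * K"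
        using that sigma by (intro mult_mono) auto
      moreover have "\<bar>(\<sigma> * y1 - \<sigma> * y2) * y\<bar> = \<sigma> * \<bar>y1 - y2\<bar> * \<bar>y\<bar>"
        using sigma by (simp add: right_diff_distrib[symmetric] abs_mult)
      ultimately show ?thesis by simp
    qed
    have "\<bar>h x\<bar> \<le> \<sigma> * (\<bar>Es $ 2\<bar> + c) * K + \<sigma> * (\<bar>Es $ 1\<bar> + c * (T + 1)) * K"
      unfolding h_def by (rule order_trans[OF abs_triangle_ineq4]) (intro add_mono z es f p)
    then show ?thesis by (simp add: algebra_simps)
  qed
  have pt: "\<bar>q x + 2 * c * m t * ?a * (pulse t x * pulse t x)\<bar>
     \<le> 2 * c * (c * (T + 1)) * \<omega> * (pulse t x * pulse t x) + c * (T + 1) * ?H * \<bar>pulse t x\<bar>" for x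
  proof -
    have 1: "(pulse t x * pulse t x) * \<bar>\<Psi> t x $ 1 - ?a\<bar> \<le> (pulse t x * pulse t x) * \<omega>"
    proof (cases "cos \<nu> < cos (th t x) \<and> cos \<mu> < cos (et x)")
      case True
      then show ?thesis using \<omega>[OF norm_torus_rep_less] by (intro mult_left_mono) auto
    next
      case False
      then have "pulse t x = 0" using profileD(8)[OF F] profileD(7)[OF g] by (auto simp: not_less pulse_def)
      then show ?thesis by simp
    qed
    have "q x + 2 * c * m t * ?a * (pulse t x * pulse t x)
       = - (2 * c * m t) * (pulse t x * pulse t x * (\<Psi> t x $ 1 - ?a)) + m t * (pulse t x * h x)"
      unfolding q by (simp add: algebra_simps)
    then show ?thesis
      using pulse_error_bound[OF c_pos m_bounds(1)[OF t(1)] m_bounds(2)[OF t] 1 hb] by (simp only:)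
  qed
  have hc: "continuous_on UNIV h" unfolding h_def
    by (intro continuous_on_diff continuous_on_mult continuous_on_const continuous_on_product_space continuous_profiles \<Psi>c)
  have qc: "continuous_on UNIV q"
    unfolding q by (intro continuous_on_add continuous_on_mult continuous_on_const continuous_pulse \<Psi>c hc)
  have ip: "integrable torus_measure (\<lambda>x. pulse t x * pulse t x)" "integrable torus_measure (\<lambda>x. \<bar>pulse t x\<bar>)"
    "integrable torus_measure q"
    by (intro continuous_torus_integrable continuous_on_mult continuous_on_rabs continuous_pulse qc)+
  have eq: "(\<integral>x. q x \<partial>torus_measure) + 2 * c * m t * ?a = (\<integral>x. q x + 2 * c * m t * ?a * (pulse t x * pulse t x) \<partial>torus_measure)"
    using ip by (simp add: integral_pulse_square)
  have "\<bar>(\<integral>x. q x \<partial>torus_measure) + 2 * c * m t * ?a\<bar>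
    \<le> (\<integral>x. \<bar>q x + 2 * c * m t * ?a * (pulse t x * pulse t x)\<bar> \<partial>torus_measure)"
    unfolding eq by (rule integral_abs_bound)
  also have "\<dots> \<le> (\<integral>x. 2 * c * (c * (T + 1)) * \<omega> * (pulse t x * pulse t x) + c * (T + 1) * ?H * \<bar>pulse t x\<bar> \<partial>torus_measure)"
    by (rule integral_mono[OF _ _ pt]; intro integrable_abs Bochner_Integration.integrable_add integrable_mult_right ip)
  also have "\<dots> = 2 * c * (c * (T + 1)) * \<omega> + c * (T + 1) * ?H * (\<integral>x. \<bar>pulse t x\<bar> \<partial>torus_measure)"
    using ip by (simp add: integral_pulse_square)
  also have "\<dots> \<le> 2 * c * (c * (T + 1)) * \<omega> + c * (T + 1) * ?H * (5 * \<epsilon>)"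
    using c_pos T sigma K by (intro add_left_mono mult_left_mono integral_abs_pulse_le mult_nonneg_nonneg add_nonneg_nonneg) auto
  finally show ?thesis using YQ by simp
qed

text \<open>
  The weight of the limit measure is \<open>t / (2 T\<^sup>2) = 2 c (c t)\<close>, whereas the packet carries
  \<open>2 c m = 2 c (c t + c \<delta>)\<close>. Replacing the packet by the exact solution costs the factor \<open>1 + U\<close> once,
  against which \<open>norm D\<close> was chosen small.
\<close>

lemma lorentz_estimate:
  assumes t: "0 \<le> t" "t \<le> T" and \<Psi>: "continuous_on UNIV (\<Psi> t)" "\<And>x. norm (\<Psi> t x) \<le> K"
    and \<omega>: "\<And>x. norm (torus_rep (x - x_c x0 t)) < \<nu> + \<mu> \<Longrightarrow> \<bar>\<Psi> t x $ 1 - \<Psi> t (x_c x0 t) $ 1\<bar> \<le> \<omega>" "0 \<le> \<omega>"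
    and D: "norm D * (1 + U) \<le> \<epsilon>"
  shows "\<bar>(Y t + D) \<bullet> mult_op (lorentz_mult \<Psi> t) (Y t + D) + t / (2 * T\<^sup>2) * (w \<bullet> \<Psi> t (x_c x0 t))\<bar>
    \<le> 2 * c * (c * (T + 1)) * \<omega> + c * (T + 1) * (\<sigma> * K * (\<bar>Es $ 1\<bar> + \<bar>Es $ 2\<bar> + c + c * (T + 1))) * (5 * \<epsilon>)
      + \<sigma> * K * (2 * (2 * pi * (\<bar>Es $ 1\<bar> + \<bar>Es $ 2\<bar>) + c * (T + 1) * sqrt 2 + 2 * pi * (c * (T + 2))) + 1) * \<epsilon>
      + 2 * c * c * \<delta> * K"
proof -
  let ?N = "mult_op (lorentz_mult \<Psi> t)"
  let ?B = "2 * pi * (\<bar>Es $ 1\<bar> + \<bar>Es $ 2\<bar>) + c * (T + 1) * sqrt 2 + 2 * pi * (c * (T + 2))"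
  let ?a = "\<Psi> t (x_c x0 t) $ 1"
  have K: "0 \<le> K" using \<Psi>(2)[of 0] norm_ge_zero order_trans by blast
  note M = multiplier_lorentz[of t \<Psi> K, OF t(1) \<Psi>]
  have U1: "0 < 1 + U" using U_nonneg by linarith
  have D1: "norm D \<le> 1"
  proof -
    have "norm D * 1 \<le> norm D * (1 + U)" using U_nonneg by (intro mult_left_mono) auto
    then show ?thesis using D eps by linarith
  qed
  have tri: "\<bar>a + b + d\<bar> \<le> a' + b' + d'" if "\<bar>a\<bar> \<le> a'" "\<bar>b\<bar> \<le> b'" "\<bar>d\<bar> \<le> d'" for a b d a' b' d' :: real
    using that by linarith
  have ring: "a * (s * k * l * d) + d * (s * k * l * a) + d * (s * k * l * d) = s * l * (2 * a + d) * (d * k)"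
    for a s k l d :: real by (simp add: algebra_simps)
  have eq: "(Y t + D) \<bullet> ?N (Y t + D) - Y t \<bullet> ?N (Y t) = Y t \<bullet> ?N D + D \<bullet> ?N (Y t) + D \<bullet> ?N D"
    by (simp add: linear_add[OF linear_mult_op[OF M]] inner_add_left inner_add_right)
  have "\<bar>(Y t + D) \<bullet> ?N (Y t + D) - Y t \<bullet> ?N (Y t)\<bar> \<le> norm (Y t) * norm (?N D) + norm D * norm (?N (Y t)) + norm D * norm (?N D)"
    unfolding eq by (rule tri[OF Cauchy_Schwarz_ineq2 Cauchy_Schwarz_ineq2 Cauchy_Schwarz_ineq2])
  also have "\<dots> \<le> norm (Y t) * (\<sigma> * (1 + U) * K * norm D) + norm D * (\<sigma> * (1 + U) * K * norm (Y t)) + norm D * (\<sigma> * (1 + U) * K * norm D)"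
    by (intro add_mono mult_left_mono norm_mult_op_le[OF M] norm_ge_zero)
  also have "\<dots> = \<sigma> * K * (2 * norm (Y t) + norm D) * (norm D * (1 + U))" by (rule ring)
  also have "\<dots> \<le> \<sigma> * K * (2 * ?B + 1) * \<epsilon>"
  proof (rule mult_mono[OF mult_left_mono D])
    have B0: "0 \<le> ?B" by (rule order_trans[OF norm_ge_zero norm_Y_le[OF t]])
    have sK: "0 \<le> \<sigma> * K" using sigma K by simp
    have "0 \<le> 2 * z + 1" if "0 \<le> z" for z :: real using that by simp
    from mult_nonneg_nonneg[OF sK this[OF B0]] show "0 \<le> \<sigma> * K * (2 * ?B + 1)" .
    show "0 \<le> \<sigma> * K" by (rule sK)
    show "2 * norm (Y t) + norm D \<le> 2 * ?B + 1"
      by (rule add_mono[OF mult_left_mono[OF norm_Y_le[OF t]] D1]) simp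
    show "0 \<le> norm D * (1 + U)" using U1 by simp
  qed
  finally have 1: "\<bar>(Y t + D) \<bullet> ?N (Y t + D) - Y t \<bullet> ?N (Y t)\<bar> \<le> \<sigma> * K * (2 * ?B + 1) * \<epsilon>" .
  note 2 = lorentz_on_Phi[of t \<Psi> K \<omega>, OF t \<Psi> \<omega>]
  have wa: "w \<bullet> \<Psi> t (x_c x0 t) = ?a" by (simp add: w_def inner_axis')
  have "t / (2 * T\<^sup>2) = 2 * c * (c * t)" using T by (simp add: c power2_eq_square field_simps)
  then have 3: "t / (2 * T\<^sup>2) * (w \<bullet> \<Psi> t (x_c x0 t)) = 2 * c * m t * ?a - 2 * c * c * \<delta> * ?a"
    unfolding wa by (simp add: algebra_simps)
  have 4: "\<bar>2 * c * c * \<delta> * ?a\<bar> \<le> 2 * c * c * \<delta> * K"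
  proof -
    have "\<bar>?a\<bar> \<le> K" using component_le_norm_cart[of "\<Psi> t (x_c x0 t)" 1] \<Psi>(2)[of "x_c x0 t"] by linarith
    moreover have "0 \<le> 2 * c * c * \<delta>" using c_pos delta_pos by simp
    ultimately show ?thesis unfolding abs_mult[of "2 * c * c * \<delta>"] by (simp only: abs_of_nonneg mult_left_mono)
  qed
  have comb: "\<bar>x + (p - q)\<bar> \<le> e2 + e1 + e4" if "\<bar>x - y\<bar> \<le> e1" "\<bar>y + p\<bar> \<le> e2" "\<bar>q\<bar> \<le> e4"
    for x y p q e1 e2 e4 :: real using that by linarith
  show ?thesis unfolding 3 by (rule comb[OF 1 2 4])
qed

lemma initial_estimate: "norm (Y 0 - background 0) \<le> c * \<delta> * sqrt 2 + 2 * pi * (c * (T + 2)) * \<epsilon>"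
proof -
  have "norm (m 0 *\<^sub>R abs_h2 (field_of (\<lambda>x. 0) (pulse 0) (pulse 0))) = c * \<delta> * sqrt 2"
    using m_bounds(1)[of 0] by (simp only: norm_scaleR norm_pulse_field abs_of_nonneg order_refl add_0)
  moreover have "Y 0 - background 0 = m 0 *\<^sub>R abs_h2 (field_of (\<lambda>x. 0) (pulse 0) (pulse 0)) + abs_h2 (small_part 0)"
    by (simp add: Y_decomposition)
  ultimately show ?thesis
    using norm_triangle_ineq[of "m 0 *\<^sub>R abs_h2 (field_of (\<lambda>x. 0) (pulse 0) (pulse 0))" "abs_h2 (small_part 0)"]
      norm_small_part_le[of 0] T by auto
qed

text \<open>
  With \<open>c = 1 / (2 T)\<close> the amplitude at the final time is \<open>m T \<ge> 1 / 2\<close>.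
\<close>

lemma final_estimate:
  assumes D: "norm D * (1 + U) \<le> \<epsilon>"
  shows "1 / 2 - (2 * pi * (c * (T + 2)) + 1) * \<epsilon> \<le> norm (Y T + D - background T)"
proof -
  let ?P = "m T *\<^sub>R abs_h2 (field_of (\<lambda>x. 0) (pulse T) (pulse T))"
  have "norm D * 1 \<le> norm D * (1 + U)" using U_nonneg by (intro mult_left_mono) auto
  then have D1: "norm D \<le> \<epsilon>" using D by linarith
  have "m T \<ge> 1 / 2" using T delta_pos by (simp add: c field_simps)
  moreover have "sqrt 2 \<ge> 1" by simp
  ultimately have "1 / 2 * 1 \<le> m T * sqrt 2" by (intro mult_mono) auto
  also have "\<dots> = norm ?P"
    using m_bounds(1)[of T] T by (simp only: norm_scaleR norm_pulse_field abs_of_nonneg less_imp_le)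
  finally have P: "1 / 2 \<le> norm ?P" by simp
  have "?P = (Y T + D - background T) - (abs_h2 (small_part T) + D)" by (simp add: Y_decomposition)
  then have "norm ?P \<le> norm (Y T + D - background T) + norm (abs_h2 (small_part T) + D)"
    by (metis norm_triangle_ineq4)
  also have "norm (abs_h2 (small_part T) + D) \<le> 2 * pi * (c * (T + 2)) * \<epsilon> + \<epsilon>"
    by (intro norm_triangle_le add_mono norm_small_part_le D1) (use T in auto)
  finally show ?thesis using P by (simp add: algebra_simps)
qed

end

section \<open>Continuous test fields on the torus\<close>

lemma periodic_int_shift:
  assumes "periodic f"
  shows "f (x + axis i (2 * pi * of_int k)) = f x"
proof -
  have step: "f (y + axis i (2 * pi)) = f y" for y using assms by (simp add: periodic_def)
  have ax: "axis i (a + b) = axis i a + (axis i b :: real^2)" for a b by (simp add: vec_eq_iff axis_def)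
  have "\<forall>x. f (x + axis i (2 * pi * of_int k)) = f x"
  proof (induction k rule: int_induct[of _ 0])
    case base
    show ?case by (simp add: axis_def zero_vec_def[symmetric])
  next
    case (step1 k)
    have "x + axis i (2 * pi * of_int (k + 1)) = (x + axis i (2 * pi * of_int k)) + axis i (2 * pi)" for x :: "real^2"
      by (simp add: distrib_left ax)
    then show ?case using step1 step by (simp only: simp_thms)
  next
    case (step2 k)
    have "(x + axis i (2 * pi * of_int (k - 1))) + axis i (2 * pi) = x + axis i (2 * pi * of_int k)" for x :: "real^2"
      by (simp add: add.assoc ax[symmetric] algebra_simps)
    then show ?case using step2 step by metis
  qed
  then show ?thesis ..
qed

lemma periodic_torus_rep:
  assumes "periodic f"
  shows "f (torus_rep x) = f x"
proof -
  let ?k = "\<lambda>i. - \<lfloor>(x $ i + pi) / (2 * pi)\<rfloor>"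
  have "torus_rep x = (x + axis 1 (2 * pi * of_int (?k 1))) + axis 2 (2 * pi * of_int (?k 2))"
    by (rule vec2_eqI) (simp_all add: torus_rep_component axis_def)
  then show ?thesis by (simp only: periodic_int_shift[OF assms])
qed

lemma periodic_near:
  assumes "periodic f"
  shows "f (a + torus_rep (x - a)) = f x"
proof -
  have "periodic (\<lambda>y. f (a + y))" using assms by (simp add: periodic_def add.assoc[symmetric])
  from periodic_torus_rep[OF this, of "x - a"] show ?thesis by simp
qed

context
  fixes T :: real and \<Psi> :: "real \<Rightarrow> real^2 \<Rightarrow> real^2"
  assumes cont: "continuous_on ({0..T} \<times> UNIV) (\<lambda>(t, x). \<Psi> t x)" and per: "\<forall>t\<in>{0..T}. periodic (\<Psi> t)"
begin

lemma test_field_bounded: obtains K where "\<And>t x. t \<in> {0..T} \<Longrightarrow> norm (\<Psi> t x) \<le> K"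
proof -
  have "compact ((\<lambda>(t, x). \<Psi> t x) ` ({0..T} \<times> cball 0 (2 * pi)))"
    by (intro compact_continuous_image compact_Times continuous_on_subset[OF cont]) auto
  from compact_imp_bounded[OF this] obtain K where K: "\<And>t x. t \<in> {0..T} \<Longrightarrow> x \<in> cball 0 (2 * pi) \<Longrightarrow> norm (\<Psi> t x) \<le> K"
    by (fastforce simp: bounded_iff)
  have "norm (\<Psi> t x) \<le> K" if "t \<in> {0..T}" for t x
  proof -
    have "norm (torus_rep x) \<le> \<bar>torus_rep x $ 1\<bar> + \<bar>torus_rep x $ 2\<bar>"
      using norm_le_l1_cart[of "torus_rep x"] by (simp add: sum_2)
    also have "\<dots> \<le> 2 * pi" using abs_torus_rep_le[of x 1] abs_torus_rep_le[of x 2] by simp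
    finally have "norm (\<Psi> t (torus_rep x)) \<le> K" using K that by simp
    then show ?thesis using periodic_torus_rep[of "\<Psi> t" x] per that by simp
  qed
  then show thesis by (rule that)
qed

text \<open>
  Periodicity moves \<open>x\<close> to its representative closest to \<open>x_c\<close>, and all of these lie in one compact set.
\<close>

lemma test_field_uniform:
  assumes "\<omega> > 0"
  obtains d where "d > 0" "\<And>t x. t \<in> {0..T} \<Longrightarrow> norm (torus_rep (x - x_c x0 t)) < d \<Longrightarrow> \<bar>\<Psi> t x $ 1 - \<Psi> t (x_c x0 t) $ 1\<bar> \<le> \<omega>"
proof -
  \<comment> \<open>The curve \<open>x_c\<close> stays within distance \<open>T\<close> of \<open>x0\<close>; one more unit leaves room for the neighbourhood.\<close>
  let ?K = "{0..T} \<times> cball x0 (T + 1)"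
  have "uniformly_continuous_on ?K (\<lambda>(t, x). \<Psi> t x)"
    by (intro compact_uniformly_continuous compact_Times continuous_on_subset[OF cont]) auto
  then obtain d where d: "d > 0" "\<And>p q. p \<in> ?K \<Longrightarrow> q \<in> ?K \<Longrightarrow> dist q p < d \<Longrightarrow> dist ((\<lambda>(t, x). \<Psi> t x) q) ((\<lambda>(t, x). \<Psi> t x) p) < \<omega>"
    unfolding uniformly_continuous_on_def using assms by meson
  have "\<bar>\<Psi> t x $ 1 - \<Psi> t (x_c x0 t) $ 1\<bar> \<le> \<omega>"
    if t: "t \<in> {0..T}" and x: "norm (torus_rep (x - x_c x0 t)) < min d 1" for t x
  proof -
    let ?y = "x_c x0 t + torus_rep (x - x_c x0 t)"
    have n: "norm (x_c x0 t - x0) \<le> T" using t by (simp add: x_c_def norm_w)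
    have "dist x0 (x_c x0 t) \<le> T + 1" using n by (simp add: dist_norm norm_minus_commute)
    moreover have "dist x0 ?y \<le> T + 1"
    proof -
      have "norm (?y - x0) \<le> norm (x_c x0 t - x0) + norm (torus_rep (x - x_c x0 t))"
        using norm_triangle_ineq[of "x_c x0 t - x0" "torus_rep (x - x_c x0 t)"] by (simp add: algebra_simps)
      then show ?thesis using n x by (simp add: dist_norm norm_minus_commute)
    qed
    moreover have "dist (t, ?y) (t, x_c x0 t) < d" using x by (simp add: dist_norm norm_Pair)
    ultimately have "dist (\<Psi> t ?y) (\<Psi> t (x_c x0 t)) < \<omega>" using d(2)[of "(t, x_c x0 t)" "(t, ?y)"] t by simp
    moreover have "\<Psi> t ?y = \<Psi> t x" using per t periodic_near by blast
    ultimately have "norm (\<Psi> t x - \<Psi> t (x_c x0 t)) < \<omega>" by (simp add: dist_norm)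
    then show ?thesis using component_le_norm_cart[of "\<Psi> t x - \<Psi> t (x_c x0 t)" 1] by simp
  qed
  then show thesis using that[of "min d 1"] d(1) by simp
qed

end

context cutoff
begin

section \<open>Choice of the scales and passage to the limit\<close>

text \<open>
  The scales are chosen in the order core radius, \<open>\<mu>\<close>, \<open>\<nu>\<close>. The width \<open>\<mu>\<close> has to fit into the core and into a disk of radius \<open>\<epsilon>\<close>;
  once \<open>g\<close> is fixed, and with it the bound \<open>B\<close> of its derivatives, \<open>\<nu>\<close> is made so small that \<open>F\<close>, which
  is at most \<open>2 sqrt \<nu>\<close>, absorbs \<open>B\<close> and the Gronwall constant.
\<close>

lemma driven_packet_exists:
  assumes sigma: "0 < \<sigma>" and T: "0 < T" and eps: "0 < \<epsilon>" "\<epsilon> \<le> 1"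
  obtains \<nu> \<mu> F F' F'' g g' g'' where
    "driven_packet \<Theta> r0 C \<nu> \<mu> \<sigma> (1 / (2 * T)) (exp (- real n)) F F' F'' g g' g'' x0 n T \<epsilon>"
    "\<nu> + \<mu> \<le> \<epsilon>"
proof -
  define c \<delta> where "c = 1 / (2 * T)" and "\<delta> = exp (- real n)"
  have cd: "0 \<le> c" "0 \<le> \<delta>" using T by (simp_all add: c_def \<delta>_def)
  define R where "R = r0 * exp (- L_coef \<sigma> n 0)"
  have L: "1 \<le> L_coef \<sigma> n 0" using L_coef_ge_1[OF sigma] by simp
  have R: "0 < R" "R \<le> r0" using r0 L by (simp_all add: R_def mult_left_le)
  define \<mu> where "\<mu> = min (\<epsilon> / 2) (R / 2)"
  have mu: "0 < \<mu>" "\<mu> \<le> \<epsilon> / 2" "\<mu> \<le> R / 2" "\<mu> < pi" using eps R r0 by (auto simp: \<mu>_def)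
  obtain g g' g'' where g: "profile \<mu> g g' g''" "integral {0..2*pi} (\<lambda>s. (g s)\<^sup>2) = 1"
    using profile_exists[OF mu(1,4)] by blast
  obtain B where B: "\<And>s. \<bar>g s\<bar> \<le> B" "\<And>s. \<bar>g' s\<bar> \<le> B" "\<And>s. \<bar>g'' s\<bar> \<le> B" using profileD(10)[OF g(1)] by blast
  have B0: "0 \<le> B" using B(1)[of 0] by linarith
  define U where "U = A_coef \<sigma> n 0 * (1 + C)"
  have U: "0 \<le> U" using A_coef_bounds(1)[OF sigma, of 0 n] C_nonneg by (simp add: U_def)
  define Z where "Z = T * exp (\<sigma> * U * T) * (1 + U)"
  have Z: "0 \<le> Z" using T U by (simp add: Z_def)
  define Q where "Q = 2 * pi * (3 * (c * (1 + \<sigma>) * (1 + T + \<delta>) * B)) * Z"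
  have Q: "0 \<le> Q" using cd sigma T B0 Z by (simp add: Q_def)
  \<comment> \<open>The bound on \<open>F\<close> that makes \<open>F\<close>, its products with \<open>g\<close> and \<open>g'\<close>, and the weighted residual at most \<open>\<epsilon>\<close>.\<close>
  define \<kappa> where "\<kappa> = \<epsilon> / (1 + B + Q)"
  have k: "0 < \<kappa>" "\<kappa> \<le> \<epsilon>" "\<kappa> * B \<le> \<epsilon>" "\<kappa> * Q \<le> \<epsilon>"
  proof -
    have p: "0 < 1 + B + Q" using B0 Q by linarith
    then show "0 < \<kappa>" using eps by (simp add: \<kappa>_def)
    have "\<epsilon> * z \<le> \<epsilon> * (1 + B + Q)" if "z \<le> 1 + B + Q" for z using that eps by (intro mult_left_mono) auto
    then have "\<kappa> * z \<le> \<epsilon>" if "z \<le> 1 + B + Q" for z using that p by (simp add: \<kappa>_def pos_divide_le_eq)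
    from this[of 1] this[of B] this[of Q] show "\<kappa> \<le> \<epsilon>" "\<kappa> * B \<le> \<epsilon>" "\<kappa> * Q \<le> \<epsilon>" using B0 Q by simp_all
  qed
  define \<nu> where "\<nu> = min \<mu> ((\<kappa> / 2)\<^sup>2)"
  have nu: "0 < \<nu>" "\<nu> \<le> \<mu>" "\<nu> < pi" using mu k by (auto simp: \<nu>_def)
  have "sqrt \<nu> \<le> sqrt ((\<kappa> / 2)\<^sup>2)" by (rule real_sqrt_le_mono) (simp add: \<nu>_def)
  then have sq: "2 * sqrt \<nu> \<le> \<kappa>" using k(1) by simp
  obtain F F' F'' where F: "profile \<nu> F F' F''" "integral {0..2*pi} (\<lambda>s. (F' s)\<^sup>2) = 1"
    "integral {0..2*pi} (\<lambda>s. \<bar>F' s\<bar>) \<le> 2 * sqrt \<nu>" "\<And>s. \<bar>F s\<bar> \<le> 2 * sqrt \<nu>"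
    using thin_profile_exists[OF nu(1,3)] by blast
  have Fk: "\<bar>F s\<bar> \<le> \<kappa>" for s using F(4)[of s] sq by linarith
  \<comment> \<open>The residual does not involve the background field, which is therefore taken to be zero here.\<close>
  interpret P: packet \<nu> \<mu> \<sigma> c \<delta> F F' F'' g g' g'' x0 0 by unfold_locales (rule F g)+
  have "driven_packet \<Theta> r0 C \<nu> \<mu> \<sigma> c \<delta> F F' F'' g g' g'' x0 n T \<epsilon>"
  proof unfold_locales
    show "\<nu> + \<mu> \<le> r0 * exp (- L_coef \<sigma> n 0)" using nu(2) mu(3) by (simp add: R_def[symmetric])
    have "\<bar>F s\<bar> * z \<le> \<kappa> * B" if "z \<le> B" "0 \<le> z" for s z using that Fk k B0 by (intro mult_mono) auto
    then show "\<bar>F s * g t\<bar> \<le> \<epsilon>" "\<bar>F s * g' t\<bar> \<le> \<epsilon>" for s t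
      unfolding abs_mult using B k(3) order_trans by (meson abs_ge_zero)+
    show "integral {0..2*pi} (\<lambda>s. \<bar>F' s\<bar>) \<le> \<epsilon>" using F(3) sq k(2) by linarith
    fix t assume t: "0 \<le> t" "t \<le> T"
    have "norm (abs_h2 (P.rho t)) * Z \<le> 2 * pi * (3 * (c * (1 + \<sigma>) * (1 + T + \<delta>) * (\<kappa> * B))) * Z"
      by (rule mult_right_mono[OF P.norm_rho_le[OF less_imp_le[OF sigma] cd t Fk B] Z])
    also have "\<dots> = \<kappa> * Q" by (simp only: Q_def mult_ac)
    finally show "norm (abs_h2 (P.rho t)) * (T * exp (\<sigma> * (A_coef \<sigma> n 0 * (1 + C)) * T) * (1 + A_coef \<sigma> n 0 * (1 + C))) \<le> \<epsilon>"
      using k(4) unfolding Z_def U_def by linarith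
  qed (use sigma T nu mu eps F(2) g(2) in \<open>simp_all add: c_def \<delta>_def\<close>)
  moreover have "\<nu> + \<mu> \<le> \<epsilon>" using nu(2) mu(2) by simp
  ultimately show thesis unfolding c_def \<delta>_def by (rule that)
qed

text \<open>
  The bounds are spelled out in terms of \<open>\<epsilon>\<close>, \<open>\<delta>\<close> and the modulus of continuity \<open>\<omega>\<close> of the test field,
  free of the profiles and of \<open>n\<close>, so that the limit can be taken in them directly.
\<close>

lemma concentrating_solution:
  fixes \<sigma> T \<epsilon> :: real and n :: nat and x0 Es :: "real^2"
  assumes sigma: "0 < \<sigma>" and T: "0 < T" and eps: "0 < \<epsilon>" "\<epsilon> \<le> 1"
  defines "c \<equiv> 1 / (2 * T)" and "\<delta> \<equiv> exp (- real n)" and "e \<equiv> \<bar>Es $ 1\<bar> + \<bar>Es $ 2\<bar>"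
  obtains X where
    "energy_solution \<sigma> T (u \<Theta> r0 \<sigma> x0 n) X"
    "norm (X 0 - state (\<lambda>x. Es) (\<lambda>x. 0)) \<le> c * \<delta> * sqrt 2 + 2 * pi * (c * (T + 2)) * \<epsilon>"
    "1 / 2 - (2 * pi * (c * (T + 2)) + 1) * \<epsilon> \<le> norm (X T - state (\<lambda>x. exp (- \<sigma> * T) *\<^sub>R Es) (\<lambda>x. 0))"
    "\<And>t. t \<in> {0..T} \<Longrightarrow> (\<integral>\<^sup>+x. ennreal ((norm (current \<sigma> (u \<Theta> r0 \<sigma> x0 n t) (X t) x))\<^sup>2) \<partial>torus_measure)
      \<le> ennreal ((\<sigma> * (2 * pi * e) + 2 * c + \<sigma> * (2 * pi * (c * (T + 2))) + \<sigma>)\<^sup>2)"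
    "\<And>\<Psi> K. continuous_on ({0..T} \<times> UNIV) (\<lambda>(t, x). \<Psi> t x) \<Longrightarrow> (\<And>t x. t \<in> {0..T} \<Longrightarrow> norm (\<Psi> t x) \<le> K) \<Longrightarrow>
      continuous_on {0..T} (\<lambda>t. \<integral>x. lorentz_force \<sigma> (u \<Theta> r0 \<sigma> x0 n t) (X t) x \<bullet> \<Psi> t x \<partial>torus_measure)"
    "\<And>\<Psi> K \<omega> t. continuous_on ({0..T} \<times> UNIV) (\<lambda>(t, x). \<Psi> t x) \<Longrightarrow> (\<And>t x. t \<in> {0..T} \<Longrightarrow> norm (\<Psi> t x) \<le> K) \<Longrightarrow>
      (\<And>t x. t \<in> {0..T} \<Longrightarrow> norm (torus_rep (x - x_c x0 t)) < \<epsilon> \<Longrightarrow> \<bar>\<Psi> t x $ 1 - \<Psi> t (x_c x0 t) $ 1\<bar> \<le> \<omega>) \<Longrightarrow>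
      0 \<le> \<omega> \<Longrightarrow> t \<in> {0..T} \<Longrightarrow>
      \<bar>(\<integral>x. lorentz_force \<sigma> (u \<Theta> r0 \<sigma> x0 n t) (X t) x \<bullet> \<Psi> t x \<partial>torus_measure) + t / (2 * T\<^sup>2) * (w \<bullet> \<Psi> t (x_c x0 t))\<bar>
      \<le> 2 * c * (c * (T + 1)) * \<omega> + c * (T + 1) * (\<sigma> * K * (e + c + c * (T + 1))) * (5 * \<epsilon>)
        + \<sigma> * K * (2 * (2 * pi * e + c * (T + 1) * sqrt 2 + 2 * pi * (c * (T + 2))) + 1) * \<epsilon> + 2 * c * c * \<delta> * K"
proof -
  obtain \<nu> \<mu> F F' F'' g g' g'' where
    P: "driven_packet \<Theta> r0 C \<nu> \<mu> \<sigma> (1 / (2 * T)) (exp (- real n)) F F' F'' g g' g'' x0 n T \<epsilon>" and nm: "\<nu> + \<mu> \<le> \<epsilon>"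
    by (rule driven_packet_exists[OF sigma T eps])
  interpret P: driven_packet \<Theta> r0 C \<nu> \<mu> \<sigma> c \<delta> F F' F'' g g' g'' x0 Es n T \<epsilon>
    unfolding c_def \<delta>_def by (rule P)
  obtain D :: "real \<Rightarrow> h2" where D: "continuous_on {0..} D" "D 0 = 0"
    "\<And>t. 0 \<le> t \<Longrightarrow> t \<le> T \<Longrightarrow> norm (D t) * (1 + A_coef \<sigma> n 0 * (1 + C)) \<le> \<epsilon>"
    "energy_solution \<sigma> T (u \<Theta> r0 \<sigma> x0 n) (\<lambda>t. abs_h2 (P.Phi t) + D t)"
  proof (rule P.exact_solution)
    fix D :: "real \<Rightarrow> h2"
    assume "continuous_on {0..} D" "D 0 = 0"
      "\<And>t. 0 \<le> t \<Longrightarrow> t \<le> T \<Longrightarrow> norm (D t) * (1 + A_coef \<sigma> n 0 * (1 + C)) \<le> \<epsilon>"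
      "energy_solution \<sigma> T (u \<Theta> r0 \<sigma> x0 n) (\<lambda>t. abs_h2 (P.Phi t) + D t)"
    then show thesis by (rule that)
  qed
  define X where "X t = abs_h2 (P.Phi t) + D t" for t
  have Xc: "continuous_on {0..T} X"
    using D(4) unfolding energy_solution_def X_def by blast
  have slice: "continuous_on UNIV (\<Psi> t)" if "continuous_on ({0..T} \<times> UNIV) (\<lambda>(t, x). \<Psi> t x)" "t \<in> {0..T}"
    for \<Psi> :: "real \<Rightarrow> real^2 \<Rightarrow> real^2" and t
  proof -
    have "continuous_on UNIV (\<lambda>x. (\<lambda>(t, x). \<Psi> t x) (t, x))"
      by (rule continuous_on_compose2[OF that(1)]) (use that in \<open>auto intro!: continuous_intros\<close>)
    then show ?thesis by simp
  qed
  have lor: "(\<integral>x. lorentz_force \<sigma> (u \<Theta> r0 \<sigma> x0 n t) (X t) x \<bullet> \<Psi> t x \<partial>torus_measure) = X t \<bullet> mult_op (P.lorentz_mult \<Psi> t) (X t)"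
    if "continuous_on ({0..T} \<times> UNIV) (\<lambda>(t, x). \<Psi> t x)" "\<And>t x. t \<in> {0..T} \<Longrightarrow> norm (\<Psi> t x) \<le> K" "t \<in> {0..T}" for \<Psi> K t
    by (rule P.lorentz_integral[of t \<Psi> K]) (use that slice in auto)
  show thesis
  proof (rule that[of X])
    show "energy_solution \<sigma> T (u \<Theta> r0 \<sigma> x0 n) X" using D(4) unfolding X_def .
    show "norm (X 0 - state (\<lambda>x. Es) (\<lambda>x. 0)) \<le> c * \<delta> * sqrt 2 + 2 * pi * (c * (T + 2)) * \<epsilon>"
      using P.initial_estimate by (simp add: X_def D(2) P.background_def)
    show "1 / 2 - (2 * pi * (c * (T + 2)) + 1) * \<epsilon> \<le> norm (X T - state (\<lambda>x. exp (- \<sigma> * T) *\<^sub>R Es) (\<lambda>x. 0))"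
      using P.final_estimate[OF D(3)[of T]] T by (simp add: X_def P.background_def)
    show "(\<integral>\<^sup>+x. ennreal ((norm (current \<sigma> (u \<Theta> r0 \<sigma> x0 n t) (X t) x))\<^sup>2) \<partial>torus_measure)
      \<le> ennreal ((\<sigma> * (2 * pi * e) + 2 * c + \<sigma> * (2 * pi * (c * (T + 2))) + \<sigma>)\<^sup>2)" if "t \<in> {0..T}" for t
    proof -
      have t: "0 \<le> t" "t \<le> T" using that by auto
      show ?thesis
        unfolding P.nn_integral_current[OF t(1)] X_def e_def
        by (rule ennreal_leI[OF power_mono[OF P.norm_current_le[OF t D(3)[OF t]] norm_ge_zero]])
    qed
    show "continuous_on {0..T} (\<lambda>t. \<integral>x. lorentz_force \<sigma> (u \<Theta> r0 \<sigma> x0 n t) (X t) x \<bullet> \<Psi> t x \<partial>torus_measure)"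
      if "continuous_on ({0..T} \<times> UNIV) (\<lambda>(t, x). \<Psi> t x)" "\<And>t x. t \<in> {0..T} \<Longrightarrow> norm (\<Psi> t x) \<le> K" for \<Psi> K
    proof (rule continuous_on_eq)
      show "continuous_on {0..T} (\<lambda>t. X t \<bullet> mult_op (P.lorentz_mult \<Psi> t) (X t))"
        by (rule P.continuous_lorentz[OF Xc that(1)]) (rule that(2))
    qed (rule lor[OF that, symmetric])
    show "\<bar>(\<integral>x. lorentz_force \<sigma> (u \<Theta> r0 \<sigma> x0 n t) (X t) x \<bullet> \<Psi> t x \<partial>torus_measure) + t / (2 * T\<^sup>2) * (w \<bullet> \<Psi> t (x_c x0 t))\<bar>
      \<le> 2 * c * (c * (T + 1)) * \<omega> + c * (T + 1) * (\<sigma> * K * (e + c + c * (T + 1))) * (5 * \<epsilon>)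
        + \<sigma> * K * (2 * (2 * pi * e + c * (T + 1) * sqrt 2 + 2 * pi * (c * (T + 2))) + 1) * \<epsilon> + 2 * c * c * \<delta> * K"
      if \<Psi>: "continuous_on ({0..T} \<times> UNIV) (\<lambda>(t, x). \<Psi> t x)" "\<And>t x. t \<in> {0..T} \<Longrightarrow> norm (\<Psi> t x) \<le> K"
        and \<omega>: "\<And>t x. t \<in> {0..T} \<Longrightarrow> norm (torus_rep (x - x_c x0 t)) < \<epsilon> \<Longrightarrow> \<bar>\<Psi> t x $ 1 - \<Psi> t (x_c x0 t) $ 1\<bar> \<le> \<omega>"
          "0 \<le> \<omega>" and tT: "t \<in> {0..T}" for \<Psi> K \<omega> t
    proof -
      have t: "0 \<le> t" "t \<le> T" using tT by auto
      have near: "\<bar>\<Psi> t x $ 1 - \<Psi> t (x_c x0 t) $ 1\<bar> \<le> \<omega>" if "norm (torus_rep (x - x_c x0 t)) < \<nu> + \<mu>" for x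
        by (rule \<omega>(1)[OF tT]) (use that nm in linarith)
      have l: "(\<integral>x. lorentz_force \<sigma> (u \<Theta> r0 \<sigma> x0 n t) (X t) x \<bullet> \<Psi> t x \<partial>torus_measure) = X t \<bullet> mult_op (P.lorentz_mult \<Psi> t) (X t)"
        by (rule lor[of \<Psi> K t, OF \<Psi>(1) _ tT]) (rule \<Psi>(2))
      show ?thesis
        unfolding l unfolding X_def e_def
        by (rule P.lorentz_estimate[of t \<Psi> K \<omega>, OF t slice[OF \<Psi>(1) tT] \<Psi>(2)[OF tT] near \<omega>(2) D(3)[OF t]])
    qed
  qed
qed

end

theorem corollary3p6:
  fixes T \<sigma> r0 C :: real and x0 Estar :: "real^2" and \<Theta> :: "real \<Rightarrow> real"
  assumes "T > 0" and "\<sigma> > 0"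
    and "0 < r0" and "r0 < pi"
    and "smooth \<Theta>" and "\<And>z. 0 \<le> \<Theta> z \<and> \<Theta> z \<le> 1"
    and "\<And>z. z \<le> 0 \<Longrightarrow> \<Theta> z = 0"
    and "\<And>z. 1 / 4 \<le> z \<Longrightarrow> z \<le> 3 / 4 \<Longrightarrow> \<Theta> z = z"
    and "\<And>z. 1 \<le> z \<Longrightarrow> \<Theta> z = 1"
    and "\<And>z. \<bar>deriv \<Theta> z\<bar> + \<bar>deriv (deriv \<Theta>) z\<bar> \<le> C"
    and "\<And>z. 0 \<le> z \<Longrightarrow> z \<le> 1 \<Longrightarrow> \<Theta> z \<le> C * z"
    and "Estar \<noteq> 0"
  shows "\<exists>X :: nat \<Rightarrow> real \<Rightarrow> h2.
    (\<forall>n\<ge>1. energy_solution \<sigma> T (u \<Theta> r0 \<sigma> x0 n) (X n)) \<and>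
    (\<lambda>n. X n 0) \<longlonglongrightarrow> state (\<lambda>x. Estar) (\<lambda>x. 0) \<and>
    liminf (\<lambda>n. ereal (norm (X n T - state (\<lambda>x. exp (- \<sigma> * T) *\<^sub>R Estar) (\<lambda>x. 0)))) > 0 \<and>
    (\<exists>K::real. \<forall>n\<ge>1.
      (\<integral>\<^sup>+t\<in>{0..T}. (\<integral>\<^sup>+x. ennreal ((norm (current \<sigma> (u \<Theta> r0 \<sigma> x0 n t) (X n t) x))\<^sup>2)
         \<partial>torus_measure) \<partial>lborel) \<le> ennreal K) \<and>
    (\<forall>\<Psi> :: real \<Rightarrow> real^2 \<Rightarrow> real^2.
      continuous_on ({0..T} \<times> UNIV) (\<lambda>(t, x). \<Psi> t x) \<longrightarrow> (\<forall>t\<in>{0..T}. periodic (\<Psi> t)) \<longrightarrow>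
      (\<lambda>n. LINT t:{0..T}|lborel. (\<integral>x. lorentz_force \<sigma> (u \<Theta> r0 \<sigma> x0 n t) (X n t) x \<bullet> \<Psi> t x
         \<partial>torus_measure))
      \<longlonglongrightarrow> - (LINT t:{0..T}|lborel. t / (2 * T\<^sup>2) * (w \<bullet> \<Psi> t (x_c x0 t))))"
proof -
  interpret cutoff \<Theta> r0 C
  proof
    show "\<bar>deriv \<Theta> z\<bar> \<le> C" for z using assms(10)[of z] by linarith
  qed (use assms in auto)
  define c e \<epsilon> where "c = 1 / (2 * T)" and "e = \<bar>Estar $ 1\<bar> + \<bar>Estar $ 2\<bar>" and "\<epsilon> = (\<lambda>n. 1 / real (Suc n))"
  have eps: "0 < \<epsilon> n" "\<epsilon> n \<le> 1" for n by (simp_all add: \<epsilon>_def)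
  have eps0: "\<epsilon> \<longlonglongrightarrow> 0" unfolding \<epsilon>_def by (rule LIMSEQ_Suc[OF lim_1_over_n])
  have delta0: "(\<lambda>n. exp (- real n)) \<longlonglongrightarrow> 0" by (rule filterlim_compose[OF exp_at_bot]) (auto intro: filterlim_uminus_at_bot[THEN iffD2] filterlim_real_sequentially simp: filterlim_uminus_at_bot)
  define J where "J = (\<sigma> * (2 * pi * e) + 2 * c + \<sigma> * (2 * pi * (c * (T + 2))) + \<sigma>)\<^sup>2"
  define G where "G K \<omega> n = 2 * c * (c * (T + 1)) * \<omega> + c * (T + 1) * (\<sigma> * K * (e + c + c * (T + 1))) * (5 * \<epsilon> n)
        + \<sigma> * K * (2 * (2 * pi * e + c * (T + 1) * sqrt 2 + 2 * pi * (c * (T + 2))) + 1) * \<epsilon> n + 2 * c * c * exp (- real n) * K" for K \<omega> n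
  let ?I = "\<lambda>X n \<Psi> t. \<integral>x. lorentz_force \<sigma> (u \<Theta> r0 \<sigma> x0 n t) (X t) x \<bullet> \<Psi> t x \<partial>torus_measure"
  \<comment> \<open>All bounds for one \<open>n\<close>, collected so that one solution per \<open>n\<close> can be chosen.\<close>
  define good where "good n X \<longleftrightarrow> energy_solution \<sigma> T (u \<Theta> r0 \<sigma> x0 n) X \<and>
    norm (X 0 - state (\<lambda>x. Estar) (\<lambda>x. 0)) \<le> c * exp (- real n) * sqrt 2 + 2 * pi * (c * (T + 2)) * \<epsilon> n \<and>
    1 / 2 - (2 * pi * (c * (T + 2)) + 1) * \<epsilon> n \<le> norm (X T - state (\<lambda>x. exp (- \<sigma> * T) *\<^sub>R Estar) (\<lambda>x. 0)) \<and>
    (\<forall>t\<in>{0..T}. (\<integral>\<^sup>+x. ennreal ((norm (current \<sigma> (u \<Theta> r0 \<sigma> x0 n t) (X t) x))\<^sup>2) \<partial>torus_measure) \<le> ennreal J) \<and>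
    (\<forall>\<Psi> K. continuous_on ({0..T} \<times> UNIV) (\<lambda>(t, x). \<Psi> t x) \<longrightarrow> (\<forall>t\<in>{0..T}. \<forall>x. norm (\<Psi> t x) \<le> K) \<longrightarrow>
      continuous_on {0..T} (?I X n \<Psi>)) \<and>
    (\<forall>\<Psi> K \<omega>. continuous_on ({0..T} \<times> UNIV) (\<lambda>(t, x). \<Psi> t x) \<longrightarrow> (\<forall>t\<in>{0..T}. \<forall>x. norm (\<Psi> t x) \<le> K) \<longrightarrow>
      (\<forall>t\<in>{0..T}. \<forall>x. norm (torus_rep (x - x_c x0 t)) < \<epsilon> n \<longrightarrow> \<bar>\<Psi> t x $ 1 - \<Psi> t (x_c x0 t) $ 1\<bar> \<le> \<omega>) \<longrightarrow>
      0 \<le> \<omega> \<longrightarrow> (\<forall>t\<in>{0..T}. \<bar>?I X n \<Psi> t + t / (2 * T\<^sup>2) * (w \<bullet> \<Psi> t (x_c x0 t))\<bar> \<le> G K \<omega> n))" for n X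
  have "\<exists>X. good n X" for n
    unfolding good_def J_def G_def c_def e_def
  proof (rule concentrating_solution[where n = n and ?x0.0 = x0 and Es = Estar, OF assms(2,1) eps(1)[of n] eps(2)[of n]], goal_cases)
    case (1 X)
    show ?case
      by (rule exI[of _ X]) (intro conjI ballI allI impI 1; blast)
  qed
  then obtain X where X: "\<And>n. good n (X n)" by metis
  have sol: "energy_solution \<sigma> T (u \<Theta> r0 \<sigma> x0 n) (X n)" and
    init: "norm (X n 0 - state (\<lambda>x. Estar) (\<lambda>x. 0)) \<le> c * exp (- real n) * sqrt 2 + 2 * pi * (c * (T + 2)) * \<epsilon> n" and
    fin: "1 / 2 - (2 * pi * (c * (T + 2)) + 1) * \<epsilon> n \<le> norm (X n T - state (\<lambda>x. exp (- \<sigma> * T) *\<^sub>R Estar) (\<lambda>x. 0))" and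
    cur: "\<forall>t\<in>{0..T}. (\<integral>\<^sup>+x. ennreal ((norm (current \<sigma> (u \<Theta> r0 \<sigma> x0 n t) (X n t) x))\<^sup>2) \<partial>torus_measure) \<le> ennreal J" and
    cont: "\<forall>\<Psi> K. continuous_on ({0..T} \<times> UNIV) (\<lambda>(t, x). \<Psi> t x) \<longrightarrow> (\<forall>t\<in>{0..T}. \<forall>x. norm (\<Psi> t x) \<le> K) \<longrightarrow>
      continuous_on {0..T} (?I (X n) n \<Psi>)" and
    lor: "\<forall>\<Psi> K \<omega>. continuous_on ({0..T} \<times> UNIV) (\<lambda>(t, x). \<Psi> t x) \<longrightarrow> (\<forall>t\<in>{0..T}. \<forall>x. norm (\<Psi> t x) \<le> K) \<longrightarrow>
      (\<forall>t\<in>{0..T}. \<forall>x. norm (torus_rep (x - x_c x0 t)) < \<epsilon> n \<longrightarrow> \<bar>\<Psi> t x $ 1 - \<Psi> t (x_c x0 t) $ 1\<bar> \<le> \<omega>) \<longrightarrow>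
      0 \<le> \<omega> \<longrightarrow> (\<forall>t\<in>{0..T}. \<bar>?I (X n) n \<Psi> t + t / (2 * T\<^sup>2) * (w \<bullet> \<Psi> t (x_c x0 t))\<bar> \<le> G K \<omega> n)" for n
    using X[of n] unfolding good_def by blast+
  show ?thesis
  proof (intro exI[of _ X] conjI allI impI)
    show "energy_solution \<sigma> T (u \<Theta> r0 \<sigma> x0 n) (X n)" for n by (rule sol)
    show "(\<lambda>n. X n 0) \<longlonglongrightarrow> state (\<lambda>x. Estar) (\<lambda>x. 0)"
    proof (rule LIM_zero_cancel, rule Lim_null_comparison)
      show "\<forall>\<^sub>F n in sequentially. norm (X n 0 - state (\<lambda>x. Estar) (\<lambda>x. 0)) \<le> c * exp (- real n) * sqrt 2 + 2 * pi * (c * (T + 2)) * \<epsilon> n"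
        by (intro always_eventually allI init)
      have "(\<lambda>n. c * exp (- real n) * sqrt 2 + 2 * pi * (c * (T + 2)) * \<epsilon> n) \<longlonglongrightarrow> c * 0 * sqrt 2 + 2 * pi * (c * (T + 2)) * 0"
        by (intro tendsto_intros delta0 eps0)
      then show "(\<lambda>n. c * exp (- real n) * sqrt 2 + 2 * pi * (c * (T + 2)) * \<epsilon> n) \<longlonglongrightarrow> 0" by simp
    qed
    show "liminf (\<lambda>n. ereal (norm (X n T - state (\<lambda>x. exp (- \<sigma> * T) *\<^sub>R Estar) (\<lambda>x. 0)))) > 0"
    proof -
      have "(\<lambda>n. 1 / 2 - (2 * pi * (c * (T + 2)) + 1) * \<epsilon> n) \<longlonglongrightarrow> 1 / 2 - (2 * pi * (c * (T + 2)) + 1) * 0"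
        by (intro tendsto_intros eps0)
      then have "\<forall>\<^sub>F n in sequentially. 1 / 4 < 1 / 2 - (2 * pi * (c * (T + 2)) + 1) * \<epsilon> n"
        by (rule order_tendstoD) simp
      then have "\<forall>\<^sub>F n in sequentially. ereal (1 / 4) \<le> ereal (norm (X n T - state (\<lambda>x. exp (- \<sigma> * T) *\<^sub>R Estar) (\<lambda>x. 0)))"
      proof eventually_elim
        case (elim n)
        then show ?case using fin[of n] by simp
      qed
      from Liminf_bounded[OF this] have "ereal (1 / 4) \<le> liminf (\<lambda>n. ereal (norm (X n T - state (\<lambda>x. exp (- \<sigma> * T) *\<^sub>R Estar) (\<lambda>x. 0))))" .
      moreover have "(0 :: ereal) < ereal (1 / 4)" by simp
      ultimately show ?thesis by (rule less_le_trans[rotated])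
    qed
    show "\<exists>K::real. \<forall>n\<ge>1. (\<integral>\<^sup>+t\<in>{0..T}. (\<integral>\<^sup>+x. ennreal ((norm (current \<sigma> (u \<Theta> r0 \<sigma> x0 n t) (X n t) x))\<^sup>2)
         \<partial>torus_measure) \<partial>lborel) \<le> ennreal K"
    proof (intro exI[of _ "J * T"] allI impI)
      fix n :: nat
      have "(\<integral>\<^sup>+t\<in>{0..T}. (\<integral>\<^sup>+x. ennreal ((norm (current \<sigma> (u \<Theta> r0 \<sigma> x0 n t) (X n t) x))\<^sup>2) \<partial>torus_measure) \<partial>lborel)
        \<le> (\<integral>\<^sup>+t. ennreal J * indicator {0..T} t \<partial>lborel)"
        using cur by (intro nn_integral_mono) (auto simp: indicator_def)
      also have "\<dots> = ennreal (J * T)"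
        using assms(1) by (simp add: nn_integral_cmult_indicator ennreal_mult J_def)
      finally show "(\<integral>\<^sup>+t\<in>{0..T}. (\<integral>\<^sup>+x. ennreal ((norm (current \<sigma> (u \<Theta> r0 \<sigma> x0 n t) (X n t) x))\<^sup>2)
         \<partial>torus_measure) \<partial>lborel) \<le> ennreal (J * T)" .
    qed
    fix \<Psi> :: "real \<Rightarrow> real^2 \<Rightarrow> real^2"
    assume \<Psi>: "continuous_on ({0..T} \<times> UNIV) (\<lambda>(t, x). \<Psi> t x)" and per: "\<forall>t\<in>{0..T}. periodic (\<Psi> t)"
    obtain K where K: "\<And>t x. t \<in> {0..T} \<Longrightarrow> norm (\<Psi> t x) \<le> K" using test_field_bounded[OF \<Psi> per] by blast
    define f where "f t = t / (2 * T\<^sup>2) * (w \<bullet> \<Psi> t (x_c x0 t))" for t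
    have fc: "continuous_on {0..T} f"
    proof -
      have "continuous_on {0..T} (\<lambda>t. (\<lambda>(t, x). \<Psi> t x) (t, x_c x0 t))"
        by (rule continuous_on_compose2[OF \<Psi>]) (auto intro!: continuous_intros simp: x_c_def)
      then show ?thesis unfolding f_def using assms(1) by (auto intro!: continuous_intros)
    qed
    have Ic: "continuous_on {0..T} (?I (X n) n \<Psi>)" for n using cont \<Psi> K by blast
    have LI: "(LINT t:{0..T}|lborel. h t) = integral {0..T} h" if "continuous_on {0..T} h" for h :: "real \<Rightarrow> real"
    proof (rule set_borel_integral_eq_integral(2))
      have "set_integrable lborel (cbox 0 T) h"
        unfolding set_integrable_def by (rule borel_integrable_compact) (use that in auto)
      then show "set_integrable lborel {0..T} h" by simp
    qed
    have bound: "\<bar>(LINT t:{0..T}|lborel. ?I (X n) n \<Psi> t) + (LINT t:{0..T}|lborel. f t)\<bar> \<le> G K \<omega> n * T"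
      if \<omega>: "0 \<le> \<omega>" "\<forall>t\<in>{0..T}. \<forall>x. norm (torus_rep (x - x_c x0 t)) < \<epsilon> n \<longrightarrow> \<bar>\<Psi> t x $ 1 - \<Psi> t (x_c x0 t) $ 1\<bar> \<le> \<omega>" for n \<omega>
    proof -
      have K': "\<forall>t\<in>{0..T}. \<forall>x. norm (\<Psi> t x) \<le> K" using K by blast
      have est: "\<forall>t\<in>{0..T}. \<bar>?I (X n) n \<Psi> t + f t\<bar> \<le> G K \<omega> n"
        unfolding f_def by (rule lor[rule_format, OF \<Psi> K'[rule_format] \<omega>(2)[rule_format] \<omega>(1), THEN ballI]; assumption)
      have "\<bar>integral {0..T} (\<lambda>t. ?I (X n) n \<Psi> t + f t)\<bar> \<le> G K \<omega> n * (T - 0)"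
        using integral_bound[of 0 T "\<lambda>t. ?I (X n) n \<Psi> t + f t" "G K \<omega> n"] assms(1) est continuous_on_add[OF Ic fc] by auto
      then show ?thesis
        unfolding LI[OF Ic] LI[OF fc]
        using integral_add[OF integrable_continuous_interval[OF Ic] integrable_continuous_interval[OF fc], of n] by simp
    qed
    have "(\<lambda>n. (LINT t:{0..T}|lborel. ?I (X n) n \<Psi> t) + (LINT t:{0..T}|lborel. f t)) \<longlonglongrightarrow> 0"
    proof (rule tendstoI)
      fix r :: real assume r: "0 < r"
      \<comment> \<open>For fixed \<open>\<omega>\<close> the bound on the time integral tends to \<open>q * \<omega>\<close> as \<open>n\<close> grows.\<close>
      define q where "q = 2 * c * (c * (T + 1)) * T"
      define \<omega> where "\<omega> = r / (2 * (q + 1))"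
      have q0: "0 \<le> q" using assms(1) by (simp add: q_def c_def)
      have w0: "0 < \<omega>" using r q0 by (simp add: \<omega>_def)
      have "q * \<omega> \<le> (q + 1) * \<omega>" using w0 by (intro mult_right_mono) auto
      also have "\<dots> = r / 2"
        using nonzero_mult_divide_mult_cancel_left[of "q + 1" r 2] q0 by (simp add: \<omega>_def mult.commute)
      finally have "q * \<omega> < r" using r by simp
      then have w1: "2 * c * (c * (T + 1)) * \<omega> * T < r" by (simp only: q_def mult_ac)
      obtain d where d: "d > 0" "\<And>t x. t \<in> {0..T} \<Longrightarrow> norm (torus_rep (x - x_c x0 t)) < d \<Longrightarrow> \<bar>\<Psi> t x $ 1 - \<Psi> t (x_c x0 t) $ 1\<bar> \<le> \<omega>"
        using test_field_uniform[OF \<Psi> per w0] by blast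
      have "(\<lambda>n. G K \<omega> n * T) \<longlonglongrightarrow> (2 * c * (c * (T + 1)) * \<omega> + c * (T + 1) * (\<sigma> * K * (e + c + c * (T + 1))) * (5 * 0)
        + \<sigma> * K * (2 * (2 * pi * e + c * (T + 1) * sqrt 2 + 2 * pi * (c * (T + 2))) + 1) * 0 + 2 * c * c * 0 * K) * T"
        unfolding G_def by (intro tendsto_intros eps0 delta0)
      then have "(\<lambda>n. G K \<omega> n * T) \<longlonglongrightarrow> 2 * c * (c * (T + 1)) * \<omega> * T" by simp
      then have "\<forall>\<^sub>F n in sequentially. G K \<omega> n * T < r" using w1 by (rule order_tendstoD)
      moreover have "\<forall>\<^sub>F n in sequentially. \<epsilon> n < d" using eps0 d(1) by (rule order_tendstoD)
      ultimately show "\<forall>\<^sub>F n in sequentially. dist ((LINT t:{0..T}|lborel. ?I (X n) n \<Psi> t) + (LINT t:{0..T}|lborel. f t)) 0 < r"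
      proof eventually_elim
        case (elim n)
        have "\<forall>t\<in>{0..T}. \<forall>x. norm (torus_rep (x - x_c x0 t)) < \<epsilon> n \<longrightarrow> \<bar>\<Psi> t x $ 1 - \<Psi> t (x_c x0 t) $ 1\<bar> \<le> \<omega>"
          using d(2) elim(2) by (meson less_trans)
        from bound[OF less_imp_le[OF w0] this] elim(1) show ?case by simp
      qed
    qed
    from tendsto_diff[OF this tendsto_const[of "LINT t:{0..T}|lborel. f t"]]
    show "(\<lambda>n. LINT t:{0..T}|lborel. ?I (X n) n \<Psi> t) \<longlonglongrightarrow> - (LINT t:{0..T}|lborel. t / (2 * T\<^sup>2) * (w \<bullet> \<Psi> t (x_c x0 t)))"
      by (simp add: f_def)
  qed
qed

end
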